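(* Let $\beta>0$ and $0<y<\beta$ be fixed, let $p=p_n\ge n$ and $n\to\infty$. Let $\lambda_{(n)}$ be the smallest eigenvalue of the $\beta$-Laguerre ensemble with parameters $(n,p,\beta)$, and let the sampling measure $Q$ and the importance sampling estimator $L_p$ of $P(\lambda_{(n)}<py)$ be as defined in the context. Then: (1) if $p/n^{5/3}\to\infty$, then $E^Q[L_p^2]\sim P(\lambda_{(n)}<py)^2$; (2) if $p/n^{5/3}=\Theta(1)$, then $E^Q[L_p^2]=O(1)\,P(\lambda_{(n)}<py)^2$; (3) if $p/n\to\infty$, then $L_p$ is asymptotically efficient, i.e. $E^Q[L_p]=P(\lambda_{(n)}<py)$ and $\dfrac{\log E^Q[L_p^2]}{2\log P(\lambda_{(n)}<py)}\to1$.
   Context: The $\beta$-Laguerre ensemble with parameters $(n,p,\beta)$, $p\ge n$, $\beta>0$: random $(\lambda_1,\dots,\lambda_n)\in(0,\infty)^n$ with density $$f_{n,p,\beta}(\lambda_1,\dots,\lambda_n)=c_{n,p,\beta}\prod_{1\le i<j\le n}|\lambda_i-\lambda_j|^{\beta}\prod_{i=1}^n\lambda_i^{\frac{\beta(p-n+1)}{2}-1}e^{-\frac12\sum_{i=1}^n\lambda_i},\qquad c_{n,p,\beta}=2^{-\frac{\beta np}{2}}\prod_{j=1}^n\frac{\Gamma(1+\frac\beta2)}{\Gamma(1+\frac\beta2 j)\,\Gamma(\frac\beta2(p-n+j))}.$$ The order statistics $\lambda_{(1)}>\cdots>\lambda_{(n)}$ have joint density $g_{n,p,\beta}(\lambda_1,\dots,\lambda_n)=n!\,f_{n,p,\beta}(\lambda_1,\dots,\lambda_n)\,I_{(\lambda_1>\cdots>\lambda_n)}$.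 Put $A_n=c_{n,p,\beta}/c_{n-1,p-1,\beta}$. Measure $Q$: first sample $\lambda_{(1)}>\cdots>\lambda_{(n-1)}$ with density $g_{n-1,p-1,\beta}$; then, given these, sample $\lambda_{(n)}$ (real valued) with density $\frac{\beta-y}{2y}e^{\frac{\beta-y}{2y}(\lambda_{(n)}-py\wedge\lambda_{(n-1)})}I_{(\lambda_{(n)}<py\wedge\lambda_{(n-1)})}$, where $a\wedge b=\min(a,b)$. $E^Q$ is expectation under $Q$. Estimator: $$L_p=\frac{nA_n\prod_{1\le i<n}(\lambda_{(i)}-\lambda_{(n)})^\beta\,\lambda_{(n)}^{\frac{\beta(p-n+1)}{2}-1}e^{-\frac12\lambda_{(n)}}}{\frac{\beta-y}{2y}e^{\frac{\beta-y}{2y}(\lambda_{(n)}-py\wedge\lambda_{(n-1)})}}\,I_{(\lambda_{(n)}<py)}$$ if $\lambda_{(n)}>0$, and $L_p=0$ if $\lambda_{(n)}\le0$. (Thus $L_p$ is the likelihood ratio $dP/dQ$ times $I_{(\lambda_{(n)}<py)}$, where $P$ is the law of the ordered eigenvalues with density $g_{n,p,\beta}$.) As $n\to\infty$: $a_n\sim b_n$ means $a_n/b_n\to1$; $O(1)$ is a bounded sequence; $a_n=\Theta(1)$ means $0<\liminf|a_n|\le\limsup|a_n|<\infty$. *)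

theory Defs
  imports "HOL-Probability.Probability" "HOL-Library.Landau_Symbols"
begin

text \<open>
  A configuration of \<open>n\<close> eigenvalues is a function \<open>x\<close> on the index set \<open>{1..n}\<close>, living in the
  product of \<open>n\<close> copies of Lebesgue measure. The parameter \<open>p\<close> is real; integrality is not needed.
\<close>

definition laguerre_const :: "nat \<Rightarrow> real \<Rightarrow> real \<Rightarrow> real" where
  "laguerre_const n p \<beta> =
     2 powr (- (\<beta> * real n * p / 2)) *
     (\<Prod>j = 1..n. Gamma (1 + \<beta> / 2) /
        (Gamma (1 + \<beta> / 2 * real j) * Gamma (\<beta> / 2 * (p - real n + real j))))"

definition laguerre_density :: "nat \<Rightarrow> real \<Rightarrow> real \<Rightarrow> (nat \<Rightarrow> real) \<Rightarrow> real" where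
  "laguerre_density n p \<beta> x =
     (if \<forall>i\<in>{1..n}. 0 < x i then
        laguerre_const n p \<beta> *
        (\<Prod>j = 1..n. \<Prod>i = 1..<j. \<bar>x i - x j\<bar> powr \<beta>) *
        (\<Prod>i = 1..n. x i powr (\<beta> * (p - real n + 1) / 2 - 1)) *
        exp (- (1 / 2) * (\<Sum>i = 1..n. x i))
      else 0)"

definition laguerre_ensemble :: "nat \<Rightarrow> real \<Rightarrow> real \<Rightarrow> (nat \<Rightarrow> real) measure" where
  "laguerre_ensemble n p \<beta> =
     density (\<Pi>\<^sub>M i\<in>{1..n}. lborel) (\<lambda>x. ennreal (laguerre_density n p \<beta> x))"

definition smallest_eigenvalue_prob :: "nat \<Rightarrow> real \<Rightarrow> real \<Rightarrow> real \<Rightarrow> real" where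
  "smallest_eigenvalue_prob n p \<beta> t =
     measure (laguerre_ensemble n p \<beta>)
       {x \<in> space (laguerre_ensemble n p \<beta>). Min (x ` {1..n}) < t}"

text \<open>Joint density of the order statistics, listed in decreasing order.\<close>

definition ordered_laguerre_density :: "nat \<Rightarrow> real \<Rightarrow> real \<Rightarrow> (nat \<Rightarrow> real) \<Rightarrow> real" where
  "ordered_laguerre_density n p \<beta> x =
     (if \<forall>i\<in>{1..<n}. x i > x (Suc i) then fact n * laguerre_density n p \<beta> x else 0)"

text \<open>
  Conditional density under \<open>Q\<close> of the last coordinate, at the point \<open>u\<close>, given that the
  smallest of the coordinates sampled before is \<open>z\<close>.
\<close>

definition proposal_density :: "real \<Rightarrow> real \<Rightarrow> real \<Rightarrow> real \<Rightarrow> real \<Rightarrow> real" where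
  "proposal_density p \<beta> y z u =
     (if u < min (p * y) z
      then (\<beta> - y) / (2 * y) * exp ((\<beta> - y) / (2 * y) * (u - min (p * y) z))
      else 0)"

text \<open>
  Two-step sampling: the joint density is the density of the first \<open>n - 1\<close> coordinates times the
  conditional density of the last one. Only meaningful for \<open>n \<ge> 2\<close>.
\<close>

definition sampling_measure :: "nat \<Rightarrow> real \<Rightarrow> real \<Rightarrow> real \<Rightarrow> (nat \<Rightarrow> real) measure" where
  "sampling_measure n p \<beta> y =
     density (\<Pi>\<^sub>M i\<in>{1..n}. lborel)
       (\<lambda>x. ennreal (ordered_laguerre_density (n - 1) (p - 1) \<beta> x *
                     proposal_density p \<beta> y (x (n - 1)) (x n)))"

text \<open>
  The denominator is written without its support indicator; almost surely under \<open>Q\<close> the last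
  coordinate is below the others, so every base of a real power below is then positive.
\<close>

definition IS_estimator :: "nat \<Rightarrow> real \<Rightarrow> real \<Rightarrow> real \<Rightarrow> (nat \<Rightarrow> real) \<Rightarrow> real" where
  "IS_estimator n p \<beta> y x =
     (if 0 < x n then
        real n * (laguerre_const n p \<beta> / laguerre_const (n - 1) (p - 1) \<beta>) *
        (\<Prod>i = 1..<n. (x i - x n) powr \<beta>) *
        x n powr (\<beta> * (p - real n + 1) / 2 - 1) * exp (- (1 / 2) * x n) /
        ((\<beta> - y) / (2 * y) * exp ((\<beta> - y) / (2 * y) * (x n - min (p * y) (x (n - 1))))) *
        (if x n < p * y then 1 else 0)
      else 0)"

end

theory Submission
  imports Defs "HOL-Real_Asymp.Real_Asymp"
begin

text \<open>
  Write \<open>a = \<beta>(p - n + 1)/2\<close>, \<open>t = py\<close>, and fix \<open>y < \<tau> < \<beta>\<close>, \<open>t' = \<tau>p\<close>. Call a configuration of the \<open>n - 1\<close>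
  larger eigenvalues good if all of them exceed \<open>t'\<close>. The one-point weight \<open>s\<^bsup>a-1\<^esup>e\<^bsup>-s/2\<^esup>\<close> is log-concave, hence below
  its tangent exponential at \<open>t\<close>, whose rate tends to that of the proposal as \<open>p/n \<rightarrow> \<infinity>\<close>. Integrating out the smallest
  eigenvalue therefore bounds \<open>E\<^sup>Q[L\<^sup>2] / P\<^sup>2\<close>, up to a factor tending to \<open>1\<close> and the contribution of bad configurations,
  by the ratio of second moment and squared first moment of \<open>\<Prod>\<^sub>i (x\<^sub>i - t)\<^sup>\<beta>\<close> over good configurations.

  By the Prekopa--Leindler inequality, the strict log-concavity of the ensemble makes this ratio at most \<open>e\<^bsup>O(n/p)\<^esup>\<close>.
  Bad configurations have weight \<open>e\<^bsup>-cp\<^esup>\<close>, while the moments that could magnify them are only \<open>e\<^bsup>o(p)\<^esup>\<close>;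
  this follows from comparing normalising constants, which are computed by Aomoto's recursion in the shape parameter together with
  log-convexity, in the manner of the Bohr--Mollerup theorem. So the ratio tends to \<open>1\<close> as soon as
  \<open>p/n \<rightarrow> \<infinity>\<close>, which contains all three regimes; for logarithmic efficiency one also needs \<open>P \<rightarrow> 0\<close>.
\<close>

section \<open>Symmetric functions under product Lebesgue measure\<close>

text \<open>The proposal rate is dictated by the weight: its logarithmic slope at
  \<open>t = p * y\<close> is \<open>(a - 1) / t - 1 / 2\<close>, which for \<open>a\<close> close
  to \<open>\<beta> * p / 2\<close> is close to \<open>(\<beta> - y) / (2 * y)\<close>. Once slope
  and proposal rate agree, the last coordinate contributes the same factor
  \<open>1 / \<theta>\<^sup>2\<close> to the second moment and to the squared first moment, and
  cancels.

  The product over the other eigenvalues is the exponential of a linear statistic. Its derivative in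
  one coordinate is of order \<open>1 / p\<close> only while that coordinate keeps a distance of
  order \<open>p\<close> from \<open>t\<close>, which is why \<open>t'\<close> is a second threshold
  proportional to \<open>p\<close>. The curvature of the log-weight is of order \<open>1 / p\<close>
  as well, so each coordinate costs \<open>(1 / p)\<^sup>2 / (1 / p)\<close>.

  Normalising constants are needed at the shapes \<open>a\<close>, \<open>a + \<beta>\<close> and
  \<open>a + 2 * \<beta>\<close>, where \<beta> need not be an integer, while the recursion moves
  the shape by 1; convexity in the shape bridges the gap. The number of variables is raised at shape
  1, where the weight is a pure exponential and all coordinates can be measured from the smallest
  one.\<close>

interpretation lborel_prod: product_sigma_finite "\<lambda>_::nat. lborel :: real measure" ..

abbreviation lebesgue_power :: "nat set \<Rightarrow> (nat \<Rightarrow> real) measure" where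
  "lebesgue_power I \<equiv> (\<Pi>\<^sub>M i\<in>I. lborel)"

section \<open>Invariance of product Lebesgue measure under transpositions and diagonal
  translations\<close>

abbreviation swap_coords :: "nat \<Rightarrow> nat \<Rightarrow> (nat \<Rightarrow> real) \<Rightarrow> nat \<Rightarrow> real" where
  "swap_coords i j x \<equiv> x(i := x j, j := x i)"

lemma measurable_coord: "i \<in> I \<Longrightarrow> (\<lambda>x. x i) \<in> borel_measurable (lebesgue_power I)"
  by simp

lemma measurable_swap_coords:
  assumes "i \<in> I" "j \<in> I"
  shows "swap_coords i j \<in> measurable (lebesgue_power I) (lebesgue_power I)"
proof (rule measurable_PiM_single')
  fix k assume "k \<in> I"
  then show "(\<lambda>x. swap_coords i j x k) \<in> measurable (lebesgue_power I) lborel"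
    using assms by (cases "k = i"; cases "k = j") auto
qed (use assms in \<open>auto simp: space_PiM PiE_def extensional_def\<close>)

text \<open>Product Lebesgue measure is determined by boxes, and the preimage of a box under a
  transposition is the box with two sides exchanged.\<close>

lemma distr_swap_coords:
  assumes "finite I" "i \<in> I" "j \<in> I"
  shows "distr (lebesgue_power I) (lebesgue_power I) (swap_coords i j) = lebesgue_power I"
proof (rule lborel_prod.PiM_eqI)
  fix A :: "nat \<Rightarrow> real set" assume A: "\<And>k. k \<in> I \<Longrightarrow> A k \<in> sets lborel"
  let ?B = "A(i := A j, j := A i)"
  have eq: "swap_coords i j -` Pi\<^sub>E I A \<inter> space (lebesgue_power I) = Pi\<^sub>E I ?B"
  proof (cases "i = j")
    case False
    show ?thesis
    proof (intro equalityI subsetI)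
      fix x assume x: "x \<in> swap_coords i j -` Pi\<^sub>E I A \<inter> space (lebesgue_power I)"
      then have *: "swap_coords i j x k \<in> A k" if "k \<in> I" for k using that PiE_mem by blast
      have "x k \<in> ?B k" if "k \<in> I" for k
        using *[OF that] *[OF assms(2)] *[OF assms(3)] False by (auto split: if_splits)
      then show "x \<in> Pi\<^sub>E I ?B" using x by (auto simp: space_PiM PiE_def)
    next
      fix x assume x: "x \<in> Pi\<^sub>E I ?B"
      then have *: "x k \<in> ?B k" if "k \<in> I" for k using that PiE_mem by blast
      have "swap_coords i j x k \<in> A k" if "k \<in> I" for k
        using *[OF that] *[OF assms(2)] *[OF assms(3)] False by (auto split: if_splits)
      moreover have "swap_coords i j x \<in> extensional I"
        using x assms by (auto simp: PiE_def extensional_def)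
      moreover have "x \<in> extensional I" using x by (auto simp: PiE_def)
      ultimately show "x \<in> swap_coords i j -` Pi\<^sub>E I A \<inter> space (lebesgue_power I)"
        by (auto simp: space_PiM PiE_def)
    qed
  qed (use A in \<open>auto simp: space_PiM dest: PiE_mem\<close>)
  have "emeasure (distr (lebesgue_power I) (lebesgue_power I) (swap_coords i j)) (Pi\<^sub>E I A)
      = emeasure (lebesgue_power I) (Pi\<^sub>E I ?B)"
    using A assms by (subst emeasure_distr[OF measurable_swap_coords])
      (auto simp: eq intro!: sets_PiM_I_finite)
  also have "\<dots> = (\<Prod>k\<in>I. emeasure lborel (?B k))"
    using A assms by (intro lborel_prod.emeasure_PiM) auto
  also have "\<dots> = (\<Prod>k\<in>I. emeasure lborel (A (Transposition.transpose i j k)))"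
    by (intro prod.cong) (auto simp: transpose_def)
  also have "\<dots> = (\<Prod>k\<in>I. emeasure lborel (A k))"
  proof (rule prod.reindex_bij_betw[where h = "Transposition.transpose i j"])
    have "Transposition.transpose i j ` I = I"
      using assms by (auto simp: transpose_def image_iff split: if_splits)
    then show "bij_betw (Transposition.transpose i j) I I" by (simp add: bij_betw_def)
  qed
  finally show "emeasure (distr (lebesgue_power I) (lebesgue_power I) (swap_coords i j)) (Pi\<^sub>E I A)
      = (\<Prod>k\<in>I. emeasure lborel (A k))" .
qed (use assms in auto)

lemma nn_integral_swap_coords:
  assumes "finite I" "i \<in> I" "j \<in> I" "f \<in> borel_measurable (lebesgue_power I)"
  shows "(\<integral>\<^sup>+x. f (swap_coords i j x) \<partial>lebesgue_power I) = (\<integral>\<^sup>+x. f x \<partial>lebesgue_power I)"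
  using assms nn_integral_distr[OF measurable_swap_coords, of i I j f]
  by (simp add: distr_swap_coords)

lemma integral_swap_coords:
  fixes f :: "_ \<Rightarrow> real"
  assumes "finite I" "i \<in> I" "j \<in> I" "f \<in> borel_measurable (lebesgue_power I)"
  shows "(\<integral>x. f (swap_coords i j x) \<partial>lebesgue_power I) = (\<integral>x. f x \<partial>lebesgue_power I)"
  using assms integral_distr[OF measurable_swap_coords, of i I j f]
  by (simp add: distr_swap_coords)

lemma distr_translate_lborel: "distr lborel borel (\<lambda>x. x + c) = (lborel :: real measure)"
proof -
  have "(\<lambda>x::real. x + c) = (+) c" by auto
  then show ?thesis using lborel_distr_plus[of c] by simp
qed

text \<open>Used to measure all coordinates from the smallest one. The shifted point is a restricted
  abstraction because points of the product space are \<open>undefined\<close> off \<open>I\<close>.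
  Invariance is again checked on boxes.\<close>

lemma nn_integral_translate_power:
  assumes "finite I" and f: "f \<in> borel_measurable (lebesgue_power I)"
  shows "(\<integral>\<^sup>+x. f (\<lambda>i\<in>I. x i + c) \<partial>lebesgue_power I) = (\<integral>\<^sup>+x. f x \<partial>lebesgue_power I)"
proof -
  have m: "(\<lambda>x. \<lambda>i\<in>I. x i + c) \<in> measurable (lebesgue_power I) (lebesgue_power I)"
    by measurable
  have "distr (lebesgue_power I) (lebesgue_power I) (\<lambda>x. \<lambda>i\<in>I. x i + c) = lebesgue_power I"
  proof (rule lborel_prod.PiM_eqI)
    fix A :: "nat \<Rightarrow> real set" assume A: "\<And>k. k \<in> I \<Longrightarrow> A k \<in> sets lborel"
    let ?B = "\<lambda>k. (\<lambda>x. x + c) -` A k"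
    have B: "?B k \<in> sets lborel \<and> emeasure lborel (?B k) = emeasure lborel (A k)" if "k \<in> I" for k
    proof -
      have "?B k \<in> sets borel" using A[OF that] measurable_sets[of "\<lambda>x. x + c" borel borel "A k"] by auto
      then show ?thesis
        using A[OF that] by (subst (2) distr_translate_lborel[of c, symmetric]) (auto simp: emeasure_distr)
    qed
    have eq: "(\<lambda>x. \<lambda>i\<in>I. x i + c) -` Pi\<^sub>E I A \<inter> space (lebesgue_power I) = Pi\<^sub>E I ?B"
      by (auto simp: space_PiM PiE_iff)
    show "emeasure (distr (lebesgue_power I) (lebesgue_power I) (\<lambda>x. \<lambda>i\<in>I. x i + c)) (Pi\<^sub>E I A)
       = (\<Prod>k\<in>I. emeasure lborel (A k))"
      using A B assms(1) by (subst emeasure_distr[OF m])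
        (auto simp: eq lborel_prod.emeasure_PiM intro!: sets_PiM_I_finite prod.cong)
  qed (use assms in auto)
  then show ?thesis using nn_integral_distr[OF m, of f] f by simp
qed

text \<open>Transpositions generate all permutations of \<open>I\<close>, and single transpositions
  are what the arguments below apply.\<close>

definition symmetric_on :: "nat set \<Rightarrow> ((nat \<Rightarrow> real) \<Rightarrow> 'a) \<Rightarrow> bool" where
  "symmetric_on I F \<longleftrightarrow> (\<forall>i\<in>I. \<forall>j\<in>I. \<forall>x. F (swap_coords i j x) = F x)"

lemma symmetric_onD: "symmetric_on I F \<Longrightarrow> i \<in> I \<Longrightarrow> j \<in> I \<Longrightarrow> F (swap_coords i j x) = F x"
  by (simp add: symmetric_on_def)

text \<open>Takes the place of the remark that ties form a null set. The integrands of interest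
  carry a Vandermonde factor, so with this condition the decomposition by the position of the
  minimum holds at every point.\<close>

definition zero_on_ties :: "nat set \<Rightarrow> ((nat \<Rightarrow> real) \<Rightarrow> 'a::zero) \<Rightarrow> bool" where
  "zero_on_ties I F \<longleftrightarrow> (\<forall>x. \<forall>i\<in>I. \<forall>j\<in>I. i \<noteq> j \<longrightarrow> x i = x j \<longrightarrow> F x = 0)"

text \<open>Away from ties the minimum sits at exactly one index, and at ties \<open>F\<close>
  vanishes; hence \<open>F\<close> is the pointwise sum of its pieces \<open>T i\<close> with
  minimum at \<open>i\<close>. A transposition carries each piece to the one with minimum at
  \<open>k\<close>, so all integrals agree.\<close>

lemma nn_integral_peel_min:
  fixes F :: "(nat \<Rightarrow> real) \<Rightarrow> ennreal"
  assumes "finite I" "k \<notin> I" and F[measurable]: "F \<in> borel_measurable (lebesgue_power (insert k I))"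
    and sym: "symmetric_on (insert k I) F" and ties: "zero_on_ties (insert k I) F"
  shows "(\<integral>\<^sup>+x. F x \<partial>lebesgue_power (insert k I)) =
     of_nat (Suc (card I)) *
     (\<integral>\<^sup>+x. F x * (if \<forall>j\<in>I. x k < x j then 1 else 0) \<partial>lebesgue_power (insert k I))"
proof -
  let ?K = "insert k I"
  define T where "T i x = F x * (if \<forall>j\<in>?K - {i}. x i < x j then 1 else (0::ennreal))" for i x
  have [measurable]: "T i \<in> borel_measurable (lebesgue_power ?K)" if "i \<in> ?K" for i
  proof -
    have "(\<lambda>x. \<forall>j\<in>?K - {i}. x i < x j) \<in> measurable (lebesgue_power ?K) (count_space UNIV)"
      using assms(1) that by (intro pred_intros_finite(3)) measurable
    then show ?thesis unfolding T_def by measurable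
  qed
  have "F x = (\<Sum>i\<in>?K. T i x)" for x
  proof (cases "\<exists>i\<in>?K. \<exists>j\<in>?K. i \<noteq> j \<and> x i = x j")
    case True
    then have "F x = 0" using ties by (auto simp: zero_on_ties_def)
    then show ?thesis by (simp add: T_def)
  next
    case False
    then have inj: "inj_on x ?K" by (auto simp: inj_on_def)
    have fin: "finite (x ` ?K)" "x ` ?K \<noteq> {}" using assms by auto
    then obtain m where m: "m \<in> ?K" "x m = Min (x ` ?K)" using Min_in[OF fin] by (metis imageE)
    have lt: "x m < x j" if "j \<in> ?K - {m}" for j
      using that m Min_le[OF fin(1), of "x j"] False by (metis DiffE image_eqI insertI1 order_le_imp_less_or_eq singletonI)
    have "T i x = 0" if "i \<in> ?K - {m}" for i
      unfolding T_def using lt[OF that] that m(1) by (auto dest: less_asym)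
    then have "(\<Sum>i\<in>?K. T i x) = (\<Sum>i\<in>{m}. T i x)"
      using m assms(1) by (intro sum.mono_neutral_right) auto
    also have "\<dots> = F x" using lt by (simp add: T_def)
    finally show ?thesis by simp
  qed
  then have "(\<integral>\<^sup>+x. F x \<partial>lebesgue_power ?K) = (\<integral>\<^sup>+x. (\<Sum>i\<in>?K. T i x) \<partial>lebesgue_power ?K)"
    by (intro nn_integral_cong) blast
  also have "\<dots> = (\<Sum>i\<in>?K. \<integral>\<^sup>+x. T i x \<partial>lebesgue_power ?K)"
    by (intro nn_integral_sum) auto
  also have "\<dots> = (\<Sum>i\<in>?K. \<integral>\<^sup>+x. T k x \<partial>lebesgue_power ?K)"
  proof (intro sum.cong refl)
    fix i assume i: "i \<in> ?K"
    have "T i x = T k (swap_coords i k x)" for x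
    proof -
      have "(\<forall>j\<in>?K - {i}. x i < x j) \<longleftrightarrow> (\<forall>j\<in>?K - {k}. swap_coords i k x k < swap_coords i k x j)"
        using i \<open>k \<notin> I\<close> by (auto split: if_splits)
      moreover have "F (swap_coords i k x) = F x" using sym i by (auto simp: symmetric_on_def)
      ultimately show ?thesis by (simp add: T_def)
    qed
    then show "(\<integral>\<^sup>+x. T i x \<partial>lebesgue_power ?K) = (\<integral>\<^sup>+x. T k x \<partial>lebesgue_power ?K)"
      using nn_integral_swap_coords[of ?K i k "T k"] i assms(1) by simp
  qed
  also have "\<dots> = of_nat (Suc (card I)) * (\<integral>\<^sup>+x. T k x \<partial>lebesgue_power ?K)"
    using assms by simp
  also have "T k = (\<lambda>x. F x * (if \<forall>j\<in>I. x k < x j then 1 else 0))"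
    unfolding T_def using \<open>k \<notin> I\<close> by simp
  finally show ?thesis .
qed

lemma borel_measurable_fun_upd_power:
  assumes "f \<in> borel_measurable (lebesgue_power (insert k I))" "k \<notin> I"
  shows "(\<lambda>x. f (x(k := u))) \<in> borel_measurable (lebesgue_power I)"
proof -
  have "(\<lambda>x. x(k := u)) \<in> measurable (lebesgue_power I) (lebesgue_power (insert k I))"
    by measurable
  from measurable_compose[OF this assms(1)] show ?thesis .
qed

text \<open>Each step peels off the minimum and stores it in the last coordinate, which makes the
  listing decreasing. The slice at a fixed minimum \<open>u\<close>, cut to points above
  \<open>u\<close>, is again symmetric and zero on ties, so the induction hypothesis applies to
  it.\<close>

lemma nn_integral_eq_fact_ordered:
  fixes F :: "(nat \<Rightarrow> real) \<Rightarrow> ennreal"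
  assumes "F \<in> borel_measurable (lebesgue_power {1..n})"
    and "symmetric_on {1..n} F" and "zero_on_ties {1..n} F"
  shows "(\<integral>\<^sup>+x. F x \<partial>lebesgue_power {1..n}) =
     fact n * (\<integral>\<^sup>+x. F x * (if \<forall>i\<in>{1..<n}. x i > x (Suc i) then 1 else 0) \<partial>lebesgue_power {1..n})"
  using assms
proof (induction n arbitrary: F)
  case (Suc n)
  let ?k = "Suc n" and ?I = "{1..n}"
  have ins: "{1..Suc n} = insert ?k ?I" by auto
  note [simp del] = One_nat_def
  note [measurable] = Suc.prems(1)[unfolded ins]
  \<comment> \<open>In a decreasing listing, \<open>u\<close> below the last entry is the same as
    \<open>u\<close> below all entries. The second form is the symmetric one, as the induction
    hypothesis requires.\<close>
  have ord: "(\<forall>i\<in>{1..<Suc n}. (x(?k := u)) i > (x(?k := u)) (Suc i)) \<longleftrightarrow>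
      (\<forall>j\<in>?I. u < x j) \<and> (\<forall>i\<in>{1..<n}. x i > x (Suc i))" for x :: "nat \<Rightarrow> real" and u
  proof safe
    assume H: "\<forall>i\<in>{1..<Suc n}. (x(?k := u)) i > (x(?k := u)) (Suc i)"
    show A: "x (Suc i) < x i" if "i \<in> {1..<n}" for i
      using H[rule_format, of i] that by auto
    show "u < x j" if j: "j \<in> ?I" for j
    proof -
      have "x n \<le> x j"
        using j
      proof (induction "n - j" arbitrary: j)
        case (Suc m)
        have "x n \<le> x (Suc j)" using Suc(2,3) by (intro Suc.hyps(1)) auto
        moreover have "x (Suc j) < x j" using Suc(2,3) by (intro A) auto
        ultimately show ?case by linarith
      qed auto
      moreover have "u < x n" using H[rule_format, of n] j by auto
      ultimately show ?thesis by simp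
    qed
  next
    fix i assume H: "\<forall>j\<in>?I. u < x j" "\<forall>i\<in>{1..<n}. x i > x (Suc i)" and i: "i \<in> {1..<Suc n}"
    show "(x(?k := u)) i > (x(?k := u)) (Suc i)"
    proof (cases "i = n")
      case True
      then show ?thesis using bspec[OF H(1), of i] i by simp
    next
      case False
      then show ?thesis using bspec[OF H(2), of i] i by simp
    qed
  qed
  have pred[measurable]: "(\<lambda>x. \<forall>j\<in>?I. x ?k < x j) \<in> measurable (lebesgue_power (insert ?k ?I)) (count_space UNIV)"
    by (intro pred_intros_finite(3)) measurable
  have pred2[measurable]: "(\<lambda>x. \<forall>i\<in>{1..<Suc n}. x i > x (Suc i)) \<in> measurable (lebesgue_power (insert ?k ?I)) (count_space UNIV)"
    by (intro pred_intros_finite(3) borel_measurable_pred_less measurable_coord) auto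
  have "(\<integral>\<^sup>+x. F x \<partial>lebesgue_power {1..Suc n}) = of_nat (Suc n) *
      (\<integral>\<^sup>+x. F x * (if \<forall>j\<in>?I. x ?k < x j then 1 else 0) \<partial>lebesgue_power (insert ?k ?I))"
    using Suc.prems unfolding ins by (subst nn_integral_peel_min) auto
  also have "(\<integral>\<^sup>+x. F x * (if \<forall>j\<in>?I. x ?k < x j then 1 else 0) \<partial>lebesgue_power (insert ?k ?I)) =
     (\<integral>\<^sup>+u. (\<integral>\<^sup>+x. F (x(?k := u)) * (if \<forall>j\<in>?I. u < x j then 1 else 0) \<partial>lebesgue_power ?I) \<partial>lborel)"
  proof (subst lborel_prod.product_nn_integral_insert_rev)
    have "(\<forall>j\<in>?I. (x(?k := u)) ?k < (x(?k := u)) j) \<longleftrightarrow> (\<forall>j\<in>?I. u < x j)" for x :: "nat \<Rightarrow> real" and u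
      by auto
    then show "(\<integral>\<^sup>+u. (\<integral>\<^sup>+x. F (x(?k := u)) * (if \<forall>j\<in>?I. (x(?k := u)) ?k < (x(?k := u)) j then 1 else 0)
         \<partial>lebesgue_power ?I) \<partial>lborel) =
      (\<integral>\<^sup>+u. (\<integral>\<^sup>+x. F (x(?k := u)) * (if \<forall>j\<in>?I. u < x j then 1 else 0) \<partial>lebesgue_power ?I) \<partial>lborel)"
      by (simp only:)
  qed (simp, simp, measurable)
  also have "\<dots> = (\<integral>\<^sup>+u. fact n * (\<integral>\<^sup>+x. F (x(?k := u)) * (if \<forall>j\<in>?I. u < x j then 1 else 0) *
      (if \<forall>i\<in>{1..<n}. x i > x (Suc i) then 1 else 0) \<partial>lebesgue_power ?I) \<partial>lborel)"
  proof (intro nn_integral_cong Suc.IH)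
    fix u :: real
    have [measurable]: "(\<lambda>x. F (x(?k := u))) \<in> borel_measurable (lebesgue_power ?I)"
      by (intro borel_measurable_fun_upd_power) auto
    have [measurable]: "(\<lambda>x. \<forall>j\<in>?I. u < x j) \<in> measurable (lebesgue_power ?I) (count_space UNIV)"
      by (intro pred_intros_finite(3)) measurable
    show "(\<lambda>x. F (x(?k := u)) * (if \<forall>j\<in>?I. u < x j then 1 else 0)) \<in> borel_measurable (lebesgue_power ?I)"
      by measurable
    show "symmetric_on ?I (\<lambda>x. F (x(?k := u)) * (if \<forall>j\<in>?I. u < x j then 1 else 0))"
      unfolding symmetric_on_def
    proof (intro ballI allI)
      fix i j and x :: "nat \<Rightarrow> real" assume ij: "i \<in> ?I" "j \<in> ?I"
      have e1: "(swap_coords i j x)(?k := u) = swap_coords i j (x(?k := u))" using ij by auto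
      have e2: "F (swap_coords i j (x(?k := u))) = F (x(?k := u))"
      proof -
        have "i \<in> {1..Suc n}" "j \<in> {1..Suc n}" using ij by auto
        then show ?thesis by (rule symmetric_onD[OF Suc.prems(2)])
      qed
      have e3: "(\<forall>l\<in>?I. u < swap_coords i j x l) \<longleftrightarrow> (\<forall>l\<in>?I. u < x l)"
      proof (intro iffI ballI)
        fix l assume H: "\<forall>l\<in>?I. u < swap_coords i j x l" and l: "l \<in> ?I"
        show "u < x l"
          using bspec[OF H ij(1)] bspec[OF H ij(2)] bspec[OF H l] by (auto split: if_splits)
      next
        fix l assume H: "\<forall>l\<in>?I. u < x l" and l: "l \<in> ?I"
        show "u < swap_coords i j x l"
          using bspec[OF H ij(1)] bspec[OF H ij(2)] bspec[OF H l] by auto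
      qed
      show "F ((swap_coords i j x)(?k := u)) * (if \<forall>l\<in>?I. u < swap_coords i j x l then 1 else 0)
         = F (x(?k := u)) * (if \<forall>j\<in>?I. u < x j then 1 else 0)"
        by (intro arg_cong2[where f = "(*)"] trans[OF arg_cong[where f = F, OF e1] e2]) (simp only: e3)
    qed
    show "zero_on_ties ?I (\<lambda>x. F (x(?k := u)) * (if \<forall>j\<in>?I. u < x j then 1 else 0))"
      unfolding zero_on_ties_def
    proof (intro allI ballI impI)
      fix x :: "nat \<Rightarrow> real" and i j assume "i \<in> ?I" "j \<in> ?I" "i \<noteq> j" "x i = x j"
      then have "F (x(?k := u)) = 0"
        using Suc.prems(3)[unfolded zero_on_ties_def, rule_format, of i j "x(?k := u)"] by auto
      then show "F (x(?k := u)) * (if \<forall>j\<in>?I. u < x j then 1 else 0) = 0" by simp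
    qed
  qed
  also have "\<dots> = (\<integral>\<^sup>+u. (\<integral>\<^sup>+x. fact n * (F (x(?k := u)) *
      (if \<forall>i\<in>{1..<Suc n}. (x(?k := u)) i > (x(?k := u)) (Suc i) then 1 else 0)) \<partial>lebesgue_power ?I) \<partial>lborel)"
  proof (intro nn_integral_cong)
    fix u :: real
    let ?h = "\<lambda>x. F x * (if \<forall>i\<in>{1..<Suc n}. x i > x (Suc i) then 1 else 0)"
    have "?h \<in> borel_measurable (lebesgue_power (insert ?k ?I))" by measurable
    then have m: "(\<lambda>x. ?h (x(?k := u))) \<in> borel_measurable (lebesgue_power ?I)"
      by (rule borel_measurable_fun_upd_power) simp
    have "F (x(?k := u)) * (if \<forall>j\<in>?I. u < x j then 1 else 0) *
      (if \<forall>i\<in>{1..<n}. x i > x (Suc i) then 1 else 0) = ?h (x(?k := u))" for x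
      unfolding ord by simp
    then show "fact n * (\<integral>\<^sup>+x. F (x(?k := u)) * (if \<forall>j\<in>?I. u < x j then 1 else 0) *
      (if \<forall>i\<in>{1..<n}. x i > x (Suc i) then 1 else 0) \<partial>lebesgue_power ?I) =
      (\<integral>\<^sup>+x. fact n * ?h (x(?k := u)) \<partial>lebesgue_power ?I)"
      by (simp only: nn_integral_cmult[OF m])
  qed
  also have "\<dots> = (\<integral>\<^sup>+x. fact n * (F x * (if \<forall>i\<in>{1..<Suc n}. x i > x (Suc i) then 1 else 0))
      \<partial>lebesgue_power (insert ?k ?I))"
    by (rule lborel_prod.product_nn_integral_insert_rev[symmetric]) (simp_all del: atLeastLessThan_iff, measurable)
  also have "\<dots> = fact n * (\<integral>\<^sup>+x. F x * (if \<forall>i\<in>{1..<Suc n}. x i > x (Suc i) then 1 else 0)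
      \<partial>lebesgue_power (insert ?k ?I))"
    by (rule nn_integral_cmult) measurable
  finally show ?case unfolding ins by (simp add: mult.assoc mult.left_commute)
qed simp

section \<open>The Prekopa--Leindler inequality\<close>

lemma emeasure_lborel_translate:
  assumes "S \<in> sets borel"
  shows "emeasure lborel ((\<lambda>x::real. x - b) -` S) = emeasure lborel S"
proof -
  have "emeasure lborel S = emeasure (distr lborel borel (\<lambda>x. x + (- b))) S"
    by (simp only: distr_translate_lborel)
  also have "\<dots> = emeasure lborel ((\<lambda>x::real. x - b) -` S)"
    using assms by (subst emeasure_distr) auto
  finally show ?thesis by simp
qed

text \<open>Substitute for a reduction to compact sets, where one would cut at the maximum. If the
  maximum is not attained, an increasing sequence in \<open>A\<close> towards the supremum exhausts
  \<open>A\<close> by lower parts.\<close>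

lemma emeasure_le_if_lower_parts:
  fixes A :: "real set"
  assumes A: "A \<in> sets borel" "A \<noteq> {}" and le: "\<And>a. a \<in> A \<Longrightarrow> emeasure lborel (A \<inter> {..a}) \<le> c"
  shows "emeasure lborel A \<le> c"
proof (cases "\<exists>m\<in>A. \<forall>x\<in>A. x \<le> m")
  case True
  then obtain m where m: "m \<in> A" "\<forall>x\<in>A. x \<le> m" by blast
  then have "A \<inter> {..m} = A" by auto
  then show ?thesis using le[OF m(1)] by simp
next
  case False
  from A have "ereal ` A \<noteq> {}" by auto
  from Sup_countable_SUP[OF this] obtain f :: "nat \<Rightarrow> ereal"
    where f: "incseq f" "range f \<subseteq> ereal ` A" "Sup (ereal ` A) = (SUP i. f i)" by blast
  define g where "g i = real_of_ereal (f i)" for i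
  have g: "g i \<in> A" "f i = ereal (g i)" for i
  proof -
    have "f i \<in> ereal ` A" using f(2) by blast
    then show "g i \<in> A" "f i = ereal (g i)" unfolding g_def by auto
  qed
  have inc: "incseq (\<lambda>i. A \<inter> {..g i})"
    using f(1) unfolding incseq_def by (auto simp: g(2) intro: order_trans)
  have "A = (\<Union>i. A \<inter> {..g i})"
  proof (intro equalityI subsetI)
    fix x assume x: "x \<in> A"
    then obtain z where z: "z \<in> A" "x < z" using False by (meson not_le)
    have "ereal x < ereal z" using z by simp
    also have "\<dots> \<le> Sup (ereal ` A)" using z by (intro Sup_upper) auto
    finally have "ereal x < (SUP i. f i)" using f(3) by simp
    then obtain i where "ereal x < f i" by (auto simp: less_SUP_iff)
    then have "x \<le> g i" by (simp add: g(2))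
    then show "x \<in> (\<Union>i. A \<inter> {..g i})" using x by auto
  qed auto
  then have "emeasure lborel A = (SUP i. emeasure lborel (A \<inter> {..g i}))"
    using A inc by (subst SUP_emeasure_incseq) auto
  also have "\<dots> \<le> c" using le g by (intro SUP_least) auto
  finally show ?thesis .
qed

text \<open>Reflection in the origin exchanges upper and lower parts.\<close>

lemma emeasure_le_if_upper_parts:
  fixes B :: "real set"
  assumes B: "B \<in> sets borel" "B \<noteq> {}" and le: "\<And>b. b \<in> B \<Longrightarrow> emeasure lborel (B \<inter> {b..}) \<le> c"
  shows "emeasure lborel B \<le> c"
proof -
  have em: "emeasure lborel (uminus -` S) = emeasure lborel S" if "S \<in> sets borel" for S :: "real set"
    using that by (subst (2) lborel_distr_uminus[symmetric], subst emeasure_distr) auto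
  have "emeasure lborel (uminus -` B) \<le> c"
  proof (rule emeasure_le_if_lower_parts)
    show "uminus -` B \<in> sets borel"
      using B measurable_sets[of uminus borel borel B] by auto
    show "uminus -` B \<noteq> {}" using B by (metis (no_types) all_not_in_conv minus_minus vimageI)
    fix a assume a: "a \<in> uminus -` B"
    have "emeasure lborel (uminus -` B \<inter> {..a}) = emeasure lborel (uminus -` (B \<inter> {- a..}))"
      by (rule arg_cong) auto
    also have "\<dots> = emeasure lborel (B \<inter> {- a..})" using B by (intro em) auto
    also have "\<dots> \<le> c" using a by (intro le) auto
    finally show "emeasure lborel (uminus -` B \<inter> {..a}) \<le> c" .
  qed
  then show ?thesis using B by (simp add: em)
qed

text \<open>The translates \<open>A \<inter> {..a} + b\<close> and \<open>a + B \<inter> {b..}\<close> overlap in at most one point.\<close>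

lemma emeasure_midpoints:
  fixes A B C :: "real set"
  assumes A: "A \<in> sets borel" "A \<noteq> {}" and B: "B \<in> sets borel" "B \<noteq> {}" and C: "C \<in> sets borel"
    and mid: "\<And>a b. a \<in> A \<Longrightarrow> b \<in> B \<Longrightarrow> (a + b) / 2 \<in> C"
  shows "emeasure lborel A + emeasure lborel B \<le> 2 * emeasure lborel C"
proof -
  let ?c = "2 * emeasure lborel C"
  have one: "emeasure lborel (A \<inter> {..a}) + emeasure lborel (B \<inter> {b..}) \<le> ?c"
    if a: "a \<in> A" and b: "b \<in> B" for a b
  proof -
    define T1 where "T1 = (\<lambda>x. x - b) -` (A \<inter> {..a})"
    define T2 where "T2 = (\<lambda>x. x - a) -` (B \<inter> {b..})"
    define C2 where "C2 = (\<lambda>x. x / 2) -` C"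
    have meas: "T1 \<in> sets borel" "T2 \<in> sets borel" "C2 \<in> sets borel"
      using A B C measurable_sets[of "\<lambda>x. x - b" borel borel "A \<inter> {..a}"]
        measurable_sets[of "\<lambda>x. x - a" borel borel "B \<inter> {b..}"]
        measurable_sets[of "\<lambda>x::real. x / 2" borel borel C]
      unfolding T1_def T2_def C2_def by auto
    have "emeasure lborel (A \<inter> {..a}) + emeasure lborel (B \<inter> {b..}) = emeasure lborel T1 + emeasure lborel T2"
      using A B unfolding T1_def T2_def
      by (intro arg_cong2[where f = "(+)"] emeasure_lborel_translate[symmetric]) auto
    also have "emeasure lborel T1 = emeasure lborel (T1 - {a + b})"
      using meas by (intro emeasure_Diff_null_set[symmetric]) (auto intro: null_setsI)
    also have "emeasure lborel (T1 - {a + b}) + emeasure lborel T2 = emeasure lborel ((T1 - {a + b}) \<union> T2)"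
      using meas by (intro plus_emeasure) (auto simp: T1_def T2_def)
    also have "\<dots> \<le> emeasure lborel C2"
    proof (intro emeasure_mono)
      show "(T1 - {a + b}) \<union> T2 \<subseteq> C2"
      proof
        fix s assume "s \<in> (T1 - {a + b}) \<union> T2"
        then show "s \<in> C2"
          using mid[of "s - b" b] mid[of a "s - a"] a b unfolding T1_def T2_def C2_def by auto
      qed
    qed (use meas in auto)
    also have "emeasure lborel C2 = ?c"
    proof -
      have "emeasure lborel C = (\<integral>\<^sup>+x. indicator C x \<partial>lborel)" using C by simp
      also have "\<dots> = ennreal \<bar>1/2\<bar> * (\<integral>\<^sup>+x. indicator C (0 + 1/2 * x) \<partial>lborel)"
        using C by (intro nn_integral_real_affine) auto
      also have "(\<integral>\<^sup>+x. indicator C (0 + 1/2 * x) \<partial>lborel) = (\<integral>\<^sup>+x. indicator C2 x \<partial>lborel)"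
        by (intro nn_integral_cong) (auto simp: C2_def indicator_def)
      also have "\<dots> = emeasure lborel C2" using meas by simp
      finally have "?c = 2 * (ennreal (1/2) * emeasure lborel C2)" by simp
      also have "\<dots> = (ennreal 2 * ennreal (1/2)) * emeasure lborel C2" by (simp add: mult.assoc)
      also have "\<dots> = emeasure lborel C2" by (subst ennreal_mult[symmetric]) auto
      finally show ?thesis by simp
    qed
    finally show ?thesis .
  qed
  show ?thesis
  \<comment> \<open>The cut points are removed one at a time, for fixed \<open>b\<close> and then
    for the whole of \<open>A\<close>. Each removal moves a summand to the other side by subtraction
    in \<open>ennreal\<close>, which is faithful only for a finite right-hand side.\<close>
  proof (cases "?c = top")
    case False
    have B1: "emeasure lborel (B \<inter> {b..}) \<le> ?c" if "b \<in> B" for b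
    proof -
      obtain a where "a \<in> A" using A(2) by blast
      from order_trans[OF _ one[OF this that]] show ?thesis by (simp add: add_increasing)
    qed
    have "emeasure lborel A \<le> ?c - emeasure lborel (B \<inter> {b..})" if "b \<in> B" for b
    proof (rule emeasure_le_if_lower_parts[OF A])
      fix a assume "a \<in> A"
      from one[OF this that] show "emeasure lborel (A \<inter> {..a}) \<le> ?c - emeasure lborel (B \<inter> {b..})"
        by (simp add: ennreal_le_minus_iff)
    qed
    then have 2: "emeasure lborel A + emeasure lborel (B \<inter> {b..}) \<le> ?c" if "b \<in> B" for b
      using that B1[OF that] by (fastforce simp: ennreal_le_minus_iff dest: leD)
    then have A1: "emeasure lborel A \<le> ?c"
    proof -
      obtain b where "b \<in> B" using B(2) by blast
      from order_trans[OF _ 2[OF this]] show ?thesis by (simp add: add_increasing2)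
    qed
    have "emeasure lborel B \<le> ?c - emeasure lborel A"
    proof (rule emeasure_le_if_upper_parts[OF B])
      fix b assume "b \<in> B"
      from 2[OF this] show "emeasure lborel (B \<inter> {b..}) \<le> ?c - emeasure lborel A"
        by (simp add: ennreal_le_minus_iff add.commute)
    qed
    then show ?thesis using A1 by (auto simp: ennreal_le_minus_iff add.commute dest: leD)
  qed simp
qed

section \<open>From level sets to the functional inequality\<close>

lemma nn_integral_level:
  fixes y :: ennreal and c :: real
  assumes "c > 0"
  shows "ennreal c * (\<integral>\<^sup>+\<tau>. indicator {0..<1} \<tau> * (if ennreal (c * \<tau>) < y then 1 else 0) \<partial>lborel) = min y (ennreal c)"
proof (cases "ennreal c \<le> y")
  case True
  have "ennreal (c * \<tau>) < y" if "\<tau> \<in> {0..<1}" for \<tau>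
  proof -
    have "ennreal (c * \<tau>) < ennreal c" using assms that by (intro ennreal_lessI) auto
    then show ?thesis using True by simp
  qed
  then have "(\<integral>\<^sup>+\<tau>. indicator {0..<1} \<tau> * (if ennreal (c * \<tau>) < y then 1 else 0) \<partial>lborel) = (\<integral>\<^sup>+\<tau>. indicator {0..<1::real} \<tau> \<partial>lborel)"
    by (intro nn_integral_cong) (auto split: split_indicator)
  then show ?thesis using True by (simp add: min_def)
next
  case False
  then obtain r where r: "y = ennreal r" "0 \<le> r" by (cases y) auto
  with False assms have rc: "r < c" by (metis ennreal_leI not_le)
  have "(\<integral>\<^sup>+\<tau>. indicator {0..<1} \<tau> * (if ennreal (c * \<tau>) < y then 1 else 0) \<partial>lborel) = (\<integral>\<^sup>+\<tau>. indicator {0..<r / c} \<tau> \<partial>lborel)"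
  proof (intro nn_integral_cong)
    fix \<tau> :: real
    have "r / c < 1" using rc assms by simp
    moreover have "\<tau> < r / c \<longleftrightarrow> c * \<tau> < r" using assms by (simp add: field_simps)
    moreover have "\<tau> < 1" if "c * \<tau> < r"
    proof -
      have "c * \<tau> < c * 1" using that rc by simp
      then show ?thesis using assms by (simp only: mult_less_cancel_left_pos)
    qed
    ultimately show "indicator {0..<1} \<tau> * (if ennreal (c * \<tau>) < y then 1 else 0) = (indicator {0..<r / c} \<tau> :: ennreal)"
      using assms r by (auto split: split_indicator simp: ennreal_less_iff)
  qed
  also have "\<dots> = ennreal (r / c)" using r assms by simp
  finally show ?thesis using r assms rc False
    by (simp add: ennreal_mult[symmetric] min_def)
qed

text \<open>Layer-cake formula with levels written as \<open>c * \<tau>\<close> for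
  \<open>\<tau>\<close> in \<open>[0, 1)\<close>. The normalisation lets superlevel sets of
  functions with different suprema be compared at the same \<open>\<tau>\<close>.\<close>

lemma nn_integral_min_level:
  fixes f :: "real \<Rightarrow> ennreal"
  assumes [measurable]: "f \<in> borel_measurable borel" and "c > 0"
  shows "(\<integral>\<^sup>+u. min (f u) (ennreal c) \<partial>lborel) =
    ennreal c * (\<integral>\<^sup>+\<tau>. indicator {0..<1} \<tau> * emeasure lborel {u. ennreal (c * \<tau>) < f u} \<partial>lborel)"
proof -
  have "(\<integral>\<^sup>+u. min (f u) (ennreal c) \<partial>lborel) = (\<integral>\<^sup>+u. ennreal c * (\<integral>\<^sup>+\<tau>. indicator {0..<1} \<tau> * (if ennreal (c * \<tau>) < f u then 1 else 0) \<partial>lborel) \<partial>lborel)"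
    using assms by (simp add: nn_integral_level)
  also have "\<dots> = ennreal c * (\<integral>\<^sup>+u. (\<integral>\<^sup>+\<tau>. indicator {0..<1} \<tau> * (if ennreal (c * \<tau>) < f u then 1 else 0) \<partial>lborel) \<partial>lborel)"
    by (intro nn_integral_cmult) measurable
  also have "(\<integral>\<^sup>+u. (\<integral>\<^sup>+\<tau>. indicator {0..<1} \<tau> * (if ennreal (c * \<tau>) < f u then 1 else 0) \<partial>lborel) \<partial>lborel) =
     (\<integral>\<^sup>+\<tau>. (\<integral>\<^sup>+u. indicator {0..<1} \<tau> * (if ennreal (c * \<tau>) < f u then 1 else 0) \<partial>lborel) \<partial>lborel)"
    by (rule lborel_pair.Fubini'[symmetric]) measurable
  also have "\<dots> = (\<integral>\<^sup>+\<tau>. indicator {0..<1} \<tau> * emeasure lborel {u. ennreal (c * \<tau>) < f u} \<partial>lborel)"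
  proof (intro nn_integral_cong)
    fix \<tau> :: real
    have "(\<integral>\<^sup>+u. indicator {0..<1} \<tau> * (if ennreal (c * \<tau>) < f u then 1 else 0) \<partial>lborel) =
       indicator {0..<1} \<tau> * (\<integral>\<^sup>+u. indicator {u. ennreal (c * \<tau>) < f u} u \<partial>lborel)"
      by (subst nn_integral_cmult[symmetric]) (auto intro!: nn_integral_cong simp: indicator_def)
    then show "(\<integral>\<^sup>+u. indicator {0..<1} \<tau> * (if ennreal (c * \<tau>) < f u then 1 else 0) \<partial>lborel) =
       indicator {0..<1} \<tau> * emeasure lborel {u. ennreal (c * \<tau>) < f u}" by simp
  qed
  finally show ?thesis .
qed

lemma ennreal_four_mult_le_square:
  fixes x y :: ennreal
  shows "4 * (x * y) \<le> (x + y)\<^sup>2"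
proof (cases "x = top \<or> y = top")
  case False
  then obtain a b where ab: "x = ennreal a" "0 \<le> a" "y = ennreal b" "0 \<le> b"
    by (metis ennreal_cases)
  have "4 * (a * b) \<le> (a + b)\<^sup>2" using sum_squares_bound[of a b] by (simp add: power2_sum)
  then have "ennreal (4 * (a * b)) \<le> ennreal ((a + b)\<^sup>2)" by (rule ennreal_leI)
  also have "ennreal ((a + b)\<^sup>2) = (x + y)\<^sup>2" using ab by (simp add: ennreal_power flip: ennreal_plus)
  also have "ennreal (4 * (a * b)) = 4 * (x * y)" using ab by (simp add: ennreal_mult)
  finally show ?thesis .
qed (auto simp: power2_eq_square ennreal_mult_top ennreal_top_mult)

text \<open>Levels are normalised by the suprema \<open>A\<close> and \<open>B\<close> of
  \<open>f\<close> and \<open>g\<close>, and by \<open>C = sqrt (A * B)\<close> for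
  \<open>h\<close>. For every \<open>\<tau> < 1\<close> the superlevel sets of \<open>f\<close> and
  \<open>g\<close> are then nonempty, which is where boundedness enters, and their midpoints lie in
  the superlevel set of \<open>h\<close>. Brunn--Minkowski integrated over \<open>\<tau>\<close>
  gives a sum, and the arithmetic-geometric mean inequality turns it into a product.\<close>

lemma prekopa_leindler_bounded:
  fixes f g h :: "real \<Rightarrow> ennreal"
  assumes [measurable]: "f \<in> borel_measurable borel" "g \<in> borel_measurable borel" "h \<in> borel_measurable borel"
    and le: "\<And>u v. f u * g v \<le> (h ((u + v) / 2))\<^sup>2"
    and bd: "\<And>u. f u \<le> ennreal K" "\<And>u. g u \<le> ennreal K"
  shows "(\<integral>\<^sup>+u. f u \<partial>lborel) * (\<integral>\<^sup>+u. g u \<partial>lborel) \<le> (\<integral>\<^sup>+u. h u \<partial>lborel)\<^sup>2"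
proof (cases "(\<forall>u. f u = 0) \<or> (\<forall>u. g u = 0)")
  case False
  have "(SUP u. f u) \<le> ennreal K" "(SUP u. g u) \<le> ennreal K" using bd by (auto intro!: SUP_least)
  then have fin: "(SUP u. f u) < top" "(SUP u. g u) < top" by (auto simp: le_less_trans)
  define A where "A = enn2real (SUP u. f u)"
  define B where "B = enn2real (SUP u. g u)"
  have A: "ennreal A = (SUP u. f u)" and B: "ennreal B = (SUP u. g u)"
    unfolding A_def B_def using fin by auto
  have fA: "f u \<le> ennreal A" and gB: "g u \<le> ennreal B" for u unfolding A B by (auto intro: SUP_upper)
  have A0: "A > 0" using False fA by (metis ennreal_neg le_zero_eq not_le)
  have B0: "B > 0" using False gB by (metis ennreal_neg le_zero_eq not_le)
  define C where "C = sqrt (A * B)"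
  have C0: "C > 0" and C2: "C * C = A * B" using A0 B0 unfolding C_def by auto
  define a where "a \<tau> = emeasure lborel {u. ennreal (A * \<tau>) < f u}" for \<tau>
  define b where "b \<tau> = emeasure lborel {u. ennreal (B * \<tau>) < g u}" for \<tau>
  define c where "c \<tau> = emeasure lborel {u. ennreal (C * \<tau>) < h u}" for \<tau>
  have meas_level: "(\<lambda>\<tau>. emeasure lborel {u. ennreal (r * \<tau>) < k u}) \<in> borel_measurable borel"
    if [measurable]: "k \<in> borel_measurable borel" for k :: "real \<Rightarrow> ennreal" and r
  proof -
    have "(\<lambda>\<tau>. \<integral>\<^sup>+u. (if ennreal (r * \<tau>) < k u then 1 else 0) \<partial>lborel) \<in> borel_measurable borel"
      by measurable
    also have "(\<lambda>\<tau>. \<integral>\<^sup>+u. (if ennreal (r * \<tau>) < k u then 1 else 0) \<partial>lborel) =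
       (\<lambda>\<tau>. \<integral>\<^sup>+u. indicator {u. ennreal (r * \<tau>) < k u} u \<partial>lborel)"
      by (intro ext nn_integral_cong) (auto simp: indicator_def)
    finally show ?thesis by simp
  qed
  have [measurable]: "a \<in> borel_measurable borel" "b \<in> borel_measurable borel" "c \<in> borel_measurable borel"
    unfolding a_def b_def c_def by (auto intro!: meas_level)
  have abc: "a \<tau> + b \<tau> \<le> 2 * c \<tau>" if \<tau>: "\<tau> \<in> {0..<1}" for \<tau>
    unfolding a_def b_def c_def
  proof (rule emeasure_midpoints)
    have "ennreal (A * \<tau>) < ennreal A" using \<tau> A0 by (intro ennreal_lessI) auto
    then show "{u. ennreal (A * \<tau>) < f u} \<noteq> {}" unfolding A less_SUP_iff by auto
    have "ennreal (B * \<tau>) < ennreal B" using \<tau> B0 by (intro ennreal_lessI) auto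
    then show "{u. ennreal (B * \<tau>) < g u} \<noteq> {}" unfolding B less_SUP_iff by auto
    fix u v assume u: "u \<in> {u. ennreal (A * \<tau>) < f u}" and v: "v \<in> {u. ennreal (B * \<tau>) < g u}"
    have "(ennreal (C * \<tau>))\<^sup>2 = ennreal (A * \<tau>) * ennreal (B * \<tau>)"
      using A0 B0 C0 C2 \<tau> by (simp add: ennreal_power ennreal_mult[symmetric] power2_eq_square mult.assoc mult.left_commute)
    also have "\<dots> < f u * g v"
    proof -
      have "f u \<noteq> top" "g v \<noteq> top"
        using fA[of u] gB[of v] by (auto simp: top_unique)
      then obtain r s where rs: "f u = ennreal r" "0 \<le> r" "g v = ennreal s" "0 \<le> s"
        by (metis ennreal_cases)
      have "A * \<tau> < r" "B * \<tau> < s" using u v rs \<tau> A0 B0 by (auto simp: ennreal_less_iff)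
      then have "(A * \<tau>) * (B * \<tau>) < r * s" using \<tau> A0 B0 by (intro mult_strict_mono') auto
      then show ?thesis using rs \<tau> A0 B0 by (simp add: ennreal_mult[symmetric] ennreal_less_iff)
    qed
    also have "\<dots> \<le> (h ((u + v) / 2))\<^sup>2" by (rule le)
    finally have "ennreal (C * \<tau>) < h ((u + v) / 2)"
      by (meson leD leI power_mono zero_le)
    then show "(u + v) / 2 \<in> {u. ennreal (C * \<tau>) < h u}" by simp
  qed measurable
  let ?I = "\<lambda>k. \<integral>\<^sup>+\<tau>. indicator {0..<1} \<tau> * k \<tau> \<partial>lborel"
  have F: "(\<integral>\<^sup>+u. f u \<partial>lborel) = ennreal A * ?I a"
    using nn_integral_min_level[of f A] A0 fA by (simp add: min_absorb1 a_def)
  have G: "(\<integral>\<^sup>+u. g u \<partial>lborel) = ennreal B * ?I b"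
    using nn_integral_min_level[of g B] B0 gB by (simp add: min_absorb1 b_def)
  have H: "ennreal C * ?I c \<le> (\<integral>\<^sup>+u. h u \<partial>lborel)"
    using nn_integral_min_level[of h C] C0
    by (metis (no_types, lifting) assms(3) c_def min.cobounded1 nn_integral_cong nn_integral_mono)
  have "?I a + ?I b = ?I (\<lambda>\<tau>. a \<tau> + b \<tau>)"
    by (subst nn_integral_add[symmetric]) (auto simp: distrib_left)
  also have "\<dots> \<le> ?I (\<lambda>\<tau>. 2 * c \<tau>)"
    using abc by (intro nn_integral_mono) (auto split: split_indicator)
  also have "\<dots> = 2 * ?I c"
    by (subst nn_integral_cmult[symmetric]) (auto simp: mult.left_commute)
  finally have ab: "?I a + ?I b \<le> 2 * ?I c" .
  have "4 * (?I a * ?I b) \<le> (?I a + ?I b)\<^sup>2" by (rule ennreal_four_mult_le_square)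
  also have "\<dots> \<le> (2 * ?I c)\<^sup>2" using ab by (intro power_mono) auto
  also have "\<dots> = 4 * (?I c)\<^sup>2" by (simp add: power_mult_distrib)
  finally have "ennreal (1/4) * (4 * (?I a * ?I b)) \<le> ennreal (1/4) * (4 * (?I c)\<^sup>2)"
    by (rule mult_left_mono) simp
  moreover have "ennreal (1/4) * (4 * z) = z" for z
  proof -
    have "ennreal (1/4) * (4 * z) = (ennreal (1/4) * ennreal 4) * z" by (simp add: mult.assoc)
    also have "ennreal (1/4) * ennreal 4 = 1" by (subst ennreal_mult[symmetric]) auto
    finally show ?thesis by simp
  qed
  ultimately have "?I a * ?I b \<le> (?I c)\<^sup>2" by simp
  moreover have "ennreal A * ennreal B = ennreal C * ennreal C"
    using A0 B0 C0 C2 by (simp flip: ennreal_mult)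
  ultimately have "(ennreal A * ennreal B) * (?I a * ?I b) \<le> (ennreal C * ennreal C) * (?I c)\<^sup>2"
    by (simp add: mult_left_mono)
  then have "(\<integral>\<^sup>+u. f u \<partial>lborel) * (\<integral>\<^sup>+u. g u \<partial>lborel) \<le> (ennreal C * ?I c)\<^sup>2"
    unfolding F G by (simp add: power2_eq_square mult_ac)
  also have "\<dots> \<le> (\<integral>\<^sup>+u. h u \<partial>lborel)\<^sup>2" using H by (intro power_mono) auto
  finally show ?thesis .
qed auto

lemma nn_integral_SUP_truncate:
  fixes f :: "real \<Rightarrow> ennreal"
  assumes [measurable]: "f \<in> borel_measurable borel"
  shows "(\<integral>\<^sup>+u. f u \<partial>lborel) = (SUP k::nat. \<integral>\<^sup>+u. min (f u) (of_nat k) \<partial>lborel)"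
proof -
  have "f u = (SUP k::nat. min (f u) (of_nat k))" for u
  proof (rule antisym)
    have "(SUP k::nat. min (f u) (of_nat k)) = min (f u) (SUP k::nat. of_nat k)"
      by (simp add: inf_min[symmetric] inf_SUP)
    then show "f u \<le> (SUP k::nat. min (f u) (of_nat k))"
      by (simp add: ennreal_SUP_of_nat_eq_top)
  qed (auto intro: SUP_least)
  then have "(\<integral>\<^sup>+u. f u \<partial>lborel) = (\<integral>\<^sup>+u. (SUP k::nat. min (f u) (of_nat k)) \<partial>lborel)"
    by (intro nn_integral_cong) blast
  also have "\<dots> = (SUP k::nat. \<integral>\<^sup>+u. min (f u) (of_nat k) \<partial>lborel)"
    by (intro nn_integral_monotone_convergence_SUP)
       (auto simp: incseq_def le_fun_def intro!: min.mono intro: min.coboundedI2 of_nat_mono)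
  finally show ?thesis .
qed

text \<open>Truncating \<open>f\<close> and \<open>g\<close> keeps the pointwise hypothesis; the two
  truncation levels tend to infinity independently, so the product of the two suprema is
  reached.\<close>

lemma prekopa_leindler_real:
  fixes f g h :: "real \<Rightarrow> ennreal"
  assumes [measurable]: "f \<in> borel_measurable borel" "g \<in> borel_measurable borel" "h \<in> borel_measurable borel"
    and le: "\<And>u v. f u * g v \<le> (h ((u + v) / 2))\<^sup>2"
  shows "(\<integral>\<^sup>+u. f u \<partial>lborel) * (\<integral>\<^sup>+u. g u \<partial>lborel) \<le> (\<integral>\<^sup>+u. h u \<partial>lborel)\<^sup>2"
proof -
  let ?F = "\<lambda>k::nat. \<integral>\<^sup>+u. min (f u) (of_nat k) \<partial>lborel"
  let ?G = "\<lambda>k::nat. \<integral>\<^sup>+u. min (g u) (of_nat k) \<partial>lborel"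
  have kl: "?F k * ?G l \<le> (\<integral>\<^sup>+u. h u \<partial>lborel)\<^sup>2" for k l
  proof (rule prekopa_leindler_bounded[where K = "real (max k l)"])
    show "min (f u) (of_nat k) * min (g v) (of_nat l) \<le> (h ((u + v) / 2))\<^sup>2" for u v
      by (rule order_trans[OF mult_mono le[of u v]]) auto
    show "min (f u) (of_nat k) \<le> ennreal (real (max k l))" for u
      by (intro min.coboundedI2) (simp add: ennreal_of_nat_eq_real_of_nat)
    show "min (g u) (of_nat l) \<le> ennreal (real (max k l))" for u
      by (intro min.coboundedI2) (simp add: ennreal_of_nat_eq_real_of_nat)
  qed measurable
  have "(SUP k. ?F k) * (SUP l. ?G l) = (SUP l. (SUP k. ?F k * ?G l))"
    by (simp add: SUP_mult_left_ennreal SUP_mult_right_ennreal)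
  also have "\<dots> \<le> (\<integral>\<^sup>+u. h u \<partial>lborel)\<^sup>2" using kl by (intro SUP_least)
  finally show ?thesis
    by (subst (1 2) nn_integral_SUP_truncate) auto
qed

text \<open>Tensorisation: for fixed values \<open>u\<close>, \<open>v\<close> of the new
  coordinate, the induction hypothesis on the slices is exactly the one-dimensional hypothesis for
  the marginals.\<close>

lemma prekopa_leindler:
  fixes f g h :: "(nat \<Rightarrow> real) \<Rightarrow> ennreal"
  assumes "finite I"
    and "f \<in> borel_measurable (lebesgue_power I)" "g \<in> borel_measurable (lebesgue_power I)"
      "h \<in> borel_measurable (lebesgue_power I)"
    and "\<And>x y. f x * g y \<le> (h (\<lambda>i\<in>I. (x i + y i) / 2))\<^sup>2"
  shows "(\<integral>\<^sup>+x. f x \<partial>lebesgue_power I) * (\<integral>\<^sup>+x. g x \<partial>lebesgue_power I) \<le> (\<integral>\<^sup>+x. h x \<partial>lebesgue_power I)\<^sup>2"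
  using assms
proof (induction I arbitrary: f g h rule: finite_induct)
  case empty
  have "(\<integral>\<^sup>+x. k x \<partial>lebesgue_power {}) = k (\<lambda>_. undefined)" for k :: "(nat \<Rightarrow> real) \<Rightarrow> ennreal"
    by (simp add: PiM_empty nn_integral_count_space_finite)
  then show ?case using empty(4)[of "\<lambda>_. undefined" "\<lambda>_. undefined"] by (simp add: restrict_def)
next
  case (insert k I)
  have joint: "(\<lambda>u. \<integral>\<^sup>+x. w (x(k := u)) \<partial>lebesgue_power I) \<in> borel_measurable borel"
    if [measurable]: "w \<in> borel_measurable (lebesgue_power (insert k I))" for w :: "_ \<Rightarrow> ennreal"
  proof -
    interpret I: finite_product_sigma_finite "\<lambda>_. lborel :: real measure" I
      by standard (use insert in auto)
    have "(\<lambda>(u, x). w (x(k := u))) \<in> borel_measurable (lborel \<Otimes>\<^sub>M lebesgue_power I)"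
      by measurable
    from I.borel_measurable_nn_integral[OF this] show ?thesis by simp
  qed
  show ?case
    unfolding lborel_prod.product_nn_integral_insert_rev[OF insert(1,2) insert(4)]
      lborel_prod.product_nn_integral_insert_rev[OF insert(1,2) insert(5)]
      lborel_prod.product_nn_integral_insert_rev[OF insert(1,2) insert(6)]
  proof (rule prekopa_leindler_real)
    fix u v :: real
    show "(\<integral>\<^sup>+x. f (x(k := u)) \<partial>lebesgue_power I) * (\<integral>\<^sup>+x. g (x(k := v)) \<partial>lebesgue_power I)
       \<le> (\<integral>\<^sup>+x. h (x(k := (u + v) / 2)) \<partial>lebesgue_power I)\<^sup>2"
    proof (rule insert.IH)
      fix x y :: "nat \<Rightarrow> real"
      have eq: "(\<lambda>i\<in>insert k I. ((x(k := u)) i + (y(k := v)) i) / 2) = (\<lambda>i\<in>I. (x i + y i) / 2)(k := (u + v) / 2)"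
        using insert(2) by (auto simp: fun_eq_iff)
      show "f (x(k := u)) * g (y(k := v)) \<le> (h ((\<lambda>i\<in>I. (x i + y i) / 2)(k := (u + v) / 2)))\<^sup>2"
        using insert.prems(4)[of "x(k := u)" "y(k := v)"] unfolding eq .
    qed (intro borel_measurable_fun_upd_power insert.prems(1-3) insert.hyps(2))+
  qed (use insert.prems(1-3) in \<open>auto intro: joint\<close>)
qed

section \<open>Integration by parts against the Laguerre weight\<close>

text \<open>With ordered pairs, reindexing along a transposition needs no distinction of which index
  is smaller. The price is that every unordered pair occurs twice, once with each sign of the
  difference.\<close>

definition pair_prod :: "(real \<Rightarrow> real) \<Rightarrow> nat set \<Rightarrow> (nat \<Rightarrow> real) \<Rightarrow> real" where
  "pair_prod q I x = (\<Prod>i\<in>I. \<Prod>j\<in>I - {i}. q (x i - x j))"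

lemma pair_prod_insert:
  assumes "finite I" "k \<notin> I"
  shows "pair_prod q (insert k I) x = (\<Prod>j\<in>I. q (x k - x j) * q (x j - x k)) * pair_prod q I x"
proof -
  have "pair_prod q (insert k I) x =
      (\<Prod>j\<in>I. q (x k - x j)) * (\<Prod>i\<in>I. \<Prod>j\<in>insert k I - {i}. q (x i - x j))"
    using assms unfolding pair_prod_def by simp
  also have "(\<Prod>i\<in>I. \<Prod>j\<in>insert k I - {i}. q (x i - x j)) =
      (\<Prod>i\<in>I. q (x i - x k) * (\<Prod>j\<in>I - {i}. q (x i - x j)))"
  proof (intro prod.cong refl)
    fix i assume "i \<in> I"
    then have "insert k I - {i} = insert k (I - {i})" using assms by auto
    then show "(\<Prod>j\<in>insert k I - {i}. q (x i - x j)) = q (x i - x k) * (\<Prod>j\<in>I - {i}. q (x i - x j))"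
      using assms by simp
  qed
  finally show ?thesis by (simp add: pair_prod_def prod.distrib mult_ac)
qed

lemma pair_prod_cong: "(\<And>i. i \<in> I \<Longrightarrow> x i = y i) \<Longrightarrow> pair_prod q I x = pair_prod q I y"
  unfolding pair_prod_def by (intro prod.cong refl) auto

lemma bij_betw_transpose_on: "i \<in> I \<Longrightarrow> j \<in> I \<Longrightarrow> bij_betw (Transposition.transpose i j) I I"
proof -
  assume "i \<in> I" "j \<in> I"
  then have "Transposition.transpose i j ` I = I"
    by (auto simp: transpose_def image_iff split: if_splits)
  then show ?thesis by (simp add: bij_betw_def)
qed

lemma swap_coords_eq_comp: "swap_coords i j x = (\<lambda>k. x (Transposition.transpose i j k))"
  by (auto simp: transpose_def)

lemma prod_swap_coords:
  assumes "i \<in> I" "j \<in> I"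
  shows "(\<Prod>k\<in>I. f (swap_coords i j x k)) = (\<Prod>k\<in>I. f (x k))"
  unfolding swap_coords_eq_comp
  using prod.reindex_bij_betw[OF bij_betw_transpose_on[OF assms], of "\<lambda>k. f (x k)"] .

lemma pair_prod_swap_coords:
  assumes "i \<in> I" "j \<in> I"
  shows "pair_prod q I (swap_coords i j x) = pair_prod q I x"
proof -
  let ?t = "Transposition.transpose i j"
  have "pair_prod q I (swap_coords i j x) = (\<Prod>k\<in>I. \<Prod>l\<in>I - {k}. q (x (?t k) - x (?t l)))"
    unfolding pair_prod_def swap_coords_eq_comp ..
  also have "\<dots> = (\<Prod>k\<in>I. \<Prod>l\<in>I - {?t k}. q (x (?t k) - x l))"
  proof (rule prod.cong[OF refl])
    fix k assume k: "k \<in> I"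
    have "?t ` (I - {k}) = ?t ` I - ?t ` {k}" by (intro image_set_diff inj_transpose)
    also have "\<dots> = I - {?t k}" using bij_betw_transpose_on[OF assms] by (simp add: bij_betw_def)
    finally have "bij_betw ?t (I - {k}) (I - {?t k})" by (simp add: bij_betw_def)
    from prod.reindex_bij_betw[OF this, of "\<lambda>l. q (x (?t k) - x l)"]
    show "(\<Prod>l\<in>I - {k}. q (x (?t k) - x (?t l))) = (\<Prod>l\<in>I - {?t k}. q (x (?t k) - x l))" .
  qed
  also have "\<dots> = pair_prod q I x"
    unfolding pair_prod_def
    using prod.reindex_bij_betw[OF bij_betw_transpose_on[OF assms], of "\<lambda>k. \<Prod>l\<in>I - {k}. q (x k - x l)"] .
  finally show ?thesis .
qed

lemma pair_prod_nonneg: "(\<And>d. 0 \<le> q d) \<Longrightarrow> 0 \<le> pair_prod q I x"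
  unfolding pair_prod_def by (intro prod_nonneg ballI) auto

lemma borel_measurable_pair_prod:
  assumes [measurable]: "q \<in> borel_measurable borel"
  shows "pair_prod q I \<in> borel_measurable (lebesgue_power I)"
  unfolding pair_prod_def
  by (intro borel_measurable_prod measurable_compose[OF _ assms] borel_measurable_diff measurable_coord) auto

text \<open>The exponent is that of the Gamma distribution, \<open>a = \<beta>(p - n + 1)/2\<close>.\<close>

definition laguerre_weight :: "real \<Rightarrow> real \<Rightarrow> real" where
  "laguerre_weight a s = (if 0 < s then s powr (a - 1) * exp (- s / 2) else 0)"

lemma laguerre_weight_nonneg [simp]: "0 \<le> laguerre_weight a s"
  by (simp add: laguerre_weight_def)

lemma borel_measurable_laguerre_weight [measurable]: "laguerre_weight a \<in> borel_measurable borel"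
  unfolding laguerre_weight_def by measurable

section \<open>Gamma integrals and integrability of the weight\<close>

lemma nn_integral_gamma:
  fixes a c :: real
  assumes "a > 0" "c > 0"
  shows "(\<integral>\<^sup>+s. ennreal (if 0 < s then s powr (a - 1) * exp (- c * s) else 0) \<partial>lborel) = ennreal (Gamma a / c powr a)"
proof -
  let ?f = "\<lambda>s. ennreal (if 0 < s then s powr (a - 1) * exp (- c * s) else 0)"
  have "(\<integral>\<^sup>+s. ?f s \<partial>lborel) = ennreal \<bar>1 / c\<bar> * (\<integral>\<^sup>+t. ?f (0 + (1 / c) * t) \<partial>lborel)"
    using assms by (intro nn_integral_real_affine) auto
  also have "(\<integral>\<^sup>+t. ?f (0 + (1 / c) * t) \<partial>lborel) =
     (\<integral>\<^sup>+t. ennreal ((1 / c) powr (a - 1)) * ennreal (indicator {0..} t * t powr (a - 1) / exp t) \<partial>lborel)"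
    using assms by (intro nn_integral_cong)
      (auto simp: indicator_def powr_mult powr_divide exp_minus field_simps zero_less_divide_iff simp flip: ennreal_mult)
  also have "\<dots> = ennreal ((1 / c) powr (a - 1)) * ennreal (Gamma a)"
    using assms by (subst nn_integral_cmult) (auto simp: Gamma_conv_nn_integral_real)
  finally have "(\<integral>\<^sup>+s. ?f s \<partial>lborel) = ennreal (1 / c * ((1 / c) powr (a - 1) * Gamma a))"
    using assms Gamma_real_pos[of a] by (simp add: less_imp_le flip: ennreal_mult)
  also have "1 / c * ((1 / c) powr (a - 1) * Gamma a) = Gamma a / c powr a"
    using assms by (simp add: powr_diff powr_divide)
  finally show ?thesis .
qed

text \<open>Half of the decay \<open>exp (- s / 2)\<close> of the weight is spent on polynomial
  factors, leaving \<open>exp (- s / 4)\<close>.\<close>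

lemma powr_le_exp_quarter:
  fixes M :: real
  assumes "0 \<le> M"
  obtains K where "K > 0" "\<And>s. 0 \<le> s \<Longrightarrow> (1 + s) powr M \<le> K * exp (s / 4)"
proof -
  \<comment> \<open>\<open>4 * M \<le> L\<close> keeps the exponent \<open>s * M / L\<close> below
    \<open>s / 4\<close>; the summand 1 ensures \<open>L \<ge> 1\<close> also for
    \<open>M = 0\<close>, as used in \<open>1 + s \<le> L + s\<close>.\<close>
  define L where "L = 4 * M + 1"
  have L: "L \<ge> 1" using assms by (simp add: L_def)
  have "(1 + s) powr M \<le> L powr M * exp (s / 4)" if s: "0 \<le> s" for s
  proof -
    have "1 + s \<le> L * (1 + s / L)" using L s by (simp add: field_simps)
    also have "\<dots> \<le> L * exp (s / L)" using L exp_ge_add_one_self[of "s / L"] by (intro mult_left_mono) auto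
    finally have "(1 + s) powr M \<le> (L * exp (s / L)) powr M" using assms s by (intro powr_mono2) auto
    also have "\<dots> = L powr M * exp (s * M / L)" using L by (simp add: powr_mult exp_powr_real)
    also have "s * M / L \<le> s / 4"
    proof -
      have "s * (4 * M) \<le> s * L" using s by (intro mult_left_mono) (auto simp: L_def)
      then show ?thesis using L by (simp add: field_simps)
    qed
    then have "L powr M * exp (s * M / L) \<le> L powr M * exp (s / 4)" by (intro mult_left_mono) auto
    finally show ?thesis .
  qed
  moreover have "L powr M > 0" using L by simp
  ultimately show ?thesis using that by blast
qed

lemma integrable_powr_laguerre_weight:
  assumes "a > 0" "0 \<le> M"
  shows "integrable lborel (\<lambda>s. (1 + \<bar>s\<bar>) powr M * laguerre_weight a s)"
proof -
  obtain K where K: "K > 0" "\<And>s. 0 \<le> s \<Longrightarrow> (1 + s) powr M \<le> K * exp (s / 4)"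
    using powr_le_exp_quarter[OF assms(2)] by blast
  let ?g = "\<lambda>s. if 0 < s then s powr (a - 1) * exp (- (1/4) * s) else 0"
  have "integrable lborel ?g"
  proof (rule integrableI_nonneg)
    show "(\<integral>\<^sup>+s. ennreal (?g s) \<partial>lborel) < \<infinity>"
      using assms by (subst nn_integral_gamma) auto
  qed auto
  then have "integrable lborel (\<lambda>s. K * ?g s)" by (rule integrable_mult_right)
  then show ?thesis
  proof (rule Bochner_Integration.integrable_bound, goal_cases)
    case 2
    show ?case
    proof (intro AE_I2)
      fix s :: real
      show "norm ((1 + \<bar>s\<bar>) powr M * laguerre_weight a s) \<le> norm (K * ?g s)"
      proof (cases "0 < s")
        case True
        have "(1 + s) powr M * (s powr (a - 1) * exp (- s / 2)) \<le> K * exp (s / 4) * (s powr (a - 1) * exp (- s / 2))"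
          using K(2)[of s] True by (intro mult_right_mono) auto
        also have "\<dots> = K * (s powr (a - 1) * (exp (s / 4) * exp (- s / 2)))" by (simp add: mult_ac)
        also have "exp (s / 4) * exp (- s / 2) = exp (- (1/4) * s)" by (simp flip: exp_add)
        finally show ?thesis using True K by (simp add: laguerre_weight_def abs_mult)
      qed (simp add: laguerre_weight_def)
    qed
  qed auto
qed

text \<open>
  Smoothing \<open>\<bar>d\<bar>\<^sup>\<beta>\<close> to \<open>(d\<^sup>2 + \<epsilon>)\<^sup>\<beta>\<^sup>/\<^sup>2\<close> makes the integration by parts below elementary: without it the
  derivative is singular on the diagonals when \<open>\<beta> < 1\<close>. The exponent is \<open>\<beta>/4\<close> because
  \<^const>\<open>pair_prod\<close> runs over ordered pairs.
\<close>

definition smooth_gap :: "real \<Rightarrow> real \<Rightarrow> real \<Rightarrow> real" where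
  "smooth_gap \<beta> \<epsilon> d = (d\<^sup>2 + \<epsilon>) powr (\<beta> / 4)"

text \<open>Crude and unbounded as \<epsilon> tends to 0, but it serves only integrability at a
  fixed \<epsilon>. The limit is taken after symmetrisation, where the quotient is bounded by
  1.\<close>

lemma abs_div_smooth_le:
  fixes d \<epsilon> :: real
  assumes "\<epsilon> > 0"
  shows "\<bar>d\<bar> / (d\<^sup>2 + \<epsilon>) \<le> 1 + 1 / \<epsilon>"
proof -
  have "\<bar>d\<bar> \<le> 1 + d\<^sup>2"
    using sum_squares_bound[of 1 "\<bar>d\<bar>"] zero_le_power2[of d] by (simp add: power2_abs)
  also have "\<dots> \<le> (1 + 1 / \<epsilon>) * (d\<^sup>2 + \<epsilon>)" using assms by (simp add: field_simps)
  finally show ?thesis using assms by (subst pos_divide_le_eq) (auto simp: add_nonneg_pos)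
qed

text \<open>The bound is a product of functions of \<open>s\<close> and of \<open>y\<close>, uniform
  in \<epsilon>; integrability can therefore be settled one coordinate at a time.\<close>

lemma smooth_dist_le:
  fixes s y \<epsilon> :: real
  assumes "0 \<le> \<epsilon>" "\<epsilon> \<le> 1"
  shows "(s - y)\<^sup>2 + \<epsilon> \<le> ((1 + \<bar>s\<bar>) * (1 + \<bar>y\<bar>))\<^sup>2"
proof -
  have "(s - y)\<^sup>2 \<le> (\<bar>s\<bar> + \<bar>y\<bar>)\<^sup>2" by (rule power2_le_iff_abs_le[THEN iffD2]) auto
  moreover have "(\<bar>s\<bar> + \<bar>y\<bar>)\<^sup>2 + 1 \<le> ((1 + \<bar>s\<bar>) * (1 + \<bar>y\<bar>))\<^sup>2"
  proof -
    define u where "u = \<bar>s\<bar> + \<bar>y\<bar>"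
    have "(1 + \<bar>s\<bar>) * (1 + \<bar>y\<bar>) \<ge> 1 + u" by (simp add: u_def algebra_simps)
    moreover have "u \<ge> 0" by (simp add: u_def)
    ultimately have "(1 + u)\<^sup>2 \<le> ((1 + \<bar>s\<bar>) * (1 + \<bar>y\<bar>))\<^sup>2" by (intro power_mono) auto
    moreover have "u\<^sup>2 + 1 \<le> (1 + u)\<^sup>2" using \<open>u \<ge> 0\<close> by (simp add: power2_sum)
    ultimately show ?thesis unfolding u_def by linarith
  qed
  ultimately show ?thesis using assms by linarith
qed

lemma smooth_prod_le:
  fixes y :: "nat \<Rightarrow> real"
  assumes "finite J" "0 \<le> \<epsilon>" "\<epsilon> \<le> 1" "0 \<le> \<beta>"
  shows "(\<Prod>j\<in>J. ((s - y j)\<^sup>2 + \<epsilon>) powr (\<beta> / 2)) \<le> (\<Prod>j\<in>J. (1 + \<bar>y j\<bar>) powr \<beta>) * (1 + \<bar>s\<bar>) powr (\<beta> * real (card J))"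
proof -
  have "((s - y j)\<^sup>2 + \<epsilon>) powr (\<beta> / 2) \<le> (1 + \<bar>s\<bar>) powr \<beta> * (1 + \<bar>y j\<bar>) powr \<beta>" for j
  proof -
    have "((s - y j)\<^sup>2 + \<epsilon>) powr (\<beta> / 2) \<le> (((1 + \<bar>s\<bar>) * (1 + \<bar>y j\<bar>))\<^sup>2) powr (\<beta> / 2)"
      using assms smooth_dist_le[of \<epsilon> s "y j"] by (intro powr_mono2) auto
    also have "\<dots> = ((1 + \<bar>s\<bar>) * (1 + \<bar>y j\<bar>)) powr \<beta>"
      by (simp add: powr_realpow[symmetric] powr_powr del: powr_numeral)
    finally show ?thesis by (simp add: powr_mult)
  qed
  then have "(\<Prod>j\<in>J. ((s - y j)\<^sup>2 + \<epsilon>) powr (\<beta> / 2)) \<le> (\<Prod>j\<in>J. (1 + \<bar>s\<bar>) powr \<beta> * (1 + \<bar>y j\<bar>) powr \<beta>)"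
    by (intro prod_mono) auto
  also have "\<dots> = (\<Prod>j\<in>J. (1 + \<bar>y j\<bar>) powr \<beta>) * (1 + \<bar>s\<bar>) powr (\<beta> * real (card J))"
  proof -
    have "((1 + \<bar>s\<bar>) powr \<beta>) ^ card J = (1 + \<bar>s\<bar>) powr (\<beta> * real (card J))"
      by (simp add: powr_powr flip: powr_realpow)
    then show ?thesis by (simp add: prod.distrib mult.commute)
  qed
  finally show ?thesis .
qed

text \<open>\<open>D\<close> is the derivative of \<open>G s = s powr a * exp (- s / 2)\<close>
  times the smoothed interaction. Differentiating \<open>s\<close> times the density, and not the
  density itself, makes the boundary term at 0 vanish for every \<open>a > 0\<close>, also for
  \<open>a < 1\<close> where the weight is singular.\<close>

lemma laguerre_integration_by_parts:
  fixes y :: "nat \<Rightarrow> real" and a \<beta> \<epsilon> :: real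
  assumes "finite J" "a > 0" "\<epsilon> > 0" "\<epsilon> \<le> 1" "\<beta> \<ge> 0"
  defines "D \<equiv> \<lambda>s. laguerre_weight a s * (\<Prod>j\<in>J. ((s - y j)\<^sup>2 + \<epsilon>) powr (\<beta> / 2)) *
      (a - s / 2 + \<beta> * (\<Sum>j\<in>J. s * (s - y j) / ((s - y j)\<^sup>2 + \<epsilon>)))"
  shows "integrable lborel D" and "(\<integral>s. D s \<partial>lborel) = 0"
proof -
  define P where "P s = (\<Prod>j\<in>J. ((s - y j)\<^sup>2 + \<epsilon>) powr (\<beta> / 2))" for s
  define S where "S s = (\<Sum>j\<in>J. s * (s - y j) / ((s - y j)\<^sup>2 + \<epsilon>))" for s
  define C where "C = (\<Prod>j\<in>J. (1 + \<bar>y j\<bar>) powr \<beta>)"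
  define M where "M = \<beta> * real (card J)"
  have M: "M \<ge> 0" using assms by (simp add: M_def)
  have C: "C \<ge> 0" by (auto simp: C_def intro!: prod_nonneg)
  have pos: "d\<^sup>2 + \<epsilon> > 0" for d :: real using assms by (simp add: add_nonneg_pos)
  have P: "P s \<le> C * (1 + \<bar>s\<bar>) powr M" "0 \<le> P s" for s
    unfolding P_def C_def M_def using assms by (auto intro!: smooth_prod_le prod_nonneg)
  have D_eq: "D s = laguerre_weight a s * P s * (a - s / 2 + \<beta> * S s)" for s
    by (simp add: D_def P_def S_def)
  have [measurable]: "P \<in> borel_measurable borel" "S \<in> borel_measurable borel"
    unfolding P_def S_def by measurable
  have D_meas: "D \<in> borel_measurable borel" unfolding D_eq[abs_def] by measurable
  define L where "L = a + 1 + \<beta> * (real (card J) * (1 + 1 / \<epsilon>))"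
  have L: "L \<ge> 0" using assms by (simp add: L_def)
  have S: "\<bar>S s\<bar> \<le> \<bar>s\<bar> * (real (card J) * (1 + 1 / \<epsilon>))" for s
  proof -
    have "\<bar>S s\<bar> \<le> (\<Sum>j\<in>J. \<bar>s * (s - y j) / ((s - y j)\<^sup>2 + \<epsilon>)\<bar>)"
      unfolding S_def by (rule sum_abs)
    also have "\<dots> \<le> (\<Sum>j\<in>J. \<bar>s\<bar> * (1 + 1 / \<epsilon>))"
    proof (intro sum_mono)
      fix j
      have "\<bar>s * (s - y j) / ((s - y j)\<^sup>2 + \<epsilon>)\<bar> = \<bar>s\<bar> * (\<bar>s - y j\<bar> / ((s - y j)\<^sup>2 + \<epsilon>))"
        using pos[of "s - y j"] by (simp add: abs_mult)
      also have "\<dots> \<le> \<bar>s\<bar> * (1 + 1 / \<epsilon>)" using abs_div_smooth_le[OF assms(3)] by (intro mult_left_mono) auto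
      finally show "\<bar>s * (s - y j) / ((s - y j)\<^sup>2 + \<epsilon>)\<bar> \<le> \<bar>s\<bar> * (1 + 1 / \<epsilon>)" .
    qed
    also have "\<dots> = \<bar>s\<bar> * (real (card J) * (1 + 1 / \<epsilon>))" by simp
    finally show ?thesis .
  qed
  have lin: "\<bar>a - s / 2 + \<beta> * S s\<bar> \<le> L * (1 + \<bar>s\<bar>)" for s
  proof -
    let ?c = "real (card J) * (1 + 1 / \<epsilon>)"
    have "\<bar>a - s / 2 + \<beta> * S s\<bar> \<le> a + \<bar>s\<bar> + \<beta> * \<bar>S s\<bar>"
      using assms abs_triangle_ineq[of "a - s / 2" "\<beta> * S s"] by (simp add: abs_mult)
    also have "\<dots> \<le> a + \<bar>s\<bar> + \<beta> * (\<bar>s\<bar> * ?c)"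
      using S[of s] assms by (intro add_left_mono mult_left_mono) auto
    also have "\<dots> \<le> L * (1 + \<bar>s\<bar>)"
    proof -
      have "0 \<le> a * \<bar>s\<bar>" "0 \<le> \<beta> * ?c" using assms by auto
      then show ?thesis unfolding L_def by (simp only: distrib_left distrib_right mult_1 mult_1_right mult_ac)
    qed
    finally show ?thesis .
  qed
  show int: "integrable lborel D"
  proof (rule Bochner_Integration.integrable_bound)
    show "integrable lborel (\<lambda>s. C * L * ((1 + \<bar>s\<bar>) powr (M + 1) * laguerre_weight a s))"
      using assms M by (intro integrable_mult_right integrable_powr_laguerre_weight) auto
    show "AE s in lborel. norm (D s) \<le> norm (C * L * ((1 + \<bar>s\<bar>) powr (M + 1) * laguerre_weight a s))"
    proof (intro AE_I2)
      fix s
      have "norm (D s) = laguerre_weight a s * (P s * \<bar>a - s / 2 + \<beta> * S s\<bar>)"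
        using P(2)[of s] by (simp add: D_eq abs_mult)
      also have "\<dots> \<le> laguerre_weight a s * ((C * (1 + \<bar>s\<bar>) powr M) * (L * (1 + \<bar>s\<bar>)))"
        using P[of s] lin[of s] by (intro mult_left_mono mult_mono) auto
      also have "\<dots> = C * L * ((1 + \<bar>s\<bar>) powr (M + 1) * laguerre_weight a s)"
        by (simp add: powr_add)
      also have "\<dots> \<le> norm \<dots>" by simp
      finally show "norm (D s) \<le> norm (C * L * ((1 + \<bar>s\<bar>) powr (M + 1) * laguerre_weight a s))" .
    qed
  qed (use D_meas in simp)
  define G where "G s = s powr a * exp (- s / 2) * P s" for s
  have P_deriv: "(P has_real_derivative P s * (\<beta> * (\<Sum>j\<in>J. (s - y j) / ((s - y j)\<^sup>2 + \<epsilon>)))) (at s)" for s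
    using assms(1) unfolding P_def
  proof (induction J rule: finite_induct)
    case (insert k J)
    let ?q = "\<lambda>s. ((s - y k)\<^sup>2 + \<epsilon>) powr (\<beta> / 2)"
    have q: "(?q has_real_derivative ?q s * (\<beta> * ((s - y k) / ((s - y k)\<^sup>2 + \<epsilon>)))) (at s)"
    proof -
      let ?X = "(s - y k)\<^sup>2 + \<epsilon>"
      have "(?q has_real_derivative (\<beta> / 2) * ?X powr (\<beta> / 2 - 1) * (2 * (s - y k))) (at s)"
        using pos[of "s - y k"] by (auto intro!: derivative_eq_intros)
      moreover have "?X powr (\<beta> / 2 - 1) = ?X powr (\<beta> / 2) / ?X"
        using pos[of "s - y k"] by (simp add: powr_diff)
      moreover have "(\<beta> / 2) * (?X powr (\<beta> / 2) / ?X) * (2 * (s - y k)) = ?q s * (\<beta> * ((s - y k) / ?X))"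
        by (simp only: divide_inverse) simp
      ultimately show ?thesis by (simp only:)
    qed
    show ?case
      using DERIV_mult[OF q insert.IH] insert by (simp add: algebra_simps)
  qed simp
  have G_deriv: "(G has_real_derivative D s) (at s)" if "s > 0" for s
  proof -
    have "((\<lambda>s. s powr a * exp (- s / 2)) has_real_derivative (laguerre_weight a s * (a - s / 2))) (at s)"
    proof -
      have "((\<lambda>s. s powr a * exp (- s / 2)) has_real_derivative
          (a * s powr (a - 1) * exp (- s / 2) + s powr a * (exp (- s / 2) * (- 1 / 2)))) (at s)"
        using that by (auto intro!: derivative_eq_intros)
      moreover have "s powr a = s powr (a - 1) * s" using that by (simp add: powr_diff)
      ultimately show ?thesis using that by (simp add: laguerre_weight_def algebra_simps)
    qed
    from DERIV_mult[OF this P_deriv[of s]] have "(G has_real_derivative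
       laguerre_weight a s * (a - s / 2) * P s + P s * (\<beta> * (\<Sum>j\<in>J. (s - y j) / ((s - y j)\<^sup>2 + \<epsilon>))) * (s powr a * exp (- s / 2))) (at s)"
      unfolding G_def by simp
    moreover have e1: "s powr a * exp (- s / 2) = laguerre_weight a s * s"
      using that by (simp add: laguerre_weight_def powr_diff)
    have e2: "S s = s * (\<Sum>j\<in>J. (s - y j) / ((s - y j)\<^sup>2 + \<epsilon>))"
      by (simp add: S_def sum_distrib_left)
    have "laguerre_weight a s * (a - s / 2) * P s + P s * (\<beta> * (\<Sum>j\<in>J. (s - y j) / ((s - y j)\<^sup>2 + \<epsilon>))) *
        (s powr a * exp (- s / 2)) = D s"
      unfolding e1 D_eq e2 by (simp only: distrib_left mult_ac)
    ultimately show ?thesis by (simp only:)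
  qed
  have "(LBINT s=ereal 0..\<infinity>. D s) = 0 - 0"
  proof (rule interval_integral_FTC_integrable)
    show "(G has_vector_derivative D s) (at s)" if "ereal 0 < ereal s" for s
      using G_deriv[of s] that by (simp add: has_real_derivative_iff_has_vector_derivative)
    show "isCont D s" if "ereal 0 < ereal s" for s
    proof -
      have "s > 0" using that by simp
      have nz: "d\<^sup>2 + \<epsilon> \<noteq> 0" for d :: real using pos[of d] by simp
      have "eventually (\<lambda>t. t \<in> {0<..}) (nhds s)"
        using \<open>s > 0\<close> by (intro eventually_nhds_in_open) auto
      then have ev: "eventually (\<lambda>t. t powr (a - 1) * exp (- t / 2) * P t * (a - t / 2 + \<beta> * S t) = D t) (nhds s)"
        by eventually_elim (simp add: D_eq laguerre_weight_def)
      have "isCont (\<lambda>t. t powr (a - 1) * exp (- t / 2) * P t * (a - t / 2 + \<beta> * S t)) s"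
        unfolding P_def S_def using \<open>s > 0\<close> by (intro continuous_intros) (auto simp: nz)
      then show ?thesis using isCont_cong[OF ev] by simp
    qed
    show "set_integrable lborel (einterval (ereal 0) \<infinity>) D"
      unfolding set_integrable_def by (intro integrable_mult_indicator[OF _ int]) auto
    show "((G \<circ> real_of_ereal) \<longlongrightarrow> 0) (at_right (ereal 0))"
    proof -
      have "isCont P 0" using DERIV_isCont[OF P_deriv[of 0]] .
      then have "(P \<longlongrightarrow> P 0) (at_right 0)" by (simp add: isCont_def filterlim_at_split)
      moreover have "((\<lambda>s. s powr a) \<longlongrightarrow> 0) (at_right 0)"
      proof -
        have "((\<lambda>s::real. s powr a) \<longlongrightarrow> 0 powr a) (at_right 0)"
          using assms by (intro tendsto_powr') (auto simp: eventually_at_filter intro!: tendsto_ident_at)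
        then show ?thesis by simp
      qed
      ultimately have "(G \<longlongrightarrow> 0 * exp (- 0 / 2) * P 0) (at_right 0)"
        unfolding G_def by (intro tendsto_intros) auto
      then show ?thesis by (simp add: ereal_tendsto_simps1)
    qed
    show "((G \<circ> real_of_ereal) \<longlongrightarrow> 0) (at_left \<infinity>)"
    proof -
      obtain K where K: "K > 0" "\<And>s. 0 \<le> s \<Longrightarrow> (1 + s) powr (a + M) \<le> K * exp (s / 4)"
        using powr_le_exp_quarter[of "a + M"] assms M by auto
      have "norm (G s) \<le> C * K * exp (- (1/4) * s)" if "s > 0" for s
      proof -
        have "norm (G s) = s powr a * exp (- s / 2) * P s" using P(2)[of s] by (simp add: G_def abs_mult)
        also have "\<dots> \<le> (1 + s) powr a * exp (- s / 2) * (C * (1 + s) powr M)"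
          using P[of s] that assms by (intro mult_mono powr_mono2) auto
        also have "\<dots> = C * ((1 + s) powr (a + M) * exp (- s / 2))" by (simp add: powr_add)
        also have "\<dots> \<le> C * ((K * exp (s / 4)) * exp (- s / 2))"
          using K(2)[of s] that C by (intro mult_left_mono mult_right_mono) auto
        also have "\<dots> = C * K * (exp (s / 4) * exp (- s / 2))" by simp
        also have "exp (s / 4) * exp (- s / 2) = exp (- (1/4) * s)" by (simp flip: exp_add)
        finally show ?thesis .
      qed
      then have "eventually (\<lambda>s. norm (G s) \<le> C * K * exp (- (1/4) * s)) at_top"
        by (rule eventually_mono[OF eventually_gt_at_top[of 0]])
      moreover have "((\<lambda>s::real. C * K * exp (- (1/4) * s)) \<longlongrightarrow> 0) at_top"
        by real_asymp
      ultimately have "(G \<longlongrightarrow> 0) at_top" by (rule Lim_null_comparison)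
      then show ?thesis by (simp add: ereal_tendsto_simps1)
    qed
  qed auto
  also have "(LBINT s=ereal 0..\<infinity>. D s) = (\<integral>s. D s \<partial>lborel)"
    unfolding interval_lebesgue_integral_def set_lebesgue_integral_def
    by (auto intro!: Bochner_Integration.integral_cong simp: einterval_def indicator_def D_eq laguerre_weight_def)
  finally show "(\<integral>s. D s \<partial>lborel) = 0" by simp
qed

section \<open>Aomoto's recursion\<close>

definition smooth_laguerre :: "real \<Rightarrow> real \<Rightarrow> real \<Rightarrow> nat set \<Rightarrow> (nat \<Rightarrow> real) \<Rightarrow> real" where
  "smooth_laguerre \<beta> \<epsilon> a I x = pair_prod (smooth_gap \<beta> \<epsilon>) I x * (\<Prod>l\<in>I. laguerre_weight a (x l))"

text \<open>A product form that dominates square-free monomials and, through its square, all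
  differences of coordinates, while its powers still factor over the coordinates.\<close>

definition growth :: "nat set \<Rightarrow> (nat \<Rightarrow> real) \<Rightarrow> real" where
  "growth I x = (\<Prod>l\<in>I. 1 + \<bar>x l\<bar>)"

lemma growth_ge_1: "1 \<le> growth I x"
  unfolding growth_def by (rule prod_ge_1) auto

lemma growth_pos: "0 < growth I x"
  using growth_ge_1[of I x] by linarith

lemma coord_le_growth: 
  assumes "finite I" "i \<in> I"
  shows "1 + \<bar>x i\<bar> \<le> growth I x"
proof -
  have "growth I x = (1 + \<bar>x i\<bar>) * growth (I - {i}) x"
    unfolding growth_def using assms by (rule prod.remove)
  moreover have "(1 + \<bar>x i\<bar>) * 1 \<le> (1 + \<bar>x i\<bar>) * growth (I - {i}) x"
    using growth_ge_1 by (intro mult_left_mono) auto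
  ultimately show ?thesis by simp
qed

lemma abs_prod_le_growth:
  assumes "finite I" "S \<subseteq> I"
  shows "\<bar>\<Prod>l\<in>S. x l\<bar> \<le> growth I x"
proof -
  have "\<bar>\<Prod>l\<in>S. x l\<bar> = (\<Prod>l\<in>S. \<bar>x l\<bar>)" by (rule abs_prod)
  also have "\<dots> \<le> (\<Prod>l\<in>S. 1 + \<bar>x l\<bar>)" by (intro prod_mono) auto
  also have "\<dots> \<le> (\<Prod>l\<in>I. 1 + \<bar>x l\<bar>)" using assms by (intro prod_mono2) auto
  finally show ?thesis by (simp add: growth_def)
qed

lemma smooth_gap_nonneg [simp]: "0 \<le> smooth_gap \<beta> \<epsilon> d"
  by (simp add: smooth_gap_def)

lemma borel_measurable_smooth_gap [measurable]: "smooth_gap \<beta> \<epsilon> \<in> borel_measurable borel"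
  unfolding smooth_gap_def by measurable

lemma smooth_gap_le_growth:
  assumes "finite I" "i \<in> I" "j \<in> I" "0 \<le> \<epsilon>" "\<epsilon> \<le> 1" "0 \<le> \<beta>"
  shows "smooth_gap \<beta> \<epsilon> (x i - x j) \<le> growth I x powr \<beta>"
proof -
  let ?R = "growth I x"
  have "(x i - x j)\<^sup>2 + \<epsilon> \<le> ((1 + \<bar>x i\<bar>) * (1 + \<bar>x j\<bar>))\<^sup>2"
    using assms by (intro smooth_dist_le)
  also have "\<dots> \<le> (?R * ?R)\<^sup>2"
    using coord_le_growth[OF assms(1,2), of x] coord_le_growth[OF assms(1,3), of x] growth_pos[of I x]
    by (intro power_mono mult_mono) auto
  also have "\<dots> = ?R ^ 4" by (simp add: power2_eq_square power4_eq_xxxx)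
  finally have "smooth_gap \<beta> \<epsilon> (x i - x j) \<le> (?R ^ 4) powr (\<beta> / 4)"
    unfolding smooth_gap_def using assms by (intro powr_mono2) auto
  also have "\<dots> = ?R powr \<beta>"
  proof -
    have "?R ^ 4 = ?R powr 4" using powr_realpow[OF growth_pos[of I x], of 4] by simp
    then show ?thesis by (simp add: powr_powr)
  qed
  finally show ?thesis .
qed

lemma pair_prod_smooth_le:
  assumes "finite I" "0 \<le> \<epsilon>" "\<epsilon> \<le> 1" "0 \<le> \<beta>"
  shows "pair_prod (smooth_gap \<beta> \<epsilon>) I x \<le> growth I x powr (\<beta> * real (card I) * real (card I))"
proof -
  let ?R = "growth I x"
  have R1: "1 \<le> ?R powr \<beta>" using growth_ge_1[of I x] assms by (intro ge_one_powr_ge_zero) auto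
  have "pair_prod (smooth_gap \<beta> \<epsilon>) I x \<le> (\<Prod>i\<in>I. (?R powr \<beta>) ^ card I)"
    unfolding pair_prod_def
  proof (intro prod_mono conjI prod_nonneg)
    fix i assume i: "i \<in> I"
    have "(\<Prod>j\<in>I - {i}. smooth_gap \<beta> \<epsilon> (x i - x j)) \<le> (\<Prod>j\<in>I - {i}. ?R powr \<beta>)"
      using assms i by (intro prod_mono conjI smooth_gap_le_growth) auto
    also have "\<dots> = (?R powr \<beta>) ^ card (I - {i})" by simp
    also have "\<dots> \<le> (?R powr \<beta>) ^ card I"
      using R1 assms by (intro power_increasing card_mono) auto
    finally show "(\<Prod>j\<in>I - {i}. smooth_gap \<beta> \<epsilon> (x i - x j)) \<le> (?R powr \<beta>) ^ card I" .
  qed auto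
  also have "\<dots> = ?R powr (\<beta> * real (card I) * real (card I))"
  proof -
    have p: "0 < ?R powr c" for c using growth_pos[of I x] by simp
    have "(?R powr \<beta>) ^ card I = ?R powr (\<beta> * real (card I))"
      using p[of \<beta>] by (simp add: powr_powr flip: powr_realpow)
    then show ?thesis using p[of "\<beta> * real (card I)"] by (simp add: powr_powr flip: powr_realpow)
  qed
  finally show ?thesis .
qed

lemma borel_measurable_smooth_laguerre [measurable]:
  "smooth_laguerre \<beta> \<epsilon> a I \<in> borel_measurable (lebesgue_power I)"
  unfolding smooth_laguerre_def
  by (intro borel_measurable_times borel_measurable_pair_prod borel_measurable_prod
      measurable_compose[OF measurable_coord]) auto

lemma borel_measurable_growth [measurable]: "growth I \<in> borel_measurable (lebesgue_power I)"
  unfolding growth_def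
  by (intro borel_measurable_prod borel_measurable_add borel_measurable_abs measurable_coord) auto

lemma smooth_laguerre_nonneg: "0 \<le> smooth_laguerre \<beta> \<epsilon> a I x"
  unfolding smooth_laguerre_def by (intro mult_nonneg_nonneg pair_prod_nonneg prod_nonneg) auto

lemma smooth_laguerre_eq_0:
  assumes "finite I" "\<not> (\<forall>l\<in>I. 0 < x l)"
  shows "smooth_laguerre \<beta> \<epsilon> a I x = 0"
proof -
  obtain l where l: "l \<in> I" "\<not> 0 < x l" using assms by blast
  have "\<exists>l\<in>I. laguerre_weight a (x l) = 0" by (rule bexI[OF _ l(1)]) (use l in \<open>auto simp: laguerre_weight_def\<close>)
  then show ?thesis using assms(1) by (simp add: smooth_laguerre_def prod_zero)
qed

text \<open>Common majorant of the smoothed integrands: a product, hence integrable by Fubini, and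
  independent of \<epsilon>, hence fit for dominated convergence.\<close>

definition laguerre_bound :: "real \<Rightarrow> real \<Rightarrow> nat set \<Rightarrow> (nat \<Rightarrow> real) \<Rightarrow> real" where
  "laguerre_bound N a I x = (\<Prod>l\<in>I. (1 + \<bar>x l\<bar>) powr N * laguerre_weight a (x l))"

lemma laguerre_bound_eq: "laguerre_bound N a I x = growth I x powr N * (\<Prod>l\<in>I. laguerre_weight a (x l))"
  unfolding laguerre_bound_def growth_def by (simp add: prod.distrib prod_powr_distrib)

lemma integrable_laguerre_bound:
  assumes "finite I" "a > 0" "N \<ge> 0"
  shows "integrable (lebesgue_power I) (laguerre_bound N a I)"
  unfolding laguerre_bound_def
  using lborel_prod.product_integrable_prod[OF assms(1), of "\<lambda>_ s. (1 + \<bar>s\<bar>) powr N * laguerre_weight a s"]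
    integrable_powr_laguerre_weight[OF assms(2,3)] by simp

lemma smooth_laguerre_bound:
  assumes "finite I" "0 \<le> \<epsilon>" "\<epsilon> \<le> 1" "0 \<le> \<beta>" "0 \<le> C"
    and g: "(\<forall>l\<in>I. 0 < x l) \<Longrightarrow> \<bar>g\<bar> \<le> C * growth I x powr N"
  shows "\<bar>g * smooth_laguerre \<beta> \<epsilon> a I x\<bar> \<le> C * laguerre_bound (N + \<beta> * real (card I) * real (card I)) a I x"
proof (cases "\<forall>l\<in>I. 0 < x l")
  case True
  let ?M = "\<beta> * real (card I) * real (card I)"
  let ?w = "\<Prod>l\<in>I. laguerre_weight a (x l)"
  have w: "0 \<le> ?w" by (intro prod_nonneg) auto
  have "\<bar>g * smooth_laguerre \<beta> \<epsilon> a I x\<bar> = \<bar>g\<bar> * (pair_prod (smooth_gap \<beta> \<epsilon>) I x * ?w)"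
    unfolding smooth_laguerre_def[symmetric]
    by (simp only: abs_mult abs_of_nonneg[OF smooth_laguerre_nonneg])
  also have "\<dots> \<le> (C * growth I x powr N) * (growth I x powr ?M * ?w)"
    using w assms pair_prod_smooth_le[OF assms(1-4), of x] g[OF True]
    by (intro mult_mono mult_nonneg_nonneg pair_prod_nonneg) auto
  also have "\<dots> = C * laguerre_bound (N + ?M) a I x"
    using growth_pos[of I x] by (simp add: laguerre_bound_eq powr_add)
  finally show ?thesis .
next
  case False
  have "0 \<le> laguerre_bound (N + \<beta> * real (card I) * real (card I)) a I x"
    unfolding laguerre_bound_def by (intro prod_nonneg) auto
  then show ?thesis using smooth_laguerre_eq_0[OF assms(1) False] assms by simp
qed

lemma integrable_smooth_laguerre:
  assumes "finite I" "0 \<le> \<epsilon>" "\<epsilon> \<le> 1" "0 \<le> \<beta>" "0 < a" "0 \<le> C" "0 \<le> N"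
    and [measurable]: "g \<in> borel_measurable (lebesgue_power I)"
    and g: "\<And>x. (\<forall>l\<in>I. 0 < x l) \<Longrightarrow> \<bar>g x\<bar> \<le> C * growth I x powr N"
  shows "integrable (lebesgue_power I) (\<lambda>x. g x * smooth_laguerre \<beta> \<epsilon> a I x)"
proof (rule Bochner_Integration.integrable_bound)
  let ?M = "N + \<beta> * real (card I) * real (card I)"
  show "integrable (lebesgue_power I) (\<lambda>x. C * laguerre_bound ?M a I x)"
    using assms by (intro integrable_mult_right integrable_laguerre_bound) auto
  show "AE x in lebesgue_power I. norm (g x * smooth_laguerre \<beta> \<epsilon> a I x) \<le> norm (C * laguerre_bound ?M a I x)"
  proof (intro AE_I2)
    fix x
    have "\<bar>g x * smooth_laguerre \<beta> \<epsilon> a I x\<bar> \<le> C * laguerre_bound ?M a I x"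
      using assms(1-4,6) g by (rule smooth_laguerre_bound)
    then show "norm (g x * smooth_laguerre \<beta> \<epsilon> a I x) \<le> norm (C * laguerre_bound ?M a I x)" by simp
  qed
qed measurable

lemma borel_measurable_monomial: "S \<subseteq> I \<Longrightarrow> (\<lambda>x. \<Prod>l\<in>S. x l) \<in> borel_measurable (lebesgue_power I)"
  by (intro borel_measurable_prod measurable_coord) auto

lemma borel_measurable_gap_term:
  assumes "i \<in> I" "j \<in> I" "S \<subseteq> I"
  shows "(\<lambda>x. (\<Prod>l\<in>S. x l) * (x i * (x i - x j) / ((x i - x j)\<^sup>2 + \<epsilon>))) \<in> borel_measurable (lebesgue_power I)"
    and "(\<lambda>x. (\<Prod>l\<in>S. x l) * ((x i - x j)\<^sup>2 / ((x i - x j)\<^sup>2 + \<epsilon>))) \<in> borel_measurable (lebesgue_power I)"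
  by (intro borel_measurable_times borel_measurable_divide borel_measurable_diff borel_measurable_power
    borel_measurable_add borel_measurable_const borel_measurable_monomial measurable_coord assms)+

section \<open>Moments of monomials and their recursion\<close>

context
  fixes I :: "nat set" and \<beta> a :: real
  assumes I: "finite I" and \<beta>: "0 < \<beta>" and a: "0 < a"
begin

definition moment :: "real \<Rightarrow> nat set \<Rightarrow> real" where
  "moment \<epsilon> S = (\<integral>x. (\<Prod>l\<in>S. x l) * smooth_laguerre \<beta> \<epsilon> a I x \<partial>lebesgue_power I)"

text \<open>The interaction term after symmetrisation in \<open>i\<close> and \<open>j\<close>. Off
  the diagonal the extra quotient tends to 1, so the whole expression tends to the moment of the
  same monomial.\<close>

definition gap_moment :: "real \<Rightarrow> nat set \<Rightarrow> nat \<Rightarrow> nat \<Rightarrow> real" where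
  "gap_moment \<epsilon> S i j = (\<integral>x. (\<Prod>l\<in>S. x l) * ((x i - x j)\<^sup>2 / ((x i - x j)\<^sup>2 + \<epsilon>)) *
     smooth_laguerre \<beta> \<epsilon> a I x \<partial>lebesgue_power I)"

lemma integrable_moment:
  assumes "S \<subseteq> I" "0 \<le> \<epsilon>" "\<epsilon> \<le> 1"
  shows "integrable (lebesgue_power I) (\<lambda>x. (\<Prod>l\<in>S. x l) * smooth_laguerre \<beta> \<epsilon> a I x)"
proof (rule integrable_smooth_laguerre[where C = 1 and N = 1])
  show "\<bar>\<Prod>l\<in>S. x l\<bar> \<le> 1 * growth I x powr 1" for x
    using abs_prod_le_growth[OF I assms(1), of x] growth_pos[of I x] by simp
qed (use I \<beta> a assms in \<open>auto intro: borel_measurable_monomial\<close>)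

lemma abs_gap_term_le:
  assumes "i \<in> I" "j \<in> I" "S \<subseteq> I" "0 < \<epsilon>"
  shows "\<bar>(\<Prod>l\<in>S. x l) * (x i * (x i - x j) / ((x i - x j)\<^sup>2 + \<epsilon>))\<bar> \<le> (1 + 1 / \<epsilon>) * growth I x powr 2"
proof -
  have "\<bar>(\<Prod>l\<in>S. x l) * (x i * (x i - x j) / ((x i - x j)\<^sup>2 + \<epsilon>))\<bar> =
      \<bar>\<Prod>l\<in>S. x l\<bar> * (\<bar>x i\<bar> * (\<bar>x i - x j\<bar> / ((x i - x j)\<^sup>2 + \<epsilon>)))"
    using assms(4) zero_le_power2[of "x i - x j"] by (simp add: abs_mult)
  also have "\<dots> \<le> growth I x * (growth I x * (1 + 1 / \<epsilon>))"
    using abs_prod_le_growth[OF I assms(3), of x] coord_le_growth[OF I assms(1), of x]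
      abs_div_smooth_le[OF assms(4), of "x i - x j"] growth_pos[of I x] assms(4)
    by (intro mult_mono mult_nonneg_nonneg divide_nonneg_pos) (auto simp: add_nonneg_pos)
  also have "\<dots> = (1 + 1 / \<epsilon>) * growth I x powr 2"
    using growth_pos[of I x] powr_realpow[of "growth I x" 2] by (simp add: power2_eq_square)
  finally show ?thesis .
qed

lemma integrable_gap_term:
  assumes "i \<in> I" "j \<in> I" "S \<subseteq> I" "0 < \<epsilon>" "\<epsilon> \<le> 1"
  shows "integrable (lebesgue_power I)
    (\<lambda>x. (\<Prod>l\<in>S. x l) * (x i * (x i - x j) / ((x i - x j)\<^sup>2 + \<epsilon>)) * smooth_laguerre \<beta> \<epsilon> a I x)"
  using I \<beta> a assms abs_gap_term_le[OF assms(1-4)]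
  by (intro integrable_smooth_laguerre[where C = "1 + 1 / \<epsilon>" and N = 2] borel_measurable_gap_term) auto

lemma smooth_laguerre_swap_coords:
  "i \<in> I \<Longrightarrow> j \<in> I \<Longrightarrow> smooth_laguerre \<beta> \<epsilon> a I (swap_coords i j x) = smooth_laguerre \<beta> \<epsilon> a I x"
  unfolding smooth_laguerre_def
  by (simp only: pair_prod_swap_coords prod_swap_coords[where f = "laguerre_weight a"])

text \<open>Together with the factor \<open>x i\<close>, the monomial contains both
  \<open>x i\<close> and \<open>x j\<close> and is invariant under their exchange, while the
  remaining quotient changes sign.\<close>

lemma gap_term_antisymmetric:
  assumes i: "i \<in> I" and j: "j \<in> S" and S: "S \<subseteq> I - {i}" and e: "0 < \<epsilon>" "\<epsilon> \<le> 1"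
  shows "(\<integral>x. (\<Prod>l\<in>S. x l) * (x i * (x i - x j) / ((x i - x j)\<^sup>2 + \<epsilon>)) * smooth_laguerre \<beta> \<epsilon> a I x \<partial>lebesgue_power I) = 0"
proof -
  let ?h = "\<lambda>x. (\<Prod>l\<in>S. x l) * (x i * (x i - x j) / ((x i - x j)\<^sup>2 + \<epsilon>)) * smooth_laguerre \<beta> \<epsilon> a I x"
  have ij: "i \<in> I" "j \<in> I" "i \<noteq> j" "i \<notin> S" "finite S" using assms finite_subset[OF _ I] by auto
  have h: "?h x = (\<Prod>l\<in>insert i S. x l) * ((x i - x j) / ((x i - x j)\<^sup>2 + \<epsilon>)) * smooth_laguerre \<beta> \<epsilon> a I x" for x
    using ij by simp
  have "?h (swap_coords i j x) = - ?h x" for x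
  proof -
    have e0: "(swap_coords i j x) i = x j" "(swap_coords i j x) j = x i" using ij by auto
    have e1: "(\<Prod>l\<in>insert i S. (swap_coords i j x) l) = (\<Prod>l\<in>insert i S. x l)"
      using prod_swap_coords[of i "insert i S" j "\<lambda>t. t" x] j by simp
    have e2: "(x j - x i) / ((x j - x i)\<^sup>2 + \<epsilon>) = - ((x i - x j) / ((x i - x j)\<^sup>2 + \<epsilon>))"
      by (metis minus_diff_eq minus_divide_left power2_commute)
    show ?thesis
      unfolding h unfolding e1 e0 e2 smooth_laguerre_swap_coords[OF ij(1,2)] by simp
  qed
  moreover have "(\<integral>x. ?h (swap_coords i j x) \<partial>lebesgue_power I) = (\<integral>x. ?h x \<partial>lebesgue_power I)"
    using integrable_gap_term[OF ij(1,2) _ e, of S] S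
    by (intro integral_swap_coords[OF I ij(1,2)] borel_measurable_integrable) auto
  ultimately have "(\<integral>x. - ?h x \<partial>lebesgue_power I) = (\<integral>x. ?h x \<partial>lebesgue_power I)" by (simp only:)
  then show ?thesis by (simp only: integral_minus)
qed

text \<open>Here the exchange fixes the monomial. Adding the term to its image turns
  \<open>x i * (x i - x j)\<close> into \<open>(x i - x j)\<^sup>2\<close>, which removes the
  singularity in the limit \<epsilon> to 0.\<close>

lemma gap_term_symmetrize:
  assumes i: "i \<in> I" and j: "j \<in> I - {i} - S" and S: "S \<subseteq> I - {i}" and e: "0 < \<epsilon>" "\<epsilon> \<le> 1"
  shows "(\<integral>x. (\<Prod>l\<in>S. x l) * (x i * (x i - x j) / ((x i - x j)\<^sup>2 + \<epsilon>)) * smooth_laguerre \<beta> \<epsilon> a I x \<partial>lebesgue_power I)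
     = gap_moment \<epsilon> S i j / 2"
proof -
  let ?h = "\<lambda>x. (\<Prod>l\<in>S. x l) * (x i * (x i - x j) / ((x i - x j)\<^sup>2 + \<epsilon>)) * smooth_laguerre \<beta> \<epsilon> a I x"
  have ij: "i \<in> I" "j \<in> I" "i \<noteq> j" "i \<notin> S" "j \<notin> S" "finite S" using assms finite_subset[OF _ I] by auto
  have int: "integrable (lebesgue_power I) ?h"
    using integrable_gap_term[OF ij(1,2) _ e, of S] S by auto
  have sw: "?h x + ?h (swap_coords i j x) =
      (\<Prod>l\<in>S. x l) * ((x i - x j)\<^sup>2 / ((x i - x j)\<^sup>2 + \<epsilon>)) * smooth_laguerre \<beta> \<epsilon> a I x" for x
  proof -
    have e0: "(swap_coords i j x) i = x j" "(swap_coords i j x) j = x i" using ij by auto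
    have e1: "(\<Prod>l\<in>S. (swap_coords i j x) l) = (\<Prod>l\<in>S. x l)"
      using ij by (intro prod.cong) auto
    have e2: "x j * (x j - x i) / ((x j - x i)\<^sup>2 + \<epsilon>) = - (x j * (x i - x j)) / ((x i - x j)\<^sup>2 + \<epsilon>)"
      by (simp add: power2_commute algebra_simps)
    have e3: "x i * (x i - x j) / ((x i - x j)\<^sup>2 + \<epsilon>) + - (x j * (x i - x j)) / ((x i - x j)\<^sup>2 + \<epsilon>) =
      (x i - x j)\<^sup>2 / ((x i - x j)\<^sup>2 + \<epsilon>)"
      by (simp add: power2_eq_square algebra_simps flip: add_divide_distrib)
    show ?thesis
      unfolding e1 e0 e2 smooth_laguerre_swap_coords[OF ij(1,2)] e3[symmetric] by (simp add: algebra_simps)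
  qed
  have eq: "(\<integral>x. ?h (swap_coords i j x) \<partial>lebesgue_power I) = (\<integral>x. ?h x \<partial>lebesgue_power I)"
    using int by (intro integral_swap_coords[OF I ij(1,2)] borel_measurable_integrable)
  have int': "integrable (lebesgue_power I) (\<lambda>x. ?h (swap_coords i j x))"
    using integrable_distr[OF measurable_swap_coords[OF ij(1,2)], of ?h] int
    by (simp only: distr_swap_coords[OF I ij(1,2)])
  have "gap_moment \<epsilon> S i j = (\<integral>x. ?h x + ?h (swap_coords i j x) \<partial>lebesgue_power I)"
    unfolding gap_moment_def sw ..
  also have "\<dots> = (\<integral>x. ?h x \<partial>lebesgue_power I) + (\<integral>x. ?h (swap_coords i j x) \<partial>lebesgue_power I)"
    by (rule Bochner_Integration.integral_add[OF int int'])
  finally show ?thesis unfolding eq by simp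
qed

text \<open>Fubini in coordinate \<open>i\<close>: since \<open>i\<close> is not in
  \<open>S\<close>, the monomial and all interactions among the other coordinates form a constant
  \<open>?c\<close> in front of the one-dimensional total derivative.\<close>

lemma integral_by_parts_coord:
  assumes i: "i \<in> I" and S: "S \<subseteq> I - {i}" and e: "0 < \<epsilon>" "\<epsilon> \<le> 1"
  defines "F \<equiv> \<lambda>x. (\<Prod>l\<in>S. x l) * (a - x i / 2 + \<beta> * (\<Sum>j\<in>I - {i}. x i * (x i - x j) / ((x i - x j)\<^sup>2 + \<epsilon>))) *
      smooth_laguerre \<beta> \<epsilon> a I x"
  assumes int: "integrable (lebesgue_power I) F"
  shows "(\<integral>x. F x \<partial>lebesgue_power I) = 0"
proof -
  define J where "J = I - {i}"
  have J: "finite J" "i \<notin> J" "I = insert i J" using I i by (auto simp: J_def)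
  have inner: "(\<integral>s. F (x(i := s)) \<partial>lborel) = 0" for x
  proof -
    let ?c = "(\<Prod>l\<in>S. x l) * pair_prod (smooth_gap \<beta> \<epsilon>) J x * (\<Prod>l\<in>J. laguerre_weight a (x l))"
    let ?D = "\<lambda>s. laguerre_weight a s * (\<Prod>j\<in>J. ((s - x j)\<^sup>2 + \<epsilon>) powr (\<beta> / 2)) *
      (a - s / 2 + \<beta> * (\<Sum>j\<in>J. s * (s - x j) / ((s - x j)\<^sup>2 + \<epsilon>)))"
    have "F (x(i := s)) = ?c * ?D s" for s
    proof -
      have e1: "(\<Prod>l\<in>S. (x(i := s)) l) = (\<Prod>l\<in>S. x l)" using S by (intro prod.cong) auto
      have e2: "(\<Prod>l\<in>I. laguerre_weight a ((x(i := s)) l)) = laguerre_weight a s * (\<Prod>l\<in>J. laguerre_weight a (x l))"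
        using J by (auto intro!: prod.cong)
      have e3: "(\<Sum>j\<in>I - {i}. (x(i := s)) i * ((x(i := s)) i - (x(i := s)) j) / (((x(i := s)) i - (x(i := s)) j)\<^sup>2 + \<epsilon>))
         = (\<Sum>j\<in>J. s * (s - x j) / ((s - x j)\<^sup>2 + \<epsilon>))"
        unfolding J_def by (intro sum.cong) auto
      have e4: "pair_prod (smooth_gap \<beta> \<epsilon>) J (x(i := s)) = pair_prod (smooth_gap \<beta> \<epsilon>) J x"
        using J by (intro pair_prod_cong) auto
      have "smooth_gap \<beta> \<epsilon> (s - x j) * smooth_gap \<beta> \<epsilon> (x j - s) = ((s - x j)\<^sup>2 + \<epsilon>) powr (\<beta> / 2)" for j
      proof -
        have "smooth_gap \<beta> \<epsilon> (x j - s) = smooth_gap \<beta> \<epsilon> (s - x j)" by (simp add: smooth_gap_def power2_commute)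
        then show ?thesis by (simp add: smooth_gap_def flip: powr_add)
      qed
      moreover have "(\<Prod>j\<in>J. smooth_gap \<beta> \<epsilon> ((x(i := s)) i - (x(i := s)) j) * smooth_gap \<beta> \<epsilon> ((x(i := s)) j - (x(i := s)) i))
         = (\<Prod>j\<in>J. smooth_gap \<beta> \<epsilon> (s - x j) * smooth_gap \<beta> \<epsilon> (x j - s))"
        using J by (intro prod.cong) auto
      ultimately have e5: "pair_prod (smooth_gap \<beta> \<epsilon>) I (x(i := s)) =
         (\<Prod>j\<in>J. ((s - x j)\<^sup>2 + \<epsilon>) powr (\<beta> / 2)) * pair_prod (smooth_gap \<beta> \<epsilon>) J x"
        unfolding J(3) pair_prod_insert[OF J(1,2)] e4 by simp
      show ?thesis unfolding F_def smooth_laguerre_def e1 e2 e3 e5 by simp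
    qed
    then have F_eq: "(\<lambda>s. F (x(i := s))) = (\<lambda>s. ?c * ?D s)" by (rule ext)
    have D0: "(\<integral>s. ?D s \<partial>lborel) = 0"
      using J(1) a e \<beta> by (intro laguerre_integration_by_parts) auto
    show ?thesis unfolding F_eq integral_mult_right_zero D0 by (rule mult_zero_right)
  qed
  have "(\<integral>x. F x \<partial>lebesgue_power I) = (\<integral>x. (\<integral>s. F (x(i := s)) \<partial>lborel) \<partial>lebesgue_power J)"
    using int unfolding J(3) by (intro lborel_prod.product_integral_insert J)
  then show ?thesis by (simp add: inner)
qed

text \<open>The derivative of the exponential adds \<open>x i\<close> to the monomial, the power of
  \<open>x i\<close> gives the factor \<open>a\<close>, and the interactions cancel for
  \<open>j\<close> in \<open>S\<close> and symmetrise for the other \<open>j\<close>.\<close>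

lemma smoothed_aomoto:
  assumes i: "i \<in> I" and S: "S \<subseteq> I - {i}" and e: "0 < \<epsilon>" "\<epsilon> \<le> 1"
  shows "moment \<epsilon> (insert i S) / 2 = a * moment \<epsilon> S + \<beta> / 2 * (\<Sum>j\<in>I - {i} - S. gap_moment \<epsilon> S i j)"
proof -
  let ?\<Phi> = "smooth_laguerre \<beta> \<epsilon> a I"
  let ?m = "\<lambda>x. \<Prod>l\<in>S. x l"
  let ?t = "\<lambda>j x. ?m x * (x i * (x i - x j) / ((x i - x j)\<^sup>2 + \<epsilon>)) * ?\<Phi> x"
  have S': "S \<subseteq> I" "insert i S \<subseteq> I" "i \<notin> S" "finite S" using S i finite_subset[OF _ I] by auto
  have i1: "integrable (lebesgue_power I) (\<lambda>x. ?m x * ?\<Phi> x)"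
    using S' e by (intro integrable_moment) auto
  have i2: "integrable (lebesgue_power I) (\<lambda>x. (\<Prod>l\<in>insert i S. x l) * ?\<Phi> x)"
    using S' e by (intro integrable_moment) auto
  have i3: "integrable (lebesgue_power I) (?t j)" if "j \<in> I - {i}" for j
    using that S' i e by (intro integrable_gap_term) auto
  let ?F = "\<lambda>x. ?m x * (a - x i / 2 + \<beta> * (\<Sum>j\<in>I - {i}. x i * (x i - x j) / ((x i - x j)\<^sup>2 + \<epsilon>))) * ?\<Phi> x"
  have F: "?F = (\<lambda>x. (a * (?m x * ?\<Phi> x) - (1/2) * ((\<Prod>l\<in>insert i S. x l) * ?\<Phi> x)) + \<beta> * (\<Sum>j\<in>I - {i}. ?t j x))"
  proof
    fix x
    have "(\<Sum>j\<in>I - {i}. ?t j x) = ?m x * (\<Sum>j\<in>I - {i}. x i * (x i - x j) / ((x i - x j)\<^sup>2 + \<epsilon>)) * ?\<Phi> x"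
      by (simp only: sum_distrib_left sum_distrib_right)
    then show "?F x = (a * (?m x * ?\<Phi> x) - (1/2) * ((\<Prod>l\<in>insert i S. x l) * ?\<Phi> x)) + \<beta> * (\<Sum>j\<in>I - {i}. ?t j x)"
      using S' by (simp add: algebra_simps)
  qed
  have iS: "integrable (lebesgue_power I) (\<lambda>x. \<beta> * (\<Sum>j\<in>I - {i}. ?t j x))"
    using i3 by (intro integrable_mult_right Bochner_Integration.integrable_sum) auto
  have iF: "integrable (lebesgue_power I) ?F"
    unfolding F by (intro Bochner_Integration.integrable_add Bochner_Integration.integrable_diff integrable_mult_right i1 i2 iS)
  have "0 = (\<integral>x. ?F x \<partial>lebesgue_power I)"
    using integral_by_parts_coord[OF i S e iF] by simp
  also have "\<dots> = (a * moment \<epsilon> S - 1/2 * moment \<epsilon> (insert i S)) + \<beta> * (\<Sum>j\<in>I - {i}. \<integral>x. ?t j x \<partial>lebesgue_power I)"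
    unfolding F moment_def using i1 i2 iS i3
    by (simp only: Bochner_Integration.integral_add Bochner_Integration.integral_diff integral_mult_right_zero
       Bochner_Integration.integral_sum integrable_mult_right Bochner_Integration.integrable_diff)
  also have "(\<Sum>j\<in>I - {i}. \<integral>x. ?t j x \<partial>lebesgue_power I) = (\<Sum>j\<in>I - {i} - S. gap_moment \<epsilon> S i j / 2)"
  proof (rule sum.mono_neutral_cong_right)
    show "\<forall>j\<in>I - {i} - (I - {i} - S). (\<integral>x. ?t j x \<partial>lebesgue_power I) = 0"
      using gap_term_antisymmetric[OF i _ S e] by blast
    show "(\<integral>x. ?t j x \<partial>lebesgue_power I) = gap_moment \<epsilon> S i j / 2" if "j \<in> I - {i} - S" for j
      using gap_term_symmetrize[OF i that S e] .
  qed (use I in auto)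
  also have "\<dots> = (\<Sum>j\<in>I - {i} - S. gap_moment \<epsilon> S i j) / 2" by (simp add: sum_divide_distrib)
  finally show ?thesis by (simp add: field_simps)
qed

lemma smooth_laguerre_tendsto:
  assumes "e \<longlonglongrightarrow> 0" "\<And>m. 0 \<le> e m"
  shows "(\<lambda>m. smooth_laguerre \<beta> (e m) a I x) \<longlonglongrightarrow> smooth_laguerre \<beta> 0 a I x"
proof -
  have "(\<lambda>m. smooth_gap \<beta> (e m) d) \<longlonglongrightarrow> smooth_gap \<beta> 0 d" for d
    unfolding smooth_gap_def using assms \<beta>
    by (intro tendsto_powr' tendsto_intros) auto
  then show ?thesis unfolding smooth_laguerre_def pair_prod_def by (intro tendsto_intros)
qed

lemma moment_tendsto:
  assumes e: "e \<longlonglongrightarrow> 0" "\<And>m. 0 < e m" "\<And>m. e m \<le> 1" and S: "S \<subseteq> I"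
  shows "(\<lambda>m. moment (e m) S) \<longlonglongrightarrow> moment 0 S"
  unfolding moment_def
proof (rule integral_dominated_convergence)
  let ?w = "laguerre_bound (1 + \<beta> * real (card I) * real (card I)) a I"
  show "integrable (lebesgue_power I) (\<lambda>x. 1 * ?w x)"
    using I a \<beta> by (intro integrable_mult_right integrable_laguerre_bound) auto
  show "AE x in lebesgue_power I. (\<lambda>m. (\<Prod>l\<in>S. x l) * smooth_laguerre \<beta> (e m) a I x) \<longlonglongrightarrow> (\<Prod>l\<in>S. x l) * smooth_laguerre \<beta> 0 a I x"
    using e by (intro AE_I2 tendsto_intros smooth_laguerre_tendsto) (auto simp: less_imp_le)
  show "AE x in lebesgue_power I. norm ((\<Prod>l\<in>S. x l) * smooth_laguerre \<beta> (e m) a I x) \<le> 1 * ?w x" for m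
  proof (intro AE_I2)
    fix x
    show "norm ((\<Prod>l\<in>S. x l) * smooth_laguerre \<beta> (e m) a I x) \<le> 1 * ?w x"
      unfolding real_norm_def
      using abs_prod_le_growth[OF I S, of x] growth_pos[of I x] I \<beta> e(2,3)[of m]
      by (intro smooth_laguerre_bound) auto
  qed
qed (use S in \<open>auto intro!: borel_measurable_times borel_measurable_monomial borel_measurable_smooth_laguerre\<close>)

lemma gap_moment_tendsto:
  assumes e: "e \<longlonglongrightarrow> 0" "\<And>m. 0 < e m" "\<And>m. e m \<le> 1" and S: "S \<subseteq> I" and ij: "i \<in> I" "j \<in> I" "i \<noteq> j"
  shows "(\<lambda>m. gap_moment (e m) S i j) \<longlonglongrightarrow> moment 0 S"
  unfolding moment_def gap_moment_def
proof (rule integral_dominated_convergence)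
  let ?w = "laguerre_bound (1 + \<beta> * real (card I) * real (card I)) a I"
  show "integrable (lebesgue_power I) (\<lambda>x. 1 * ?w x)"
    using I a \<beta> by (intro integrable_mult_right integrable_laguerre_bound) auto
  show "AE x in lebesgue_power I. (\<lambda>m. (\<Prod>l\<in>S. x l) * ((x i - x j)\<^sup>2 / ((x i - x j)\<^sup>2 + e m)) * smooth_laguerre \<beta> (e m) a I x)
      \<longlonglongrightarrow> (\<Prod>l\<in>S. x l) * smooth_laguerre \<beta> 0 a I x"
  proof (intro AE_I2)
    fix x
    show "(\<lambda>m. (\<Prod>l\<in>S. x l) * ((x i - x j)\<^sup>2 / ((x i - x j)\<^sup>2 + e m)) * smooth_laguerre \<beta> (e m) a I x)
      \<longlonglongrightarrow> (\<Prod>l\<in>S. x l) * smooth_laguerre \<beta> 0 a I x"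
    proof (cases "x i = x j")
      \<comment> \<open>On the diagonal the quotient is 0 for every \<epsilon> instead of tending to
        1. The limit is still right, because the unsmoothed Vandermonde factor vanishes
        there.\<close>
      case True
      have "pair_prod (smooth_gap \<beta> 0) I x = 0"
        unfolding pair_prod_def
      proof (rule prod_zero[OF I], rule bexI[OF _ ij(1)], rule prod_zero)
        show "\<exists>l\<in>I - {i}. smooth_gap \<beta> 0 (x i - x l) = 0"
          using ij True by (intro bexI[of _ j]) (auto simp: smooth_gap_def)
      qed (use I in auto)
      then show ?thesis using True by (simp add: smooth_laguerre_def)
    next
      case False
      have "(\<lambda>m. (x i - x j)\<^sup>2 / ((x i - x j)\<^sup>2 + e m)) \<longlonglongrightarrow> (x i - x j)\<^sup>2 / ((x i - x j)\<^sup>2 + 0)"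
        using False e by (intro tendsto_intros) auto
      then have 1: "(\<lambda>m. (x i - x j)\<^sup>2 / ((x i - x j)\<^sup>2 + e m)) \<longlonglongrightarrow> 1" using False by simp
      have "(\<lambda>m. (\<Prod>l\<in>S. x l) * ((x i - x j)\<^sup>2 / ((x i - x j)\<^sup>2 + e m)) * smooth_laguerre \<beta> (e m) a I x)
         \<longlonglongrightarrow> (\<Prod>l\<in>S. x l) * 1 * smooth_laguerre \<beta> 0 a I x"
        using e by (intro tendsto_mult tendsto_const 1 smooth_laguerre_tendsto) (auto simp: less_imp_le)
      then show ?thesis by simp
    qed
  qed
  show "AE x in lebesgue_power I. norm ((\<Prod>l\<in>S. x l) * ((x i - x j)\<^sup>2 / ((x i - x j)\<^sup>2 + e m)) * smooth_laguerre \<beta> (e m) a I x) \<le> 1 * ?w x" for m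
  proof (intro AE_I2)
    fix x
    let ?r = "(x i - x j)\<^sup>2 / ((x i - x j)\<^sup>2 + e m)"
    have p: "0 < (x i - x j)\<^sup>2 + e m" using e(2)[of m] by (simp add: add_nonneg_pos)
    have "?r \<le> 1" using divide_le_eq_1_pos[OF p] e(2)[of m] by (simp add: less_imp_le)
    moreover have "0 \<le> ?r" using p by (intro divide_nonneg_pos) auto
    ultimately have r: "\<bar>?r\<bar> \<le> 1" by (simp only: abs_of_nonneg)
    have "\<bar>(\<Prod>l\<in>S. x l) * ?r\<bar> \<le> \<bar>\<Prod>l\<in>S. x l\<bar> * 1"
      unfolding abs_mult using r by (intro mult_left_mono) auto
    also have "\<dots> \<le> 1 * growth I x powr 1"
      using abs_prod_le_growth[OF I S, of x] growth_pos[of I x] by simp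
    finally have "\<bar>(\<Prod>l\<in>S. x l) * ?r\<bar> \<le> 1 * growth I x powr 1" .
    then show "norm ((\<Prod>l\<in>S. x l) * ?r * smooth_laguerre \<beta> (e m) a I x) \<le> 1 * ?w x"
      unfolding real_norm_def
      using I \<beta> e(2,3)[of m] by (intro smooth_laguerre_bound) auto
  qed
qed (intro borel_measurable_times[OF borel_measurable_gap_term(2)] borel_measurable_times
    borel_measurable_monomial borel_measurable_smooth_laguerre S ij)+

text \<open>In the limit every \<open>j\<close> outside \<open>insert i S\<close> contributes the
  same moment, so only the number of such \<open>j\<close> matters.\<close>

lemma aomoto_step:
  assumes i: "i \<in> I" and S: "S \<subseteq> I - {i}"
  shows "moment 0 (insert i S) = 2 * (a + \<beta> / 2 * real (card I - Suc (card S))) * moment 0 S"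
proof -
  \<comment> \<open>Any null sequence inside \<open>(0, 1]\<close> would do; the upper end is what
    the majorants are valid for.\<close>
  define e :: "nat \<Rightarrow> real" where "e m = 1 / real (Suc m)" for m
  have e: "e \<longlonglongrightarrow> 0" "\<And>m. 0 < e m" "\<And>m. e m \<le> 1"
    unfolding e_def using LIMSEQ_inverse_real_of_nat by (auto simp: inverse_eq_divide)
  have S': "S \<subseteq> I" "insert i S \<subseteq> I" "finite S" using S i finite_subset[OF _ I] by auto
  have "(\<lambda>m. moment (e m) (insert i S) / 2) \<longlonglongrightarrow> moment 0 (insert i S) / 2"
    using S' by (intro tendsto_intros moment_tendsto e) auto
  moreover have "(\<lambda>m. moment (e m) (insert i S) / 2) \<longlonglongrightarrow> a * moment 0 S + \<beta> / 2 * (\<Sum>j\<in>I - {i} - S. moment 0 S)"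
    unfolding smoothed_aomoto[OF i S e(2,3)]
    using S' i by (intro tendsto_intros moment_tendsto gap_moment_tendsto e) auto
  ultimately have "moment 0 (insert i S) / 2 = a * moment 0 S + \<beta> / 2 * (\<Sum>j\<in>I - {i} - S. moment 0 S)"
    by (rule LIMSEQ_unique)
  moreover have "card (I - {i} - S) = card I - Suc (card S)"
    using S i I S' by (subst card_Diff_subset) auto
  ultimately show ?thesis by (simp add: algebra_simps)
qed

lemma aomoto:
  "S \<subseteq> I \<Longrightarrow> moment 0 S = moment 0 {} * (\<Prod>k<card S. 2 * (a + \<beta> / 2 * real (card I - Suc k)))"
proof (induction "card S" arbitrary: S)
  case 0
  then have "S = {}" using finite_subset[OF _ I] by auto
  then show ?case by simp
next
  case (Suc k)
  then obtain i T where T: "S = insert i T" "i \<notin> T" "card T = k" by (metis card_Suc_eq)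
  have "moment 0 S = 2 * (a + \<beta> / 2 * real (card I - Suc k)) * moment 0 T"
    unfolding T(1) using Suc.prems T by (subst aomoto_step) auto
  also have "moment 0 T = moment 0 {} * (\<Prod>k<card T. 2 * (a + \<beta> / 2 * real (card I - Suc k)))"
    using Suc.hyps(1)[of T] Suc.prems T by auto
  finally show ?case using T Suc.hyps(2)[symmetric] by simp
qed

end

definition laguerre_integral :: "real \<Rightarrow> nat set \<Rightarrow> real \<Rightarrow> real" where
  "laguerre_integral \<beta> I a = (\<integral>x. smooth_laguerre \<beta> 0 a I x \<partial>lebesgue_power I)"

text \<open>The full monomial over \<open>I\<close> raises the shape of every one-point weight by
  one, so the recursion run from the empty set to \<open>I\<close> connects the shapes
  \<open>a\<close> and \<open>a + 1\<close>.\<close>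

theorem laguerre_integral_plus1:
  assumes "finite I" "0 < \<beta>" "0 < a"
  shows "laguerre_integral \<beta> I (a + 1) = laguerre_integral \<beta> I a * (\<Prod>k<card I. 2 * (a + \<beta> / 2 * real k))"
proof -
  have "(\<Prod>l\<in>I. x l) * smooth_laguerre \<beta> 0 a I x = smooth_laguerre \<beta> 0 (a + 1) I x" for x
  proof -
    have "s * laguerre_weight a s = laguerre_weight (a + 1) s" for s
      by (simp add: laguerre_weight_def powr_diff)
    then have "(\<Prod>l\<in>I. x l) * (\<Prod>l\<in>I. laguerre_weight a (x l)) = (\<Prod>l\<in>I. laguerre_weight (a + 1) (x l))"
      by (simp flip: prod.distrib)
    then show ?thesis by (simp add: smooth_laguerre_def mult.left_commute)
  qed
  then have "laguerre_integral \<beta> I (a + 1) = moment I \<beta> a 0 I"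
    by (simp add: laguerre_integral_def moment_def[OF assms])
  also have "\<dots> = moment I \<beta> a 0 {} * (\<Prod>k<card I. 2 * (a + \<beta> / 2 * real (card I - Suc k)))"
    by (rule aomoto[OF assms]) simp
  also have "moment I \<beta> a 0 {} = laguerre_integral \<beta> I a"
    by (simp add: laguerre_integral_def moment_def[OF assms])
  also have "(\<Prod>k<card I. 2 * (a + \<beta> / 2 * real (card I - Suc k))) = (\<Prod>k<card I. 2 * (a + \<beta> / 2 * real k))"
    by (rule prod.nat_diff_reindex)
  finally show ?thesis .
qed

section \<open>Normalising constants\<close>

text \<open>Uniqueness in the style of Bohr--Mollerup. \<open>D = f - g\<close> has period 1.
  Convexity of \<open>f\<close> bounds \<open>f (y + s)\<close> from above by
  \<open>\<rho> y\<close>, convexity of \<open>g\<close> bounds \<open>g (y + s)\<close> from below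
  by \<open>\<rho> (y - 1)\<close>; far out these increments differ by a null sequence, so
  \<open>D\<close> does not increase. A periodic function that does not increase is
  constant.\<close>

lemma convex_shift_eq:
  fixes f g \<rho> :: "real \<Rightarrow> real"
  assumes f: "convex_on {0<..} f" and g: "convex_on {0<..} g"
    and f1: "\<And>a. a > 0 \<Longrightarrow> f (a + 1) = f a + \<rho> a" and g1: "\<And>a. a > 0 \<Longrightarrow> g (a + 1) = g a + \<rho> a"
    and \<rho>: "\<And>a. a > 0 \<Longrightarrow> (\<lambda>m. \<rho> (a + real m + 1) - \<rho> (a + real m)) \<longlonglongrightarrow> 0"
    and eq: "f 1 = g 1" and a: "a > 0"
  shows "f a = g a"
proof -
  define D where "D x = f x - g x" for x
  have per: "D (x + real m) = D x" if "x > 0" for x m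
  proof (induction m)
    case (Suc m)
    have "D (x + real (Suc m)) = D ((x + real m) + 1)" by (simp add: algebra_simps)
    also have "\<dots> = D (x + real m)" using that f1[of "x + real m"] g1[of "x + real m"] by (simp add: D_def)
    finally show ?case using Suc by simp
  qed simp
  have le1: "D (x + s) \<le> D x" if x: "x > 0" and s: "0 < s" "s < 1" for x s
  proof -
    have bound: "D (x + s) \<le> D x + s * (\<rho> (x + real m + 1) - \<rho> (x + real m))" for m
    proof -
      \<comment> \<open>By periodicity the comparison may be made arbitrarily far to the right; the
        extra 1 keeps \<open>y - 1\<close> positive.\<close>
      define y where "y = x + real m + 1"
      have y: "y > 1" using x by (simp add: y_def)
      have "f (y + s) = f ((1 - s) * y + s * (y + 1))" by (simp add: algebra_simps)
      also have "\<dots> \<le> (1 - s) * f y + s * f (y + 1)"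
        using convex_onD[OF f, of s y "y + 1"] y s by simp
      also have "f (y + 1) = f y + \<rho> y" using f1 y by simp
      finally have F: "f (y + s) \<le> f y + s * \<rho> y" by (simp add: algebra_simps)
      \<comment> \<open>The weight that writes \<open>y\<close> as a convex combination of
        \<open>y - 1\<close> and \<open>y + s\<close>.\<close>
      define r where "r = 1 / (1 + s)"
      have r: "r * (1 + s) = 1" "0 \<le> r" "r \<le> 1" using s by (auto simp: r_def)
      have e: "(1 - r) * (y - 1) + r * (y + s) = y" using r(1) by (simp add: algebra_simps)
      have "g ((1 - r) * (y - 1) + r * (y + s)) \<le> (1 - r) * g (y - 1) + r * g (y + s)"
        using convex_onD[OF g, of r "y - 1" "y + s"] y s r by simp
      then have "(1 + s) * g y \<le> (1 + s) * ((1 - r) * g (y - 1) + r * g (y + s))"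
        unfolding e using s by (intro mult_left_mono) auto
      also have "\<dots> = (1 + s - r * (1 + s)) * g (y - 1) + r * (1 + s) * g (y + s)" by (simp add: algebra_simps)
      also have "\<dots> = s * g (y - 1) + g (y + s)" unfolding r(1) by simp
      also have "g (y - 1) = g y - \<rho> (y - 1)" using g1[of "y - 1"] y by simp
      finally have G: "g (y + s) \<ge> g y + s * \<rho> (y - 1)" by (simp add: algebra_simps)
      have "D (x + s) = D (y + s)" using per[of "x + s" "Suc m"] x s by (simp add: y_def algebra_simps)
      also have "\<dots> \<le> D y + s * (\<rho> y - \<rho> (y - 1))" using F G by (simp add: D_def algebra_simps)
      also have "D y = D x" using per[of x "Suc m"] x by (simp add: y_def algebra_simps)
      finally show ?thesis by (simp add: y_def)
    qed
    have "(\<lambda>m. D x + s * (\<rho> (x + real m + 1) - \<rho> (x + real m))) \<longlonglongrightarrow> D x + s * 0"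
      by (intro tendsto_intros \<rho> x)
    then show ?thesis using LIMSEQ_le_const[of _ "D x + s * 0" "D (x + s)"] bound by auto
  qed
  \<comment> \<open>Periodicity moves \<open>z\<close> to the right of \<open>x\<close>; the
    distance is then covered by \<open>k\<close> unit steps, which do not change \<open>D\<close>,
    and one fractional step. As \<open>x\<close> and \<open>z\<close> are arbitrary, both
    inequalities follow.\<close>
  have le: "D z \<le> D x" if "x > 0" "z > 0" for x z
  proof -
    obtain m :: nat where m: "x < z + real m" using reals_Archimedean2[of "x - z"] by (auto simp: algebra_simps)
    define w where "w = z + real m - x"
    define k where "k = nat \<lfloor>w\<rfloor>"
    have w: "w > 0" using m by (simp add: w_def)
    then have k: "real k \<le> w" "w < real k + 1" unfolding k_def by linarith+
    have "D z = D (z + real m)" using per that by simp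
    also have "z + real m = (x + real k) + (w - real k)" by (simp add: w_def)
    also have "D \<dots> \<le> D (x + real k)"
      using le1[of "x + real k" "w - real k"] k that by (cases "w = real k") auto
    also have "\<dots> = D x" using per that by simp
    finally show ?thesis .
  qed
  have "D a = D 1" using le[of a 1] le[of 1 a] a by simp
  then show ?thesis using eq by (simp add: D_def)
qed

section \<open>The unsmoothed integral, and its recursion in the number of variables at shape
  1\<close>

lemma integrable_smooth_laguerre_0:
  assumes "finite I" "0 < \<beta>" "0 < a"
  shows "integrable (lebesgue_power I) (smooth_laguerre \<beta> 0 a I)"
proof -
  have "growth I x \<noteq> 0" for x using growth_pos[of I x] by simp
  then show ?thesis
    using integrable_smooth_laguerre[of I 0 \<beta> a 1 0 "\<lambda>_. 1"] assms by simp
qed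

lemma nn_integral_smooth_laguerre:
  assumes "finite I" "0 < \<beta>" "0 < a"
  shows "(\<integral>\<^sup>+x. ennreal (smooth_laguerre \<beta> 0 a I x) \<partial>lebesgue_power I) = ennreal (laguerre_integral \<beta> I a)"
  unfolding laguerre_integral_def
  using integrable_smooth_laguerre_0[OF assms] smooth_laguerre_nonneg by (intro nn_integral_eq_integral) auto

lemma laguerre_integral_nonneg: "0 \<le> laguerre_integral \<beta> I a"
  unfolding laguerre_integral_def using smooth_laguerre_nonneg by (intro integral_nonneg_AE) auto

lemma smooth_gap_0: "smooth_gap \<beta> 0 d = \<bar>d\<bar> powr (\<beta> / 2)"
proof (cases "d = 0")
  case False
  then have "d\<^sup>2 + 0 = \<bar>d\<bar> powr 2" by simp
  then show ?thesis by (simp only: smooth_gap_def powr_powr) simp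
qed (simp add: smooth_gap_def)

lemma smooth_gap_0_sym_square: "smooth_gap \<beta> 0 d * smooth_gap \<beta> 0 (- d) = \<bar>d\<bar> powr \<beta>"
  by (simp add: smooth_gap_0 flip: powr_add)

lemma symmetric_on_smooth_laguerre: "symmetric_on I (\<lambda>x. ennreal (smooth_laguerre \<beta> \<epsilon> a I x))"
  unfolding symmetric_on_def smooth_laguerre_def
  by (auto simp only: pair_prod_swap_coords prod_swap_coords[where f = "laguerre_weight a"])

lemma smooth_laguerre_tie:
  assumes "finite I" "i \<in> I" "j \<in> I" "i \<noteq> j" "x i = x j"
  shows "smooth_laguerre \<beta> 0 a I x = 0"
proof -
  have "pair_prod (smooth_gap \<beta> 0) I x = 0"
    unfolding pair_prod_def
  proof (rule prod_zero[OF assms(1)], rule bexI[OF _ assms(2)], rule prod_zero)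
    show "\<exists>l\<in>I - {i}. smooth_gap \<beta> 0 (x i - x l) = 0"
      using assms by (intro bexI[of _ j]) (auto simp: smooth_gap_def)
  qed (use assms in auto)
  then show ?thesis by (simp add: smooth_laguerre_def)
qed

lemma zero_on_ties_smooth_laguerre: "finite I \<Longrightarrow> zero_on_ties I (\<lambda>x. ennreal (smooth_laguerre \<beta> 0 a I x))"
  unfolding zero_on_ties_def using smooth_laguerre_tie by auto

lemma smooth_laguerre_insert:
  assumes "finite I" "k \<notin> I"
  shows "smooth_laguerre \<beta> 0 a (insert k I) x =
    (\<Prod>j\<in>I. \<bar>x j - x k\<bar> powr \<beta>) * laguerre_weight a (x k) * smooth_laguerre \<beta> 0 a I x"
proof -
  have "smooth_gap \<beta> 0 (x k - x j) * smooth_gap \<beta> 0 (x j - x k) = \<bar>x j - x k\<bar> powr \<beta>" for j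
    using smooth_gap_0_sym_square[of \<beta> "x j - x k"] by (simp add: mult.commute)
  then show ?thesis
    unfolding smooth_laguerre_def pair_prod_insert[OF assms] using assms by (simp add: mult_ac)
qed

lemma smooth_laguerre_cong: "(\<And>i. i \<in> I \<Longrightarrow> x i = y i) \<Longrightarrow> smooth_laguerre \<beta> \<epsilon> a I x = smooth_laguerre \<beta> \<epsilon> a I y"
  unfolding smooth_laguerre_def by (auto cong: pair_prod_cong)

lemma prod_powr_smooth_laguerre:
  assumes "finite I"
  shows "(\<Prod>l\<in>I. \<bar>x l\<bar> powr c) * smooth_laguerre \<beta> \<epsilon> a I x = smooth_laguerre \<beta> \<epsilon> (a + c) I x"
proof -
  have "\<bar>s\<bar> powr c * laguerre_weight a s = laguerre_weight (a + c) s" for s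
    by (simp add: laguerre_weight_def mult.assoc[symmetric] flip: powr_add) (simp add: algebra_simps)
  then have "(\<Prod>l\<in>I. \<bar>x l\<bar> powr c) * (\<Prod>l\<in>I. laguerre_weight a (x l)) = (\<Prod>l\<in>I. laguerre_weight (a + c) (x l))"
    by (simp flip: prod.distrib)
  then show ?thesis by (simp add: smooth_laguerre_def mult.left_commute)
qed

text \<open>Let \<open>u\<close> be the smallest coordinate and measure the others from it. The
  interactions with \<open>u\<close> become the factors \<open>x j powr \<beta>\<close>, which raise
  the shape to \<open>1 + \<beta>\<close>, and the exponentials collect to
  \<open>exp (- (?n / 2) * u)\<close>. The integral over \<open>u\<close> is \<open>2 / ?n\<close>,
  whose denominator cancels the factor for the choice of the minimum.\<close>

lemma laguerre_integral_at_1: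
  assumes "finite I" "k \<notin> I" "0 < \<beta>"
  shows "laguerre_integral \<beta> (insert k I) 1 = 2 * laguerre_integral \<beta> I (1 + \<beta>)"
proof -
  let ?n = "real (Suc (card I))"
  let ?F = "\<lambda>x. ennreal (smooth_laguerre \<beta> 0 1 (insert k I) x)"
  let ?G = "\<lambda>x. ?F x * (if \<forall>j\<in>I. x k < x j then 1 else 0)"
  have pred[measurable]: "(\<lambda>x. \<forall>j\<in>I. x k < x j) \<in> measurable (lebesgue_power (insert k I)) (count_space UNIV)"
    using assms by (intro pred_intros_finite(3) borel_measurable_pred_less measurable_coord) auto
  have G[measurable]: "?G \<in> borel_measurable (lebesgue_power (insert k I))" by measurable
  have inner: "(\<integral>\<^sup>+x. ?G (x(k := u)) \<partial>lebesgue_power I) =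
      ennreal (if 0 < u then u powr (1 - 1) * exp (- (?n / 2) * u) else 0) * ennreal (laguerre_integral \<beta> I (1 + \<beta>))" for u
  proof -
    \<comment> \<open>Only the remaining coordinates are translated; the minimum keeps its value
      \<open>u\<close>.\<close>
    have "(\<integral>\<^sup>+x. ?G (x(k := u)) \<partial>lebesgue_power I) = (\<integral>\<^sup>+x. ?G ((\<lambda>i\<in>I. x i + u)(k := u)) \<partial>lebesgue_power I)"
      using nn_integral_translate_power[OF assms(1) borel_measurable_fun_upd_power[OF G assms(2), of u], of u] by simp
    also have "\<dots> = (\<integral>\<^sup>+x. ennreal (if 0 < u then u powr (1 - 1) * exp (- (?n / 2) * u) else 0) *
        ennreal (smooth_laguerre \<beta> 0 (1 + \<beta>) I x) \<partial>lebesgue_power I)"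
    proof (intro nn_integral_cong)
      fix x :: "nat \<Rightarrow> real"
      let ?z = "(\<lambda>i\<in>I. x i + u)(k := u)"
      have z: "?z k = u" "\<And>i. i \<in> I \<Longrightarrow> ?z i = x i + u" using assms(2) by auto
      have all: "(\<forall>j\<in>I. ?z k < ?z j) \<longleftrightarrow> (\<forall>j\<in>I. 0 < x j)" using z by auto
      show "?G ?z = ennreal (if 0 < u then u powr (1 - 1) * exp (- (?n / 2) * u) else 0) *
        ennreal (smooth_laguerre \<beta> 0 (1 + \<beta>) I x)"
      proof (cases "0 < u \<and> (\<forall>j\<in>I. 0 < x j)")
        case False
        show ?thesis
        proof (cases "0 < u")
          case True
          then have "\<not> (\<forall>j\<in>I. 0 < x j)" using False by simp
          then have n1: "\<not> (\<forall>j\<in>I. ?z k < ?z j)" and r0: "smooth_laguerre \<beta> 0 (1 + \<beta>) I x = 0"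
            using all smooth_laguerre_eq_0[OF assms(1)] by blast+
          show ?thesis by (simp only: n1 r0 if_False mult_zero_right ennreal_0)
        next
          case False
          then have s0: "smooth_laguerre \<beta> 0 1 (insert k I) ?z = 0"
            using assms z(1) by (intro smooth_laguerre_eq_0) auto
          show ?thesis by (simp only: s0 False if_False mult_zero_left ennreal_0)
        qed
      next
        case True
        then have u: "0 < u" and pos: "\<And>j. j \<in> I \<Longrightarrow> 0 < x j" by auto
        have "smooth_laguerre \<beta> 0 1 (insert k I) ?z =
           (\<Prod>j\<in>I. \<bar>?z j - u\<bar> powr \<beta>) * laguerre_weight 1 u * smooth_laguerre \<beta> 0 1 I ?z"
          unfolding smooth_laguerre_insert[OF assms(1,2)] z(1) ..
        also have "(\<Prod>j\<in>I. \<bar>?z j - u\<bar> powr \<beta>) = (\<Prod>j\<in>I. \<bar>x j\<bar> powr \<beta>)"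
          using assms(2) by (intro prod.cong) auto
        also have "smooth_laguerre \<beta> 0 1 I ?z = exp (- u / 2) ^ card I * smooth_laguerre \<beta> 0 1 I x"
        proof -
          have "pair_prod (smooth_gap \<beta> 0) I ?z = pair_prod (smooth_gap \<beta> 0) I x"
            unfolding pair_prod_def using z(2) assms(2) by (intro prod.cong) auto
          moreover have "(\<Prod>l\<in>I. laguerre_weight 1 (?z l)) = (\<Prod>l\<in>I. exp (- u / 2) * laguerre_weight 1 (x l))"
          proof (intro prod.cong refl)
            fix l assume l: "l \<in> I"
            have "exp (- (x l + u) / 2) = exp (- u / 2) * exp (- x l / 2)"
              by (simp add: field_simps flip: exp_add)
            then show "laguerre_weight 1 (?z l) = exp (- u / 2) * laguerre_weight 1 (x l)"
              using z(2)[OF l] pos[OF l] u by (simp add: laguerre_weight_def)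
          qed
          ultimately show ?thesis by (simp add: smooth_laguerre_def prod.distrib mult_ac)
        qed
        also have "(\<Prod>j\<in>I. \<bar>x j\<bar> powr \<beta>) * laguerre_weight 1 u * (exp (- u / 2) ^ card I * smooth_laguerre \<beta> 0 1 I x)
           = (laguerre_weight 1 u * exp (- u / 2) ^ card I) * ((\<Prod>j\<in>I. \<bar>x j\<bar> powr \<beta>) * smooth_laguerre \<beta> 0 1 I x)"
          by (simp add: mult_ac)
        also have "(\<Prod>j\<in>I. \<bar>x j\<bar> powr \<beta>) * smooth_laguerre \<beta> 0 1 I x = smooth_laguerre \<beta> 0 (1 + \<beta>) I x"
          by (rule prod_powr_smooth_laguerre[OF assms(1)])
        also have "laguerre_weight 1 u * exp (- u / 2) ^ card I = exp (- (?n / 2) * u)"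
          using u by (simp add: laguerre_weight_def field_simps flip: exp_of_nat_mult exp_add)
        finally have eq: "smooth_laguerre \<beta> 0 1 (insert k I) ?z = exp (- (?n / 2) * u) * smooth_laguerre \<beta> 0 (1 + \<beta>) I x" .
        have A: "\<forall>j\<in>I. ?z k < ?z j" using all pos by blast
        have "?G ?z = ennreal (exp (- (?n / 2) * u) * smooth_laguerre \<beta> 0 (1 + \<beta>) I x)"
          by (simp only: if_P[OF A] mult_1_right eq)
        also have "\<dots> = ennreal (exp (- (?n / 2) * u)) * ennreal (smooth_laguerre \<beta> 0 (1 + \<beta>) I x)"
          by (intro ennreal_mult smooth_laguerre_nonneg) simp
        also have "ennreal (exp (- (?n / 2) * u)) = ennreal (if 0 < u then u powr (1 - 1) * exp (- (?n / 2) * u) else 0)"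
          using u by simp
        finally show ?thesis .
      qed
    qed
    also have "\<dots> = ennreal (if 0 < u then u powr (1 - 1) * exp (- (?n / 2) * u) else 0) * ennreal (laguerre_integral \<beta> I (1 + \<beta>))"
      using assms by (subst nn_integral_cmult) (auto simp: nn_integral_smooth_laguerre)
    finally show ?thesis .
  qed
  have "ennreal (laguerre_integral \<beta> (insert k I) 1) = (\<integral>\<^sup>+x. ?F x \<partial>lebesgue_power (insert k I))"
    using assms by (subst nn_integral_smooth_laguerre) auto
  also have "\<dots> = of_nat (Suc (card I)) * (\<integral>\<^sup>+x. ?G x \<partial>lebesgue_power (insert k I))"
    using assms by (intro nn_integral_peel_min symmetric_on_smooth_laguerre zero_on_ties_smooth_laguerre) auto
  also have "(\<integral>\<^sup>+x. ?G x \<partial>lebesgue_power (insert k I)) = (\<integral>\<^sup>+u. (\<integral>\<^sup>+x. ?G (x(k := u)) \<partial>lebesgue_power I) \<partial>lborel)"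
    by (rule lborel_prod.product_nn_integral_insert_rev[OF assms(1,2) G])
  also have "\<dots> = (\<integral>\<^sup>+u. ennreal (if 0 < u then u powr (1 - 1) * exp (- (?n / 2) * u) else 0) \<partial>lborel) * ennreal (laguerre_integral \<beta> I (1 + \<beta>))"
    unfolding inner by (intro nn_integral_multc) auto
  also have "(\<integral>\<^sup>+u. ennreal (if 0 < u then u powr (1 - 1) * exp (- (?n / 2) * u) else 0) \<partial>lborel) = ennreal (Gamma 1 / (?n / 2) powr 1)"
    by (intro nn_integral_gamma) auto
  also have "of_nat (Suc (card I)) * (ennreal (Gamma 1 / (?n / 2) powr 1) * ennreal (laguerre_integral \<beta> I (1 + \<beta>))) =
     ennreal (?n * (1 / (?n / 2) * laguerre_integral \<beta> I (1 + \<beta>)))"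
  proof -
    have g: "Gamma 1 / (?n / 2) powr 1 = 1 / (?n / 2)" by simp
    show ?thesis
      unfolding ennreal_of_nat_eq_real_of_nat g
      by (simp only: ennreal_mult[symmetric] laguerre_integral_nonneg mult_nonneg_nonneg divide_nonneg_nonneg of_nat_0_le_iff
          zero_le_one zero_le_numeral)
  qed
  also have "?n * (1 / (?n / 2) * laguerre_integral \<beta> I (1 + \<beta>)) = 2 * laguerre_integral \<beta> I (1 + \<beta>)"
    by (simp add: field_simps)
  finally show ?thesis
    using laguerre_integral_nonneg[of \<beta> I "1 + \<beta>"] laguerre_integral_nonneg[of \<beta> "insert k I" 1] by simp
qed

section \<open>Log-convexity in the shape and the closed form\<close>

lemma laguerre_weight_geometric_mean:
  assumes "0 \<le> u" "u \<le> 1"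
  shows "laguerre_weight ((1 - u) * a + u * b) s = laguerre_weight a s powr (1 - u) * laguerre_weight b s powr u"
proof (cases "0 < s")
  case True
  have "laguerre_weight a s powr (1 - u) * laguerre_weight b s powr u =
     (s powr ((a - 1) * (1 - u)) * s powr ((b - 1) * u)) * (exp (- s / 2 * (1 - u)) * exp (- s / 2 * u))"
    using True by (simp add: laguerre_weight_def powr_mult powr_powr exp_powr_real mult_ac)
  also have "s powr ((a - 1) * (1 - u)) * s powr ((b - 1) * u) = s powr ((1 - u) * a + u * b - 1)"
    by (simp add: algebra_simps flip: powr_add)
  also have "exp (- s / 2 * (1 - u)) * exp (- s / 2 * u) = exp (- s / 2)"
    by (simp add: algebra_simps flip: exp_add)
  finally show ?thesis using True by (simp add: laguerre_weight_def)
qed (simp add: laguerre_weight_def)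

lemma smooth_laguerre_geometric_mean:
  assumes "finite I" "0 \<le> u" "u \<le> 1"
  shows "smooth_laguerre \<beta> \<epsilon> ((1 - u) * a + u * b) I x = smooth_laguerre \<beta> \<epsilon> a I x powr (1 - u) * smooth_laguerre \<beta> \<epsilon> b I x powr u"
proof -
  let ?V = "pair_prod (smooth_gap \<beta> \<epsilon>) I x"
  have V: "0 \<le> ?V" by (rule pair_prod_nonneg) simp
  have w: "0 \<le> (\<Prod>l\<in>I. laguerre_weight c (x l))" for c by (intro prod_nonneg) auto
  have "smooth_laguerre \<beta> \<epsilon> a I x powr (1 - u) * smooth_laguerre \<beta> \<epsilon> b I x powr u =
    (?V powr (1 - u) * ?V powr u) * ((\<Prod>l\<in>I. laguerre_weight a (x l) powr (1 - u)) * (\<Prod>l\<in>I. laguerre_weight b (x l) powr u))"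
    unfolding smooth_laguerre_def using V w by (simp add: powr_mult mult_ac flip: prod_powr_distrib)
  also have "?V powr (1 - u) * ?V powr u = ?V"
    using V by (simp flip: powr_add)
  also have "(\<Prod>l\<in>I. laguerre_weight a (x l) powr (1 - u)) * (\<Prod>l\<in>I. laguerre_weight b (x l) powr u) =
     (\<Prod>l\<in>I. laguerre_weight ((1 - u) * a + u * b) (x l))"
    unfolding laguerre_weight_geometric_mean[OF assms(2,3)] by (rule prod.distrib[symmetric])
  finally show ?thesis by (simp add: smooth_laguerre_def)
qed

text \<open>Hoelder's inequality, obtained from Young's inequality after dividing both integrands by
  their integrals. The integrand at an intermediate shape is the geometric mean of the integrands at
  the end points.\<close>

lemma laguerre_integral_log_convex:
  assumes "finite I" "0 < \<beta>" "0 < a" "0 < b" "0 \<le> u" "u \<le> 1"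
    and Z: "0 < laguerre_integral \<beta> I a" "0 < laguerre_integral \<beta> I b"
  shows "laguerre_integral \<beta> I ((1 - u) * a + u * b) \<le>
    laguerre_integral \<beta> I a powr (1 - u) * laguerre_integral \<beta> I b powr u"
proof -
  let ?Za = "laguerre_integral \<beta> I a" and ?Zb = "laguerre_integral \<beta> I b"
  let ?f = "\<lambda>c. smooth_laguerre \<beta> 0 c I"
  let ?K = "?Za powr (1 - u) * ?Zb powr u"
  have c: "0 < (1 - u) * a + u * b"
  proof (cases "u = 0")
    case False
    then have "0 < u * b" "0 \<le> (1 - u) * a" using assms by auto
    then show ?thesis by linarith
  qed (use assms in simp)
  have K: "?K > 0" using Z by simp
  have pw: "?f ((1 - u) * a + u * b) x \<le> ?K * ((1 - u) * (?f a x / ?Za) + u * (?f b x / ?Zb))" for x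
  proof (cases "?f a x > 0 \<and> ?f b x > 0")
    case True
    have "(?f a x / ?Za) powr (1 - u) * (?f b x / ?Zb) powr u \<le> (1 - u) * (?f a x / ?Za) + u * (?f b x / ?Zb)"
      using True assms by (intro Youngs_inequality_0) auto
    then have "?K * ((?f a x / ?Za) powr (1 - u) * (?f b x / ?Zb) powr u) \<le> ?K * ((1 - u) * (?f a x / ?Za) + u * (?f b x / ?Zb))"
      using K by (intro mult_left_mono) auto
    moreover have "?K * ((?f a x / ?Za) powr (1 - u) * (?f b x / ?Zb) powr u) = ?f a x powr (1 - u) * ?f b x powr u"
      using Z True by (simp add: powr_divide)
    ultimately show ?thesis unfolding smooth_laguerre_geometric_mean[OF assms(1,5,6)] by simp
  next
    case False
    then have "?f a x = 0 \<or> ?f b x = 0"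
      using smooth_laguerre_nonneg[of \<beta> 0 a I x] smooth_laguerre_nonneg[of \<beta> 0 b I x] by linarith
    then have "?f ((1 - u) * a + u * b) x = 0 \<or> u = 0 \<or> u = 1"
      unfolding smooth_laguerre_geometric_mean[OF assms(1,5,6)] by auto
    moreover have "0 \<le> ?K * ((1 - u) * (?f a x / ?Za) + u * (?f b x / ?Zb))"
      using K Z assms smooth_laguerre_nonneg[of \<beta> 0 a I x] smooth_laguerre_nonneg[of \<beta> 0 b I x]
      by (intro mult_nonneg_nonneg add_nonneg_nonneg) auto
    ultimately show ?thesis using Z by auto
  qed
  have int: "integrable (lebesgue_power I) (?f c)" if "c > 0" for c
    using assms that by (intro integrable_smooth_laguerre_0) auto
  have "laguerre_integral \<beta> I ((1 - u) * a + u * b) \<le> (\<integral>x. ?K * ((1 - u) * (?f a x / ?Za) + u * (?f b x / ?Zb)) \<partial>lebesgue_power I)"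
    unfolding laguerre_integral_def[of \<beta> I "(1 - u) * a + u * b"]
    using pw int[OF c] int[OF assms(3)] int[OF assms(4)]
    by (intro integral_mono) auto
  also have "\<dots> = ?K * ((1 - u) * (?Za / ?Za) + u * (?Zb / ?Zb))"
    using int[OF assms(3)] int[OF assms(4)] by (simp add: laguerre_integral_def)
  also have "\<dots> = ?K" using Z by simp
  finally show ?thesis .
qed

text \<open>The Laguerre case of Selberg's integral, with indices starting at 0. The powers of 2
  come from the rate \<open>1 / 2\<close> in the weight; their exponents
  \<open>a + \<beta> * real k\<close> add up to the degree of homogeneity of the integral.\<close>

definition laguerre_selberg :: "real \<Rightarrow> nat \<Rightarrow> real \<Rightarrow> real" where
  "laguerre_selberg \<beta> n a = (\<Prod>k<n. 2 powr (a + \<beta> * real k) * Gamma (a + \<beta> / 2 * real k) *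
     (Gamma (1 + \<beta> / 2 * real (Suc k)) / Gamma (1 + \<beta> / 2)))"

lemma laguerre_selberg_pos: "0 < \<beta> \<Longrightarrow> 0 < a \<Longrightarrow> 0 < laguerre_selberg \<beta> n a"
  unfolding laguerre_selberg_def
  by (intro prod_pos mult_pos_pos divide_pos_pos Gamma_real_pos ballI) (auto intro: add_pos_nonneg)

lemma laguerre_selberg_plus1:
  assumes "0 < \<beta>" "0 < a"
  shows "laguerre_selberg \<beta> n (a + 1) = laguerre_selberg \<beta> n a * (\<Prod>k<n. 2 * (a + \<beta> / 2 * real k))"
  unfolding laguerre_selberg_def prod.distrib[symmetric]
proof (intro prod.cong refl)
  fix k
  have "a + \<beta> / 2 * real k > 0" using assms by (intro add_pos_nonneg) auto
  then have "Gamma (a + 1 + \<beta> / 2 * real k) = (a + \<beta> / 2 * real k) * Gamma (a + \<beta> / 2 * real k)"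
  proof -
    assume pos: "a + \<beta> / 2 * real k > 0"
    then have "a + \<beta> / 2 * real k \<notin> \<int>\<^sub>\<le>\<^sub>0" using nonpos_Ints_nonpos by force
    from Gamma_plus1[OF this] show ?thesis by (simp add: add_ac)
  qed
  moreover have "2 powr (a + 1 + \<beta> * real k) = 2 * 2 powr (a + \<beta> * real k)"
    by (simp add: powr_add)
  ultimately show "2 powr (a + 1 + \<beta> * real k) * Gamma (a + 1 + \<beta> / 2 * real k) *
     (Gamma (1 + \<beta> / 2 * real (Suc k)) / Gamma (1 + \<beta> / 2)) =
     2 powr (a + \<beta> * real k) * Gamma (a + \<beta> / 2 * real k) *
     (Gamma (1 + \<beta> / 2 * real (Suc k)) / Gamma (1 + \<beta> / 2)) * (2 * (a + \<beta> / 2 * real k))"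
    by (simp only: mult_ac)
qed

text \<open>A shift of the index in the Gamma factors. It is the counterpart of
  \<open>laguerre_integral_at_1\<close> and makes both sides agree at shape 1.\<close>

lemma laguerre_selberg_at_1:
  assumes "0 < \<beta>"
  shows "laguerre_selberg \<beta> (Suc n) 1 = 2 * laguerre_selberg \<beta> n (1 + \<beta>)"
proof -
  let ?g = "\<lambda>k. Gamma (1 + \<beta> / 2 * real k)"
  let ?G = "Gamma (1 + \<beta> / 2)"
  have G: "?G \<noteq> 0" "?g k \<noteq> 0" for k
  proof -
    have "0 < ?G" "0 < ?g k" using assms by (intro Gamma_real_pos add_pos_nonneg; simp)+
    then show "?G \<noteq> 0" "?g k \<noteq> 0" by linarith+
  qed
  have "laguerre_selberg \<beta> (Suc n) 1 = (\<Prod>k<Suc n. 2 powr (1 + \<beta> * real k)) * (\<Prod>k<Suc n. ?g k) * (\<Prod>k<Suc n. ?g (Suc k) / ?G)"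
    unfolding laguerre_selberg_def by (simp only: prod.distrib)
  also have "(\<Prod>k<Suc n. 2 powr (1 + \<beta> * real k)) = 2 * (\<Prod>k<n. 2 powr (1 + \<beta> * real (Suc k)))"
    unfolding prod.lessThan_Suc_shift by simp
  also have "(\<Prod>k<Suc n. ?g k) = (\<Prod>k<n. ?g (Suc k))"
    unfolding prod.lessThan_Suc_shift by simp
  also have "(\<Prod>k<Suc n. ?g (Suc k) / ?G) = (\<Prod>k<n. ?g (Suc (Suc k)) / ?G)"
    unfolding prod.lessThan_Suc_shift using G by simp
  finally have 1: "laguerre_selberg \<beta> (Suc n) 1 = 2 * (\<Prod>k<n. 2 powr (1 + \<beta> * real (Suc k)) * ?g (Suc (Suc k)) * (?g (Suc k) / ?G))"
    by (simp add: prod.distrib prod_dividef mult_ac)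
  have "1 + \<beta> * real (Suc k) = 1 + \<beta> + \<beta> * real k" "1 + \<beta> / 2 * real (Suc (Suc k)) = 1 + \<beta> + \<beta> / 2 * real k" for k
    by (simp_all add: field_simps)
  then show ?thesis unfolding 1 unfolding laguerre_selberg_def by (simp only:)
qed

lemma convex_on_eqI:
  assumes "convex_on S f" and "\<And>x. x \<in> S \<Longrightarrow> g x = f x"
  shows "convex_on S g"
  using assms unfolding convex_on_def by (auto simp: convexD)

lemma convex_on_ln_laguerre_selberg:
  assumes "0 < \<beta>"
  shows "convex_on {0<..} (\<lambda>a. ln (laguerre_selberg \<beta> n a))"
proof (induction n)
  case 0
  then show ?case by (simp add: laguerre_selberg_def convex_on_const)
next
  case (Suc n)
  let ?c = "ln (Gamma (1 + \<beta> / 2 * real (Suc n)) / Gamma (1 + \<beta> / 2))"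
  have shift: "convex_on {0<..} (\<lambda>a. ln (Gamma (a + \<beta> / 2 * real n)))"
  proof (rule convex_onI)
    fix t x y :: real assume t: "0 < t" "t < 1" and xy: "x \<in> {0<..}" "y \<in> {0<..}"
    define d where "d = \<beta> / 2 * real n"
    have d: "0 \<le> d" using assms by (simp add: d_def)
    have "(1 - t) * x + t * y + d = (1 - t) * (x + d) + t * (y + d)" by (simp add: algebra_simps)
    then show "ln (Gamma ((1 - t) *\<^sub>R x + t *\<^sub>R y + \<beta> / 2 * real n)) \<le>
        (1 - t) * ln (Gamma (x + \<beta> / 2 * real n)) + t * ln (Gamma (y + \<beta> / 2 * real n))"
      unfolding d_def[symmetric]
      using convex_onD[OF log_convex_Gamma_real, of t "x + d" "y + d"] t xy d by (simp add: add_pos_nonneg)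
  qed simp
  have lin: "convex_on {0<..} (\<lambda>a. (a + \<beta> * real n) * ln 2 + ?c)"
    by (rule convex_onI) (auto simp: algebra_simps)
  have "convex_on {0<..} (\<lambda>a. ln (laguerre_selberg \<beta> n a) + (ln (Gamma (a + \<beta> / 2 * real n)) + ((a + \<beta> * real n) * ln 2 + ?c)))"
    by (intro convex_on_add Suc.IH shift lin)
  moreover have "ln (laguerre_selberg \<beta> (Suc n) a) =
      ln (laguerre_selberg \<beta> n a) + (ln (Gamma (a + \<beta> / 2 * real n)) + ((a + \<beta> * real n) * ln 2 + ?c))"
    if "a \<in> {0<..}" for a
  proof -
    have pos: "0 < laguerre_selberg \<beta> n a" "0 < Gamma (a + \<beta> / 2 * real n)"
       "0 < Gamma (1 + \<beta> / 2 * real (Suc n)) / Gamma (1 + \<beta> / 2)"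
      using that assms by (auto intro!: laguerre_selberg_pos Gamma_real_pos divide_pos_pos add_pos_nonneg)
    have "laguerre_selberg \<beta> (Suc n) a = laguerre_selberg \<beta> n a * (2 powr (a + \<beta> * real n) * Gamma (a + \<beta> / 2 * real n) *
     (Gamma (1 + \<beta> / 2 * real (Suc n)) / Gamma (1 + \<beta> / 2)))"
      by (simp add: laguerre_selberg_def)
    then show ?thesis
      using pos by (simp add: ln_mult_pos ln_powr del: of_nat_Suc times_divide_eq_right times_divide_eq_left)
  qed
  ultimately show ?case by (rule convex_on_eqI)
qed

text \<open>The value at shape 1 comes from one variable fewer at shape \<open>1 + \<beta>\<close>,
  which is why the induction must range over all \<open>a\<close>. The other shapes follow because
  both logarithms are convex and satisfy the same shift relation.\<close>

theorem laguerre_integral_eq_selberg: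
  assumes "0 < \<beta>" "0 < a"
  shows "laguerre_integral \<beta> {1..n} a = laguerre_selberg \<beta> n a"
  using assms(2)
proof (induction n arbitrary: a)
  case 0
  have "laguerre_integral \<beta> {} a = 1"
    by (simp add: laguerre_integral_def PiM_empty smooth_laguerre_def pair_prod_def lebesgue_integral_count_space_finite)
  then show ?case by (simp add: laguerre_selberg_def)
next
  case (Suc n)
  let ?I = "{1..Suc n}"
  have I: "?I = insert (Suc n) {1..n}" by auto
  have one: "laguerre_integral \<beta> ?I 1 = laguerre_selberg \<beta> (Suc n) 1"
    unfolding I using assms(1) Suc.IH[of "1 + \<beta>"]
    by (subst laguerre_integral_at_1) (auto simp: laguerre_selberg_at_1)
  \<comment> \<open>Logarithms require positivity. The zero set of the integrand does not depend on
    the shape, so an integral vanishing at \<open>c\<close> would also vanish at 1, where the value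
    is already known.\<close>
  have pos: "0 < laguerre_integral \<beta> ?I c" if "0 < c" for c
  proof (rule ccontr)
    assume "\<not> 0 < laguerre_integral \<beta> ?I c"
    then have "laguerre_integral \<beta> ?I c = 0" using laguerre_integral_nonneg[of \<beta> ?I c] by linarith
    then have ae: "AE x in lebesgue_power ?I. smooth_laguerre \<beta> 0 c ?I x = 0"
      using assms(1) that unfolding laguerre_integral_def
      by (subst (asm) integral_nonneg_eq_0_iff_AE) (auto intro: integrable_smooth_laguerre_0 smooth_laguerre_nonneg)
    have imp: "smooth_laguerre \<beta> 0 1 ?I x = 0" if "smooth_laguerre \<beta> 0 c ?I x = 0" for x
      using that by (auto simp: smooth_laguerre_def laguerre_weight_def split: if_splits)
    have "AE x in lebesgue_power ?I. smooth_laguerre \<beta> 0 1 ?I x = 0"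
      by (rule eventually_mono[OF ae imp])
    then have "laguerre_integral \<beta> ?I 1 = 0"
      unfolding laguerre_integral_def by (rule integral_eq_zero_AE)
    then show False using one laguerre_selberg_pos[OF assms(1), of 1 "Suc n"] by simp
  qed
  let ?\<rho> = "\<lambda>a. \<Sum>k<Suc n. ln (2 * (a + \<beta> / 2 * real k))"
  have f: "2 * (x + \<beta> / 2 * real k) > 0" if "x > 0" for x k
    using that assms(1) by (intro mult_pos_pos add_pos_nonneg) auto
  have "ln (laguerre_integral \<beta> ?I a) = ln (laguerre_selberg \<beta> (Suc n) a)"
  proof (rule convex_shift_eq[where \<rho> = ?\<rho> and f = "\<lambda>a. ln (laguerre_integral \<beta> ?I a)"
      and g = "\<lambda>a. ln (laguerre_selberg \<beta> (Suc n) a)" and a = a])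
    show "convex_on {0<..} (\<lambda>a. ln (laguerre_selberg \<beta> (Suc n) a))"
      by (rule convex_on_ln_laguerre_selberg[OF assms(1)])
    show "convex_on {0<..} (\<lambda>a. ln (laguerre_integral \<beta> ?I a))"
    proof (rule convex_onI)
      fix t x y :: real assume t: "0 < t" "t < 1" and xy: "x \<in> {0<..}" "y \<in> {0<..}"
      let ?z = "(1 - t) * x + t * y"
      have z: "0 < ?z" using t xy by (intro add_pos_pos) auto
      have "ln (laguerre_integral \<beta> ?I ?z) \<le> ln (laguerre_integral \<beta> ?I x powr (1 - t) * laguerre_integral \<beta> ?I y powr t)"
        using pos[OF z] pos[of x] pos[of y] t xy assms(1)
        by (intro ln_mono laguerre_integral_log_convex) auto
      also have "\<dots> = (1 - t) * ln (laguerre_integral \<beta> ?I x) + t * ln (laguerre_integral \<beta> ?I y)"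
        using pos[of x] pos[of y] xy by (simp add: ln_mult_pos ln_powr)
      finally show "ln (laguerre_integral \<beta> ?I ((1 - t) *\<^sub>R x + t *\<^sub>R y)) \<le>
         (1 - t) * ln (laguerre_integral \<beta> ?I x) + t * ln (laguerre_integral \<beta> ?I y)" by simp
    qed simp
    have lp: "ln (\<Prod>k<Suc n. 2 * (x + \<beta> / 2 * real k)) = ?\<rho> x" if "x > 0" for x
    proof (rule ln_prod)
      show "2 * (x + \<beta> / 2 * real k) \<noteq> 0" for k using f[OF that, of k] by linarith
    qed simp
    have pp: "0 < (\<Prod>k<Suc n. 2 * (x + \<beta> / 2 * real k))" if "x > 0" for x
      using f[OF that] by (intro prod_pos) auto
    show "ln (laguerre_integral \<beta> ?I (x + 1)) = ln (laguerre_integral \<beta> ?I x) + ?\<rho> x" if "x > 0" for x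
    proof -
      have "laguerre_integral \<beta> ?I (x + 1) = laguerre_integral \<beta> ?I x * (\<Prod>k<Suc n. 2 * (x + \<beta> / 2 * real k))"
        using laguerre_integral_plus1[of ?I \<beta> x] that assms(1) by simp
      then show ?thesis unfolding lp[OF that, symmetric] by (simp only: ln_mult_pos[OF pos[OF that] pp[OF that]])
    qed
    show "ln (laguerre_selberg \<beta> (Suc n) (x + 1)) = ln (laguerre_selberg \<beta> (Suc n) x) + ?\<rho> x" if "x > 0" for x
      unfolding lp[OF that, symmetric] laguerre_selberg_plus1[OF assms(1) that]
      by (rule ln_mult_pos[OF laguerre_selberg_pos[OF assms(1) that] pp[OF that]])
    show "(\<lambda>m. ?\<rho> (x + real m + 1) - ?\<rho> (x + real m)) \<longlonglongrightarrow> 0" if "x > 0" for x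
    proof -
      have "(\<lambda>m. \<Sum>k<Suc n. (ln (2 * (x + real m + 1 + \<beta> / 2 * real k)) - ln (2 * (x + real m + \<beta> / 2 * real k)))) \<longlonglongrightarrow> (\<Sum>k<Suc n. 0)"
      proof (intro tendsto_sum)
        fix k
        define c where "c = \<beta> / 2 * real k"
        show "(\<lambda>m. ln (2 * (x + real m + 1 + \<beta> / 2 * real k)) - ln (2 * (x + real m + \<beta> / 2 * real k))) \<longlonglongrightarrow> 0"
          unfolding c_def[symmetric] by real_asymp
      qed
      then show ?thesis by (simp add: sum_subtractf)
    qed
    show "ln (laguerre_integral \<beta> ?I 1) = ln (laguerre_selberg \<beta> (Suc n) 1)" using one by simp
  qed (use Suc.prems in simp)
  then show ?case
    using pos[OF Suc.prems] laguerre_selberg_pos[OF assms(1) Suc.prems, of "Suc n"] by simp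
qed

section \<open>Lower tail of the smallest eigenvalue\<close>

text \<open>The constant is the maximum of \<open>v powr s * exp (- \<rho> * v)\<close>, attained at
  \<open>v = s / \<rho>\<close>. Replacing \<open>v powr s\<close> accordingly in the Gamma integral
  lowers the decay rate to \<open>1 - \<rho>\<close>. The parameter is kept free so that it can
  later be held fixed while \<open>z\<close> and \<open>s\<close> grow.\<close>

lemma Gamma_add_le_tilt:
  fixes z s \<rho> :: real
  assumes "0 < z" "0 < s" "0 < \<rho>" "\<rho> < 1"
  shows "Gamma (z + s) \<le> (s / (exp 1 * \<rho>)) powr s * (1 - \<rho>) powr (- z) * Gamma z"
proof -
  let ?C = "(s / (exp 1 * \<rho>)) powr s"
  have tilt: "v powr s \<le> ?C * exp (\<rho> * v)" if v: "0 < v" for v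
  proof -
    have "ln (\<rho> * v / s) \<le> \<rho> * v / s - 1" using assms v by (intro ln_le_minus_one) auto
    then have "s * ln (\<rho> * v / s) \<le> s * (\<rho> * v / s - 1)" using assms by (intro mult_left_mono) auto
    also have "\<dots> = \<rho> * v - s" using assms by (simp add: field_simps)
    also have "ln (\<rho> * v / s) = ln v - ln (s / \<rho>)" using assms v by (simp add: ln_mult_pos ln_div)
    finally have "s * ln v \<le> s * (ln (s / \<rho>) - 1) + \<rho> * v" by (simp add: algebra_simps)
    also have "ln (s / \<rho>) - 1 = ln (s / (exp 1 * \<rho>))" using assms by (simp add: ln_mult_pos ln_div)
    finally have "exp (s * ln v) \<le> exp (s * ln (s / (exp 1 * \<rho>)) + \<rho> * v)" by simp
    then show ?thesis using v assms by (simp add: powr_def exp_add)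
  qed
  have "ennreal (Gamma (z + s)) = ennreal (Gamma (z + s) / 1 powr (z + s))" by simp
  also have "\<dots> = (\<integral>\<^sup>+v. ennreal (if 0 < v then v powr (z + s - 1) * exp (- 1 * v) else 0) \<partial>lborel)"
    using assms by (subst nn_integral_gamma) auto
  also have "\<dots> \<le> (\<integral>\<^sup>+v. ennreal ?C * ennreal (if 0 < v then v powr (z - 1) * exp (- (1 - \<rho>) * v) else 0) \<partial>lborel)"
  proof (intro nn_integral_mono)
    fix v :: real
    have "v powr (z + s - 1) * exp (- 1 * v) \<le> ?C * (v powr (z - 1) * exp (- (1 - \<rho>) * v))" if v: "0 < v"
    proof -
      have "v powr (z + s - 1) * exp (- 1 * v) = v powr s * (v powr (z - 1) * exp (- v))"
        using v by (simp add: algebra_simps flip: powr_add)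
      also have "\<dots> \<le> (?C * exp (\<rho> * v)) * (v powr (z - 1) * exp (- v))"
        using tilt[OF v] by (intro mult_right_mono) auto
      also have "\<dots> = ?C * (v powr (z - 1) * (exp (\<rho> * v) * exp (- v)))" by (simp add: mult_ac)
      also have "exp (\<rho> * v) * exp (- v) = exp (- (1 - \<rho>) * v)" by (simp add: algebra_simps flip: exp_add)
      finally show ?thesis .
    qed
    then show "ennreal (if 0 < v then v powr (z + s - 1) * exp (- 1 * v) else 0) \<le>
       ennreal ?C * ennreal (if 0 < v then v powr (z - 1) * exp (- (1 - \<rho>) * v) else 0)"
      by (auto simp: ennreal_mult[symmetric] intro!: ennreal_leI)
  qed
  also have "\<dots> = ennreal ?C * ennreal (Gamma z / (1 - \<rho>) powr z)"
    using assms by (subst nn_integral_cmult) (auto simp: nn_integral_gamma[of z "1 - \<rho>", simplified])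
  also have "\<dots> = ennreal (?C * (Gamma z / (1 - \<rho>) powr z))"
    using Gamma_real_pos[OF assms(1)] by (intro ennreal_mult[symmetric]) auto
  finally have "Gamma (z + s) \<le> ?C * (Gamma z / (1 - \<rho>) powr z)"
    using Gamma_real_pos[OF assms(1)] by (subst (asm) ennreal_le_iff) auto
  then show ?thesis by (simp add: powr_minus field_simps)
qed

text \<open>The tilted bound at its optimal parameter, simplified with
  \<open>(1 + s / z) powr z \<le> exp s\<close>.\<close>

lemma Gamma_add_le:
  fixes z s :: real
  assumes "0 < z" "0 < s"
  shows "Gamma (z + s) \<le> (z + s) powr s * Gamma z"
proof -
  \<comment> \<open>Minimises \<open>- s * ln \<rho> - z * ln (1 - \<rho>)\<close>.\<close>
  define \<rho> where "\<rho> = s / (z + s)"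
  have \<rho>: "0 < \<rho>" "\<rho> < 1" using assms by (auto simp: \<rho>_def)
  have "(s / (exp 1 * \<rho>)) powr s * (1 - \<rho>) powr (- z) \<le> (z + s) powr s"
  proof -
    have e1: "s / (exp 1 * \<rho>) = (z + s) / exp 1" using assms by (simp add: \<rho>_def)
    have e2: "1 - \<rho> = inverse (1 + s / z)" using assms by (simp add: \<rho>_def field_simps)
    have "(1 - \<rho>) powr (- z) = (1 + s / z) powr z"
      unfolding e2 using assms by (simp add: powr_minus inverse_powr)
    also have "\<dots> \<le> exp (s / z) powr z" using assms by (intro powr_mono2) auto
    also have "\<dots> = exp s" using assms by (simp add: exp_powr_real)
    finally have "(1 - \<rho>) powr (- z) \<le> exp s" .
    moreover have "((z + s) / exp 1) powr s = (z + s) powr s / exp s"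
      using assms by (simp add: powr_divide exp_powr_real)
    ultimately have "((z + s) / exp 1) powr s * (1 - \<rho>) powr (- z) \<le> (z + s) powr s / exp s * exp s"
      by (simp only:) (intro mult_left_mono, auto)
    then show ?thesis unfolding e1 by simp
  qed
  then have "(s / (exp 1 * \<rho>)) powr s * (1 - \<rho>) powr (- z) * Gamma z \<le> (z + s) powr s * Gamma z"
    using Gamma_real_pos[OF assms(1)] by (intro mult_right_mono) auto
  with Gamma_add_le_tilt[OF assms \<rho>] show ?thesis by linarith
qed

lemma nn_integral_exp_below:
  fixes \<kappa> m :: real
  assumes "\<kappa> > 0"
  shows "(\<integral>\<^sup>+u. ennreal (if u < m then exp (\<kappa> * (u - m)) else 0) \<partial>lborel) = ennreal (1 / \<kappa>)"
proof -
  have "(\<integral>\<^sup>+u. ennreal (if u < m then exp (\<kappa> * (u - m)) else 0) \<partial>lborel) =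
     ennreal \<bar>-1\<bar> * (\<integral>\<^sup>+v. ennreal (if m + (-1) * v < m then exp (\<kappa> * ((m + (-1) * v) - m)) else 0) \<partial>lborel)"
    by (intro nn_integral_real_affine) auto
  also have "\<dots> = (\<integral>\<^sup>+v. ennreal (if 0 < v then v powr (1 - 1) * exp (- \<kappa> * v) else 0) \<partial>lborel)"
    by (auto intro!: nn_integral_cong)
  also have "\<dots> = ennreal (Gamma 1 / \<kappa> powr 1)" using assms by (intro nn_integral_gamma) auto
  finally show ?thesis using assms by simp
qed

text \<open>The integral for \<open>Gamma (y + 1)\<close> is cut to \<open>v > y\<close>, where
  \<open>v powr y\<close> exceeds \<open>y powr y\<close>. Compared with Stirling's formula a factor
  of order \<open>sqrt y\<close> is lost, which does not matter on an exponential scale.\<close>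

lemma Gamma_ge:
  fixes y :: real
  assumes "y > 0"
  shows "y powr (y - 1) * exp (- y) \<le> Gamma y"
proof -
  have "ennreal (y powr y * exp (- y)) = ennreal (y powr y) * (ennreal (exp (- y)) * ennreal (1 / 1))"
    by (simp add: ennreal_mult)
  also have "ennreal (1 / 1) = (\<integral>\<^sup>+u. ennreal (if u < 0 then exp (1 * (u - 0)) else 0) \<partial>lborel)"
    by (intro nn_integral_exp_below[symmetric]) auto
  also have "\<dots> = ennreal \<bar>-1\<bar> * (\<integral>\<^sup>+v. ennreal (if y + (-1) * v < 0 then exp (1 * (y + (-1) * v - 0)) else 0) \<partial>lborel)"
    by (intro nn_integral_real_affine) auto
  also have "\<dots> = (\<integral>\<^sup>+v. ennreal (if y < v then exp (y - v) else 0) \<partial>lborel)"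
    by (simp, intro nn_integral_cong) auto
  also have "ennreal (y powr y) * (ennreal (exp (- y)) * (\<integral>\<^sup>+v. ennreal (if y < v then exp (y - v) else 0) \<partial>lborel)) =
    (\<integral>\<^sup>+v. ennreal (y powr y * (exp (- y) * (if y < v then exp (y - v) else 0))) \<partial>lborel)"
    by (simp add: nn_integral_cmult[symmetric] ennreal_mult)
  also have "\<dots> \<le> (\<integral>\<^sup>+v. ennreal (if 0 < v then v powr (y + 1 - 1) * exp (- 1 * v) else 0) \<partial>lborel)"
  proof (intro nn_integral_mono ennreal_leI)
    fix v :: real
    have "y powr y * (exp (- y) * exp (y - v)) \<le> v powr y * exp (- v)" if "y < v"
      using that assms by (simp flip: exp_add add: powr_mono2)
    then show "y powr y * (exp (- y) * (if y < v then exp (y - v) else 0)) \<le> (if 0 < v then v powr (y + 1 - 1) * exp (- 1 * v) else 0)"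
      using assms by auto
  qed
  also have "\<dots> = ennreal (Gamma (y + 1) / 1 powr (y + 1))"
    using assms by (intro nn_integral_gamma) auto
  finally have "y powr y * exp (- y) \<le> Gamma (y + 1)"
    using assms Gamma_real_pos[of "y + 1"] by (subst (asm) ennreal_le_iff) auto
  also have "Gamma (y + 1) = y * Gamma y"
  proof -
    have "y \<notin> \<int>\<^sub>\<le>\<^sub>0" using assms nonpos_Ints_nonpos by force
    then show ?thesis by (rule Gamma_plus1)
  qed
  finally show ?thesis using assms by (simp add: powr_diff field_simps)
qed

text \<open>A Chernoff bound: for \<open>u \<le> t \<le> 2 * a\<close> the rate \<open>1 / 2\<close>
  may be raised to \<open>a / t\<close> at the price \<open>exp (a - t / 2)\<close>, and the
  integral is then extended to the half-line. With rate \<open>a / t\<close> the Gamma distribution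
  of shape \<open>a\<close> has mean \<open>t\<close>.\<close>

lemma nn_integral_laguerre_weight_below:
  assumes "0 < t" "t \<le> 2 * a"
  shows "(\<integral>\<^sup>+u. ennreal (if u \<le> t then laguerre_weight a u else 0) \<partial>lborel) \<le> ennreal (Gamma a * (t / a) powr a * exp (a - t / 2))"
proof -
  have a: "a > 0" using assms by simp
  have "(\<integral>\<^sup>+u. ennreal (if u \<le> t then laguerre_weight a u else 0) \<partial>lborel) \<le>
    (\<integral>\<^sup>+u. ennreal (exp (a - t / 2)) * ennreal (if 0 < u then u powr (a - 1) * exp (- (a / t) * u) else 0) \<partial>lborel)"
  proof (intro nn_integral_mono)
    fix u
    have "u powr (a - 1) * exp (- u / 2) \<le> exp (a - t / 2) * (u powr (a - 1) * exp (- (a / t) * u))" if u: "u \<le> t"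
    proof -
      have "0 \<le> (a / t - 1 / 2) * (t - u)" using assms u by (intro mult_nonneg_nonneg) (auto simp: field_simps)
      also have "\<dots> = (a - t / 2 + (- (a / t) * u)) - (- u / 2)" using assms by (simp add: field_simps)
      finally have "exp (- u / 2) \<le> exp (a - t / 2 + (- (a / t) * u))" by simp
      then have "u powr (a - 1) * exp (- u / 2) \<le> u powr (a - 1) * (exp (a - t / 2) * exp (- (a / t) * u))"
        unfolding exp_add by (intro mult_left_mono) auto
      then show ?thesis by (simp add: mult_ac)
    qed
    then show "ennreal (if u \<le> t then laguerre_weight a u else 0) \<le>
      ennreal (exp (a - t / 2)) * ennreal (if 0 < u then u powr (a - 1) * exp (- (a / t) * u) else 0)"
      by (auto simp: laguerre_weight_def ennreal_mult[symmetric] intro!: ennreal_leI)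
  qed
  also have "\<dots> = ennreal (exp (a - t / 2)) * ennreal (Gamma a / (a / t) powr a)"
    using assms a by (subst nn_integral_cmult) (auto simp: nn_integral_gamma[of a "a / t", simplified])
  also have "\<dots> = ennreal (Gamma a * (t / a) powr a * exp (a - t / 2))"
    using assms a Gamma_real_pos[OF a] by (simp add: ennreal_mult[symmetric] powr_divide field_simps)
  finally show ?thesis .
qed

text \<open>Shape \<open>a + \<beta>\<close> with \<open>m\<close> variables has its Gamma factors
  at \<open>a + \<beta> / 2 * k\<close> for \<open>k\<close> from 2 to \<open>m + 1\<close>, shape
  \<open>a\<close> with \<open>m + 1\<close> variables for \<open>k\<close> from 0 to
  \<open>m\<close>; only three of them survive in the quotient. The cross-multiplied form keeps
  divisions out of the induction.\<close>

lemma laguerre_selberg_ratio: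
  assumes "0 < \<beta>" "0 < a"
  shows "real (Suc m) * laguerre_selberg \<beta> m (a + \<beta>) *
      (2 powr a * Gamma (\<beta> / 2 * real (Suc m)) * (Gamma a * Gamma (a + \<beta> / 2))) =
     laguerre_selberg \<beta> (Suc m) a * (Gamma (\<beta> / 2) * Gamma (a + \<beta> / 2 * real (Suc m)))"
proof (induction m)
  case 0
  have "1 + \<beta> / 2 > 0" using assms by linarith
  from Gamma_real_pos[OF this] have "Gamma (1 + \<beta> / 2) \<noteq> 0" by simp
  then show ?case by (simp add: laguerre_selberg_def)
next
  case (Suc m)
  define G where "G = Gamma (1 + \<beta> / 2)"
  define g where "g k = Gamma (\<beta> / 2 * real k)" for k
  define h where "h k = Gamma (a + \<beta> / 2 * real k)" for k
  have pos: "G > 0" "g (Suc k) > 0" for k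
    unfolding G_def g_def using assms by (auto intro!: Gamma_real_pos)
  have c: "Gamma (1 + \<beta> / 2 * real (Suc k)) = \<beta> / 2 * real (Suc k) * g (Suc k)" for k
  proof -
    have "\<beta> / 2 * real (Suc k) > 0" using assms by simp
    then have "\<beta> / 2 * real (Suc k) \<notin> \<int>\<^sub>\<le>\<^sub>0" using nonpos_Ints_nonpos by force
    from Gamma_plus1[OF this] show ?thesis by (simp only: g_def add.commute)
  qed
  have s1: "laguerre_selberg \<beta> (Suc m) (a + \<beta>) = laguerre_selberg \<beta> m (a + \<beta>) *
      (2 powr (a + \<beta> * real (Suc m)) * h (Suc (Suc m)) * (\<beta> / 2 * real (Suc m) * g (Suc m) / G))"
  proof -
    have "a + \<beta> + \<beta> * real m = a + \<beta> * real (Suc m)" "a + \<beta> + \<beta> / 2 * real m = a + \<beta> / 2 * real (Suc (Suc m))"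
      by (simp_all add: field_simps)
    then show ?thesis unfolding laguerre_selberg_def prod.lessThan_Suc c h_def G_def by (simp only:)
  qed
  have s2: "laguerre_selberg \<beta> (Suc (Suc m)) a = laguerre_selberg \<beta> (Suc m) a *
      (2 powr (a + \<beta> * real (Suc m)) * h (Suc m) * (\<beta> / 2 * real (Suc (Suc m)) * g (Suc (Suc m)) / G))"
    unfolding laguerre_selberg_def prod.lessThan_Suc c h_def G_def by (simp only:)
  define X where "X = laguerre_selberg \<beta> m (a + \<beta>)"
  define Y where "Y = laguerre_selberg \<beta> (Suc m) a"
  define T where "T = (2::real) powr (a + \<beta> * real (Suc m))"
  define D where "D = Gamma a * Gamma (a + \<beta> / 2)"
  define M where "M = real (Suc m)"
  define M' where "M' = real (Suc (Suc m))"
  have IH: "M * X * (2 powr a * g (Suc m) * D) = Y * (Gamma (\<beta> / 2) * h (Suc m))"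
    using Suc.IH by (simp only: X_def Y_def D_def M_def g_def h_def)
  have "M' * (X * (T * h (Suc (Suc m)) * (\<beta> / 2 * M * g (Suc m) / G))) * (2 powr a * g (Suc (Suc m)) * D) =
     (M * X * (2 powr a * g (Suc m) * D)) * (T * h (Suc (Suc m)) * (\<beta> / 2 * M' * g (Suc (Suc m)) / G))"
    by simp
  also have "\<dots> = (Y * (T * h (Suc m) * (\<beta> / 2 * M' * g (Suc (Suc m)) / G))) * (Gamma (\<beta> / 2) * h (Suc (Suc m)))"
    unfolding IH by simp
  finally show ?case
    unfolding s1 s2 by (simp only: X_def Y_def D_def M_def M'_def T_def g_def h_def)
qed

section \<open>Tail bound for the smallest coordinate\<close>

lemma pred_le_const:
  fixes f :: "_ \<Rightarrow> real"
  assumes [measurable]: "f \<in> borel_measurable M"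
  shows "Measurable.pred M (\<lambda>x. f x \<le> c)"
  by measurable

text \<open>If \<open>u > 0\<close> is the minimum, then
  \<open>\<bar>x j - u\<bar> \<le> x j\<close>. This decouples the minimum from the other
  coordinates, whose interaction with it turns into a shift of their shape by \<beta>.\<close>

lemma nn_integral_laguerre_min_le:
  assumes "0 < \<beta>" "0 < a"
  shows "(\<integral>\<^sup>+x. ennreal (smooth_laguerre \<beta> 0 a {1..Suc m} x) * (if \<exists>i\<in>{1..Suc m}. x i \<le> t then 1 else 0)
      \<partial>lebesgue_power {1..Suc m}) \<le>
    ennreal (real (Suc m) * laguerre_selberg \<beta> m (a + \<beta>)) * (\<integral>\<^sup>+u. ennreal (if u \<le> t then laguerre_weight a u else 0) \<partial>lborel)"
proof -
  let ?k = "Suc m" and ?I = "{1..m}"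
  let ?K = "insert ?k ?I"
  have K: "{1..Suc m} = ?K" by auto
  note [simp del] = One_nat_def
  have W_meas: "(\<lambda>u. ennreal (if u \<le> t then laguerre_weight a u else 0)) \<in> borel_measurable lborel"
    by measurable
  let ?F = "\<lambda>x. ennreal (smooth_laguerre \<beta> 0 a ?K x) * (if \<exists>i\<in>?K. x i \<le> t then 1 else 0)"
  let ?G = "\<lambda>x. ?F x * (if \<forall>j\<in>?I. x ?k < x j then 1 else 0)"
  have pred[measurable]: "(\<lambda>x. \<forall>j\<in>?I. x ?k < x j) \<in> measurable (lebesgue_power ?K) (count_space UNIV)"
    by (intro pred_intros_finite(3) borel_measurable_pred_less measurable_coord) auto
  have pred2[measurable]: "(\<lambda>x. \<exists>i\<in>?K. x i \<le> t) \<in> measurable (lebesgue_power ?K) (count_space UNIV)"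
    by (intro pred_intros_finite(4)) (auto intro!: pred_le_const measurable_coord)
  have F: "?F \<in> borel_measurable (lebesgue_power ?K)" by measurable
  have G: "?G \<in> borel_measurable (lebesgue_power ?K)" by measurable
  have sym: "symmetric_on ?K ?F"
    unfolding symmetric_on_def
  proof (intro ballI allI)
    fix i j and x :: "nat \<Rightarrow> real" assume ij: "i \<in> ?K" "j \<in> ?K"
    have e1: "ennreal (smooth_laguerre \<beta> 0 a ?K (swap_coords i j x)) = ennreal (smooth_laguerre \<beta> 0 a ?K x)"
      by (rule symmetric_onD[OF symmetric_on_smooth_laguerre ij])
    have e2: "(\<exists>l\<in>?K. swap_coords i j x l \<le> t) \<longleftrightarrow> (\<exists>l\<in>?K. x l \<le> t)"
    proof -
      have "swap_coords i j x ` ?K = x ` ?K"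
        unfolding swap_coords_eq_comp
        using bij_betw_transpose_on[OF ij] by (simp only: image_image[symmetric] bij_betw_def)
      then have "(\<exists>z\<in>swap_coords i j x ` ?K. z \<le> t) \<longleftrightarrow> (\<exists>z\<in>x ` ?K. z \<le> t)" by (simp only:)
      then show ?thesis by (simp only: Set.bex_simps(7))
    qed
    show "?F (swap_coords i j x) = ?F x" by (simp only: e1 e2)
  qed
  have ties: "zero_on_ties ?K ?F"
    unfolding zero_on_ties_def
  proof (intro allI ballI impI)
    fix x :: "nat \<Rightarrow> real" and i j assume "i \<in> ?K" "j \<in> ?K" "i \<noteq> j" "x i = x j"
    then have "smooth_laguerre \<beta> 0 a ?K x = 0" by (intro smooth_laguerre_tie[of _ i j]) auto
    then show "?F x = 0" by (simp only: ennreal_0 mult_zero_left)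
  qed
  have inner: "(\<integral>\<^sup>+x. ?G (x(?k := u)) \<partial>lebesgue_power ?I) \<le>
      ennreal (if u \<le> t then laguerre_weight a u else 0) * ennreal (laguerre_selberg \<beta> m (a + \<beta>))" for u
  proof -
    have "(\<integral>\<^sup>+x. ?G (x(?k := u)) \<partial>lebesgue_power ?I) \<le>
      (\<integral>\<^sup>+x. ennreal (if u \<le> t then laguerre_weight a u else 0) * ennreal (smooth_laguerre \<beta> 0 (a + \<beta>) ?I x) \<partial>lebesgue_power ?I)"
    proof (intro nn_integral_mono)
      fix x :: "nat \<Rightarrow> real"
      define z where "z = x(?k := u)"
      have z: "z ?k = u" "\<And>i. i \<in> ?I \<Longrightarrow> z i = x i" by (auto simp: z_def)
      have "?G z \<le> ennreal (if u \<le> t then laguerre_weight a u else 0) * ennreal (smooth_laguerre \<beta> 0 (a + \<beta>) ?I x)"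
      proof (cases "0 < u \<and> (\<forall>j\<in>?I. z ?k < z j) \<and> (\<exists>i\<in>?K. z i \<le> t)")
        case True
        then have u: "0 < u" and lt: "\<And>j. j \<in> ?I \<Longrightarrow> u < x j" and ut: "u \<le> t"
          using z by (auto intro: less_imp_le less_le_trans)
        have "smooth_laguerre \<beta> 0 a ?K z = (\<Prod>j\<in>?I. \<bar>z j - u\<bar> powr \<beta>) * laguerre_weight a u * smooth_laguerre \<beta> 0 a ?I z"
          by (subst smooth_laguerre_insert) (auto simp: z(1))
        also have "smooth_laguerre \<beta> 0 a ?I z = smooth_laguerre \<beta> 0 a ?I x"
          by (rule smooth_laguerre_cong) (rule z(2))
        also have "(\<Prod>j\<in>?I. \<bar>z j - u\<bar> powr \<beta>) * laguerre_weight a u * smooth_laguerre \<beta> 0 a ?I x \<le>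
          (\<Prod>j\<in>?I. \<bar>x j\<bar> powr \<beta>) * laguerre_weight a u * smooth_laguerre \<beta> 0 a ?I x"
        proof (intro mult_right_mono prod_mono conjI powr_mono2)
          fix j assume j: "j \<in> ?I"
          show "\<bar>z j - u\<bar> \<le> \<bar>x j\<bar>" using lt[OF j] u z(2)[OF j] by simp
        qed (use assms smooth_laguerre_nonneg in auto)
        also have "\<dots> = laguerre_weight a u * ((\<Prod>j\<in>?I. \<bar>x j\<bar> powr \<beta>) * smooth_laguerre \<beta> 0 a ?I x)"
          by (simp only: mult_ac)
        also have "(\<Prod>j\<in>?I. \<bar>x j\<bar> powr \<beta>) * smooth_laguerre \<beta> 0 a ?I x = smooth_laguerre \<beta> 0 (a + \<beta>) ?I x"
          by (intro prod_powr_smooth_laguerre) simp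
        finally have le: "smooth_laguerre \<beta> 0 a ?K z \<le> laguerre_weight a u * smooth_laguerre \<beta> 0 (a + \<beta>) ?I x" .
        have A: "\<forall>j\<in>?I. z ?k < z j" and E: "\<exists>i\<in>?K. z i \<le> t" using True by blast+
        have "?G z = ennreal (smooth_laguerre \<beta> 0 a ?K z)" by (simp only: if_P[OF A] if_P[OF E] mult_1_right)
        also have "\<dots> \<le> ennreal (laguerre_weight a u * smooth_laguerre \<beta> 0 (a + \<beta>) ?I x)"
          using le by (rule ennreal_leI)
        also have "\<dots> = ennreal (if u \<le> t then laguerre_weight a u else 0) * ennreal (smooth_laguerre \<beta> 0 (a + \<beta>) ?I x)"
          unfolding if_P[OF ut] by (intro ennreal_mult smooth_laguerre_nonneg) simp
        finally show ?thesis .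
      next
        case False
        then consider "\<not> 0 < u" | "\<not> (\<forall>j\<in>?I. z ?k < z j)" | "\<not> (\<exists>i\<in>?K. z i \<le> t)" by blast
        then have "?G z = 0"
        proof cases
          case 1
          then have "smooth_laguerre \<beta> 0 a ?K z = 0"
            using z(1) by (intro smooth_laguerre_eq_0) auto
          then show ?thesis by (simp only: ennreal_0 mult_zero_left)
        next
          case 2
          then show ?thesis by (simp only: if_not_P if_False mult_zero_right)
        next
          case 3
          then show ?thesis by (simp only: if_not_P if_False mult_zero_left mult_zero_right)
        qed
        then show ?thesis by (simp only: zero_le)
      qed
      then show "?G (x(?k := u)) \<le> ennreal (if u \<le> t then laguerre_weight a u else 0) * ennreal (smooth_laguerre \<beta> 0 (a + \<beta>) ?I x)"
        by (simp only: z_def)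
    qed
    also have "\<dots> = ennreal (if u \<le> t then laguerre_weight a u else 0) * ennreal (laguerre_selberg \<beta> m (a + \<beta>))"
      using assms laguerre_integral_eq_selberg[of \<beta> "a + \<beta>" m]
      by (subst nn_integral_cmult) (auto simp: nn_integral_smooth_laguerre)
    finally show ?thesis .
  qed
  let ?W = "\<integral>\<^sup>+u. ennreal (if u \<le> t then laguerre_weight a u else 0) \<partial>lborel"
  have "(\<integral>\<^sup>+x. ?G x \<partial>lebesgue_power ?K) = (\<integral>\<^sup>+u. (\<integral>\<^sup>+x. ?G (x(?k := u)) \<partial>lebesgue_power ?I) \<partial>lborel)"
    using G by (intro lborel_prod.product_nn_integral_insert_rev) auto
  also have "\<dots> \<le> (\<integral>\<^sup>+u. ennreal (if u \<le> t then laguerre_weight a u else 0) * ennreal (laguerre_selberg \<beta> m (a + \<beta>)) \<partial>lborel)"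
    using inner by (intro nn_integral_mono)
  also have "\<dots> = ?W * ennreal (laguerre_selberg \<beta> m (a + \<beta>))"
    by (rule nn_integral_multc[OF W_meas])
  finally have G_le: "(\<integral>\<^sup>+x. ?G x \<partial>lebesgue_power ?K) \<le> ?W * ennreal (laguerre_selberg \<beta> m (a + \<beta>))" .
  have "(\<integral>\<^sup>+x. ?F x \<partial>lebesgue_power ?K) = of_nat (Suc (card ?I)) * (\<integral>\<^sup>+x. ?G x \<partial>lebesgue_power ?K)"
    using F sym ties by (intro nn_integral_peel_min) auto
  also have "of_nat (Suc (card ?I)) = ennreal (real (Suc m))"
    unfolding ennreal_of_nat_eq_real_of_nat by simp
  also have "ennreal (real (Suc m)) * (\<integral>\<^sup>+x. ?G x \<partial>lebesgue_power ?K) \<le> ennreal (real (Suc m)) * (?W * ennreal (laguerre_selberg \<beta> m (a + \<beta>)))"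
    using G_le by (rule mult_left_mono) simp
  also have "\<dots> = (ennreal (real (Suc m)) * ennreal (laguerre_selberg \<beta> m (a + \<beta>))) * ?W"
    by (simp only: mult_ac)
  also have "ennreal (real (Suc m)) * ennreal (laguerre_selberg \<beta> m (a + \<beta>)) = ennreal (real (Suc m) * laguerre_selberg \<beta> m (a + \<beta>))"
    using laguerre_selberg_pos[of \<beta> "a + \<beta>" m] assms by (intro ennreal_mult[symmetric]) auto
  finally show ?thesis unfolding K .
qed

text \<open>Logarithm of the tail bound; \<open>\<rho>\<close> is a free tilting parameter.\<close>

definition tail_exponent :: "real \<Rightarrow> real \<Rightarrow> nat \<Rightarrow> real \<Rightarrow> real \<Rightarrow> real" where
  "tail_exponent \<beta> \<rho> n a t = a * (ln (t / (2 * a)) + 1 - t / (2 * a)) + ln (Gamma (\<beta> / 2)) +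
     (1 - \<beta> / 2) * ln (\<beta> / 2 * real n) + \<beta> / 2 - \<beta> / 2 * real (n - 1) * ln \<rho> - (a + \<beta> / 2) * ln (1 - \<rho>)"

text \<open>The decay comes from \<open>a * (ln r + 1 - r)\<close> with
  \<open>r = t / (2 * a)\<close>, the Chernoff exponent of the one-point weight. The rest of the
  exponent bounds \<open>Gamma (a + y) / (Gamma y * Gamma (a + \<beta> / 2))\<close>, which behaves
  like a binomial coefficient, with the tilt parameter in the role of a success probability.\<close>

lemma laguerre_min_tail:
  assumes "0 < \<beta>" "0 < a" "0 < t" "t \<le> 2 * a" "2 \<le> n" "0 < \<rho>" "\<rho> < 1"
  shows "(\<integral>\<^sup>+x. ennreal (smooth_laguerre \<beta> 0 a {1..n} x) * (if \<exists>i\<in>{1..n}. x i \<le> t then 1 else 0) \<partial>lebesgue_power {1..n})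
    \<le> ennreal (laguerre_selberg \<beta> n a * exp (tail_exponent \<beta> \<rho> n a t))"
proof -
  define m where "m = n - 1"
  have n: "n = Suc m" "m \<ge> 1" using assms by (auto simp: m_def)
  define y where "y = \<beta> / 2 * real (Suc m)"
  define y' where "y' = \<beta> / 2 * real m"
  have y: "0 < y'" "0 < y" "y = y' + \<beta> / 2" using assms n by (simp_all add: y_def y'_def distrib_left add_divide_distrib del: of_nat_Suc) (simp_all add: field_simps)
  then have y'_le: "y' \<le> y" using assms by simp
  define S where "S = laguerre_selberg \<beta> n a"
  have S: "S > 0" unfolding S_def using assms by (intro laguerre_selberg_pos)
  define g where "g = Gamma (\<beta> / 2)"
  define h where "h = Gamma (a + \<beta> / 2)"
  define ga where "ga = Gamma a"
  have gp: "g > 0" "h > 0" "ga > 0" "Gamma y > 0" unfolding g_def h_def ga_def using assms y by (auto intro!: Gamma_real_pos)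
  have ratio: "real (Suc m) * laguerre_selberg \<beta> m (a + \<beta>) = S * (g * Gamma (a + y)) / (2 powr a * Gamma y * (ga * h))"
  proof -
    have "real (Suc m) * laguerre_selberg \<beta> m (a + \<beta>) * (2 powr a * Gamma y * (ga * h)) = S * (g * Gamma (a + y))"
      using laguerre_selberg_ratio[OF assms(1,2), of m] by (simp only: S_def n y_def g_def h_def ga_def)
    moreover have "2 powr a * Gamma y * (ga * h) \<noteq> 0" using gp by simp
    ultimately show ?thesis by (rule eq_divide_imp[rotated])
  qed
  have "Gamma (a + y) \<le> (y' / (exp 1 * \<rho>)) powr y' * (1 - \<rho>) powr (- (a + \<beta> / 2)) * h"
    using Gamma_add_le_tilt[of "a + \<beta> / 2" y' \<rho>] assms y unfolding h_def y(3) by (simp add: add_ac)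
  \<comment> \<open>The base is enlarged from \<open>y'\<close> to \<open>y\<close>, so that after
    division by the lower bound for \<open>Gamma y\<close> only
    \<open>(1 - \<beta> / 2) * ln y\<close> is left of the logarithms of \<open>y\<close>.\<close>
  also have "\<dots> \<le> (y / (exp 1 * \<rho>)) powr y' * (1 - \<rho>) powr (- (a + \<beta> / 2)) * h"
    using y y'_le assms gp by (intro mult_right_mono powr_mono2 divide_right_mono) auto
  finally have G1: "Gamma (a + y) \<le> (y / (exp 1 * \<rho>)) powr y' * (1 - \<rho>) powr (- (a + \<beta> / 2)) * h" .
  have G2: "y powr (y - 1) * exp (- y) \<le> Gamma y" by (rule Gamma_ge[OF y(2)])
  have q: "Gamma (a + y) / (Gamma y * h) \<le> exp ((1 - \<beta> / 2) * ln y + \<beta> / 2 - y' * ln \<rho> - (a + \<beta> / 2) * ln (1 - \<rho>))"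
  proof -
    have "Gamma (a + y) / (Gamma y * h) \<le> ((y / (exp 1 * \<rho>)) powr y' * (1 - \<rho>) powr (- (a + \<beta> / 2)) * h) / ((y powr (y - 1) * exp (- y)) * h)"
      using G1 G2 gp y assms by (intro frac_le mult_right_mono mult_pos_pos) auto
    also have "\<dots> = ((y / (exp 1 * \<rho>)) powr y' * (1 - \<rho>) powr (- (a + \<beta> / 2))) / (y powr (y - 1) * exp (- y))"
      using gp by simp
    also have "\<dots> = exp ((y' * (ln y - 1 - ln \<rho>) - (a + \<beta> / 2) * ln (1 - \<rho>)) - ((y - 1) * ln y - y))"
    proof -
      have e1: "(y / (exp 1 * \<rho>)) powr y' = exp (y' * (ln y - 1 - ln \<rho>))"
        using y assms by (simp add: powr_def ln_div ln_mult_pos algebra_simps)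
      have e2: "(1 - \<rho>) powr (- (a + \<beta> / 2)) = exp (- ((a + \<beta> / 2) * ln (1 - \<rho>)))"
        using assms by (simp add: powr_def algebra_simps)
      have e3: "y powr (y - 1) * exp (- y) = exp ((y - 1) * ln y - y)"
        using y by (simp add: powr_def flip: exp_add)
      show ?thesis unfolding e1 e2 e3 by (simp only: exp_add[symmetric] exp_diff[symmetric] diff_conv_add_uminus)
    qed
    also have "(y' * (ln y - 1 - ln \<rho>) - (a + \<beta> / 2) * ln (1 - \<rho>)) - ((y - 1) * ln y - y) =
      (1 - \<beta> / 2) * ln y + \<beta> / 2 - y' * ln \<rho> - (a + \<beta> / 2) * ln (1 - \<rho>)"
      unfolding y(3) by (simp add: algebra_simps)
    finally show ?thesis .
  qed
  have "real (Suc m) * laguerre_selberg \<beta> m (a + \<beta>) * (ga * (t / a) powr a * exp (a - t / 2)) =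
     S * (((t / a) powr a / 2 powr a * exp (a - t / 2)) * (g * (Gamma (a + y) / (Gamma y * h))))"
  proof -
    have "S * (g * P) / (V * Q * (ga * h)) * (ga * U * E) = S * ((U / V * E) * (g * (P / (Q * h))))" for P Q U V E
      using gp by simp
    then show ?thesis unfolding ratio .
  qed
  also have "(t / a) powr a / 2 powr a * exp (a - t / 2) = exp (a * (ln (t / (2 * a)) + 1 - t / (2 * a)))"
  proof -
    have "(t / a) powr a = exp (a * ln (t / a))" using assms unfolding powr_def by simp
    also have "ln (t / a) = ln t - ln a" using assms by (simp add: ln_div)
    finally have e1: "(t / a) powr a = exp (a * (ln t - ln a))" "(2::real) powr a = exp (a * ln 2)"
      unfolding powr_def by simp_all
    have "a * (t / (2 * a)) = t / 2" using assms by simp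
    moreover have "ln (t / (2 * a)) = ln t - (ln 2 + ln a)" using assms by (simp add: ln_div ln_mult_pos)
    ultimately have "a * (ln (t / (2 * a)) + 1 - t / (2 * a)) = a * (ln t - ln a) - a * ln 2 + (a - t / 2)"
      by (simp only: right_diff_distrib distrib_left)
    then show ?thesis unfolding e1 by (simp only: exp_add exp_diff)
  qed
  also have "S * (exp (a * (ln (t / (2 * a)) + 1 - t / (2 * a))) * (g * (Gamma (a + y) / (Gamma y * h)))) \<le>
     S * (exp (a * (ln (t / (2 * a)) + 1 - t / (2 * a))) * (g * exp ((1 - \<beta> / 2) * ln y + \<beta> / 2 - y' * ln \<rho> - (a + \<beta> / 2) * ln (1 - \<rho>))))"
    using q S gp by (intro mult_left_mono) auto
  also have "\<dots> = S * exp (tail_exponent \<beta> \<rho> n a t)"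
  proof -
    have "g = exp (ln g)" using gp by simp
    then have "exp (a * (ln (t / (2 * a)) + 1 - t / (2 * a))) * (g * exp ((1 - \<beta> / 2) * ln y + \<beta> / 2 - y' * ln \<rho> - (a + \<beta> / 2) * ln (1 - \<rho>))) =
      exp (a * (ln (t / (2 * a)) + 1 - t / (2 * a)) + (ln g + ((1 - \<beta> / 2) * ln y + \<beta> / 2 - y' * ln \<rho> - (a + \<beta> / 2) * ln (1 - \<rho>))))"
      by (simp only: exp_add)
    also have "a * (ln (t / (2 * a)) + 1 - t / (2 * a)) + (ln g + ((1 - \<beta> / 2) * ln y + \<beta> / 2 - y' * ln \<rho> - (a + \<beta> / 2) * ln (1 - \<rho>))) =
      tail_exponent \<beta> \<rho> n a t"
      unfolding tail_exponent_def g_def y_def y'_def n(1) by simp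
    finally show ?thesis by simp
  qed
  finally have bound: "real (Suc m) * laguerre_selberg \<beta> m (a + \<beta>) * (ga * (t / a) powr a * exp (a - t / 2)) \<le> S * exp (tail_exponent \<beta> \<rho> n a t)" .
  have "(\<integral>\<^sup>+x. ennreal (smooth_laguerre \<beta> 0 a {1..n} x) * (if \<exists>i\<in>{1..n}. x i \<le> t then 1 else 0) \<partial>lebesgue_power {1..n}) \<le>
     ennreal (real (Suc m) * laguerre_selberg \<beta> m (a + \<beta>)) * (\<integral>\<^sup>+u. ennreal (if u \<le> t then laguerre_weight a u else 0) \<partial>lborel)"
    unfolding n(1) using assms by (intro nn_integral_laguerre_min_le) auto
  also have "\<dots> \<le> ennreal (real (Suc m) * laguerre_selberg \<beta> m (a + \<beta>)) * ennreal (ga * (t / a) powr a * exp (a - t / 2))"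
    unfolding ga_def using assms by (intro mult_left_mono nn_integral_laguerre_weight_below) auto
  also have "\<dots> = ennreal (real (Suc m) * laguerre_selberg \<beta> m (a + \<beta>) * (ga * (t / a) powr a * exp (a - t / 2)))"
    using laguerre_selberg_pos[of \<beta> "a + \<beta>" m] assms gp by (intro ennreal_mult[symmetric] mult_nonneg_nonneg) auto
  also have "\<dots> \<le> ennreal (S * exp (tail_exponent \<beta> \<rho> n a t))" using bound by (rule ennreal_leI)
  finally show ?thesis unfolding S_def .
qed

text \<open>Every variable costs at most one power of the largest argument. The bound is later
  divided by a power of \<open>t' - t\<close> with a matching exponent and a base of the same order
  \<open>p\<close>, so the logarithms of \<open>p\<close> cancel and only an exponent of order
  \<open>n\<close> remains.\<close>

lemma laguerre_selberg_shift_le: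
  assumes "0 < \<beta>" "0 < a" "0 < s"
  shows "laguerre_selberg \<beta> n (a + s) \<le> laguerre_selberg \<beta> n a * (2 * (a + s + \<beta> / 2 * real n)) powr (s * real n)"
proof (induction n)
  case 0
  then show ?case using assms by (simp add: laguerre_selberg_def)
next
  case (Suc n)
  let ?c = "Gamma (1 + \<beta> / 2 * real (Suc n)) / Gamma (1 + \<beta> / 2)"
  let ?B = "\<lambda>n. 2 * (a + s + \<beta> / 2 * real n)"
  have d: "laguerre_selberg \<beta> (Suc n) c = laguerre_selberg \<beta> n c * (2 powr (c + \<beta> * real n) * Gamma (c + \<beta> / 2 * real n) * ?c)" for c
    by (simp add: laguerre_selberg_def)
  have c: "0 < ?c" using assms by (intro divide_pos_pos Gamma_real_pos add_pos_nonneg) auto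
  have pos: "0 < a + \<beta> / 2 * real n" using assms by (intro add_pos_nonneg) auto
  have B: "0 < ?B k" for k using assms by (intro mult_pos_pos add_pos_nonneg) auto
  have "2 powr (a + s + \<beta> * real n) * Gamma (a + s + \<beta> / 2 * real n) * ?c \<le>
    (2 powr (a + \<beta> * real n) * Gamma (a + \<beta> / 2 * real n) * ?c) * ?B n powr s"
  proof -
    have "Gamma (a + s + \<beta> / 2 * real n) \<le> (a + s + \<beta> / 2 * real n) powr s * Gamma (a + \<beta> / 2 * real n)"
      using Gamma_add_le[OF pos assms(3)] by (simp add: add_ac)
    then have "2 powr (a + s + \<beta> * real n) * Gamma (a + s + \<beta> / 2 * real n) * ?c \<le>
      2 powr (a + s + \<beta> * real n) * ((a + s + \<beta> / 2 * real n) powr s * Gamma (a + \<beta> / 2 * real n)) * ?c"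
      using c by (intro mult_right_mono mult_left_mono) auto
    also have "\<dots> = (2 powr (a + \<beta> * real n) * Gamma (a + \<beta> / 2 * real n) * ?c) * (2 powr s * (a + s + \<beta> / 2 * real n) powr s)"
    proof -
      have "2 powr (a + s + \<beta> * real n) = 2 powr (a + \<beta> * real n) * 2 powr s"
        by (simp add: algebra_simps flip: powr_add)
      then show ?thesis by (simp only: mult_ac)
    qed
    also have "2 powr s * (a + s + \<beta> / 2 * real n) powr s = ?B n powr s"
      by (rule powr_mult[symmetric])
    finally show ?thesis .
  qed
  \<comment> \<open>All factors are raised to the largest base, so that the powers can be merged
    into one.\<close>
  also have "\<dots> \<le> (2 powr (a + \<beta> * real n) * Gamma (a + \<beta> / 2 * real n) * ?c) * ?B (Suc n) powr s"
  proof (rule mult_left_mono)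
    show "?B n powr s \<le> ?B (Suc n) powr s" using assms B[of n] by (intro powr_mono2) auto
    show "0 \<le> 2 powr (a + \<beta> * real n) * Gamma (a + \<beta> / 2 * real n) * ?c"
      by (intro mult_nonneg_nonneg powr_ge_zero less_imp_le[OF c] less_imp_le[OF Gamma_real_pos[OF pos]])
  qed
  finally have step: "2 powr (a + s + \<beta> * real n) * Gamma (a + s + \<beta> / 2 * real n) * ?c \<le>
    (2 powr (a + \<beta> * real n) * Gamma (a + \<beta> / 2 * real n) * ?c) * ?B (Suc n) powr s" .
  have Sp: "0 < laguerre_selberg \<beta> n a" "0 < laguerre_selberg \<beta> n (a + s)" using assms by (auto intro!: laguerre_selberg_pos)
  have nonneg: "0 \<le> 2 powr (a + s + \<beta> * real n) * Gamma (a + s + \<beta> / 2 * real n) * ?c"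
    using c Gamma_real_pos[of "a + s + \<beta> / 2 * real n"] assms by (intro mult_nonneg_nonneg) (auto simp: add_pos_nonneg less_imp_le)
  have "laguerre_selberg \<beta> n (a + s) \<le> laguerre_selberg \<beta> n a * ?B (Suc n) powr (s * real n)"
  proof -
    have "?B n powr (s * real n) \<le> ?B (Suc n) powr (s * real n)" using assms B[of n] by (intro powr_mono2) auto
    then have "laguerre_selberg \<beta> n a * ?B n powr (s * real n) \<le> laguerre_selberg \<beta> n a * ?B (Suc n) powr (s * real n)"
      using Sp by (intro mult_left_mono) auto
    with Suc.IH show ?thesis by linarith
  qed
  then have "laguerre_selberg \<beta> (Suc n) (a + s) \<le> (laguerre_selberg \<beta> n a * ?B (Suc n) powr (s * real n)) *
     ((2 powr (a + \<beta> * real n) * Gamma (a + \<beta> / 2 * real n) * ?c) * ?B (Suc n) powr s)"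
    unfolding d[of "a + s"]
    by (rule mult_mono[OF _ step _ nonneg]) (simp add: Sp less_imp_le)
  also have "\<dots> = laguerre_selberg \<beta> (Suc n) a * (?B (Suc n) powr (s * real n) * ?B (Suc n) powr s)"
    unfolding d[of a] by (simp only: mult_ac)
  also have "?B (Suc n) powr (s * real n) * ?B (Suc n) powr s = ?B (Suc n) powr (s * real (Suc n))"
    by (simp add: algebra_simps flip: powr_add)
  finally show ?case .
qed

section \<open>Concentration above the threshold\<close>

abbreviation decreasing_upto :: "nat \<Rightarrow> (nat \<Rightarrow> real) \<Rightarrow> bool" where
  "decreasing_upto n x \<equiv> \<forall>i\<in>{1..<n}. x i > x (Suc i)"

lemma decreasing_upto_less:
  assumes d: "decreasing_upto n x" and i: "1 \<le> i"
  shows "i < j \<Longrightarrow> j \<le> n \<Longrightarrow> x j < x i"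
proof (induction j)
  case (Suc j)
  have step: "x (Suc j) < x j" using bspec[OF d, of j] Suc.prems i by simp
  show ?case
  proof (cases "i = j")
    case False
    then have "x j < x i" using Suc.prems by (intro Suc.IH) auto
    with step show ?thesis by linarith
  qed (use step in simp)
qed simp

text \<open>For two decreasing listings, corresponding gaps have the same sign, so the
  arithmetic-geometric mean inequality applies gap by gap. Without the common order the Vandermonde
  product would not be log-concave.\<close>

lemma pair_prod_midpoint:
  assumes "0 < \<beta>" and x: "decreasing_upto n x" and y: "decreasing_upto n y"
    and m: "\<And>i. i \<in> {1..n} \<Longrightarrow> m i = (x i + y i) / 2"
  shows "pair_prod (smooth_gap \<beta> 0) {1..n} x * pair_prod (smooth_gap \<beta> 0) {1..n} y
    \<le> (pair_prod (smooth_gap \<beta> 0) {1..n} m)\<^sup>2"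
proof -
  have gap: "smooth_gap \<beta> 0 u * smooth_gap \<beta> 0 v \<le> (smooth_gap \<beta> 0 ((u + v) / 2))\<^sup>2"
    if "0 \<le> u * v" for u v
  proof -
    have "\<bar>u\<bar> * \<bar>v\<bar> = u * v" using that by (simp flip: abs_mult)
    also have "\<dots> \<le> ((u + v) / 2)\<^sup>2" using sum_squares_bound[of u v] by (simp add: power2_eq_square algebra_simps)
    also have "\<dots> = \<bar>(u + v) / 2\<bar> * \<bar>(u + v) / 2\<bar>" by (simp add: power2_eq_square)
    finally have "(\<bar>u\<bar> * \<bar>v\<bar>) powr (\<beta> / 2) \<le> (\<bar>(u + v) / 2\<bar> * \<bar>(u + v) / 2\<bar>) powr (\<beta> / 2)"
      using assms(1) by (intro powr_mono2) auto
    then show ?thesis by (simp only: smooth_gap_0 powr_mult power2_eq_square)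
  qed
  have "pair_prod (smooth_gap \<beta> 0) {1..n} x * pair_prod (smooth_gap \<beta> 0) {1..n} y =
    (\<Prod>i\<in>{1..n}. \<Prod>j\<in>{1..n} - {i}. smooth_gap \<beta> 0 (x i - x j) * smooth_gap \<beta> 0 (y i - y j))"
    unfolding pair_prod_def by (simp only: prod.distrib)
  also have "\<dots> \<le> (\<Prod>i\<in>{1..n}. \<Prod>j\<in>{1..n} - {i}. (smooth_gap \<beta> 0 (m i - m j))\<^sup>2)"
  proof (intro prod_mono conjI prod_nonneg mult_nonneg_nonneg smooth_gap_nonneg ballI)
    fix i j assume i: "i \<in> {1..n}" and j: "j \<in> {1..n} - {i}"
    have "0 \<le> (x i - x j) * (y i - y j)"
    proof (cases "i < j")
      case True
      then have "x j < x i" "y j < y i" using i j by (auto intro!: decreasing_upto_less[OF x] decreasing_upto_less[OF y])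
      then show ?thesis by simp
    next
      case False
      then have "x i < x j" "y i < y j" using i j by (auto intro!: decreasing_upto_less[OF x] decreasing_upto_less[OF y])
      then show ?thesis by (intro mult_nonpos_nonpos) auto
    qed
    from gap[OF this] show "smooth_gap \<beta> 0 (x i - x j) * smooth_gap \<beta> 0 (y i - y j) \<le> (smooth_gap \<beta> 0 (m i - m j))\<^sup>2"
      using m[OF i] m[of j] j by (simp add: algebra_simps diff_divide_distrib add_divide_distrib)
  qed
  also have "\<dots> = (pair_prod (smooth_gap \<beta> 0) {1..n} m)\<^sup>2"
    unfolding pair_prod_def by (simp only: prod_power_distrib)
  finally show ?thesis .
qed

text \<open>
  Strict log-concavity of the one-point weight: with \<open>x, y = m (1 \<plusminus> s)\<close> the loss \<open>- (a - 1) s\<^sup>2\<close> pays for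
  the gain \<open>2 \<beta> \<kappa> \<bar>s\<bar>\<close> of the linear statistic, up to \<open>\<beta>\<^sup>2 \<kappa>\<^sup>2 / (a - 1)\<close>.
\<close>

lemma laguerre_weight_midpoint:
  fixes \<beta> a t t' x y :: real
  assumes "0 < \<beta>" "1 < a" "0 < t" "t < t'" "t' < x" "t' < y"
  defines "m \<equiv> (x + y) / 2" and "\<kappa> \<equiv> t' / (t' - t)"
  shows "(laguerre_weight a x * (x - t) powr (2 * \<beta>)) * laguerre_weight a y \<le>
    exp (\<beta>\<^sup>2 * \<kappa>\<^sup>2 / (a - 1)) * (laguerre_weight a m * (m - t) powr \<beta>)\<^sup>2"
proof -
  note asm = assms(1-6)
  define s where "s = (x - m) / m"
  have m: "t' < m" "0 < m" using asm by (simp_all add: m_def)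
  have sm: "s * m = x - m" using m by (simp add: s_def)
  have x: "x = m * (1 + s)" using sm by (simp add: algebra_simps)
  have "y = 2 * m - x" unfolding m_def by (simp add: field_simps)
  then have y: "y = m * (1 - s)" using sm by (simp add: algebra_simps)
  have "0 < m * (1 + s)" "0 < m * (1 - s)" unfolding x[symmetric] y[symmetric] using asm by auto
  then have s: "0 < 1 + s" "0 < 1 - s" using m by (auto simp: zero_less_mult_iff)
  have "ln x + ln y = 2 * ln m + (ln (1 + s) + ln (1 - s))"
    unfolding x y using m s by (simp add: ln_mult_pos)
  also have "ln (1 + s) + ln (1 - s) = ln ((1 + s) * (1 - s))" using s by (simp add: ln_mult_pos)
  also have "\<dots> \<le> (1 + s) * (1 - s) - 1" using s by (intro ln_le_minus_one mult_pos_pos)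
  also have "\<dots> = - s\<^sup>2" by (simp add: power2_eq_square algebra_simps)
  finally have l1: "ln x + ln y \<le> 2 * ln m - s\<^sup>2" by simp
  \<comment> \<open>\<open>m / (m - t)\<close> decreases in \<open>m\<close>, and
    \<open>m > t'\<close>; its value at \<open>t'\<close> is \<kappa>.\<close>
  have k: "m / (m - t) \<le> \<kappa>" "0 < m / (m - t)" unfolding \<kappa>_def
  proof -
    have "t' * t \<le> m * t" using asm m by (intro mult_right_mono) auto
    then have "m * (t' - t) \<le> t' * (m - t)" by (simp add: algebra_simps)
    then show "m / (m - t) \<le> t' / (t' - t)" using asm m by (simp add: divide_le_eq le_divide_eq mult.commute)
  qed (use asm m in auto)
  have xt: "x - t = (m - t) * (1 + s * (m / (m - t)))"
    using m asm sm by (simp add: field_simps)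
  have "0 < (m - t) * (1 + s * (m / (m - t)))" unfolding xt[symmetric] using asm by simp
  then have p: "0 < 1 + s * (m / (m - t))" using m asm by (simp add: zero_less_mult_iff)
  have "ln (x - t) = ln (m - t) + ln (1 + s * (m / (m - t)))"
    unfolding xt using p m asm by (simp add: ln_mult_pos)
  also have "ln (1 + s * (m / (m - t))) \<le> s * (m / (m - t))" using ln_le_minus_one[OF p] by simp
  also have "s * (m / (m - t)) \<le> \<bar>s\<bar> * \<kappa>" using k by (intro mult_mono) auto
  finally have l2: "ln (x - t) \<le> ln (m - t) + \<bar>s\<bar> * \<kappa>" by simp
  \<comment> \<open>Completing the square in \<open>\<bar>s\<bar>\<close>, with the maximum at
    \<open>\<bar>s\<bar> = \<beta> * \<kappa> / (a - 1)\<close>.\<close>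
  have l3: "- (a - 1) * s\<^sup>2 + 2 * \<beta> * (\<bar>s\<bar> * \<kappa>) \<le> \<beta>\<^sup>2 * \<kappa>\<^sup>2 / (a - 1)"
  proof -
    have "0 \<le> ((a - 1) * \<bar>s\<bar> - \<beta> * \<kappa>)\<^sup>2" by simp
    then have "(- (a - 1) * s\<^sup>2 + 2 * \<beta> * (\<bar>s\<bar> * \<kappa>)) * (a - 1) \<le> \<beta>\<^sup>2 * \<kappa>\<^sup>2"
      by (simp add: power2_diff power_mult_distrib power2_eq_square algebra_simps)
    then show ?thesis using asm by (simp add: le_divide_eq)
  qed
  have w: "laguerre_weight a z = exp ((a - 1) * ln z - z / 2)" if "0 < z" for z
    using that by (simp add: laguerre_weight_def powr_def flip: exp_add)
  have "(laguerre_weight a x * (x - t) powr (2 * \<beta>)) * laguerre_weight a y =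
    exp ((a - 1) * (ln x + ln y) - m + 2 * \<beta> * ln (x - t))"
  proof -
    have "(laguerre_weight a x * (x - t) powr (2 * \<beta>)) * laguerre_weight a y =
      exp (((a - 1) * ln x - x / 2) + 2 * \<beta> * ln (x - t) + ((a - 1) * ln y - y / 2))"
      using asm by (simp only: exp_add) (simp add: w powr_def)
    also have "((a - 1) * ln x - x / 2) + 2 * \<beta> * ln (x - t) + ((a - 1) * ln y - y / 2) =
      (a - 1) * (ln x + ln y) - (x / 2 + y / 2) + 2 * \<beta> * ln (x - t)"
      by (simp only: distrib_left)
    also have "x / 2 + y / 2 = m" by (simp add: m_def add_divide_distrib)
    finally show ?thesis .
  qed
  also have "\<dots> \<le> exp (\<beta>\<^sup>2 * \<kappa>\<^sup>2 / (a - 1) + (2 * (a - 1) * ln m - m + 2 * \<beta> * ln (m - t)))"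
  proof -
    have "(a - 1) * (ln x + ln y) \<le> (a - 1) * (2 * ln m - s\<^sup>2)" using l1 asm by (intro mult_left_mono) auto
    moreover have "2 * \<beta> * ln (x - t) \<le> 2 * \<beta> * (ln (m - t) + \<bar>s\<bar> * \<kappa>)" using l2 asm by (intro mult_left_mono) auto
    ultimately show ?thesis using l3 by (simp add: algebra_simps)
  qed
  also have "\<dots> = exp (\<beta>\<^sup>2 * \<kappa>\<^sup>2 / (a - 1)) * (laguerre_weight a m * (m - t) powr \<beta>)\<^sup>2"
  proof -
    have "laguerre_weight a m * (m - t) powr \<beta> = exp (((a - 1) * ln m - m / 2) + \<beta> * ln (m - t))"
      using m asm by (simp only: exp_add) (simp add: w powr_def)
    then have "(laguerre_weight a m * (m - t) powr \<beta>)\<^sup>2 =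
        exp ((((a - 1) * ln m - m / 2) + \<beta> * ln (m - t)) + (((a - 1) * ln m - m / 2) + \<beta> * ln (m - t)))"
      by (simp only: power2_eq_square exp_add)
    also have "(((a - 1) * ln m - m / 2) + \<beta> * ln (m - t)) + (((a - 1) * ln m - m / 2) + \<beta> * ln (m - t)) =
        2 * (a - 1) * ln m - m + 2 * \<beta> * ln (m - t)"
      by (simp add: field_simps)
    finally show ?thesis by (simp only: exp_add)
  qed
  finally show ?thesis .
qed

definition good_weight :: "real \<Rightarrow> real \<Rightarrow> nat \<Rightarrow> real \<Rightarrow> (nat \<Rightarrow> real) \<Rightarrow> real" where
  "good_weight \<beta> a n t' x =
    (if decreasing_upto n x \<and> (\<forall>i\<in>{1..n}. t' < x i) then smooth_laguerre \<beta> 0 a {1..n} x else 0)"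

lemma good_weight_nonneg: "0 \<le> good_weight \<beta> a n t' x"
  by (simp add: good_weight_def smooth_laguerre_nonneg)

lemma pred_decreasing_upto: "{1..n} \<subseteq> I \<Longrightarrow> Measurable.pred (lebesgue_power I) (decreasing_upto n)"
  by (intro pred_intros_finite(3) borel_measurable_pred_less measurable_coord) auto

lemma pred_all_greater: "J \<subseteq> I \<Longrightarrow> finite J \<Longrightarrow> Measurable.pred (lebesgue_power I) (\<lambda>x. \<forall>i\<in>J. c < x i)"
  by (intro pred_intros_finite(3) borel_measurable_pred_less measurable_coord) auto

lemma borel_measurable_good_weight: "good_weight \<beta> a n t' \<in> borel_measurable (lebesgue_power {1..n})"
  unfolding good_weight_def
  by (intro measurable_If borel_measurable_smooth_laguerre borel_measurable_const pred_intros_logic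
      pred_decreasing_upto pred_all_greater) auto

lemma borel_measurable_prod_powr:
  "J \<subseteq> I \<Longrightarrow> (\<lambda>x. \<Prod>i\<in>J. (x i - t) powr c) \<in> borel_measurable (lebesgue_power I)"
  by (intro borel_measurable_prod powr_real_measurable borel_measurable_diff measurable_coord borel_measurable_const) auto

text \<open>Prekopa--Leindler with \<open>f\<close> the weight times the squared product,
  \<open>g\<close> the bare weight and \<open>h\<close> the weight times the product. The good part
  of the chamber is convex, the Vandermonde factors are handled by
  \<open>pair_prod_midpoint\<close>, and each coordinate costs \<open>exp c\<close>.\<close>

lemma good_second_moment:
  fixes n :: nat
  assumes "0 < \<beta>" "1 < a" "0 < t" "t < t'"
  defines "c \<equiv> \<beta>\<^sup>2 * (t' / (t' - t))\<^sup>2 / (a - 1)"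
  shows "(\<integral>\<^sup>+x. ennreal (good_weight \<beta> a n t' x * (\<Prod>i\<in>{1..n}. (x i - t) powr (2 * \<beta>))) \<partial>lebesgue_power {1..n}) *
     (\<integral>\<^sup>+x. ennreal (good_weight \<beta> a n t' x) \<partial>lebesgue_power {1..n}) \<le>
     ennreal (exp (real n * c)) *
     (\<integral>\<^sup>+x. ennreal (good_weight \<beta> a n t' x * (\<Prod>i\<in>{1..n}. (x i - t) powr \<beta>)) \<partial>lebesgue_power {1..n})\<^sup>2"
proof -
  let ?I = "{1..n}"
  let ?w = "good_weight \<beta> a n t'"
  let ?f = "\<lambda>x. ?w x * (\<Prod>i\<in>?I. (x i - t) powr (2 * \<beta>))"
  let ?h = "\<lambda>x. ?w x * (\<Prod>i\<in>?I. (x i - t) powr \<beta>)"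
  \<comment> \<open>Half of the exponent, because \<open>h\<close> enters squared.\<close>
  let ?e = "exp (real n * c / 2)"
  have h0: "0 \<le> ?h x" for x by (intro mult_nonneg_nonneg good_weight_nonneg prod_nonneg) auto
  have mf: "?f \<in> borel_measurable (lebesgue_power ?I)" and mh: "?h \<in> borel_measurable (lebesgue_power ?I)"
    by (intro borel_measurable_times borel_measurable_good_weight borel_measurable_prod_powr order_refl)+
  have "(\<integral>\<^sup>+x. ennreal (?f x) \<partial>lebesgue_power ?I) * (\<integral>\<^sup>+x. ennreal (?w x) \<partial>lebesgue_power ?I) \<le>
    (\<integral>\<^sup>+x. ennreal (?e * ?h x) \<partial>lebesgue_power ?I)\<^sup>2"
  proof (rule prekopa_leindler)
    fix x y :: "nat \<Rightarrow> real"
    define m where "m = (\<lambda>i\<in>?I. (x i + y i) / 2)"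
    have m: "m i = (x i + y i) / 2" if "i \<in> ?I" for i using that by (simp add: m_def)
    have "?f x * ?w y \<le> (?e * ?h m)\<^sup>2"
    proof (cases "(decreasing_upto n x \<and> (\<forall>i\<in>?I. t' < x i)) \<and> (decreasing_upto n y \<and> (\<forall>i\<in>?I. t' < y i))")
      case True
      have dm: "decreasing_upto n m"
      proof
        fix i assume i: "i \<in> {1..<n}"
        then have "x (Suc i) < x i" "y (Suc i) < y i" using True by blast+
        then show "m (Suc i) < m i" using m[of i] m[of "Suc i"] i by simp
      qed
      have gm: "t' < m i" if "i \<in> ?I" for i
        using True that m[OF that] by (auto dest!: bspec[of _ _ i])
      let ?V = "pair_prod (smooth_gap \<beta> 0) ?I"
      let ?l = "laguerre_weight a"
      have V0: "0 \<le> ?V z" for z by (rule pair_prod_nonneg) simp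
      have "?f x * ?w y = (?V x * ?V y) * (\<Prod>i\<in>?I. (?l (x i) * (x i - t) powr (2 * \<beta>)) * ?l (y i))"
        using True by (simp add: good_weight_def smooth_laguerre_def prod.distrib mult_ac)
      also have "\<dots> \<le> (?V m)\<^sup>2 * (\<Prod>i\<in>?I. exp c * (?l (m i) * (m i - t) powr \<beta>)\<^sup>2)"
      proof (rule mult_mono)
        show "?V x * ?V y \<le> (?V m)\<^sup>2"
          using True m by (intro pair_prod_midpoint[OF assms(1)]) blast+
        show "(\<Prod>i\<in>?I. (?l (x i) * (x i - t) powr (2 * \<beta>)) * ?l (y i)) \<le> (\<Prod>i\<in>?I. exp c * (?l (m i) * (m i - t) powr \<beta>)\<^sup>2)"
        proof (intro prod_mono conjI)
          fix i assume i: "i \<in> ?I"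
          then have "t' < x i" "t' < y i" using True by blast+
          then show "(?l (x i) * (x i - t) powr (2 * \<beta>)) * ?l (y i) \<le> exp c * (?l (m i) * (m i - t) powr \<beta>)\<^sup>2"
            unfolding m[OF i] c_def by (intro laguerre_weight_midpoint[OF assms(1-4)])
        qed simp
      qed (auto intro!: prod_nonneg)
      also have "\<dots> = (?e * ?h m)\<^sup>2"
      proof -
        have "exp c ^ n = ?e\<^sup>2" by (simp add: power2_eq_square flip: exp_of_nat_mult exp_add)
        then show ?thesis
          using dm gm by (simp add: good_weight_def smooth_laguerre_def prod.distrib prod_power_distrib power_mult_distrib mult_ac)
      qed
      finally show ?thesis .
    next
      case False
      then have "?f x * ?w y = 0" unfolding good_weight_def by auto
      then show ?thesis by (simp only: zero_le_power2)
    qed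
    then have "ennreal (?f x * ?w y) \<le> ennreal ((?e * ?h m)\<^sup>2)" by (rule ennreal_leI)
    also have "ennreal ((?e * ?h m)\<^sup>2) = (ennreal (?e * ?h m))\<^sup>2"
      by (rule ennreal_power[symmetric], rule mult_nonneg_nonneg[OF exp_ge_zero h0])
    also have "ennreal (?f x * ?w y) = ennreal (?f x) * ennreal (?w y)"
      by (intro ennreal_mult mult_nonneg_nonneg good_weight_nonneg prod_nonneg) auto
    finally show "ennreal (?f x) * ennreal (?w y) \<le> (ennreal (?e * ?h (\<lambda>i\<in>?I. (x i + y i) / 2)))\<^sup>2"
      unfolding m_def .
  qed (use mf mh borel_measurable_good_weight in auto)
  also have "(\<integral>\<^sup>+x. ennreal (?e * ?h x) \<partial>lebesgue_power ?I) = ennreal ?e * (\<integral>\<^sup>+x. ennreal (?h x) \<partial>lebesgue_power ?I)"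
    using h0 mh by (subst nn_integral_cmult[symmetric]) (auto simp: ennreal_mult)
  also have "(ennreal ?e * (\<integral>\<^sup>+x. ennreal (?h x) \<partial>lebesgue_power ?I))\<^sup>2 = ennreal (exp (real n * c)) * (\<integral>\<^sup>+x. ennreal (?h x) \<partial>lebesgue_power ?I)\<^sup>2"
  proof -
    have "(ennreal ?e)\<^sup>2 = ennreal (?e\<^sup>2)" by (rule ennreal_power) simp
    also have "?e\<^sup>2 = exp (real n * c)" by (simp add: power2_eq_square flip: exp_add)
    finally have "(ennreal ?e)\<^sup>2 = ennreal (exp (real n * c))" .
    then show ?thesis by (simp only: power_mult_distrib)
  qed
  finally show ?thesis .
qed

text \<open>In terms of the shape \<open>a\<close>, the exponent \<open>\<beta> * n * p / 2\<close>
  of 2 is \<open>n * a + \<beta> * n * (n - 1) / 2\<close>, the sum of the exponents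
  \<open>a + \<beta> * k\<close> in the closed form.\<close>

lemma laguerre_const_eq:
  assumes "0 < \<beta>" "real n - 1 < p"
  shows "laguerre_const n p \<beta> = 1 / laguerre_selberg \<beta> n (\<beta> * (p - real n + 1) / 2)"
proof -
  define a where "a = \<beta> * (p - real n + 1) / 2"
  have pw: "(\<Prod>k<m. 2 powr (a + \<beta> * real k)) = 2 powr (real m * a + \<beta> * (real m * (real m - 1) / 2))" for m
  proof (induction m)
    case (Suc m)
    have "real m * a + \<beta> * (real m * (real m - 1) / 2) + (a + \<beta> * real m) = real (Suc m) * a + \<beta> * (real (Suc m) * (real (Suc m) - 1) / 2)"
      by (simp add: field_simps)
    then show ?case using Suc by (simp only: prod.lessThan_Suc powr_add[symmetric])
  qed simp
  have "\<beta> * real n * p / 2 = real n * a + \<beta> * (real n * (real n - 1) / 2)"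
    by (simp add: a_def field_simps)
  then have p2: "2 powr (- (\<beta> * real n * p / 2)) = 1 / (\<Prod>k<n. 2 powr (a + \<beta> * real k))"
    unfolding pw by (simp only: powr_minus_divide)
  let ?G = "Gamma (1 + \<beta> / 2)"
  have "(\<Prod>j = 1..n. ?G / (Gamma (1 + \<beta> / 2 * real j) * Gamma (\<beta> / 2 * (p - real n + real j)))) =
    (\<Prod>k<n. ?G / (Gamma (1 + \<beta> / 2 * real (Suc k)) * Gamma (\<beta> / 2 * (p - real n + real (Suc k)))))"
    unfolding One_nat_def by (rule prod.atLeast1_atMost_eq)
  also have "\<dots> = (\<Prod>k<n. 1 / (Gamma (a + \<beta> / 2 * real k) * (Gamma (1 + \<beta> / 2 * real (Suc k)) / ?G)))"
  proof (intro prod.cong refl)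
    fix k
    have e: "\<beta> / 2 * (p - real n + real (Suc k)) = a + \<beta> / 2 * real k" by (simp add: a_def field_simps)
    have "g / (h * f) = 1 / (f * (h / g))" for f g h :: real by simp
    then show "?G / (Gamma (1 + \<beta> / 2 * real (Suc k)) * Gamma (\<beta> / 2 * (p - real n + real (Suc k)))) =
      1 / (Gamma (a + \<beta> / 2 * real k) * (Gamma (1 + \<beta> / 2 * real (Suc k)) / ?G))"
      unfolding e .
  qed
  finally have p3: "(\<Prod>j = 1..n. ?G / (Gamma (1 + \<beta> / 2 * real j) * Gamma (\<beta> / 2 * (p - real n + real j)))) =
    (\<Prod>k<n. 1 / (Gamma (a + \<beta> / 2 * real k) * (Gamma (1 + \<beta> / 2 * real (Suc k)) / ?G)))" .
  have "1 / (\<Prod>k<n. A k) * (\<Prod>k<n. 1 / (B k * C k)) = 1 / (\<Prod>k<n. A k * B k * C k)" for A B C :: "nat \<Rightarrow> real"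
    by (simp add: prod.distrib prod_dividef mult.assoc)
  then show ?thesis
    unfolding laguerre_const_def p2 p3 laguerre_selberg_def a_def[symmetric] .
qed

lemma laguerre_density_eq:
  assumes "0 < \<beta>" "real n - 1 < p"
  defines "a \<equiv> \<beta> * (p - real n + 1) / 2"
  shows "laguerre_density n p \<beta> x = smooth_laguerre \<beta> 0 a {1..n} x / laguerre_selberg \<beta> n a"
proof -
  have const: "laguerre_const n p \<beta> = 1 / laguerre_selberg \<beta> n a"
    unfolding a_def by (rule laguerre_const_eq[OF assms(1,2)])
  \<comment> \<open>Ordered pairs with half of the exponent agree with the pairs
    \<open>i < j\<close> with the full exponent.\<close>
  have vdm: "pair_prod (smooth_gap \<beta> 0) {1..m} x = (\<Prod>j = 1..m. \<Prod>i = 1..<j. \<bar>x i - x j\<bar> powr \<beta>)" for m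
  proof (induction m)
    case 0
    show ?case by (simp add: pair_prod_def)
  next
    case (Suc m)
    have I: "{1..Suc m} = insert (Suc m) {1..m}" by auto
    have "smooth_gap \<beta> 0 (x k - x j) * smooth_gap \<beta> 0 (x j - x k) = \<bar>x j - x k\<bar> powr \<beta>" for j k
      using smooth_gap_0_sym_square[of \<beta> "x j - x k"] by (simp add: mult.commute)
    then have "pair_prod (smooth_gap \<beta> 0) {1..Suc m} x = (\<Prod>j\<in>{1..m}. \<bar>x j - x (Suc m)\<bar> powr \<beta>) * pair_prod (smooth_gap \<beta> 0) {1..m} x"
      unfolding I by (subst pair_prod_insert) auto
    also have "(\<Prod>j\<in>{1..m}. \<bar>x j - x (Suc m)\<bar> powr \<beta>) = (\<Prod>i = 1..<Suc m. \<bar>x i - x (Suc m)\<bar> powr \<beta>)"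
      by (intro prod.cong) auto
    finally show ?case using Suc by (simp add: mult.commute)
  qed
  show ?thesis
  proof (cases "\<forall>i\<in>{1..n}. 0 < x i")
    case True
    have "(\<Prod>i = 1..n. laguerre_weight a (x i)) = (\<Prod>i = 1..n. x i powr (a - 1) * exp (- x i / 2))"
      using True by (intro prod.cong) (auto simp: laguerre_weight_def)
    also have "\<dots> = (\<Prod>i = 1..n. x i powr (a - 1)) * exp (\<Sum>i = 1..n. - x i / 2)"
      by (simp add: prod.distrib exp_sum)
    also have "(\<Sum>i = 1..n. - x i / 2) = - (1 / 2) * (\<Sum>i = 1..n. x i)"
      by (simp add: sum_distrib_left sum_negf)
    finally have w: "(\<Prod>i = 1..n. laguerre_weight a (x i)) = (\<Prod>i = 1..n. x i powr (a - 1)) * exp (- (1 / 2) * (\<Sum>i = 1..n. x i))" .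
    show ?thesis
      unfolding laguerre_density_def const if_P[OF True] smooth_laguerre_def vdm w a_def[symmetric] by simp
  next
    case False
    then show ?thesis unfolding laguerre_density_def if_not_P[OF False] using smooth_laguerre_eq_0[OF _ False] by simp
  qed
qed

section \<open>The ordered ensemble and the sampling measure\<close>

lemma image_swap_coords: "i \<in> I \<Longrightarrow> j \<in> I \<Longrightarrow> swap_coords i j x ` I = x ` I"
  unfolding swap_coords_eq_comp
  using bij_betw_transpose_on[of i I j] by (simp only: image_image[symmetric] bij_betw_def)

lemma symmetric_on_image: "symmetric_on I (\<lambda>x. f (x ` I))"
  unfolding symmetric_on_def by (intro ballI allI) (simp only: image_swap_coords)

lemma symmetric_on_smooth_laguerre_real: "symmetric_on I (smooth_laguerre \<beta> \<epsilon> a I)"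
  unfolding symmetric_on_def smooth_laguerre_def
  by (auto simp only: pair_prod_swap_coords prod_swap_coords[where f = "laguerre_weight a"])

lemma symmetric_on_prod: "symmetric_on I (\<lambda>x. \<Prod>i\<in>I. f (x i))"
  unfolding symmetric_on_def by (auto simp only: prod_swap_coords)

lemma symmetric_on_comb2:
  "symmetric_on I F \<Longrightarrow> symmetric_on I H \<Longrightarrow> symmetric_on I (\<lambda>x. g (F x) (H x))"
  unfolding symmetric_on_def by (intro ballI allI arg_cong2[where f = g]) blast+

lemma ennreal_fact: "ennreal (fact n) = fact n"
  by (metis ennreal_of_nat_eq_real_of_nat of_nat_fact)

text \<open>Under the sampling measure the density of the first \<open>n - 1\<close> coordinates is
  read as a function of all \<open>n\<close> coordinates; restriction to \<open>J\<close> transfers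
  measurability.\<close>

lemma borel_measurable_smooth_laguerre_subset:
  assumes "J \<subseteq> I"
  shows "smooth_laguerre \<beta> \<epsilon> a J \<in> borel_measurable (lebesgue_power I)"
proof -
  have "(\<lambda>x. smooth_laguerre \<beta> \<epsilon> a J (restrict x J)) \<in> borel_measurable (lebesgue_power I)"
    using assms by (intro measurable_compose[OF measurable_restrict_subset borel_measurable_smooth_laguerre])
  also have "(\<lambda>x. smooth_laguerre \<beta> \<epsilon> a J (restrict x J)) = smooth_laguerre \<beta> \<epsilon> a J"
    by (intro ext smooth_laguerre_cong) simp
  finally show ?thesis .
qed

lemma ordered_laguerre_density_eq:
  assumes "0 < \<beta>" "real n - 1 < p"
  shows "ordered_laguerre_density n p \<beta> x = (if decreasing_upto n x then
     fact n * (smooth_laguerre \<beta> 0 (\<beta> * (p - real n + 1) / 2) {1..n} x / laguerre_selberg \<beta> n (\<beta> * (p - real n + 1) / 2)) else 0)"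
  unfolding ordered_laguerre_density_def laguerre_density_eq[OF assms] ..

lemma laguerre_density_nonneg:
  assumes "0 < \<beta>" "real n - 1 < p"
  shows "0 \<le> laguerre_density n p \<beta> x"
proof -
  have "0 < \<beta> * (p - real n + 1) / 2" using assms by simp
  from laguerre_selberg_pos[OF assms(1) this, of n] show ?thesis
    unfolding laguerre_density_eq[OF assms] by (intro divide_nonneg_pos smooth_laguerre_nonneg)
qed

lemma ordered_laguerre_density_nonneg:
  assumes "0 < \<beta>" "real n - 1 < p"
  shows "0 \<le> ordered_laguerre_density n p \<beta> x"
  unfolding ordered_laguerre_density_def using laguerre_density_nonneg[OF assms] by simp

lemma borel_measurable_laguerre_density:
  assumes "0 < \<beta>" "real n - 1 < p"
  shows "laguerre_density n p \<beta> \<in> borel_measurable (lebesgue_power {1..n})"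
  unfolding laguerre_density_eq[OF assms, abs_def] by measurable

lemma borel_measurable_ordered_laguerre_density:
  assumes "0 < \<beta>" "real n - 1 < p" "{1..n} \<subseteq> I"
  shows "ordered_laguerre_density n p \<beta> \<in> borel_measurable (lebesgue_power I)"
proof -
  note [measurable] = pred_decreasing_upto[OF assms(3)] borel_measurable_smooth_laguerre_subset[OF assms(3)]
  show ?thesis unfolding ordered_laguerre_density_eq[OF assms(1,2), abs_def] by measurable
qed

text \<open>The factorial in the ordered density undoes the restriction to one chamber. Symmetric
  events can thus be moved to the unordered ensemble, for which the normalising constants are
  known.\<close>

lemma nn_integral_ordered_density:
  assumes "0 < \<beta>" "real n - 1 < p" and H: "H \<in> borel_measurable (lebesgue_power {1..n})" "symmetric_on {1..n} H" "\<And>x. 0 \<le> H x"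
  shows "(\<integral>\<^sup>+x. ennreal (ordered_laguerre_density n p \<beta> x * H x) \<partial>lebesgue_power {1..n}) =
    (\<integral>\<^sup>+x. ennreal (laguerre_density n p \<beta> x * H x) \<partial>lebesgue_power {1..n})"
proof -
  let ?a = "\<beta> * (p - real n + 1) / 2"
  let ?F = "\<lambda>x. ennreal (laguerre_density n p \<beta> x * H x)"
  note [measurable] = borel_measurable_laguerre_density[OF assms(1,2)] H(1)
  have pd[measurable]: "Measurable.pred (lebesgue_power {1..n}) (decreasing_upto n)"
    by (intro pred_decreasing_upto order_refl)
  have F[measurable]: "?F \<in> borel_measurable (lebesgue_power {1..n})" by measurable
  have "(\<integral>\<^sup>+x. ?F x \<partial>lebesgue_power {1..n}) = fact n * (\<integral>\<^sup>+x. ?F x * (if decreasing_upto n x then 1 else 0) \<partial>lebesgue_power {1..n})"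
  proof (rule nn_integral_eq_fact_ordered[OF F])
    show "symmetric_on {1..n} ?F"
      unfolding laguerre_density_eq[OF assms(1,2)]
      by (rule symmetric_on_comb2[where g = "\<lambda>f h. ennreal (f / laguerre_selberg \<beta> n ?a * h)",
          OF symmetric_on_smooth_laguerre_real H(2)])
    show "zero_on_ties {1..n} ?F"
      unfolding zero_on_ties_def laguerre_density_eq[OF assms(1,2)]
    proof (intro allI ballI impI)
      fix x :: "nat \<Rightarrow> real" and i j assume "i \<in> {1..n}" "j \<in> {1..n}" "i \<noteq> j" "x i = x j"
      then have "smooth_laguerre \<beta> 0 ?a {1..n} x = 0" by (intro smooth_laguerre_tie[of _ i j]) auto
      then show "ennreal (smooth_laguerre \<beta> 0 ?a {1..n} x / laguerre_selberg \<beta> n ?a * H x) = 0" by simp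
    qed
  qed
  also have "\<dots> = (\<integral>\<^sup>+x. ennreal (fact n) * (?F x * (if decreasing_upto n x then 1 else 0)) \<partial>lebesgue_power {1..n})"
    unfolding ennreal_fact by (intro nn_integral_cmult[symmetric]) measurable
  also have "\<dots> = (\<integral>\<^sup>+x. ennreal (ordered_laguerre_density n p \<beta> x * H x) \<partial>lebesgue_power {1..n})"
  proof (intro nn_integral_cong)
    fix x
    have "0 \<le> laguerre_density n p \<beta> x * H x" using laguerre_density_nonneg[OF assms(1,2)] H(3) by simp
    then show "ennreal (fact n) * (?F x * (if decreasing_upto n x then 1 else 0)) = ennreal (ordered_laguerre_density n p \<beta> x * H x)"
    proof (cases "decreasing_upto n x")
      case True
      show ?thesis
        unfolding ordered_laguerre_density_def if_P[OF True] mult_1_right mult.assoc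
        using \<open>0 \<le> laguerre_density n p \<beta> x * H x\<close> by (intro ennreal_mult[symmetric]) auto
    next
      case False
      show ?thesis unfolding ordered_laguerre_density_def if_not_P[OF False] by simp
    qed
  qed
  finally show ?thesis by simp
qed

lemma nn_integral_laguerre_density:
  assumes "0 < \<beta>" "real n - 1 < p"
  shows "(\<integral>\<^sup>+x. ennreal (laguerre_density n p \<beta> x) \<partial>lebesgue_power {1..n}) = 1"
proof -
  let ?a = "\<beta> * (p - real n + 1) / 2"
  have a: "0 < ?a" using assms by simp
  have S: "0 < laguerre_selberg \<beta> n ?a" by (rule laguerre_selberg_pos[OF assms(1) a])
  have "(\<integral>\<^sup>+x. ennreal (laguerre_density n p \<beta> x) \<partial>lebesgue_power {1..n}) =
    (\<integral>\<^sup>+x. ennreal (smooth_laguerre \<beta> 0 ?a {1..n} x) * ennreal (1 / laguerre_selberg \<beta> n ?a) \<partial>lebesgue_power {1..n})"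
    unfolding laguerre_density_eq[OF assms] using S smooth_laguerre_nonneg
    by (intro nn_integral_cong) (simp add: ennreal_mult[symmetric])
  also have "\<dots> = ennreal (laguerre_selberg \<beta> n ?a) * ennreal (1 / laguerre_selberg \<beta> n ?a)"
    using assms(1) a by (subst nn_integral_multc) (auto simp: nn_integral_smooth_laguerre laguerre_integral_eq_selberg[OF assms(1) a] simp del: One_nat_def)
  also have "\<dots> = 1" using S by (simp add: ennreal_mult[symmetric])
  finally show ?thesis .
qed

text \<open>The factors \<open>\<bar>x i\<bar> powr c\<close> shift the shape to
  \<open>a + c\<close>, so this is the tail bound for the shifted ensemble. With
  \<open>c = 0\<close> it bounds a probability, with \<open>c = 2 * \<beta>\<close> the second
  moment over bad configurations.\<close>

lemma laguerre_density_tail: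
  assumes "0 < \<beta>" "real n - 1 < p" "0 < t" "2 \<le> n" "0 < \<rho>" "\<rho> < 1" "0 \<le> c"
    and t: "t \<le> 2 * (\<beta> * (p - real n + 1) / 2 + c)"
  shows "(\<integral>\<^sup>+x. ennreal (laguerre_density n p \<beta> x * ((\<Prod>i\<in>{1..n}. \<bar>x i\<bar> powr c) * (if \<exists>i\<in>{1..n}. x i \<le> t then 1 else 0)))
      \<partial>lebesgue_power {1..n}) \<le>
    ennreal (laguerre_selberg \<beta> n (\<beta> * (p - real n + 1) / 2 + c) / laguerre_selberg \<beta> n (\<beta> * (p - real n + 1) / 2) *
      exp (tail_exponent \<beta> \<rho> n (\<beta> * (p - real n + 1) / 2 + c) t))"
proof -
  let ?a = "\<beta> * (p - real n + 1) / 2"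
  let ?S = "laguerre_selberg \<beta> n"
  have a: "0 < ?a" using assms by simp
  then have ac: "0 < ?a + c" using assms by simp
  have S: "0 < ?S ?a" "0 < ?S (?a + c)" using laguerre_selberg_pos[OF assms(1)] a ac by auto
  have [measurable]: "Measurable.pred (lebesgue_power {1..n}) (\<lambda>x. \<exists>i\<in>{1..n}. x i \<le> t)"
    by (intro pred_intros_finite(4)) (auto intro!: pred_le_const measurable_coord)
  have "(\<integral>\<^sup>+x. ennreal (laguerre_density n p \<beta> x * ((\<Prod>i\<in>{1..n}. \<bar>x i\<bar> powr c) * (if \<exists>i\<in>{1..n}. x i \<le> t then 1 else 0))) \<partial>lebesgue_power {1..n}) =
    (\<integral>\<^sup>+x. ennreal (1 / ?S ?a) * (ennreal (smooth_laguerre \<beta> 0 (?a + c) {1..n} x) * (if \<exists>i\<in>{1..n}. x i \<le> t then 1 else 0)) \<partial>lebesgue_power {1..n})"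
  proof (intro nn_integral_cong)
    fix x
    have "laguerre_density n p \<beta> x * (\<Prod>i\<in>{1..n}. \<bar>x i\<bar> powr c) = 1 / ?S ?a * smooth_laguerre \<beta> 0 (?a + c) {1..n} x"
    proof -
      have "f / s * g = 1 / s * (g * f)" for f g s :: real by simp
      then show ?thesis
        unfolding laguerre_density_eq[OF assms(1,2)] prod_powr_smooth_laguerre[OF finite_atLeastAtMost, symmetric] .
    qed
    then show "ennreal (laguerre_density n p \<beta> x * ((\<Prod>i\<in>{1..n}. \<bar>x i\<bar> powr c) * (if \<exists>i\<in>{1..n}. x i \<le> t then 1 else 0))) =
      ennreal (1 / ?S ?a) * (ennreal (smooth_laguerre \<beta> 0 (?a + c) {1..n} x) * (if \<exists>i\<in>{1..n}. x i \<le> t then 1 else 0))"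
      using S smooth_laguerre_nonneg[of \<beta> 0 "?a + c" "{1..n}" x]
      by (cases "\<exists>i\<in>{1..n}. x i \<le> t") (simp_all only: if_True if_False mult_1_right mult_zero_right ennreal_0 simp_thms,
          simp_all add: ennreal_mult[symmetric])
  qed
  also have "\<dots> = ennreal (1 / ?S ?a) * (\<integral>\<^sup>+x. ennreal (smooth_laguerre \<beta> 0 (?a + c) {1..n} x) * (if \<exists>i\<in>{1..n}. x i \<le> t then 1 else 0) \<partial>lebesgue_power {1..n})"
    by (intro nn_integral_cmult) measurable
  also have "\<dots> \<le> ennreal (1 / ?S ?a) * ennreal (?S (?a + c) * exp (tail_exponent \<beta> \<rho> n (?a + c) t))"
    using assms ac by (intro mult_left_mono laguerre_min_tail) auto
  also have "\<dots> = ennreal (?S (?a + c) / ?S ?a * exp (tail_exponent \<beta> \<rho> n (?a + c) t))"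
    using S by (simp add: ennreal_mult[symmetric])
  finally show ?thesis .
qed

text \<open>The ordered form is the one that meets the estimator, the symmetric form the one that
  meets the tail bound.\<close>

lemma smallest_eigenvalue_prob_eq:
  assumes "0 < \<beta>" "real n - 1 < p" "1 \<le> n"
  shows "ennreal (smallest_eigenvalue_prob n p \<beta> t) =
     (\<integral>\<^sup>+x. ennreal (ordered_laguerre_density n p \<beta> x * (if x n < t then 1 else 0)) \<partial>lebesgue_power {1..n})"
    and "ennreal (smallest_eigenvalue_prob n p \<beta> t) =
     (\<integral>\<^sup>+x. ennreal (laguerre_density n p \<beta> x * (if \<exists>i\<in>{1..n}. x i < t then 1 else 0)) \<partial>lebesgue_power {1..n})"
proof -
  let ?I = "{1..n}"
  let ?M = "lebesgue_power ?I"
  note [measurable] = borel_measurable_laguerre_density[OF assms(1,2)]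
  have Min: "Min (x ` ?I) < t \<longleftrightarrow> (\<exists>i\<in>?I. x i < t)" for x :: "nat \<Rightarrow> real"
    using assms(3) by (subst Min_less_iff) auto
  have pred[measurable]: "Measurable.pred ?M (\<lambda>x. \<exists>i\<in>?I. x i < t)"
    by (intro pred_intros_finite(4) borel_measurable_pred_less measurable_coord) auto
  let ?A = "{x \<in> space ?M. \<exists>i\<in>?I. x i < t}"
  have A: "?A \<in> sets ?M" using pred by (simp only: pred_def)
  have sp: "space (laguerre_ensemble n p \<beta>) = space ?M" by (simp add: laguerre_ensemble_def)
  have e: "emeasure (laguerre_ensemble n p \<beta>) ?A =
     (\<integral>\<^sup>+x. ennreal (laguerre_density n p \<beta> x * (if \<exists>i\<in>?I. x i < t then 1 else 0)) \<partial>?M)"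
    unfolding laguerre_ensemble_def
  proof (subst emeasure_density)
    show "(\<lambda>x. ennreal (laguerre_density n p \<beta> x)) \<in> borel_measurable ?M" by measurable
    show "(\<integral>\<^sup>+x. ennreal (laguerre_density n p \<beta> x) * indicator ?A x \<partial>?M) =
      (\<integral>\<^sup>+x. ennreal (laguerre_density n p \<beta> x * (if \<exists>i\<in>?I. x i < t then 1 else 0)) \<partial>?M)"
      by (intro nn_integral_cong) (simp add: indicator_def del: One_nat_def)
  qed (rule A)
  also have "\<dots> \<le> (\<integral>\<^sup>+x. ennreal (laguerre_density n p \<beta> x) \<partial>?M)"
    using laguerre_density_nonneg[OF assms(1,2)] by (intro nn_integral_mono ennreal_leI) (auto simp: mult_left_le)
  also have "\<dots> = 1" by (rule nn_integral_laguerre_density[OF assms(1,2)])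
  finally have fin: "emeasure (laguerre_ensemble n p \<beta>) ?A < top" by (simp only: le_less_trans ennreal_one_less_top)
  show 2: "ennreal (smallest_eigenvalue_prob n p \<beta> t) =
     (\<integral>\<^sup>+x. ennreal (laguerre_density n p \<beta> x * (if \<exists>i\<in>{1..n}. x i < t then 1 else 0)) \<partial>lebesgue_power {1..n})"
    unfolding smallest_eigenvalue_prob_def Min sp measure_def ennreal_enn2real[OF fin] by (rule e)
  also have "\<dots> = (\<integral>\<^sup>+x. ennreal (ordered_laguerre_density n p \<beta> x * (if \<exists>i\<in>{1..n}. x i < t then 1 else 0)) \<partial>lebesgue_power {1..n})"
  proof (rule nn_integral_ordered_density[OF assms(1,2), symmetric])
    have "symmetric_on ?I (\<lambda>x. (\<lambda>X. if \<exists>z\<in>X. z < t then 1 else (0::real)) (x ` ?I))" by (rule symmetric_on_image)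
    then show "symmetric_on ?I (\<lambda>x. if \<exists>i\<in>?I. x i < t then 1 else (0::real))" by (simp only: Set.bex_simps(7))
  qed auto
  also have "\<dots> = (\<integral>\<^sup>+x. ennreal (ordered_laguerre_density n p \<beta> x * (if x n < t then 1 else 0)) \<partial>lebesgue_power {1..n})"
  proof (intro nn_integral_cong arg_cong[where f = ennreal])
    fix x
    have "(\<exists>i\<in>?I. x i < t) \<longleftrightarrow> x n < t" if d: "decreasing_upto n x"
    proof
      assume "\<exists>i\<in>?I. x i < t"
      then obtain i where i: "i \<in> ?I" "x i < t" by blast
      then show "x n < t" using decreasing_upto_less[OF d, of i n] by (cases "i = n") auto
    next
      assume "x n < t"
      then show "\<exists>i\<in>?I. x i < t" using assms(3) by (intro bexI[of _ n]) auto
    qed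
    then show "ordered_laguerre_density n p \<beta> x * (if \<exists>i\<in>{1..n}. x i < t then 1 else 0) =
      ordered_laguerre_density n p \<beta> x * (if x n < t then 1 else 0)"
    proof (cases "decreasing_upto n x")
      case True
      show ?thesis unfolding \<open>decreasing_upto n x \<Longrightarrow> (\<exists>i\<in>?I. x i < t) \<longleftrightarrow> x n < t\<close>[OF True] ..
    next
      case False
      show ?thesis unfolding ordered_laguerre_density_def if_not_P[OF False] mult_zero_left ..
    qed
  qed
  finally show "ennreal (smallest_eigenvalue_prob n p \<beta> t) =
     (\<integral>\<^sup>+x. ennreal (ordered_laguerre_density n p \<beta> x * (if x n < t then 1 else 0)) \<partial>lebesgue_power {1..n})" .
qed

section \<open>The proposal and the sampling measure\<close>

lemma proposal_density_nonneg: "0 < y \<Longrightarrow> y < \<beta> \<Longrightarrow> 0 \<le> proposal_density p \<beta> y z u"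
  by (simp add: proposal_density_def)

lemma borel_measurable_proposal_density:
  assumes [measurable]: "f \<in> borel_measurable M" "g \<in> borel_measurable M"
  shows "(\<lambda>x. proposal_density p \<beta> y (f x) (g x)) \<in> borel_measurable M"
  unfolding proposal_density_def by measurable

lemma nn_integral_proposal_density:
  assumes "0 < y" "y < \<beta>"
  shows "(\<integral>\<^sup>+u. ennreal (proposal_density p \<beta> y z u) \<partial>lborel) = 1"
proof -
  let ?\<theta> = "(\<beta> - y) / (2 * y)"
  have th: "?\<theta> > 0" using assms by simp
  have "(\<integral>\<^sup>+u. ennreal (proposal_density p \<beta> y z u) \<partial>lborel) =
    (\<integral>\<^sup>+u. ennreal ?\<theta> * ennreal (if u < min (p * y) z then exp (?\<theta> * (u - min (p * y) z)) else 0) \<partial>lborel)"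
    using th unfolding proposal_density_def by (intro nn_integral_cong) (simp add: ennreal_mult[symmetric])
  also have "\<dots> = ennreal ?\<theta> * (\<integral>\<^sup>+u. ennreal (if u < min (p * y) z then exp (?\<theta> * (u - min (p * y) z)) else 0) \<partial>lborel)"
    by (intro nn_integral_cmult) measurable
  also have "(\<integral>\<^sup>+u. ennreal (if u < min (p * y) z then exp (?\<theta> * (u - min (p * y) z)) else 0) \<partial>lborel) = ennreal (1 / ?\<theta>)"
    by (rule nn_integral_exp_below[OF th])
  also have "ennreal ?\<theta> * ennreal (1 / ?\<theta>) = 1"
  proof -
    have "ennreal r * ennreal (1 / r) = 1" if "0 < r" for r
      using that by (simp add: ennreal_mult[symmetric])
    then show ?thesis using th by blast
  qed
  finally show ?thesis .
qed

lemma borel_measurable_IS_estimator: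
  assumes "2 \<le> n"
  shows "IS_estimator n p \<beta> y \<in> borel_measurable (lebesgue_power {1..n})"
proof -
  have [measurable]: "(\<lambda>x. x n) \<in> borel_measurable (lebesgue_power {1..n})" "(\<lambda>x. x (n - 1)) \<in> borel_measurable (lebesgue_power {1..n})"
    using assms by (auto intro!: measurable_coord)
  have [measurable]: "(\<lambda>x. \<Prod>i = 1..<n. (x i - x n) powr \<beta>) \<in> borel_measurable (lebesgue_power {1..n})"
    using assms by (intro borel_measurable_prod powr_real_measurable borel_measurable_diff measurable_coord borel_measurable_const) auto
  show ?thesis unfolding IS_estimator_def by measurable
qed

text \<open>The joint form serves the likelihood-ratio identity, the iterated form the integration
  over the last coordinate with the others fixed.\<close>

lemma nn_integral_sampling_measure:
  assumes "0 < \<beta>" "0 < y" "y < \<beta>" "2 \<le> n" "real n \<le> p"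
    and f: "f \<in> borel_measurable (lebesgue_power {1..n})"
  shows "(\<integral>\<^sup>+x. f x \<partial>sampling_measure n p \<beta> y) =
    (\<integral>\<^sup>+x. ennreal (ordered_laguerre_density (n - 1) (p - 1) \<beta> x * proposal_density p \<beta> y (x (n - 1)) (x n)) * f x \<partial>lebesgue_power {1..n})"
    and "(\<integral>\<^sup>+x. f x \<partial>sampling_measure n p \<beta> y) =
    (\<integral>\<^sup>+x. (\<integral>\<^sup>+u. ennreal (ordered_laguerre_density (n - 1) (p - 1) \<beta> x * proposal_density p \<beta> y (x (n - 1)) u) * f (x(n := u)) \<partial>lborel) \<partial>lebesgue_power {1..n - 1})"
proof -
  let ?d = "\<lambda>x. ennreal (ordered_laguerre_density (n - 1) (p - 1) \<beta> x * proposal_density p \<beta> y (x (n - 1)) (x n))"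
  have p: "real (n - 1) - 1 < p - 1" using assms by simp
  have d[measurable]: "?d \<in> borel_measurable (lebesgue_power {1..n})"
    using assms by (intro measurable_compose[OF _ measurable_ennreal] borel_measurable_times borel_measurable_proposal_density measurable_coord
      borel_measurable_ordered_laguerre_density p) auto
  note [measurable] = f
  show 1: "(\<integral>\<^sup>+x. f x \<partial>sampling_measure n p \<beta> y) = (\<integral>\<^sup>+x. ?d x * f x \<partial>lebesgue_power {1..n})"
    unfolding sampling_measure_def by (rule nn_integral_density[OF d f])
  have I: "{1..n} = insert n {1..n - 1}" using assms by auto
  have m: "(\<lambda>x. ?d x * f x) \<in> borel_measurable (lebesgue_power (insert n {1..n - 1}))"
    unfolding I[symmetric] by measurable
  have "(\<integral>\<^sup>+x. ?d x * f x \<partial>lebesgue_power {1..n}) =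
    (\<integral>\<^sup>+x. (\<integral>\<^sup>+u. ?d (x(n := u)) * f (x(n := u)) \<partial>lborel) \<partial>lebesgue_power {1..n - 1})"
    unfolding I using assms by (intro lborel_prod.product_nn_integral_insert m) auto
  also have "\<dots> = (\<integral>\<^sup>+x. (\<integral>\<^sup>+u. ennreal (ordered_laguerre_density (n - 1) (p - 1) \<beta> x * proposal_density p \<beta> y (x (n - 1)) u) * f (x(n := u)) \<partial>lborel) \<partial>lebesgue_power {1..n - 1})"
  proof (intro nn_integral_cong arg_cong2[where f = "(*)"] arg_cong[where f = ennreal] refl)
    fix x :: "nat \<Rightarrow> real" and u
    have "decreasing_upto (n - 1) (x(n := u)) \<longleftrightarrow> decreasing_upto (n - 1) x"
      by (intro ball_cong refl) auto
    moreover have "smooth_laguerre \<beta> 0 c {1..n - 1} (x(n := u)) = smooth_laguerre \<beta> 0 c {1..n - 1} x" for c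
      using assms by (intro smooth_laguerre_cong) auto
    ultimately show "ordered_laguerre_density (n - 1) (p - 1) \<beta> (x(n := u)) = ordered_laguerre_density (n - 1) (p - 1) \<beta> x"
      unfolding ordered_laguerre_density_eq[OF assms(1) p] by (simp only:)
    show "proposal_density p \<beta> y ((x(n := u)) (n - 1)) ((x(n := u)) n) = proposal_density p \<beta> y (x (n - 1)) u"
    proof -
      have "n - 1 \<noteq> n" using assms(4) by arith
      then show ?thesis by (simp only: fun_upd_other fun_upd_same not_False_eq_True)
    qed
  qed
  finally show "(\<integral>\<^sup>+x. f x \<partial>sampling_measure n p \<beta> y) =
    (\<integral>\<^sup>+x. (\<integral>\<^sup>+u. ennreal (ordered_laguerre_density (n - 1) (p - 1) \<beta> x * proposal_density p \<beta> y (x (n - 1)) u) * f (x(n := u)) \<partial>lborel) \<partial>lebesgue_power {1..n - 1})"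
    unfolding 1 .
qed

text \<open>Total mass 1 enters through Cauchy--Schwarz, when the second moment is bounded below by
  the squared first moment.\<close>

lemma emeasure_sampling_measure:
  assumes "0 < \<beta>" "0 < y" "y < \<beta>" "2 \<le> n" "real n \<le> p"
  shows "emeasure (sampling_measure n p \<beta> y) (space (sampling_measure n p \<beta> y)) = 1"
proof -
  let ?d = "ordered_laguerre_density (n - 1) (p - 1) \<beta>"
  have p: "real (n - 1) - 1 < p - 1" using assms by simp
  have "emeasure (sampling_measure n p \<beta> y) (space (sampling_measure n p \<beta> y)) = (\<integral>\<^sup>+x. 1 \<partial>sampling_measure n p \<beta> y)"
    by simp
  also have "\<dots> = (\<integral>\<^sup>+x. (\<integral>\<^sup>+u. ennreal (?d x * proposal_density p \<beta> y (x (n - 1)) u) * 1 \<partial>lborel) \<partial>lebesgue_power {1..n - 1})"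
    using assms by (intro nn_integral_sampling_measure(2)) auto
  also have "\<dots> = (\<integral>\<^sup>+x. ennreal (?d x * 1) \<partial>lebesgue_power {1..n - 1})"
  proof (intro nn_integral_cong)
    fix x
    have "(\<integral>\<^sup>+u. ennreal (?d x * proposal_density p \<beta> y (x (n - 1)) u) * 1 \<partial>lborel) =
      (\<integral>\<^sup>+u. ennreal (?d x) * ennreal (proposal_density p \<beta> y (x (n - 1)) u) \<partial>lborel)"
      using ordered_laguerre_density_nonneg[OF assms(1) p] proposal_density_nonneg[OF assms(2,3)]
      by (intro nn_integral_cong) (simp add: ennreal_mult)
    also have "\<dots> = ennreal (?d x) * 1"
      unfolding nn_integral_proposal_density[OF assms(2,3), of p "x (n - 1)", symmetric]
      by (intro nn_integral_cmult measurable_compose[OF _ measurable_ennreal] borel_measurable_proposal_density) auto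
    finally show "(\<integral>\<^sup>+u. ennreal (?d x * proposal_density p \<beta> y (x (n - 1)) u) * 1 \<partial>lborel) = ennreal (?d x * 1)" by simp
  qed
  also have "\<dots> = (\<integral>\<^sup>+x. ennreal (laguerre_density (n - 1) (p - 1) \<beta> x * 1) \<partial>lebesgue_power {1..n - 1})"
    by (intro nn_integral_ordered_density assms p) (auto simp: symmetric_on_def)
  also have "\<dots> = 1" using nn_integral_laguerre_density[OF assms(1) p] by simp
  finally show ?thesis .
qed

section \<open>Integrating out the smallest eigenvalue\<close>

text \<open>Concavity of the log-weight for \<open>a \<ge> 1\<close>, from
  \<open>ln z \<le> z - 1\<close>. The point of tangency is left free: upper bounds use
  \<open>t\<close> or the minimum of \<open>t\<close> and the next eigenvalue, the lower bound below
  uses the integration variable itself.\<close>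

lemma laguerre_weight_le_tangent:
  assumes "1 \<le> a" "0 < u" "0 < m"
  shows "laguerre_weight a u \<le> laguerre_weight a m * exp (((a - 1) / m - 1 / 2) * (u - m))"
proof -
  have "ln (u / m) \<le> u / m - 1" using assms by (intro ln_le_minus_one) auto
  then have "(a - 1) * (ln u - ln m) \<le> (a - 1) * (u / m - 1)"
    using assms by (intro mult_left_mono) (auto simp: ln_div)
  also have "(a - 1) * (u / m - 1) = (a - 1) / m * (u - m)" using assms by (simp add: field_simps)
  finally have "(a - 1) * (ln u - ln m) \<le> (a - 1) / m * (u - m)" .
  moreover have "((a - 1) / m - 1 / 2) * (u - m) = (a - 1) / m * (u - m) - (u - m) / 2"
    by (simp add: left_diff_distrib)
  moreover have "(a - 1) * ln u = (a - 1) * (ln u - ln m) + (a - 1) * ln m" by (simp add: algebra_simps)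
  moreover have "(u - m) / 2 = u / 2 - m / 2" by (rule diff_divide_distrib)
  ultimately have "(a - 1) * ln u - u / 2 \<le> ((a - 1) * ln m - m / 2) + ((a - 1) / m - 1 / 2) * (u - m)"
    by argo
  then have "exp ((a - 1) * ln u - u / 2) \<le> exp ((a - 1) * ln m - m / 2) * exp (((a - 1) / m - 1 / 2) * (u - m))"
    by (simp only: exp_add[symmetric] exp_le_cancel_iff)
  moreover have "laguerre_weight a z = exp ((a - 1) * ln z - z / 2)" if "0 < z" for z
    using that by (simp add: laguerre_weight_def powr_def flip: exp_add)
  ultimately show ?thesis using assms by simp
qed

text \<open>On \<open>[t * (1 - \<delta>), t]\<close> the logarithmic slope of the weight is at most
  \<open>K\<close>, its bound at the left end point, so the weight lies above an exponential of rate
  \<open>K\<close>. Dropping everything to the left of the interval costs the term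
  \<open>exp (- (K * \<delta> * t))\<close>.\<close>

lemma nn_integral_laguerre_weight_ge:
  fixes \<delta> t a :: real
  defines "K \<equiv> (a - 1) / (t * (1 - \<delta>)) - 1 / 2"
  assumes "1 \<le> a" "0 < t" "0 < \<delta>" "\<delta> < 1" "0 < K"
  shows "ennreal (laguerre_weight a t * ((1 - exp (- (K * \<delta> * t))) / K)) \<le>
    (\<integral>\<^sup>+u. ennreal (if u < t then laguerre_weight a u else 0) \<partial>lborel)"
proof -
  define s where "s = t * (1 - \<delta>)"
  have s: "0 < s" "s < t" "t - s = \<delta> * t" using assms by (auto simp: s_def algebra_simps)
  let ?e = "\<lambda>u. exp (K * (u - t))"
  let ?E3 = "\<integral>\<^sup>+u. ennreal (if s \<le> u \<and> u < t then ?e u else 0) \<partial>lborel"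
  define r where "r = exp (- (K * \<delta> * t))"
  have r: "0 < r" "r < 1" using assms by (auto simp: r_def)
  have "ennreal (1 / K) = (\<integral>\<^sup>+u. ennreal (if u < t then ?e u else 0) \<partial>lborel)"
    using assms by (intro nn_integral_exp_below[symmetric])
  \<comment> \<open>The full exponential tail is split at \<open>s\<close>; the part below
    \<open>s\<close> is a translate of the whole, scaled by \<open>r\<close>.\<close>
  also have "\<dots> = (\<integral>\<^sup>+u. ennreal r * ennreal (if u < s then exp (K * (u - s)) else 0) + ennreal (if s \<le> u \<and> u < t then ?e u else 0) \<partial>lborel)"
  proof (intro nn_integral_cong)
    fix u
    have "K * \<delta> * t = K * (t - s)" unfolding s(3) by simp
    then have "K * (u - t) = - (K * \<delta> * t) + K * (u - s)" by (simp add: algebra_simps)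
    then have "?e u = r * exp (K * (u - s))" by (simp only: r_def exp_add)
    then show "ennreal (if u < t then ?e u else 0) =
      ennreal r * ennreal (if u < s then exp (K * (u - s)) else 0) + ennreal (if s \<le> u \<and> u < t then ?e u else 0)"
      using s r by (auto simp: ennreal_mult[symmetric])
  qed
  also have "\<dots> = ennreal r * (\<integral>\<^sup>+u. ennreal (if u < s then exp (K * (u - s)) else 0) \<partial>lborel) + ?E3"
    by (subst nn_integral_add) (auto simp: nn_integral_cmult)
  also have "(\<integral>\<^sup>+u. ennreal (if u < s then exp (K * (u - s)) else 0) \<partial>lborel) = ennreal (1 / K)"
    using assms by (intro nn_integral_exp_below)
  also have "ennreal r * ennreal (1 / K) = ennreal (r / K)" using r assms by (simp add: ennreal_mult[symmetric])
  finally have "ennreal (1 / K) = ennreal (r / K) + ?E3" .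
  then have "?E3 = ennreal (1 / K) - ennreal (r / K)" by simp
  also have "\<dots> = ennreal ((1 - r) / K)"
    using r assms by (subst ennreal_minus) (auto simp: diff_divide_distrib)
  finally have E3: "?E3 = ennreal ((1 - r) / K)" .
  have "ennreal (laguerre_weight a t * ((1 - r) / K)) = ennreal (laguerre_weight a t) * ?E3"
    unfolding E3 using r assms by (intro ennreal_mult) auto
  also have "\<dots> = (\<integral>\<^sup>+u. ennreal (laguerre_weight a t) * ennreal (if s \<le> u \<and> u < t then ?e u else 0) \<partial>lborel)"
    by (intro nn_integral_cmult[symmetric]) measurable
  also have "\<dots> \<le> (\<integral>\<^sup>+u. ennreal (if u < t then laguerre_weight a u else 0) \<partial>lborel)"
  proof (intro nn_integral_mono)
    fix u
    have "laguerre_weight a t * ?e u \<le> laguerre_weight a u" if u: "s \<le> u" "u < t"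
    proof -
      have u0: "0 < u" using u s by simp
      have "(a - 1) / u - 1 / 2 \<le> K"
        unfolding K_def s_def[symmetric] using u s assms(2) by (intro diff_right_mono divide_left_mono) auto
      then have "((a - 1) / u - 1 / 2) * (t - u) \<le> K * (t - u)" using u by (intro mult_right_mono) auto
      then have "laguerre_weight a u * exp (((a - 1) / u - 1 / 2) * (t - u)) \<le> laguerre_weight a u * exp (K * (t - u))"
        by (intro mult_left_mono) auto
      with laguerre_weight_le_tangent[OF assms(2,3) u0]
      have "laguerre_weight a t \<le> laguerre_weight a u * exp (K * (t - u))" by linarith
      then have "laguerre_weight a t * ?e u \<le> laguerre_weight a u * exp (K * (t - u)) * ?e u" by (intro mult_right_mono) auto
      also have "\<dots> = laguerre_weight a u" by (simp add: mult.assoc algebra_simps flip: exp_add)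
      finally show ?thesis .
    qed
    then show "ennreal (laguerre_weight a t) * ennreal (if s \<le> u \<and> u < t then ?e u else 0) \<le> ennreal (if u < t then laguerre_weight a u else 0)"
      by (auto simp: ennreal_mult[symmetric] intro!: ennreal_leI)
  qed
  finally show ?thesis unfolding r_def .
qed

text \<open>The prefactor \<open>n * A_n\<close> of the estimator. Passing from
  \<open>(n, p)\<close> to \<open>(n - 1, p - 1)\<close> leaves \<open>p - n\<close> and hence the
  shape unchanged, so both constants are taken at the same \<open>a\<close>.\<close>

definition peel_const :: "real \<Rightarrow> real \<Rightarrow> nat \<Rightarrow> real" where
  "peel_const \<beta> a n = real n * (laguerre_selberg \<beta> (n - 1) a / laguerre_selberg \<beta> n a)"

definition good_set :: "nat \<Rightarrow> real \<Rightarrow> (nat \<Rightarrow> real) \<Rightarrow> bool" where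
  "good_set n t' x \<longleftrightarrow> (\<forall>i\<in>{1..n - 1}. t' < x i)"

text \<open>Stands in for the interaction of the smallest eigenvalue with the others, independently
  of its position. On bad configurations \<open>x i - t\<close> may be small or negative, hence the
  cruder second branch.\<close>

definition envelope :: "real \<Rightarrow> real \<Rightarrow> nat \<Rightarrow> real \<Rightarrow> (nat \<Rightarrow> real) \<Rightarrow> real" where
  "envelope \<beta> t n t' x =
    (if good_set n t' x then \<Prod>i\<in>{1..n - 1}. (x i - t) powr \<beta> else \<Prod>i\<in>{1..n - 1}. \<bar>x i\<bar> powr \<beta>)"

section \<open>The likelihood ratio and the moments of the estimator for fixed parameters\<close>

context
  fixes \<beta> y p a t \<theta> :: real and n :: nat
  assumes \<beta>: "0 < \<beta>" and y: "0 < y" "y < \<beta>" and n2: "2 \<le> n" and np: "real n \<le> p"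
    and a_def: "a = \<beta> * (p - real n + 1) / 2" and t_def: "t = p * y" and \<theta>_def: "\<theta> = (\<beta> - y) / (2 * y)"
begin

private lemma a_pos: "0 < a" using \<beta> np by (simp add: a_def)

private lemma t_pos: "0 < t" using y n2 np by (simp add: t_def)

private lemma \<theta>_pos: "0 < \<theta>" using y by (simp add: \<theta>_def)

private lemma p_gt: "real n - 1 < p" "real (n - 1) - 1 < p - 1"
  using np n2 by auto

private lemma a_pred: "\<beta> * (p - 1 - real (n - 1) + 1) / 2 = a"
  using n2 by (simp add: a_def of_nat_diff)

private lemma selberg_pos: "0 < laguerre_selberg \<beta> k a"
  by (rule laguerre_selberg_pos[OF \<beta> a_pos])

private lemma const_ratio:
  "laguerre_const n p \<beta> / laguerre_const (n - 1) (p - 1) \<beta> = laguerre_selberg \<beta> (n - 1) a / laguerre_selberg \<beta> n a"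
  unfolding laguerre_const_eq[OF \<beta> p_gt(1)] laguerre_const_eq[OF \<beta> p_gt(2)] a_pred a_def[symmetric] by simp

lemma peel_const_pos: "0 < peel_const \<beta> a n"
  unfolding peel_const_def using n2 selberg_pos by (intro mult_pos_pos divide_pos_pos) auto

lemma IS_estimator_nonneg: "0 \<le> IS_estimator n p \<beta> y x"
proof -
  have "0 \<le> laguerre_const n p \<beta>" "0 \<le> laguerre_const (n - 1) (p - 1) \<beta>"
    unfolding laguerre_const_eq[OF \<beta> p_gt(1)] laguerre_const_eq[OF \<beta> p_gt(2)] a_pred a_def[symmetric]
    using selberg_pos less_imp_le by (intro divide_nonneg_nonneg zero_le_one; blast)+
  then show ?thesis
    unfolding IS_estimator_def using y
    by (auto intro!: mult_nonneg_nonneg divide_nonneg_nonneg prod_nonneg)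
qed

lemma IS_estimator_eq:
  assumes "0 < x n" "x n < t"
  shows "IS_estimator n p \<beta> y x = peel_const \<beta> a n * (\<Prod>i\<in>{1..n - 1}. (x i - x n) powr \<beta>) * laguerre_weight a (x n) /
    (\<theta> * exp (\<theta> * (x n - min t (x (n - 1)))))"
proof -
  have I: "{1..<n} = {1..n - 1}" using n2 by auto
  show ?thesis
    unfolding IS_estimator_def const_ratio I a_def[symmetric] t_def[symmetric] \<theta>_def[symmetric] peel_const_def laguerre_weight_def
    using assms by (simp add: mult.assoc)
qed

lemma IS_estimator_eq_0: "x n \<le> 0 \<or> t \<le> x n \<Longrightarrow> IS_estimator n p \<beta> y x = 0"
  unfolding IS_estimator_def t_def[symmetric] by auto

lemma proposal_density_eq:
  "proposal_density p \<beta> y z u = (if u < min t z then \<theta> * exp (\<theta> * (u - min t z)) else 0)"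
  unfolding proposal_density_def t_def[symmetric] \<theta>_def[symmetric] ..

text \<open>The likelihood-ratio property as an identity at every point. Outside the chamber and for
  a nonpositive last coordinate both sides are 0, so no almost-everywhere argument is
  involved.\<close>

lemma IS_estimator_identity:
  "ordered_laguerre_density (n - 1) (p - 1) \<beta> x * proposal_density p \<beta> y (x (n - 1)) (x n) * IS_estimator n p \<beta> y x =
    ordered_laguerre_density n p \<beta> x * (if x n < t then 1 else 0)"
proof (cases "0 < x n \<and> x n < t \<and> decreasing_upto n x")
  case True
  then have u: "0 < x n" "x n < t" and d: "decreasing_upto n x" by auto
  have less: "x n < x i" if "i \<in> {1..n - 1}" for i
    using that n2 by (intro decreasing_upto_less[OF d]) auto
  have d': "decreasing_upto (n - 1) x" using d by auto
  have m: "x n < min t (x (n - 1))" using u less[of "n - 1"] n2 by auto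
  have I: "{1..n} = insert n {1..n - 1}" using n2 by auto
  have smooth: "smooth_laguerre \<beta> 0 a {1..n} x = (\<Prod>i\<in>{1..n - 1}. (x i - x n) powr \<beta>) * laguerre_weight a (x n) * smooth_laguerre \<beta> 0 a {1..n - 1} x"
  proof -
    have "(\<Prod>i\<in>{1..n - 1}. \<bar>x i - x n\<bar> powr \<beta>) = (\<Prod>i\<in>{1..n - 1}. (x i - x n) powr \<beta>)"
      using less by (intro prod.cong refl) (metis abs_of_pos diff_gt_0_iff_gt)
    then show ?thesis unfolding I using n2 by (subst smooth_laguerre_insert) auto
  qed
  \<comment> \<open>The factor \<open>n\<close> in the estimator makes up for the quotient of the
    two factorials.\<close>
  have fact: "fact n = real n * fact (n - 1)" using n2 by (subst fact_reduce) auto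
  define E where "E = \<theta> * exp (\<theta> * (x n - min t (x (n - 1))))"
  have E: "E \<noteq> 0" using \<theta>_pos by (simp add: E_def)
  define V where "V = (\<Prod>i\<in>{1..n - 1}. (x i - x n) powr \<beta>) * laguerre_weight a (x n)"
  define W where "W = smooth_laguerre \<beta> 0 a {1..n - 1} x"
  define S where "S = laguerre_selberg \<beta> n a"
  define S' where "S' = laguerre_selberg \<beta> (n - 1) a"
  have S: "S \<noteq> 0" "S' \<noteq> 0" unfolding S_def S'_def
    by (rule selberg_pos[THEN less_imp_neq, symmetric])+
  have L: "IS_estimator n p \<beta> y x = real n * (S' / S) * V / E"
    unfolding IS_estimator_eq[of x, OF u] peel_const_def S_def S'_def V_def E_def by (simp only: mult.assoc)
  have o1: "ordered_laguerre_density (n - 1) (p - 1) \<beta> x = fact (n - 1) * (W / S')"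
    unfolding ordered_laguerre_density_eq[OF \<beta> p_gt(2)] a_pred if_P[OF d'] W_def S'_def ..
  have o2: "ordered_laguerre_density n p \<beta> x = fact n * (V * W / S)"
    unfolding ordered_laguerre_density_eq[OF \<beta> p_gt(1)] a_def[symmetric] if_P[OF d] smooth V_def W_def S_def ..
  have q: "proposal_density p \<beta> y (x (n - 1)) (x n) = E"
    unfolding proposal_density_eq if_P[OF m] E_def ..
  show ?thesis unfolding L o1 o2 q if_P[OF u(2)] fact using E S by simp
next
  case False
  then consider "x n \<le> 0" | "t \<le> x n" | "\<not> decreasing_upto n x" by linarith
  then show ?thesis
  proof cases
    case 1
    have "n \<in> {1..n}" using n2 by simp
    with 1 have "\<not> (\<forall>l\<in>{1..n}. 0 < x l)" by (meson not_le)
    then have "smooth_laguerre \<beta> 0 a {1..n} x = 0"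
      by (rule smooth_laguerre_eq_0[OF finite_atLeastAtMost])
    then show ?thesis
      unfolding ordered_laguerre_density_eq[OF \<beta> p_gt(1)] a_def[symmetric] IS_estimator_eq_0[of x, OF disjI1[OF 1]]
      by (simp only: div_0 mult_zero_left mult_zero_right if_cancel)
  next
    case 2
    have "IS_estimator n p \<beta> y x = 0" by (rule IS_estimator_eq_0[of x, OF disjI2[OF 2]])
    then show ?thesis unfolding if_not_P[OF leD[OF 2]] by (simp only: mult_zero_right)
  next
    case 3
    then obtain i where i: "i \<in> {1..<n}" "\<not> x i > x (Suc i)" by blast
    \<comment> \<open>A violation at the last pair is detected by the proposal, an earlier one by
      the density of the first \<open>n - 1\<close> coordinates.\<close>
    have "ordered_laguerre_density (n - 1) (p - 1) \<beta> x = 0 \<or> proposal_density p \<beta> y (x (n - 1)) (x n) = 0"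
    proof (cases "i = n - 1")
      case True
      then have "\<not> x n < min t (x (n - 1))" using i n2 by auto
      then show ?thesis unfolding proposal_density_eq by (simp only: if_False simp_thms)
    next
      case False
      then have "i \<in> {1..<n - 1}" using i by auto
      then have "\<not> decreasing_upto (n - 1) x" using i(2) by blast
      then show ?thesis unfolding ordered_laguerre_density_def by (simp only: if_False simp_thms)
    qed
    moreover have "ordered_laguerre_density n p \<beta> x = 0"
      unfolding ordered_laguerre_density_def if_not_P[OF 3] ..
    ultimately show ?thesis by (elim disjE) (simp_all only: mult_zero_left mult_zero_right)
  qed
qed

lemma nn_integral_IS_estimator:
  "(\<integral>\<^sup>+x. ennreal (IS_estimator n p \<beta> y x) \<partial>sampling_measure n p \<beta> y) = ennreal (smallest_eigenvalue_prob n p \<beta> t)"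
proof -
  note m = borel_measurable_IS_estimator[OF n2, of p \<beta> y]
  have "(\<integral>\<^sup>+x. ennreal (IS_estimator n p \<beta> y x) \<partial>sampling_measure n p \<beta> y) =
    (\<integral>\<^sup>+x. ennreal (ordered_laguerre_density (n - 1) (p - 1) \<beta> x * proposal_density p \<beta> y (x (n - 1)) (x n)) *
      ennreal (IS_estimator n p \<beta> y x) \<partial>lebesgue_power {1..n})"
    using m by (intro nn_integral_sampling_measure(1)[OF \<beta> y n2 np]) simp
  also have "\<dots> = (\<integral>\<^sup>+x. ennreal (ordered_laguerre_density n p \<beta> x * (if x n < t then 1 else 0)) \<partial>lebesgue_power {1..n})"
    unfolding IS_estimator_identity[symmetric]
    using ordered_laguerre_density_nonneg[OF \<beta> p_gt(2)] proposal_density_nonneg[OF y] IS_estimator_nonneg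
    by (intro nn_integral_cong ennreal_mult[symmetric] mult_nonneg_nonneg)
  also have "\<dots> = ennreal (smallest_eigenvalue_prob n p \<beta> t)"
    using n2 by (intro smallest_eigenvalue_prob_eq(1)[symmetric] \<beta> p_gt) auto
  finally show ?thesis .
qed

lemma envelope_nonneg: "0 \<le> envelope \<beta> t n t' x"
  by (simp add: envelope_def prod_nonneg)

text \<open>On good configurations, moving from \<open>t\<close> down to \<open>u\<close> multiplies
  each factor by at most \<open>exp (\<beta> * ((t - u) / (t' - t)))\<close>; over
  \<open>n - 1\<close> factors this lowers the usable slope of the tangent to
  \<open>\<theta>1\<close>. On bad configurations the tangent is taken at the minimum of
  \<open>t\<close> and \<open>x (n - 1)\<close>, where the slope is no smaller than at
  \<open>t\<close>.\<close>

lemma interaction_le_envelope: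
  assumes a1: "1 \<le> a" and t': "t < t'" and \<theta>1: "0 \<le> \<theta>1" "\<theta>1 \<le> (a - 1) / t - 1 / 2 - \<beta> * real (n - 1) / (t' - t)"
    and d: "decreasing_upto (n - 1) x" and u: "0 < u" "u < min t (x (n - 1))"
  shows "(\<Prod>i\<in>{1..n - 1}. (x i - u) powr \<beta>) * laguerre_weight a u \<le>
    laguerre_weight a t * envelope \<beta> t n t' x * exp (\<theta>1 * (u - min t (x (n - 1))))"
proof -
  let ?m = "min t (x (n - 1))"
  let ?\<theta>2 = "(a - 1) / t - 1 / 2"
  have m: "0 < ?m" "?m \<le> t" using u by auto
  have q: "0 \<le> \<beta> * real (n - 1) / (t' - t)" using \<beta> t' by simp
  have \<theta>2: "\<theta>1 \<le> ?\<theta>2" "0 \<le> ?\<theta>2" using \<theta>1 q by linarith+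
  have ge: "x (n - 1) \<le> x i" if "i \<in> {1..n - 1}" for i
    using that decreasing_upto_less[OF d, of i "n - 1"] by (cases "i = n - 1") auto
  show ?thesis
  proof (cases "good_set n t' x")
    case True
    then have gi: "t' < x i" if "i \<in> {1..n - 1}" for i using that by (auto simp: good_set_def)
    have "n - 1 \<in> {1..n - 1}" using n2 by auto
    from gi[OF this] have mt: "?m = t" using t' by simp
    let ?e = "exp (\<beta> * ((t - u) / (t' - t)))"
    have "(\<Prod>i\<in>{1..n - 1}. (x i - u) powr \<beta>) \<le> (\<Prod>i\<in>{1..n - 1}. (x i - t) powr \<beta> * ?e)"
    proof (intro prod_mono conjI)
      fix i assume i: "i \<in> {1..n - 1}"
      have xi: "0 < x i - t" using gi[OF i] t' by simp
      have "x i - u = (x i - t) * (1 + (t - u) / (x i - t))" using xi by (simp add: field_simps)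
      also have "\<dots> \<le> (x i - t) * exp ((t - u) / (x i - t))" using xi by (intro mult_left_mono exp_ge_add_one_self) auto
      also have "\<dots> \<le> (x i - t) * exp ((t - u) / (t' - t))"
        using xi gi[OF i] t' u by (intro mult_left_mono) (auto intro!: divide_left_mono)
      finally have "(x i - u) powr \<beta> \<le> ((x i - t) * exp ((t - u) / (t' - t))) powr \<beta>"
        using \<beta> xi u by (intro powr_mono2) auto
      then show "(x i - u) powr \<beta> \<le> (x i - t) powr \<beta> * ?e"
        by (simp add: powr_mult exp_powr_real mult.commute)
    qed auto
    also have "\<dots> = (\<Prod>i\<in>{1..n - 1}. (x i - t) powr \<beta>) * exp (\<beta> * real (n - 1) / (t' - t) * (t - u))"
      by (simp add: prod.distrib mult_ac flip: exp_of_nat_mult)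
    finally have V: "(\<Prod>i\<in>{1..n - 1}. (x i - u) powr \<beta>) \<le> envelope \<beta> t n t' x * exp (\<beta> * real (n - 1) / (t' - t) * (t - u))"
      using True by (simp add: envelope_def)
    have "(\<Prod>i\<in>{1..n - 1}. (x i - u) powr \<beta>) * laguerre_weight a u \<le>
      (envelope \<beta> t n t' x * exp (\<beta> * real (n - 1) / (t' - t) * (t - u))) * (laguerre_weight a t * exp (?\<theta>2 * (u - t)))"
      using V laguerre_weight_le_tangent[OF a1 u(1) t_pos] envelope_nonneg[of t' x] by (intro mult_mono) auto
    also have "\<dots> = laguerre_weight a t * envelope \<beta> t n t' x * exp (\<beta> * real (n - 1) / (t' - t) * (t - u) + ?\<theta>2 * (u - t))"
      by (simp add: exp_add)
    also have "\<beta> * real (n - 1) / (t' - t) * (t - u) + ?\<theta>2 * (u - t) = (?\<theta>2 - \<beta> * real (n - 1) / (t' - t)) * (u - t)"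
      by (simp only: left_diff_distrib) (simp add: right_diff_distrib)
    also have "laguerre_weight a t * envelope \<beta> t n t' x * exp ((?\<theta>2 - \<beta> * real (n - 1) / (t' - t)) * (u - t)) \<le>
       laguerre_weight a t * envelope \<beta> t n t' x * exp (\<theta>1 * (u - t))"
      using \<theta>1 u mt envelope_nonneg[of t' x] by (intro mult_left_mono) (auto intro!: mult_right_mono_neg)
    finally show ?thesis unfolding mt .
  next
    case False
    have "(\<Prod>i\<in>{1..n - 1}. (x i - u) powr \<beta>) \<le> (\<Prod>i\<in>{1..n - 1}. \<bar>x i\<bar> powr \<beta>)"
    proof (intro prod_mono conjI powr_mono2)
      fix i assume i: "i \<in> {1..n - 1}"
      show "0 \<le> x i - u" using ge[OF i] u by auto
      show "x i - u \<le> \<bar>x i\<bar>" using u by auto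
    qed (use \<beta> in auto)
    then have V: "(\<Prod>i\<in>{1..n - 1}. (x i - u) powr \<beta>) \<le> envelope \<beta> t n t' x" using False by (simp add: envelope_def)
    have "laguerre_weight a u \<le> laguerre_weight a ?m * exp (((a - 1) / ?m - 1 / 2) * (u - ?m))"
      using a1 u m by (intro laguerre_weight_le_tangent) auto
    also have "\<dots> \<le> laguerre_weight a ?m * exp (\<theta>1 * (u - ?m))"
    proof -
      have "(a - 1) / t \<le> (a - 1) / ?m" using m a1 t_pos by (intro divide_left_mono) auto
      then have "\<theta>1 \<le> (a - 1) / ?m - 1 / 2" using \<theta>2 by linarith
      then have "((a - 1) / ?m - 1 / 2) * (u - ?m) \<le> \<theta>1 * (u - ?m)" using u by (intro mult_right_mono_neg) auto
      then show ?thesis by (intro mult_left_mono) auto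
    qed
    \<comment> \<open>The tangent at \<open>t\<close> has nonnegative slope, so the weight at the
      minimum is at most the weight at \<open>t\<close>.\<close>
    also have "\<dots> \<le> laguerre_weight a t * exp (\<theta>1 * (u - ?m))"
    proof (intro mult_right_mono)
      have "laguerre_weight a ?m \<le> laguerre_weight a t * exp (?\<theta>2 * (?m - t))"
        using a1 m t_pos by (intro laguerre_weight_le_tangent) auto
      also have "\<dots> \<le> laguerre_weight a t * 1"
      proof (intro mult_left_mono)
        have "?\<theta>2 * (?m - t) \<le> 0" using \<theta>2 m by (intro mult_nonneg_nonpos) auto
        then show "exp (?\<theta>2 * (?m - t)) \<le> 1" by simp
      qed simp
      finally show "laguerre_weight a ?m \<le> laguerre_weight a t" by simp
    qed simp
    finally have W: "laguerre_weight a u \<le> laguerre_weight a t * exp (\<theta>1 * (u - ?m))" .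
    have "(\<Prod>i\<in>{1..n - 1}. (x i - u) powr \<beta>) * laguerre_weight a u \<le> envelope \<beta> t n t' x * (laguerre_weight a t * exp (\<theta>1 * (u - ?m)))"
      using V W envelope_nonneg[of t' x] by (intro mult_mono) auto
    then show ?thesis by (simp only: mult_ac)
  qed
qed

text \<open>The squared estimator carries the proposal twice in its denominator and the proposal
  density cancels one copy. Two exponentials of rate \<open>\<theta>1\<close> over one of rate
  \<theta> leave the rate \<open>2 * \<theta>1 - \<theta>\<close>.\<close>

lemma second_moment_pointwise:
  assumes a1: "1 \<le> a" and t': "t < t'" and \<theta>1: "0 \<le> \<theta>1" "\<theta>1 \<le> (a - 1) / t - 1 / 2 - \<beta> * real (n - 1) / (t' - t)"
    and d: "decreasing_upto (n - 1) x"
  shows "proposal_density p \<beta> y (x (n - 1)) u * (IS_estimator n p \<beta> y (x(n := u)))\<^sup>2 \<le>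
    (peel_const \<beta> a n * laguerre_weight a t * envelope \<beta> t n t' x)\<^sup>2 / \<theta> *
     (if u < min t (x (n - 1)) then exp ((2 * \<theta>1 - \<theta>) * (u - min t (x (n - 1)))) else 0)"
proof (cases "0 < u \<and> u < min t (x (n - 1))")
  case True
  then have u: "0 < u" "u < min t (x (n - 1))" "u < t" by auto
  let ?m = "min t (x (n - 1))"
  have ne: "n - 1 \<noteq> n" using n2 by arith
  define V where "V = (\<Prod>i\<in>{1..n - 1}. (x i - u) powr \<beta>) * laguerre_weight a u"
  define R where "R = laguerre_weight a t * envelope \<beta> t n t' x"
  define E where "E = exp (\<theta> * (u - ?m))"
  have "(\<Prod>i\<in>{1..n - 1}. ((x(n := u)) i - (x(n := u)) n) powr \<beta>) = (\<Prod>i\<in>{1..n - 1}. (x i - u) powr \<beta>)"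
    using n2 by (intro prod.cong) auto
  then have L: "IS_estimator n p \<beta> y (x(n := u)) = peel_const \<beta> a n * V / (\<theta> * E)"
    using IS_estimator_eq[of "x(n := u)"] u ne unfolding V_def E_def by (simp add: mult.assoc)
  have V0: "0 \<le> V" unfolding V_def by (intro mult_nonneg_nonneg prod_nonneg) auto
  have V: "V \<le> R * exp (\<theta>1 * (u - ?m))"
    unfolding V_def R_def by (rule interaction_le_envelope[OF a1 t' \<theta>1 d u(1,2)])
  have E: "E > 0" by (simp add: E_def)
  have "proposal_density p \<beta> y (x (n - 1)) u * (IS_estimator n p \<beta> y (x(n := u)))\<^sup>2 = \<theta> * E * (peel_const \<beta> a n * V / (\<theta> * E))\<^sup>2"
    unfolding L proposal_density_eq if_P[OF u(2)] E_def ..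
  also have "\<dots> = (peel_const \<beta> a n)\<^sup>2 * V\<^sup>2 / (\<theta> * E)"
    using E \<theta>_pos by (simp add: power2_eq_square field_simps)
  also have "\<dots> \<le> (peel_const \<beta> a n)\<^sup>2 * (R * exp (\<theta>1 * (u - ?m)))\<^sup>2 / (\<theta> * E)"
    using V V0 E \<theta>_pos by (intro divide_right_mono mult_left_mono power_mono) auto
  also have "\<dots> = (peel_const \<beta> a n * R)\<^sup>2 / \<theta> * ((exp (\<theta>1 * (u - ?m)))\<^sup>2 / E)"
    by (simp add: power_mult_distrib)
  also have "(exp (\<theta>1 * (u - ?m)))\<^sup>2 / E = exp ((2 * \<theta>1 - \<theta>) * (u - ?m))"
  proof -
    have "(exp (\<theta>1 * (u - ?m)))\<^sup>2 / E = exp ((\<theta>1 * (u - ?m) + \<theta>1 * (u - ?m)) - \<theta> * (u - ?m))"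
      by (simp only: E_def power2_eq_square exp_diff exp_add)
    also have "(\<theta>1 * (u - ?m) + \<theta>1 * (u - ?m)) - \<theta> * (u - ?m) = (2 * \<theta>1 - \<theta>) * (u - ?m)"
      by (simp only: left_diff_distrib mult_2 distrib_right)
    finally show ?thesis .
  qed
  finally show ?thesis unfolding if_P[OF u(2)] R_def by (simp only: mult.assoc)
next
  case False
  have "proposal_density p \<beta> y (x (n - 1)) u * (IS_estimator n p \<beta> y (x(n := u)))\<^sup>2 = 0"
  proof (cases "0 < u")
    case True
    then have "\<not> u < min t (x (n - 1))" using False by blast
    then show ?thesis unfolding proposal_density_eq by (simp only: if_False mult_zero_left)
  next
    case False
    then show ?thesis using IS_estimator_eq_0[of "x(n := u)"] by simp
  qed
  moreover have "0 \<le> (peel_const \<beta> a n * laguerre_weight a t * envelope \<beta> t n t' x)\<^sup>2 / \<theta> *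
     (if u < min t (x (n - 1)) then exp ((2 * \<theta>1 - \<theta>) * (u - min t (x (n - 1)))) else 0)"
    using \<theta>_pos by (intro mult_nonneg_nonneg divide_nonneg_pos) auto
  ultimately show ?thesis by (simp only:)
qed

text \<open>The last coordinate is integrated over the whole half-line below the minimum, which
  converges because \<open>2 * \<theta>1 > \<theta>\<close> and gives
  \<open>1 / (2 * \<theta>1 - \<theta>)\<close> whatever the other coordinates are.\<close>

lemma nn_integral_second_moment_le:
  assumes a1: "1 \<le> a" and t': "t < t'" and \<theta>1: "\<theta> < 2 * \<theta>1" "\<theta>1 \<le> (a - 1) / t - 1 / 2 - \<beta> * real (n - 1) / (t' - t)"
  shows "(\<integral>\<^sup>+x. ennreal ((IS_estimator n p \<beta> y x)\<^sup>2) \<partial>sampling_measure n p \<beta> y) \<le>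
    ennreal ((peel_const \<beta> a n * laguerre_weight a t)\<^sup>2 / (\<theta> * (2 * \<theta>1 - \<theta>))) *
     (\<integral>\<^sup>+x. ennreal (ordered_laguerre_density (n - 1) (p - 1) \<beta> x * (envelope \<beta> t n t' x)\<^sup>2) \<partial>lebesgue_power {1..n - 1})"
proof -
  let ?o = "ordered_laguerre_density (n - 1) (p - 1) \<beta>"
  let ?\<kappa> = "2 * \<theta>1 - \<theta>"
  let ?C = "(peel_const \<beta> a n * laguerre_weight a t)\<^sup>2 / \<theta>"
  have \<theta>1': "0 \<le> \<theta>1" using \<theta>1 \<theta>_pos by simp
  have \<kappa>: "0 < ?\<kappa>" using \<theta>1 by simp
  have C: "0 \<le> ?C" using \<theta>_pos by simp
  have o0: "0 \<le> ?o x" for x by (rule ordered_laguerre_density_nonneg[OF \<beta> p_gt(2)])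
  have m: "(\<lambda>x. ennreal ((IS_estimator n p \<beta> y x)\<^sup>2)) \<in> borel_measurable (lebesgue_power {1..n})"
    using borel_measurable_IS_estimator[OF n2, of p \<beta> y] by measurable
  have pw: "ennreal (?o x * proposal_density p \<beta> y (x (n - 1)) u) * ennreal ((IS_estimator n p \<beta> y (x(n := u)))\<^sup>2) \<le>
     ennreal (?C * (?o x * (envelope \<beta> t n t' x)\<^sup>2)) * ennreal (if u < min t (x (n - 1)) then exp (?\<kappa> * (u - min t (x (n - 1)))) else 0)" for x u
  proof -
    let ?w = "if u < min t (x (n - 1)) then exp (?\<kappa> * (u - min t (x (n - 1)))) else 0"
    have "?o x * (proposal_density p \<beta> y (x (n - 1)) u * (IS_estimator n p \<beta> y (x(n := u)))\<^sup>2) \<le>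
      ?o x * ((peel_const \<beta> a n * laguerre_weight a t * envelope \<beta> t n t' x)\<^sup>2 / \<theta> * ?w)"
    proof (cases "decreasing_upto (n - 1) x")
      case True
      show ?thesis by (intro mult_left_mono second_moment_pointwise[OF a1 t' \<theta>1' \<theta>1(2) True] o0)
    next
      case False
      have "?o x = 0" unfolding ordered_laguerre_density_def if_not_P[OF False] ..
      then show ?thesis by simp
    qed
    also have "\<dots> = (?C * (?o x * (envelope \<beta> t n t' x)\<^sup>2)) * ?w"
      by (simp only: power_mult_distrib) (simp add: mult_ac)
    finally have "ennreal (?o x * proposal_density p \<beta> y (x (n - 1)) u * (IS_estimator n p \<beta> y (x(n := u)))\<^sup>2) \<le> ennreal ((?C * (?o x * (envelope \<beta> t n t' x)\<^sup>2)) * ?w)"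
      by (intro ennreal_leI) (simp only: mult.assoc)
    also have "\<dots> = ennreal (?C * (?o x * (envelope \<beta> t n t' x)\<^sup>2)) * ennreal ?w"
      using C o0 by (intro ennreal_mult mult_nonneg_nonneg) auto
    also have "ennreal (?o x * proposal_density p \<beta> y (x (n - 1)) u * (IS_estimator n p \<beta> y (x(n := u)))\<^sup>2) =
      ennreal (?o x * proposal_density p \<beta> y (x (n - 1)) u) * ennreal ((IS_estimator n p \<beta> y (x(n := u)))\<^sup>2)"
      using o0 proposal_density_nonneg[OF y] by (intro ennreal_mult mult_nonneg_nonneg) auto
    finally show ?thesis .
  qed
  have env_m: "(\<lambda>x. ?o x * (envelope \<beta> t n t' x)\<^sup>2) \<in> borel_measurable (lebesgue_power {1..n - 1})"
  proof -
    note [measurable] = borel_measurable_ordered_laguerre_density[OF \<beta> p_gt(2) order_refl]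
      borel_measurable_prod_powr[where J = "{1..n - 1}" and I = "{1..n - 1}" and t = t and c = \<beta>, OF order_refl] pred_all_greater[where J = "{1..n - 1}" and I = "{1..n - 1}" and c = t', OF order_refl finite_atLeastAtMost]
    have [measurable]: "(\<lambda>x. \<Prod>i\<in>{1..n - 1}. \<bar>x i\<bar> powr \<beta>) \<in> borel_measurable (lebesgue_power {1..n - 1})"
      by (intro borel_measurable_prod powr_real_measurable borel_measurable_abs measurable_coord borel_measurable_const) auto
    show ?thesis unfolding envelope_def good_set_def by measurable
  qed
  have "(\<integral>\<^sup>+x. ennreal ((IS_estimator n p \<beta> y x)\<^sup>2) \<partial>sampling_measure n p \<beta> y) =
    (\<integral>\<^sup>+x. (\<integral>\<^sup>+u. ennreal (?o x * proposal_density p \<beta> y (x (n - 1)) u) * ennreal ((IS_estimator n p \<beta> y (x(n := u)))\<^sup>2) \<partial>lborel) \<partial>lebesgue_power {1..n - 1})"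
    by (rule nn_integral_sampling_measure(2)[OF \<beta> y n2 np m])
  also have "\<dots> \<le> (\<integral>\<^sup>+x. (\<integral>\<^sup>+u. ennreal (?C * (?o x * (envelope \<beta> t n t' x)\<^sup>2)) * ennreal (if u < min t (x (n - 1)) then exp (?\<kappa> * (u - min t (x (n - 1)))) else 0) \<partial>lborel) \<partial>lebesgue_power {1..n - 1})"
    by (intro nn_integral_mono pw)
  also have "\<dots> = (\<integral>\<^sup>+x. ennreal (?C / ?\<kappa>) * ennreal (?o x * (envelope \<beta> t n t' x)\<^sup>2) \<partial>lebesgue_power {1..n - 1})"
  proof (intro nn_integral_cong)
    fix x
    have "(\<integral>\<^sup>+u. ennreal (?C * (?o x * (envelope \<beta> t n t' x)\<^sup>2)) * ennreal (if u < min t (x (n - 1)) then exp (?\<kappa> * (u - min t (x (n - 1)))) else 0) \<partial>lborel) =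
      ennreal (?C * (?o x * (envelope \<beta> t n t' x)\<^sup>2)) * (\<integral>\<^sup>+u. ennreal (if u < min t (x (n - 1)) then exp (?\<kappa> * (u - min t (x (n - 1)))) else 0) \<partial>lborel)"
      by (intro nn_integral_cmult) measurable
    also have "\<dots> = ennreal (?C * (?o x * (envelope \<beta> t n t' x)\<^sup>2)) * ennreal (1 / ?\<kappa>)"
      unfolding nn_integral_exp_below[OF \<kappa>] ..
    also have "\<dots> = ennreal (?C * (?o x * (envelope \<beta> t n t' x)\<^sup>2) * (1 / ?\<kappa>))"
      using C o0 \<kappa> by (intro ennreal_mult[symmetric] mult_nonneg_nonneg) auto
    also have "?C * (?o x * (envelope \<beta> t n t' x)\<^sup>2) * (1 / ?\<kappa>) = ?C / ?\<kappa> * (?o x * (envelope \<beta> t n t' x)\<^sup>2)" by simp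
    also have "ennreal (?C / ?\<kappa> * (?o x * (envelope \<beta> t n t' x)\<^sup>2)) = ennreal (?C / ?\<kappa>) * ennreal (?o x * (envelope \<beta> t n t' x)\<^sup>2)"
      using C o0 \<kappa> by (intro ennreal_mult mult_nonneg_nonneg divide_nonneg_pos[OF C]) auto
    finally show "(\<integral>\<^sup>+u. ennreal (?C * (?o x * (envelope \<beta> t n t' x)\<^sup>2)) * ennreal (if u < min t (x (n - 1)) then exp (?\<kappa> * (u - min t (x (n - 1)))) else 0) \<partial>lborel) =
      ennreal (?C / ?\<kappa>) * ennreal (?o x * (envelope \<beta> t n t' x)\<^sup>2)" .
  qed
  also have "\<dots> = ennreal (?C / ?\<kappa>) * (\<integral>\<^sup>+x. ennreal (?o x * (envelope \<beta> t n t' x)\<^sup>2) \<partial>lebesgue_power {1..n - 1})"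
    using env_m by (intro nn_integral_cmult) simp
  also have "?C / ?\<kappa> = (peel_const \<beta> a n * laguerre_weight a t)\<^sup>2 / (\<theta> * ?\<kappa>)" by simp
  finally show ?thesis .
qed

text \<open>For \<open>u < t\<close> each \<open>x i - u\<close> exceeds \<open>x i - t\<close>, so
  the interaction is bounded below by its value at \<open>t\<close> and decouples from the last
  coordinate. Bad configurations are dropped.\<close>

lemma first_moment_ge:
  assumes t': "t < t'"
  shows "ennreal (peel_const \<beta> a n) * (\<integral>\<^sup>+u. ennreal (if u < t then laguerre_weight a u else 0) \<partial>lborel) *
     (\<integral>\<^sup>+x. ennreal (ordered_laguerre_density (n - 1) (p - 1) \<beta> x * (if good_set n t' x then \<Prod>i\<in>{1..n - 1}. (x i - t) powr \<beta> else 0)) \<partial>lebesgue_power {1..n - 1})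
    \<le> ennreal (smallest_eigenvalue_prob n p \<beta> t)"
proof -
  let ?o = "ordered_laguerre_density (n - 1) (p - 1) \<beta>"
  let ?g = "\<lambda>x. if good_set n t' x then \<Prod>i\<in>{1..n - 1}. (x i - t) powr \<beta> else 0"
  let ?W = "\<integral>\<^sup>+u. ennreal (if u < t then laguerre_weight a u else 0) \<partial>lborel"
  have o0: "0 \<le> ?o x" for x by (rule ordered_laguerre_density_nonneg[OF \<beta> p_gt(2)])
  have g0: "0 \<le> ?g x" for x by (simp add: prod_nonneg)
  have pc: "0 \<le> peel_const \<beta> a n" using peel_const_pos by simp
  have m: "(\<lambda>x. ennreal (IS_estimator n p \<beta> y x)) \<in> borel_measurable (lebesgue_power {1..n})"
    using borel_measurable_IS_estimator[OF n2, of p \<beta> y] by measurable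
  have pw: "ennreal (peel_const \<beta> a n * (?o x * ?g x)) * ennreal (if u < t then laguerre_weight a u else 0) \<le>
    ennreal (?o x * proposal_density p \<beta> y (x (n - 1)) u) * ennreal (IS_estimator n p \<beta> y (x(n := u)))" for x u
  proof (cases "good_set n t' x \<and> 0 < u \<and> u < t")
    case True
    then have gi: "t' < x i" if "i \<in> {1..n - 1}" for i using that by (auto simp: good_set_def)
    have u: "0 < u" "u < t" using True by auto
    have "n - 1 \<in> {1..n - 1}" using n2 by auto
    from gi[OF this] have mt: "min t (x (n - 1)) = t" using t' by simp
    have ne: "n - 1 \<noteq> n" using n2 by arith
    have um: "u < min t (x (n - 1))" using mt u by simp
    define E where "E = \<theta> * exp (\<theta> * (u - t))"
    have E: "E > 0" using \<theta>_pos by (simp add: E_def)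
    have "(\<Prod>i\<in>{1..n - 1}. ((x(n := u)) i - (x(n := u)) n) powr \<beta>) = (\<Prod>i\<in>{1..n - 1}. (x i - u) powr \<beta>)"
      using n2 by (intro prod.cong) auto
    then have L: "IS_estimator n p \<beta> y (x(n := u)) = peel_const \<beta> a n * (\<Prod>i\<in>{1..n - 1}. (x i - u) powr \<beta>) * laguerre_weight a u / E"
      using IS_estimator_eq[of "x(n := u)"] u ne mt unfolding E_def by simp
    have q: "proposal_density p \<beta> y (x (n - 1)) u = E"
      unfolding proposal_density_eq mt unfolding if_P[OF u(2)] E_def ..
    have "?g x \<le> (\<Prod>i\<in>{1..n - 1}. (x i - u) powr \<beta>)"
    proof -
      have "(\<Prod>i\<in>{1..n - 1}. (x i - t) powr \<beta>) \<le> (\<Prod>i\<in>{1..n - 1}. (x i - u) powr \<beta>)"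
      proof (intro prod_mono conjI powr_mono2)
        fix i assume "i \<in> {1..n - 1}"
        from gi[OF this] show "0 \<le> x i - t" "x i - t \<le> x i - u" using t' u by auto
      qed (use \<beta> in auto)
      then show ?thesis using True by simp
    qed
    then have "peel_const \<beta> a n * (?o x * ?g x) * laguerre_weight a u \<le> peel_const \<beta> a n * (?o x * (\<Prod>i\<in>{1..n - 1}. (x i - u) powr \<beta>)) * laguerre_weight a u"
      using o0 pc by (intro mult_right_mono mult_left_mono) auto
    also have "\<dots> = (?o x * E) * (peel_const \<beta> a n * (\<Prod>i\<in>{1..n - 1}. (x i - u) powr \<beta>) * laguerre_weight a u / E)"
      using E by simp
    finally have "ennreal (peel_const \<beta> a n * (?o x * ?g x) * laguerre_weight a u) \<le> ennreal ((?o x * E) * IS_estimator n p \<beta> y (x(n := u)))"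
      unfolding L by (rule ennreal_leI)
    moreover have "ennreal (peel_const \<beta> a n * (?o x * ?g x) * laguerre_weight a u) = ennreal (peel_const \<beta> a n * (?o x * ?g x)) * ennreal (laguerre_weight a u)"
      using o0 pc g0 by (intro ennreal_mult mult_nonneg_nonneg) auto
    moreover have "ennreal ((?o x * E) * IS_estimator n p \<beta> y (x(n := u))) = ennreal (?o x * E) * ennreal (IS_estimator n p \<beta> y (x(n := u)))"
      using o0 E IS_estimator_nonneg by (intro ennreal_mult mult_nonneg_nonneg) auto
    ultimately show ?thesis unfolding q if_P[OF u(2)] by (simp only:)
  next
    case False
    have "ennreal (peel_const \<beta> a n * (?o x * ?g x)) * ennreal (if u < t then laguerre_weight a u else 0) = 0"
    proof (cases "good_set n t' x")
      case True
      then have "u \<le> 0 \<or> \<not> u < t" using False by linarith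
      then have "(if u < t then laguerre_weight a u else 0) = 0" by (auto simp: laguerre_weight_def)
      then show ?thesis by (simp only: ennreal_0 mult_zero_right)
    next
      case ng: False
      show ?thesis unfolding if_not_P[OF ng] by (simp only: ennreal_0 mult_zero_right mult_zero_left)
    qed
    then show ?thesis by (simp only: zero_le)
  qed
  note [measurable] = borel_measurable_ordered_laguerre_density[OF \<beta> p_gt(2) order_refl]
    borel_measurable_prod_powr[where J = "{1..n - 1}" and I = "{1..n - 1}" and t = t and c = \<beta>, OF order_refl] pred_all_greater[where J = "{1..n - 1}" and I = "{1..n - 1}" and c = t', OF order_refl finite_atLeastAtMost]
  have gm: "(\<lambda>x. ennreal (?o x * ?g x)) \<in> borel_measurable (lebesgue_power {1..n - 1})"
    unfolding good_set_def by measurable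
  have "ennreal (peel_const \<beta> a n) * ?W * (\<integral>\<^sup>+x. ennreal (?o x * ?g x) \<partial>lebesgue_power {1..n - 1}) =
    (\<integral>\<^sup>+x. (ennreal (peel_const \<beta> a n) * ?W) * ennreal (?o x * ?g x) \<partial>lebesgue_power {1..n - 1})"
    using gm by (intro nn_integral_cmult[symmetric])
  also have "\<dots> = (\<integral>\<^sup>+x. (\<integral>\<^sup>+u. ennreal (peel_const \<beta> a n * (?o x * ?g x)) * ennreal (if u < t then laguerre_weight a u else 0) \<partial>lborel) \<partial>lebesgue_power {1..n - 1})"
  proof (intro nn_integral_cong)
    fix x
    have "(\<integral>\<^sup>+u. ennreal (peel_const \<beta> a n * (?o x * ?g x)) * ennreal (if u < t then laguerre_weight a u else 0) \<partial>lborel) =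
      ennreal (peel_const \<beta> a n * (?o x * ?g x)) * ?W"
      by (intro nn_integral_cmult) measurable
    moreover have "ennreal (peel_const \<beta> a n * (?o x * ?g x)) = ennreal (peel_const \<beta> a n) * ennreal (?o x * ?g x)"
      using o0 pc g0 by (intro ennreal_mult mult_nonneg_nonneg) auto
    ultimately have F: "(\<integral>\<^sup>+u. ennreal (peel_const \<beta> a n * (?o x * ?g x)) * ennreal (if u < t then laguerre_weight a u else 0) \<partial>lborel) = ennreal (peel_const \<beta> a n) * ennreal (?o x * ?g x) * ?W" by (simp only:)
    show "(ennreal (peel_const \<beta> a n) * ?W) * ennreal (?o x * ?g x) = (\<integral>\<^sup>+u. ennreal (peel_const \<beta> a n * (?o x * ?g x)) * ennreal (if u < t then laguerre_weight a u else 0) \<partial>lborel)"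
      unfolding F
      by (simp only: mult_ac)
  qed
  also have "\<dots> \<le> (\<integral>\<^sup>+x. (\<integral>\<^sup>+u. ennreal (?o x * proposal_density p \<beta> y (x (n - 1)) u) * ennreal (IS_estimator n p \<beta> y (x(n := u))) \<partial>lborel) \<partial>lebesgue_power {1..n - 1})"
    by (intro nn_integral_mono pw)
  also have "\<dots> = (\<integral>\<^sup>+x. ennreal (IS_estimator n p \<beta> y x) \<partial>sampling_measure n p \<beta> y)"
    by (rule nn_integral_sampling_measure(2)[OF \<beta> y n2 np m, symmetric])
  also have "\<dots> = ennreal (smallest_eigenvalue_prob n p \<beta> t)" by (rule nn_integral_IS_estimator)
  finally show ?thesis .
qed

end

section \<open>The relative second moment\<close>

context
  fixes \<beta> q a t t' :: real and m :: nat
  assumes \<beta>: "0 < \<beta>" and q: "real m - 1 < q" and a_def: "a = \<beta> * (q - real m + 1) / 2"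
    and t: "0 < t" "t < t'"
begin

lemma ordered_laguerre_density_good_eq:
  "ordered_laguerre_density m q \<beta> x * (if \<forall>i\<in>{1..m}. t' < x i then h else 0) =
    fact m / laguerre_selberg \<beta> m a * (good_weight \<beta> a m t' x * h)"
proof -
  have "(if D then c * (w / s) else 0) * (if G then h else 0) = c / s * ((if D \<and> G then w else 0) * h)"
    for D G and c w s :: real
    by simp
  then show ?thesis
    unfolding ordered_laguerre_density_eq[OF \<beta> q] a_def[symmetric] good_weight_def .
qed

lemma nn_integral_ordered_good_eq:
  assumes "\<And>x. 0 \<le> h x" and [measurable]: "h \<in> borel_measurable (lebesgue_power {1..m})"
  shows "(\<integral>\<^sup>+x. ennreal (ordered_laguerre_density m q \<beta> x * (if \<forall>i\<in>{1..m}. t' < x i then h x else 0)) \<partial>lebesgue_power {1..m}) =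
    ennreal (fact m / laguerre_selberg \<beta> m a) * (\<integral>\<^sup>+x. ennreal (good_weight \<beta> a m t' x * h x) \<partial>lebesgue_power {1..m})"
proof -
  have a: "0 < a" using \<beta> q by (simp add: a_def)
  have S: "0 \<le> fact m / laguerre_selberg \<beta> m a" using laguerre_selberg_pos[OF \<beta> a, of m] by simp
  note [measurable] = borel_measurable_good_weight
  show ?thesis
    unfolding ordered_laguerre_density_good_eq
    by (subst nn_integral_cmult[symmetric], measurable)
       (intro nn_integral_cong ennreal_mult S mult_nonneg_nonneg good_weight_nonneg assms(1))
qed

lemma nn_integral_ordered_density_1:
  "(\<integral>\<^sup>+x. ennreal (ordered_laguerre_density m q \<beta> x) \<partial>lebesgue_power {1..m}) = 1"
proof -
  have "(\<integral>\<^sup>+x. ennreal (ordered_laguerre_density m q \<beta> x * 1) \<partial>lebesgue_power {1..m}) =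
    (\<integral>\<^sup>+x. ennreal (laguerre_density m q \<beta> x * 1) \<partial>lebesgue_power {1..m})"
    by (intro nn_integral_ordered_density \<beta> q) (auto simp: symmetric_on_def)
  then show ?thesis by (simp only: mult_1_right nn_integral_laguerre_density[OF \<beta> q])
qed

text \<open>Being bad means that some coordinate is at most \<open>t'\<close>, a symmetric event, so
  the estimate for the unordered ensemble carries over.\<close>

lemma ordered_laguerre_density_tail:
  assumes "2 \<le> m" "0 < \<rho>" "\<rho> < 1" "0 \<le> c" "t' \<le> 2 * (a + c)"
  shows "(\<integral>\<^sup>+x. ennreal (ordered_laguerre_density m q \<beta> x *
       (if \<forall>i\<in>{1..m}. t' < x i then 0 else \<Prod>i\<in>{1..m}. \<bar>x i\<bar> powr c)) \<partial>lebesgue_power {1..m}) \<le>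
    ennreal (laguerre_selberg \<beta> m (a + c) / laguerre_selberg \<beta> m a * exp (tail_exponent \<beta> \<rho> m (a + c) t'))"
proof -
  let ?H = "\<lambda>x. (\<Prod>i\<in>{1..m}. \<bar>x i\<bar> powr c) * (if \<exists>i\<in>{1..m}. x i \<le> t' then 1 else 0)"
  have H: "(if \<forall>i\<in>{1..m}. t' < x i then 0 else \<Prod>i\<in>{1..m}. \<bar>x i\<bar> powr c) = ?H x" for x
  proof -
    have "(\<exists>i\<in>{1..m}. x i \<le> t') \<longleftrightarrow> \<not> (\<forall>i\<in>{1..m}. t' < x i)" by (meson not_le)
    moreover have "(if G then 0 else w) = w * (if \<not> G then 1 else 0)" for G and w :: real by simp
    ultimately show ?thesis by (simp only:)
  qed
  have "(\<integral>\<^sup>+x. ennreal (ordered_laguerre_density m q \<beta> x * ?H x) \<partial>lebesgue_power {1..m}) =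
    (\<integral>\<^sup>+x. ennreal (laguerre_density m q \<beta> x * ?H x) \<partial>lebesgue_power {1..m})"
  proof (rule nn_integral_ordered_density[OF \<beta> q])
    have [measurable]: "Measurable.pred (lebesgue_power {1..m}) (\<lambda>x. \<exists>i\<in>{1..m}. x i \<le> t')"
      by (intro pred_intros_finite(4) borel_measurable_pred_less measurable_coord) (auto intro!: borel_measurable_const)
    have [measurable]: "(\<lambda>x. \<Prod>i\<in>{1..m}. \<bar>x i\<bar> powr c) \<in> borel_measurable (lebesgue_power {1..m})"
      by (intro borel_measurable_prod powr_real_measurable borel_measurable_abs measurable_coord borel_measurable_const) auto
    show "?H \<in> borel_measurable (lebesgue_power {1..m})" by measurable
    have "symmetric_on {1..m} (\<lambda>x. (\<lambda>X. if \<exists>z\<in>X. z \<le> t' then 1 else (0::real)) (x ` {1..m}))" by (rule symmetric_on_image)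
    then have "symmetric_on {1..m} (\<lambda>x. if \<exists>i\<in>{1..m}. x i \<le> t' then 1 else (0::real))" by (simp only: Set.bex_simps(7))
    then show "symmetric_on {1..m} ?H" by (rule symmetric_on_comb2[OF symmetric_on_prod])
    show "0 \<le> ?H x" for x by (intro mult_nonneg_nonneg prod_nonneg) auto
  qed
  also have "\<dots> \<le> ennreal (laguerre_selberg \<beta> m (a + c) / laguerre_selberg \<beta> m a * exp (tail_exponent \<beta> \<rho> m (a + c) t'))"
    unfolding a_def using t assms \<beta> q by (intro laguerre_density_tail) (auto simp: a_def)
  finally show ?thesis unfolding H .
qed

text \<open>The good mass appears as a factor in the second-moment inequality; this keeps it away
  from 0, so that it can be divided out.\<close>

lemma ordered_good_mass:
  assumes "2 \<le> m" "0 < \<rho>" "\<rho> < 1" "t' \<le> 2 * a"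
  shows "1 \<le> (\<integral>\<^sup>+x. ennreal (ordered_laguerre_density m q \<beta> x * (if \<forall>i\<in>{1..m}. t' < x i then 1 else 0)) \<partial>lebesgue_power {1..m}) +
     ennreal (exp (tail_exponent \<beta> \<rho> m a t'))"
    and "(\<integral>\<^sup>+x. ennreal (ordered_laguerre_density m q \<beta> x * (if \<forall>i\<in>{1..m}. t' < x i then 1 else 0)) \<partial>lebesgue_power {1..m}) \<le> 1"
proof -
  let ?o = "ordered_laguerre_density m q \<beta>"
  let ?G = "\<lambda>x. \<forall>i\<in>{1..m}. t' < x i"
  let ?B = "\<lambda>x :: nat \<Rightarrow> real. if ?G x then 0 else \<Prod>i\<in>{1..m}. \<bar>x i\<bar> powr 0"
  have o0: "0 \<le> ?o x" for x by (rule ordered_laguerre_density_nonneg[OF \<beta> q])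
  have a: "0 < a" using \<beta> q by (simp add: a_def)
  note [measurable] = borel_measurable_ordered_laguerre_density[OF \<beta> q order_refl] pred_all_greater[OF order_refl finite_atLeastAtMost]
  have m1: "(\<lambda>x. ennreal (?o x * (if ?G x then 1 else 0))) \<in> borel_measurable (lebesgue_power {1..m})"
    by measurable
  have [measurable]: "(\<lambda>x. \<Prod>i\<in>{1..m}. \<bar>x i\<bar> powr (0::real)) \<in> borel_measurable (lebesgue_power {1..m})"
    by (intro borel_measurable_prod powr_real_measurable borel_measurable_abs measurable_coord borel_measurable_const) auto
  have m2: "(\<lambda>x. ennreal (?o x * ?B x)) \<in> borel_measurable (lebesgue_power {1..m})"
    by measurable
  \<comment> \<open>\<open>\<bar>x i\<bar> powr 0\<close> is 1 except at \<open>x i = 0\<close>,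
    where \<open>powr\<close> returns 0. The exceptional points are treated afterwards; the density
    vanishes there.\<close>
  have pw: "ennreal (?o x) \<le> ennreal (?o x * (if ?G x then 1 else 0)) + ennreal (?o x * ?B x)" if "\<forall>i\<in>{1..m}. x i \<noteq> 0" for x
  proof (cases "?G x")
    case True
    show ?thesis unfolding if_P[OF True] by simp
  next
    case False
    have "(\<Prod>i\<in>{1..m}. \<bar>x i\<bar> powr 0) = 1" using that by (intro prod.neutral) auto
    then show ?thesis unfolding if_not_P[OF False] by simp
  qed
  have pw: "ennreal (?o x) \<le> ennreal (?o x * (if ?G x then 1 else 0)) + ennreal (?o x * ?B x)" for x
  proof (cases "\<forall>i\<in>{1..m}. x i \<noteq> 0")
    case True
    then show ?thesis by (rule pw)
  next
    case False
    then have "\<not> (\<forall>l\<in>{1..m}. 0 < x l)" by force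
    from smooth_laguerre_eq_0[OF finite_atLeastAtMost this] have "?o x = 0"
      unfolding ordered_laguerre_density_eq[OF \<beta> q] by (simp only: div_0 mult_zero_right if_cancel)
    then show ?thesis by (simp only: ennreal_0 mult_zero_left zero_le)
  qed
  have "1 = (\<integral>\<^sup>+x. ennreal (?o x) \<partial>lebesgue_power {1..m})" by (simp only: nn_integral_ordered_density_1)
  also have "\<dots> \<le> (\<integral>\<^sup>+x. ennreal (?o x * (if ?G x then 1 else 0)) + ennreal (?o x * ?B x) \<partial>lebesgue_power {1..m})"
    by (intro nn_integral_mono pw)
  also have "\<dots> = (\<integral>\<^sup>+x. ennreal (?o x * (if ?G x then 1 else 0)) \<partial>lebesgue_power {1..m}) +
     (\<integral>\<^sup>+x. ennreal (?o x * ?B x) \<partial>lebesgue_power {1..m})"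
    by (intro nn_integral_add m1 m2)
  also have "\<dots> \<le> (\<integral>\<^sup>+x. ennreal (?o x * (if ?G x then 1 else 0)) \<partial>lebesgue_power {1..m}) +
     ennreal (laguerre_selberg \<beta> m (a + 0) / laguerre_selberg \<beta> m a * exp (tail_exponent \<beta> \<rho> m (a + 0) t'))"
    using assms by (intro add_left_mono ordered_laguerre_density_tail) auto
  also have "laguerre_selberg \<beta> m (a + 0) / laguerre_selberg \<beta> m a * exp (tail_exponent \<beta> \<rho> m (a + 0) t') = exp (tail_exponent \<beta> \<rho> m a t')"
    using laguerre_selberg_pos[OF \<beta> a, of m] by simp
  finally show "1 \<le> (\<integral>\<^sup>+x. ennreal (?o x * (if ?G x then 1 else 0)) \<partial>lebesgue_power {1..m}) + ennreal (exp (tail_exponent \<beta> \<rho> m a t'))" .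
  have "(\<integral>\<^sup>+x. ennreal (?o x * (if ?G x then 1 else 0)) \<partial>lebesgue_power {1..m}) \<le> (\<integral>\<^sup>+x. ennreal (?o x) \<partial>lebesgue_power {1..m})"
    using o0 by (intro nn_integral_mono ennreal_leI) (simp add: mult_left_le)
  then show "(\<integral>\<^sup>+x. ennreal (?o x * (if ?G x then 1 else 0)) \<partial>lebesgue_power {1..m}) \<le> 1"
    by (simp only: nn_integral_ordered_density_1)
qed

text \<open>Both sides are quadratic in the normalising factor, so the inequality passes from the
  bare weight to the density.\<close>

lemma ordered_good_second_moment:
  assumes "1 < a"
  shows "(\<integral>\<^sup>+x. ennreal (ordered_laguerre_density m q \<beta> x * (if \<forall>i\<in>{1..m}. t' < x i then \<Prod>i\<in>{1..m}. (x i - t) powr (2 * \<beta>) else 0)) \<partial>lebesgue_power {1..m}) *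
      (\<integral>\<^sup>+x. ennreal (ordered_laguerre_density m q \<beta> x * (if \<forall>i\<in>{1..m}. t' < x i then 1 else 0)) \<partial>lebesgue_power {1..m}) \<le>
    ennreal (exp (real m * (\<beta>\<^sup>2 * (t' / (t' - t))\<^sup>2 / (a - 1)))) *
      (\<integral>\<^sup>+x. ennreal (ordered_laguerre_density m q \<beta> x * (if \<forall>i\<in>{1..m}. t' < x i then \<Prod>i\<in>{1..m}. (x i - t) powr \<beta> else 0)) \<partial>lebesgue_power {1..m})\<^sup>2"
proof -
  let ?f = "ennreal (fact m / laguerre_selberg \<beta> m a)"
  have mp: "(\<lambda>x. \<Prod>i\<in>{1..m}. (x i - t) powr c) \<in> borel_measurable (lebesgue_power {1..m})" for c
    by (rule borel_measurable_prod_powr[OF order_refl])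
  have pp: "0 \<le> (\<Prod>i\<in>{1..m}. (x i - t) powr c)" for x :: "nat \<Rightarrow> real" and c by (simp add: prod_nonneg)
  have scale: "(f * A) * (f * B) \<le> E * (f * S)\<^sup>2" if "A * B \<le> E * S\<^sup>2" for f A B E S :: ennreal
    using mult_left_mono[OF that, of "f * f"] by (simp add: power2_eq_square mult_ac)
  have one: "(\<integral>\<^sup>+x. ennreal (ordered_laguerre_density m q \<beta> x * (if \<forall>i\<in>{1..m}. t' < x i then 1 else 0)) \<partial>lebesgue_power {1..m}) =
     ?f * (\<integral>\<^sup>+x. ennreal (good_weight \<beta> a m t' x * 1) \<partial>lebesgue_power {1..m})"
    by (rule nn_integral_ordered_good_eq) auto
  show ?thesis
    unfolding nn_integral_ordered_good_eq[OF pp mp] one mult_1_right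
    by (rule scale[OF good_second_moment[OF \<beta> assms t]])
qed

text \<open>A crude lower bound of exponential order, good enough as the yardstick for the bad part
  of the second moment, which is smaller by a factor \<open>exp (- c * p)\<close> up to
  \<open>exp (o(p))\<close>.\<close>

lemma ordered_good_first_moment_ge:
  "ennreal ((t' - t) powr (\<beta> * real m)) *
      (\<integral>\<^sup>+x. ennreal (ordered_laguerre_density m q \<beta> x * (if \<forall>i\<in>{1..m}. t' < x i then 1 else 0)) \<partial>lebesgue_power {1..m}) \<le>
    (\<integral>\<^sup>+x. ennreal (ordered_laguerre_density m q \<beta> x * (if \<forall>i\<in>{1..m}. t' < x i then \<Prod>i\<in>{1..m}. (x i - t) powr \<beta> else 0)) \<partial>lebesgue_power {1..m})"
proof -
  let ?o = "ordered_laguerre_density m q \<beta>"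
  let ?G = "\<lambda>x. \<forall>i\<in>{1..m}. t' < x i"
  have o0: "0 \<le> ?o x" for x by (rule ordered_laguerre_density_nonneg[OF \<beta> q])
  note [measurable] = borel_measurable_ordered_laguerre_density[OF \<beta> q order_refl] pred_all_greater[OF order_refl finite_atLeastAtMost]
  have m1: "(\<lambda>x. ennreal (?o x * (if ?G x then 1 else 0))) \<in> borel_measurable (lebesgue_power {1..m})"
    by measurable
  have "ennreal ((t' - t) powr (\<beta> * real m)) * ennreal (?o x * (if ?G x then 1 else 0)) \<le>
    ennreal (?o x * (if ?G x then \<Prod>i\<in>{1..m}. (x i - t) powr \<beta> else 0))" for x
  proof (cases "?G x")
    case True
    have "(t' - t) powr (\<beta> * real m) = (\<Prod>i\<in>{1..m}. (t' - t) powr \<beta>)"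
      using t by (simp add: powr_powr[symmetric] powr_realpow)
    also have "\<dots> \<le> (\<Prod>i\<in>{1..m}. (x i - t) powr \<beta>)"
    proof (intro prod_mono conjI powr_mono2)
      fix i assume "i \<in> {1..m}"
      with True have "t' < x i" by blast
      then show "t' - t \<le> x i - t" by simp
    qed (use t \<beta> in auto)
    finally have "(t' - t) powr (\<beta> * real m) * ?o x \<le> (\<Prod>i\<in>{1..m}. (x i - t) powr \<beta>) * ?o x"
      by (rule mult_right_mono[OF _ o0])
    then have "ennreal ((t' - t) powr (\<beta> * real m) * ?o x) \<le> ennreal (?o x * (\<Prod>i\<in>{1..m}. (x i - t) powr \<beta>))"
      by (intro ennreal_leI) (simp only: mult.commute)
    then show ?thesis unfolding if_P[OF True] mult_1_right using o0 by (simp only: ennreal_mult powr_ge_zero)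
  next
    case False
    show ?thesis unfolding if_not_P[OF False] by simp
  qed
  then show ?thesis by (subst nn_integral_cmult[OF m1, symmetric]) (rule nn_integral_mono)
qed

end

text \<open>The two branches of the envelope have disjoint supports, so its square splits without a
  cross term.\<close>

lemma ordered_envelope_split:
  assumes \<beta>: "0 < \<beta>" and q: "real (n - 1) - 1 < q" and t: "t < t'"
  shows "(\<integral>\<^sup>+x. ennreal (ordered_laguerre_density (n - 1) q \<beta> x * (envelope \<beta> t n t' x)\<^sup>2) \<partial>lebesgue_power {1..n - 1}) =
   (\<integral>\<^sup>+x. ennreal (ordered_laguerre_density (n - 1) q \<beta> x * (if \<forall>i\<in>{1..n - 1}. t' < x i then \<Prod>i\<in>{1..n - 1}. (x i - t) powr (2 * \<beta>) else 0)) \<partial>lebesgue_power {1..n - 1}) +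
   (\<integral>\<^sup>+x. ennreal (ordered_laguerre_density (n - 1) q \<beta> x * (if \<forall>i\<in>{1..n - 1}. t' < x i then 0 else \<Prod>i\<in>{1..n - 1}. \<bar>x i\<bar> powr (2 * \<beta>))) \<partial>lebesgue_power {1..n - 1})"
proof -
  let ?o = "ordered_laguerre_density (n - 1) q \<beta>"
  let ?I = "{1..n - 1}"
  let ?G = "\<lambda>x. \<forall>i\<in>?I. t' < x i"
  note [measurable] = borel_measurable_ordered_laguerre_density[OF \<beta> q order_refl] pred_all_greater[OF order_refl finite_atLeastAtMost]
    borel_measurable_prod_powr[OF order_refl]
  have [measurable]: "(\<lambda>x. \<Prod>i\<in>?I. \<bar>x i\<bar> powr (2 * \<beta>)) \<in> borel_measurable (lebesgue_power ?I)"
    by (intro borel_measurable_prod powr_real_measurable borel_measurable_abs measurable_coord borel_measurable_const) auto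
  have m1: "(\<lambda>x. ennreal (?o x * (if ?G x then \<Prod>i\<in>?I. (x i - t) powr (2 * \<beta>) else 0))) \<in> borel_measurable (lebesgue_power ?I)"
    by measurable
  have m2: "(\<lambda>x. ennreal (?o x * (if ?G x then 0 else \<Prod>i\<in>?I. \<bar>x i\<bar> powr (2 * \<beta>)))) \<in> borel_measurable (lebesgue_power ?I)"
    by measurable
  have pp: "(z powr \<beta>)\<^sup>2 = z powr (2 * \<beta>)" for z :: real
    by (simp only: power2_eq_square mult_2 powr_add)
  have "ennreal (?o x * (envelope \<beta> t n t' x)\<^sup>2) =
    ennreal (?o x * (if ?G x then \<Prod>i\<in>?I. (x i - t) powr (2 * \<beta>) else 0)) +
    ennreal (?o x * (if ?G x then 0 else \<Prod>i\<in>?I. \<bar>x i\<bar> powr (2 * \<beta>)))" for x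
  proof -
    have "ennreal (w * (if G then u else v)\<^sup>2) = ennreal (w * (if G then u\<^sup>2 else 0)) + ennreal (w * (if G then 0 else v\<^sup>2))"
      for G and u v w :: real
      by simp
    note E = this[of "?o x" "?G x" "\<Prod>i\<in>?I. (x i - t) powr \<beta>" "\<Prod>i\<in>?I. \<bar>x i\<bar> powr \<beta>"]
    show ?thesis unfolding envelope_def good_set_def by (rule E[unfolded prod_power_distrib pp])
  qed
  then show ?thesis by (simp only: nn_integral_add[OF m1 m2])
qed


text \<open>The final estimate in real numbers, separated from \<open>ennreal\<close>. Here
  \<open>s1\<close> and \<open>s2\<close> are the good first and second moments, \<open>g\<close> is
  the good mass, \<open>b\<close> the bad second moment, \<open>T1\<close> bounds the bad mass and
  \<open>T2\<close> bounds \<open>b\<close>; \<open>wt * j\<close> bounds the one-point integral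
  from below, \<open>k\<close> is \<open>\<theta> * (2 * \<theta>1 - \<theta>)\<close>, and
  \<open>D\<close> is the yardstick for \<open>s1\<close>.\<close>

lemma relative_second_moment_arith:
  fixes C pc wt j W s1 s2 g b P e T1 T2 D k :: real
  assumes pos: "0 < pc" "0 < wt" "0 < j" "0 < k" "0 < D" "0 \<le> e" "0 \<le> T2" "0 \<le> s1"
    and P: "pc * (wt * j) * s1 \<le> P" and g: "1 - T1 \<le> g" and T1: "T1 < 1"
    and s2: "s2 * g \<le> e * s1\<^sup>2" and D: "D * g \<le> s1" and b: "b \<le> T2"
  shows "0 < P"
    and "(pc * wt)\<^sup>2 / k * (s2 + b) \<le> P\<^sup>2 * (1 / (j\<^sup>2 * k) * (e / (1 - T1) + T2 / (D * (1 - T1))\<^sup>2))"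
proof -
  have g0: "0 < 1 - T1" "0 < g" using g T1 by auto
  have "D * (1 - T1) \<le> D * g" using pos g by simp
  then have s1: "D * (1 - T1) \<le> s1" using D by simp
  have Dg: "0 < D * (1 - T1)" using pos g0 by simp
  have s1p: "0 < s1" using Dg s1 by simp
  show Pp: "0 < P"
    using pos s1p by (intro less_le_trans[OF _ P]) simp
  have "s2 \<le> e * s1\<^sup>2 / g" using s2 g0 by (simp add: pos_le_divide_eq)
  also have "\<dots> \<le> e * s1\<^sup>2 / (1 - T1)" using g0 g pos by (intro divide_left_mono) auto
  finally have s2': "s2 \<le> s1\<^sup>2 * (e / (1 - T1))" by (simp add: mult.commute)
  have "1 \<le> (s1 / (D * (1 - T1)))\<^sup>2" using s1 Dg by (simp add: one_le_power)
  then have "T2 * 1 \<le> T2 * (s1 / (D * (1 - T1)))\<^sup>2" using pos by (intro mult_left_mono)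
  then have "b \<le> s1\<^sup>2 * (T2 / (D * (1 - T1))\<^sup>2)" using b by (simp add: power_divide mult.commute)
  with s2' have sb: "s2 + b \<le> s1\<^sup>2 * (e / (1 - T1) + T2 / (D * (1 - T1))\<^sup>2)" by (simp add: distrib_left)
  have nn: "0 \<le> e / (1 - T1) + T2 / (D * (1 - T1))\<^sup>2" using pos g0 by simp
  have "(pc * wt)\<^sup>2 / k * (s2 + b) \<le> (pc * wt)\<^sup>2 / k * (s1\<^sup>2 * (e / (1 - T1) + T2 / (D * (1 - T1))\<^sup>2))"
    using pos sb by (intro mult_left_mono) auto
  also have "\<dots> = (pc * (wt * j) * s1)\<^sup>2 * (1 / (j\<^sup>2 * k) * (e / (1 - T1) + T2 / (D * (1 - T1))\<^sup>2))"
    using pos by (simp add: power_mult_distrib)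
  also have "\<dots> \<le> P\<^sup>2 * (1 / (j\<^sup>2 * k) * (e / (1 - T1) + T2 / (D * (1 - T1))\<^sup>2))"
    using pos s1p P nn by (intro mult_right_mono power_mono mult_nonneg_nonneg) auto
  finally show "(pc * wt)\<^sup>2 / k * (s2 + b) \<le> P\<^sup>2 * (1 / (j\<^sup>2 * k) * (e / (1 - T1) + T2 / (D * (1 - T1))\<^sup>2))" .
qed

text \<open>A bound for fixed \<open>n\<close> and \<open>p\<close> in which every error is
  explicit. The factor before the bracket compares the two integrals over the last coordinate; the
  bracket contains the fluctuation over good configurations and the bad part.
  \<open>3 \<le> n\<close> leaves the two eigenvalues that the tail bound asks for.\<close>

lemma relative_second_moment_le:
  fixes \<beta> y p a t \<theta> \<theta>1 \<delta> t' \<rho> :: real and n :: nat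
  defines "K \<equiv> (a - 1) / (t * (1 - \<delta>)) - 1 / 2"
    and "T1 \<equiv> exp (tail_exponent \<beta> \<rho> (n - 1) a t')"
  assumes ctx: "0 < \<beta>" "0 < y" "y < \<beta>" "2 \<le> n" "real n \<le> p"
      "a = \<beta> * (p - real n + 1) / 2" "t = p * y" "\<theta> = (\<beta> - y) / (2 * y)"
    and n3: "3 \<le> n" and a1: "1 < a" and t': "t < t'" "t' \<le> 2 * a"
    and \<theta>1: "\<theta> < 2 * \<theta>1" "\<theta>1 \<le> (a - 1) / t - 1 / 2 - \<beta> * real (n - 1) / (t' - t)"
    and \<delta>: "0 < \<delta>" "\<delta> < 1" "0 < K" and \<rho>: "0 < \<rho>" "\<rho> < 1" and T1: "T1 < 1"
  shows "0 < smallest_eigenvalue_prob n p \<beta> t"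
    and "(\<integral>\<^sup>+x. ennreal ((IS_estimator n p \<beta> y x)\<^sup>2) \<partial>sampling_measure n p \<beta> y) \<le>
     ennreal ((smallest_eigenvalue_prob n p \<beta> t)\<^sup>2 *
       (1 / (((1 - exp (- (K * \<delta> * t))) / K)\<^sup>2 * (\<theta> * (2 * \<theta>1 - \<theta>))) *
        (exp (real (n - 1) * (\<beta>\<^sup>2 * (t' / (t' - t))\<^sup>2 / (a - 1))) / (1 - T1) +
         (2 * (a + 2 * \<beta> + \<beta> / 2 * real (n - 1))) powr (2 * \<beta> * real (n - 1)) *
           exp (tail_exponent \<beta> \<rho> (n - 1) (a + 2 * \<beta>) t') /
         ((t' - t) powr (\<beta> * real (n - 1)) * (1 - T1))\<^sup>2)))"
proof -
  let ?m = "n - 1"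
  let ?I = "{1..n - 1}"
  let ?o = "ordered_laguerre_density ?m (p - 1) \<beta>"
  let ?G = "\<lambda>x. \<forall>i\<in>?I. t' < x i"
  note \<beta> = ctx(1)
  have q: "real ?m - 1 < p - 1" using ctx(4,5) by simp
  have aq: "a = \<beta> * (p - 1 - real ?m + 1) / 2" using ctx(4,6) by (simp add: of_nat_diff)
  have t: "0 < t" using ctx(2,4,5,7) by simp
  have m2: "2 \<le> ?m" using n3 by simp
  note od = \<beta> q aq t t'(1)
  define G where "G = (\<integral>\<^sup>+x. ennreal (?o x * (if ?G x then 1 else 0)) \<partial>lebesgue_power ?I)"
  define S1 where "S1 = (\<integral>\<^sup>+x. ennreal (?o x * (if ?G x then \<Prod>i\<in>?I. (x i - t) powr \<beta> else 0)) \<partial>lebesgue_power ?I)"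
  define S2 where "S2 = (\<integral>\<^sup>+x. ennreal (?o x * (if ?G x then \<Prod>i\<in>?I. (x i - t) powr (2 * \<beta>) else 0)) \<partial>lebesgue_power ?I)"
  define B where "B = (\<integral>\<^sup>+x. ennreal (?o x * (if ?G x then 0 else \<Prod>i\<in>?I. \<bar>x i\<bar> powr (2 * \<beta>))) \<partial>lebesgue_power ?I)"
  define T2 where "T2 = (2 * (a + 2 * \<beta> + \<beta> / 2 * real ?m)) powr (2 * \<beta> * real ?m) * exp (tail_exponent \<beta> \<rho> ?m (a + 2 * \<beta>) t')"
  define D where "D = (t' - t) powr (\<beta> * real ?m)"
  define e where "e = exp (real ?m * (\<beta>\<^sup>2 * (t' / (t' - t))\<^sup>2 / (a - 1)))"
  define j where "j = (1 - exp (- (K * \<delta> * t))) / K"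
  define P where "P = smallest_eigenvalue_prob n p \<beta> t"
  define pc where "pc = peel_const \<beta> a n"
  define wt where "wt = laguerre_weight a t"
  have P0: "0 \<le> P" by (simp add: P_def smallest_eigenvalue_prob_def)
  have pc: "0 < pc" unfolding pc_def by (rule peel_const_pos[OF ctx])
  have wt: "0 < wt" using t by (simp add: wt_def laguerre_weight_def)
  have j: "0 < j" using t \<delta> by (simp add: j_def)
  have D: "0 < D" using t' by (simp add: D_def)
  have e: "0 \<le> e" by (simp add: e_def)
  have T2: "0 \<le> T2" by (simp add: T2_def)
  have \<theta>: "0 < \<theta>" using ctx by simp
  have k: "0 < \<theta> * (2 * \<theta>1 - \<theta>)" using \<theta> \<theta>1 by simp
  have G1: "1 \<le> G + ennreal T1" "G \<le> 1"
    unfolding G_def T1_def by (rule ordered_good_mass[OF od m2 \<rho> t'(2)])+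
  have S2G: "S2 * G \<le> ennreal e * S1\<^sup>2"
    unfolding S2_def G_def S1_def e_def by (rule ordered_good_second_moment[OF od a1])
  have DG: "ennreal D * G \<le> S1"
    unfolding S1_def G_def D_def by (rule ordered_good_first_moment_ge[OF od])
  have BT: "B \<le> ennreal T2"
  proof -
    have s: "0 < laguerre_selberg \<beta> ?m a" using \<beta> a1 by (intro laguerre_selberg_pos) auto
    have "laguerre_selberg \<beta> ?m (a + 2 * \<beta>) / laguerre_selberg \<beta> ?m a \<le> (2 * (a + 2 * \<beta> + \<beta> / 2 * real ?m)) powr (2 * \<beta> * real ?m)"
      using laguerre_selberg_shift_le[of \<beta> a "2 * \<beta>" ?m] \<beta> a1 s by (simp add: pos_divide_le_eq mult.commute)
    then have "laguerre_selberg \<beta> ?m (a + 2 * \<beta>) / laguerre_selberg \<beta> ?m a * exp (tail_exponent \<beta> \<rho> ?m (a + 2 * \<beta>) t') \<le> T2"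
      unfolding T2_def by (rule mult_right_mono[OF _ exp_ge_zero])
    moreover have "0 \<le> 2 * \<beta>" "t' \<le> 2 * (a + 2 * \<beta>)" using \<beta> t' by auto
    ultimately show ?thesis
      unfolding B_def using ordered_laguerre_density_tail[OF od m2 \<rho>] ennreal_leI order_trans by blast
  qed
  have S1P: "ennreal (pc * (wt * j)) * S1 \<le> ennreal P"
  proof -
    have "ennreal (pc * (wt * j)) * S1 = ennreal pc * ennreal (wt * j) * S1"
      using pc wt j by (subst ennreal_mult) auto
    also have "\<dots> \<le> ennreal pc * (\<integral>\<^sup>+u. ennreal (if u < t then laguerre_weight a u else 0) \<partial>lborel) * S1"
      unfolding wt_def j_def K_def using a1 t \<delta> K_def
      by (intro mult_right_mono mult_left_mono nn_integral_laguerre_weight_ge) auto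
    also have "\<dots> \<le> ennreal P"
      unfolding pc_def S1_def P_def by (rule first_moment_ge[OF ctx t'(1), unfolded good_set_def])
    finally show ?thesis .
  qed
  have pwj: "0 < pc * (wt * j)" using pc wt j by simp
  \<comment> \<open>Finiteness is read off the inequalities themselves: for \<open>S1\<close> from
    the real number \<open>P\<close>, for \<open>S2\<close> from the second-moment inequality and
    the positivity of the good mass.\<close>
  have "S1 \<noteq> top"
  proof
    assume "S1 = top"
    then have "ennreal (pc * (wt * j)) * S1 = top" using pc wt j by (simp add: ennreal_mult_top)
    then show False using S1P by (simp add: top_unique)
  qed
  then obtain s1 where s1: "S1 = ennreal s1" "0 \<le> s1" by (cases S1) auto
  obtain g where g: "G = ennreal g" "0 \<le> g" using G1(2) by (cases G) (auto simp: top_unique)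
  have T10: "0 \<le> T1" by (simp add: T1_def)
  have g1: "1 - T1 \<le> g"
  proof -
    have "ennreal 1 \<le> ennreal (g + T1)" using G1(1) g T10 by (simp add: ennreal_plus)
    then have "1 \<le> g + T1" using g T10 by (subst (asm) ennreal_le_iff) auto
    then show ?thesis by simp
  qed
  have g0: "0 < g" using g1 T1 by simp
  have "S2 \<noteq> top"
  proof
    assume "S2 = top"
    then have "S2 * G = top" using g g0 by (simp add: ennreal_top_mult)
    moreover have "ennreal e * S1\<^sup>2 = ennreal (e * s1\<^sup>2)" using s1 e by (simp add: ennreal_mult ennreal_power)
    ultimately show False using S2G by (simp add: top_unique)
  qed
  then obtain s2 where s2: "S2 = ennreal s2" "0 \<le> s2" by (cases S2) auto
  obtain b where b: "B = ennreal b" "0 \<le> b" using BT by (cases B) (auto simp: top_unique)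
  have r1: "pc * (wt * j) * s1 \<le> P"
    using S1P P0 pwj s1 by (simp add: ennreal_mult[symmetric])
  have r2: "s2 * g \<le> e * s1\<^sup>2"
  proof -
    have "ennreal (s2 * g) \<le> ennreal (e * s1\<^sup>2)"
      using S2G s1 s2 g e by (simp add: ennreal_mult ennreal_power)
    then show ?thesis using e by (subst (asm) ennreal_le_iff) auto
  qed
  have r3: "D * g \<le> s1"
    using DG s1 g D by (simp add: ennreal_mult[symmetric])
  have r4: "b \<le> T2" using BT b T2 by simp
  note R = relative_second_moment_arith[OF pc wt j k D e T2 s1(2) r1 g1 T1 r2 r3 r4]
  show "0 < smallest_eigenvalue_prob n p \<beta> t" using R(1) unfolding P_def .
  have "(\<integral>\<^sup>+x. ennreal ((IS_estimator n p \<beta> y x)\<^sup>2) \<partial>sampling_measure n p \<beta> y) \<le>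
    ennreal ((pc * wt)\<^sup>2 / (\<theta> * (2 * \<theta>1 - \<theta>))) * (S2 + B)"
    unfolding pc_def wt_def S2_def B_def ordered_envelope_split[OF \<beta> q t'(1), symmetric]
    by (rule nn_integral_second_moment_le[OF ctx less_imp_le[OF a1] t'(1) \<theta>1])
  also have "\<dots> = ennreal ((pc * wt)\<^sup>2 / (\<theta> * (2 * \<theta>1 - \<theta>)) * (s2 + b))"
    unfolding s2 b using s2 b k by (subst ennreal_mult) (auto simp: ennreal_plus)
  also have "\<dots> \<le> ennreal (P\<^sup>2 * (1 / (j\<^sup>2 * (\<theta> * (2 * \<theta>1 - \<theta>))) * (e / (1 - T1) + T2 / (D * (1 - T1))\<^sup>2)))"
    by (rule ennreal_leI[OF R(2)])
  finally show "(\<integral>\<^sup>+x. ennreal ((IS_estimator n p \<beta> y x)\<^sup>2) \<partial>sampling_measure n p \<beta> y) \<le>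
     ennreal ((smallest_eigenvalue_prob n p \<beta> t)\<^sup>2 *
       (1 / (((1 - exp (- (K * \<delta> * t))) / K)\<^sup>2 * (\<theta> * (2 * \<theta>1 - \<theta>))) *
        (exp (real (n - 1) * (\<beta>\<^sup>2 * (t' / (t' - t))\<^sup>2 / (a - 1))) / (1 - T1) +
         (2 * (a + 2 * \<beta> + \<beta> / 2 * real (n - 1))) powr (2 * \<beta> * real (n - 1)) *
           exp (tail_exponent \<beta> \<rho> (n - 1) (a + 2 * \<beta>) t') /
         ((t' - t) powr (\<beta> * real (n - 1)) * (1 - T1))\<^sup>2)))"
    unfolding P_def j_def e_def T2_def D_def .
qed

section \<open>Asymptotics\<close>

lemma exp_tendsto_0_of_rate:
  fixes f p :: "nat \<Rightarrow> real"
  assumes "(\<lambda>n. f n / p n) \<longlonglongrightarrow> - c" "0 < c" "filterlim p at_top sequentially"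
  shows "(\<lambda>n. exp (f n)) \<longlonglongrightarrow> 0"
proof -
  have "filterlim (\<lambda>n. f n / p n * p n) at_bot sequentially"
    using assms by (intro filterlim_tendsto_neg_mult_at_bot[OF assms(1)]) auto
  moreover have "\<forall>\<^sub>F n in sequentially. f n / p n * p n = f n"
    using filterlim_at_top_dense[THEN iffD1, rule_format, OF assms(3), of 0] by eventually_elim simp
  ultimately have "filterlim f at_bot sequentially" by (rule filterlim_cong[THEN iffD1, OF refl refl, rotated])
  then show ?thesis by (rule filterlim_compose[OF exp_at_bot])
qed

text \<open>With the tilt fixed, its \<open>ln \<rho>\<close> term is of order \<open>M n\<close>
  and disappears on the scale \<open>p n\<close>, whereas its \<open>ln (1 - \<rho>)\<close> term
  survives as a multiple of \<open>p n\<close> that a small tilt makes small.\<close>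

lemma tail_exponent_rate:
  fixes p x :: "nat \<Rightarrow> real" and M :: "nat \<Rightarrow> nat"
  assumes \<beta>: "0 < \<beta>" and \<sigma>: "0 < \<sigma>" and p: "filterlim p at_top sequentially"
    and M: "filterlim M at_top sequentially" and Mp: "(\<lambda>n. real (M n) / p n) \<longlonglongrightarrow> 0"
    and x: "(\<lambda>n. x n / p n) \<longlonglongrightarrow> \<beta> / 2"
  shows "(\<lambda>n. tail_exponent \<beta> \<rho> (M n) (x n) (\<sigma> * p n) / p n) \<longlonglongrightarrow>
    \<beta> / 2 * (ln (\<sigma> / \<beta>) + 1 - \<sigma> / \<beta>) - \<beta> / 2 * ln (1 - \<rho>)"
proof -
  let ?f = "\<lambda>n. x n / p n * (ln (\<sigma> / (2 * (x n / p n))) + 1 - \<sigma> / (2 * (x n / p n))) + ln (Gamma (\<beta> / 2)) * (1 / p n) +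
    (1 - \<beta> / 2) * (ln (\<beta> / 2 * real (M n)) / real (M n) * (real (M n) / p n)) + \<beta> / 2 * (1 / p n) -
    \<beta> / 2 * ln \<rho> * (real (M n) / p n - 1 / p n) - (x n / p n + \<beta> / 2 * (1 / p n)) * ln (1 - \<rho>)"
  have ip: "(\<lambda>n. 1 / p n) \<longlonglongrightarrow> 0"
    using tendsto_inverse_0_at_top[OF p] by (simp add: inverse_eq_divide)
  have "(\<lambda>m::nat. ln (\<beta> / 2 * real m) / real m) \<longlonglongrightarrow> 0" using \<beta> by real_asymp
  then have lM: "(\<lambda>n. ln (\<beta> / 2 * real (M n)) / real (M n)) \<longlonglongrightarrow> 0"
    using M by (rule filterlim_compose)
  have "?f \<longlonglongrightarrow> \<beta> / 2 * (ln (\<sigma> / (2 * (\<beta> / 2))) + 1 - \<sigma> / (2 * (\<beta> / 2))) + ln (Gamma (\<beta> / 2)) * 0 +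
    (1 - \<beta> / 2) * (0 * 0) + \<beta> / 2 * 0 - \<beta> / 2 * ln \<rho> * (0 - 0) - (\<beta> / 2 + \<beta> / 2 * 0) * ln (1 - \<rho>)"
    using \<beta> \<sigma> by (intro tendsto_intros x ip lM Mp) auto
  moreover have "\<forall>\<^sub>F n in sequentially. ?f n = tail_exponent \<beta> \<rho> (M n) (x n) (\<sigma> * p n) / p n"
    using filterlim_at_top_dense[THEN iffD1, rule_format, OF p, of 0]
      filterlim_at_top[THEN iffD1, rule_format, OF M, of 1]
  proof eventually_elim
    case (elim n)
    have "\<sigma> * p n / (2 * x n) = \<sigma> / (2 * (x n / p n))" using elim by simp
    moreover have "real (M n - 1) = real (M n) - 1" using elim by (simp add: of_nat_diff)
    ultimately show ?case
      using elim unfolding tail_exponent_def by (simp add: add_divide_distrib diff_divide_distrib algebra_simps)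
  qed
  ultimately have "(\<lambda>n. tail_exponent \<beta> \<rho> (M n) (x n) (\<sigma> * p n) / p n) \<longlonglongrightarrow> \<beta> / 2 * (ln (\<sigma> / (2 * (\<beta> / 2))) + 1 - \<sigma> / (2 * (\<beta> / 2))) + ln (Gamma (\<beta> / 2)) * 0 +
    (1 - \<beta> / 2) * (0 * 0) + \<beta> / 2 * 0 - \<beta> / 2 * ln \<rho> * (0 - 0) - (\<beta> / 2 + \<beta> / 2 * 0) * ln (1 - \<rho>)"
    by (rule Lim_transform_eventually)
  then show ?thesis by simp
qed

text \<open>For \<open>r = \<sigma> / \<beta> < 1\<close> the Chernoff rate
  \<open>ln r + 1 - r = - \<eta>\<close> is strictly negative, and the tilt is allowed to spend half
  of it. The tilt and the rate are fixed before the sequences are, so the same pair serves the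
  shapes \<open>a\<close> and \<open>a + 2 * \<beta>\<close>.\<close>

lemma tail_exponent_rate_neg:
  fixes \<beta> \<sigma> :: real
  assumes "0 < \<beta>" "0 < \<sigma>" "\<sigma> < \<beta>"
  obtains \<rho> c where "0 < \<rho>" "\<rho> < 1" "0 < c"
    "\<And>p x M. filterlim p at_top sequentially \<Longrightarrow> filterlim M at_top sequentially \<Longrightarrow>
      (\<lambda>n. real (M n) / p n) \<longlonglongrightarrow> 0 \<Longrightarrow> (\<lambda>n. x n / p n) \<longlonglongrightarrow> \<beta> / 2 \<Longrightarrow>
      (\<lambda>n. tail_exponent \<beta> \<rho> (M n) (x n) (\<sigma> * p n) / p n) \<longlonglongrightarrow> - c"
proof -
  define \<eta> where "\<eta> = \<sigma> / \<beta> - 1 - ln (\<sigma> / \<beta>)"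
  have r: "0 < \<sigma> / \<beta>" "\<sigma> / \<beta> \<noteq> 1" using assms by auto
  have "ln (\<sigma> / \<beta>) \<noteq> \<sigma> / \<beta> - 1" using ln_eq_minus_one[OF r(1)] r(2) by blast
  moreover have "ln (\<sigma> / \<beta>) \<le> \<sigma> / \<beta> - 1" by (rule ln_le_minus_one[OF r(1)])
  ultimately have \<eta>: "0 < \<eta>" unfolding \<eta>_def by linarith
  \<comment> \<open>Makes \<open>ln (1 - \<rho>)\<close> equal to \<open>- (\<eta> / 2)\<close>; the
    remaining rate is \<open>\<beta> * \<eta> / 4\<close>.\<close>
  define \<rho> where "\<rho> = 1 - exp (- (\<eta> / 2))"
  have \<rho>: "0 < \<rho>" "\<rho> < 1" using \<eta> by (auto simp: \<rho>_def)
  have l: "ln (1 - \<rho>) = - (\<eta> / 2)" by (simp add: \<rho>_def)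
  have c: "\<beta> / 2 * (ln (\<sigma> / \<beta>) + 1 - \<sigma> / \<beta>) - \<beta> / 2 * ln (1 - \<rho>) = - (\<beta> * \<eta> / 4)"
  proof -
    have e: "ln (\<sigma> / \<beta>) + 1 - \<sigma> / \<beta> = - \<eta>" by (simp add: \<eta>_def)
    show ?thesis unfolding l e by simp
  qed
  show thesis
    using \<rho> \<eta> assms tail_exponent_rate[OF assms(1,2), of _ _ _ \<rho>] unfolding c by (intro that[of \<rho> "\<beta> * \<eta> / 4"]) auto
qed

section \<open>Limits along a sequence with \<open>p n / n\<close> tending to infinity\<close>

context
  fixes \<beta> y :: real and p :: "nat \<Rightarrow> real"
  assumes \<beta>: "0 < \<beta>" and y: "0 < y" "y < \<beta>" and np: "\<And>n. 1 \<le> n \<Longrightarrow> real n \<le> p n"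
    and pn: "filterlim (\<lambda>n. p n / real n) at_top sequentially"
begin

private lemma p_at_top: "filterlim p at_top sequentially"
proof (rule filterlim_at_top_mono[OF filterlim_real_sequentially])
  show "\<forall>\<^sub>F n in sequentially. real n \<le> p n"
    using eventually_ge_at_top[of 1] by eventually_elim (rule np)
qed

private lemma ev_p_pos: "\<forall>\<^sub>F n in sequentially. 0 < p n"
  using filterlim_at_top_dense[THEN iffD1, rule_format, OF p_at_top, of 0] .

private lemma inverse_p_tendsto: "(\<lambda>n. 1 / p n) \<longlonglongrightarrow> 0"
  using tendsto_inverse_0_at_top[OF p_at_top] by (simp add: inverse_eq_divide)

private lemma n_over_p_tendsto: "(\<lambda>n. real n / p n) \<longlonglongrightarrow> 0"
  using tendsto_inverse_0_at_top[OF pn] by (simp add: inverse_eq_divide)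

private lemma pred_n_over_p_tendsto: "(\<lambda>n. real (n - 1) / p n) \<longlonglongrightarrow> 0"
proof (rule tendsto_sandwich[OF _ _ tendsto_const n_over_p_tendsto])
  show "\<forall>\<^sub>F n in sequentially. 0 \<le> real (n - 1) / p n"
    using ev_p_pos by eventually_elim simp
  show "\<forall>\<^sub>F n in sequentially. real (n - 1) / p n \<le> real n / p n"
    using ev_p_pos by eventually_elim (simp add: divide_right_mono)
qed

private lemma shape_over_p_tendsto: "(\<lambda>n. (\<beta> * (p n - real n + 1) / 2 + c) / p n) \<longlonglongrightarrow> \<beta> / 2"
proof -
  have "(\<lambda>n. \<beta> * (1 - real n / p n + 1 / p n) / 2 + c * (1 / p n)) \<longlonglongrightarrow> \<beta> * (1 - 0 + 0) / 2 + c * 0"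
    by (intro tendsto_intros n_over_p_tendsto inverse_p_tendsto) auto
  moreover have "\<forall>\<^sub>F n in sequentially. \<beta> * (1 - real n / p n + 1 / p n) / 2 + c * (1 / p n) = (\<beta> * (p n - real n + 1) / 2 + c) / p n"
    using ev_p_pos by eventually_elim (simp add: field_simps)
  ultimately show ?thesis using Lim_transform_eventually by fastforce
qed

private lemma ev_shape_ge:
  assumes "\<sigma> < \<beta>"
  shows "\<forall>\<^sub>F n in sequentially. \<sigma> * p n \<le> 2 * (\<beta> * (p n - real n + 1) / 2)"
proof -
  have "\<forall>\<^sub>F n in sequentially. \<sigma> / 2 < (\<beta> * (p n - real n + 1) / 2 + 0) / p n"
    using assms by (intro order_tendstoD(1)[OF shape_over_p_tendsto]) auto
  with ev_p_pos show ?thesis by eventually_elim (simp add: field_simps)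
qed

private lemma ev_shape_gt: "\<forall>\<^sub>F n in sequentially. 1 < \<beta> * (p n - real n + 1) / 2"
proof -
  have "\<forall>\<^sub>F n in sequentially. 0 < (\<beta> * (p n - real n + 1) / 2 + (-1)) / p n"
    using \<beta> by (intro order_tendstoD(1)[OF shape_over_p_tendsto]) auto
  with ev_p_pos show ?thesis by eventually_elim (simp add: zero_less_divide_iff)
qed

text \<open>The tail bound with threshold \<open>y * p n\<close> and no shift of the shape; its rate
  is negative because \<open>y < \<beta>\<close>. The limit 0 makes the logarithm in the efficiency
  criterion diverge.\<close>

lemma smallest_eigenvalue_prob_tendsto_0: "(\<lambda>n. smallest_eigenvalue_prob n (p n) \<beta> (p n * y)) \<longlonglongrightarrow> 0"
proof -
  obtain \<rho> c where \<rho>: "0 < \<rho>" "\<rho> < 1" and c: "0 < c" and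
    lim: "\<And>p x M. filterlim p at_top sequentially \<Longrightarrow> filterlim M at_top sequentially \<Longrightarrow>
      (\<lambda>n. real (M n) / p n) \<longlonglongrightarrow> 0 \<Longrightarrow> (\<lambda>n. x n / p n) \<longlonglongrightarrow> \<beta> / 2 \<Longrightarrow>
      (\<lambda>n. tail_exponent \<beta> \<rho> (M n) (x n) (y * p n) / p n) \<longlonglongrightarrow> - c"
    using tail_exponent_rate_neg[OF \<beta> y] by blast
  \<comment> \<open>The summand 0 is the shift \<open>c\<close> of the tail estimate.\<close>
  let ?a = "\<lambda>n. \<beta> * (p n - real n + 1) / 2 + 0"
  have "(\<lambda>n. tail_exponent \<beta> \<rho> n (?a n) (y * p n) / p n) \<longlonglongrightarrow> - c"
    by (intro lim p_at_top filterlim_ident n_over_p_tendsto shape_over_p_tendsto)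
  then have "(\<lambda>n. exp (tail_exponent \<beta> \<rho> n (?a n) (y * p n))) \<longlonglongrightarrow> 0"
    by (rule exp_tendsto_0_of_rate[OF _ c p_at_top])
  note ub = this
  show ?thesis
  proof (rule tendsto_sandwich[OF _ _ tendsto_const ub])
    show "\<forall>\<^sub>F n in sequentially. 0 \<le> smallest_eigenvalue_prob n (p n) \<beta> (p n * y)"
      by (simp add: smallest_eigenvalue_prob_def)
    show "\<forall>\<^sub>F n in sequentially. smallest_eigenvalue_prob n (p n) \<beta> (p n * y) \<le> exp (tail_exponent \<beta> \<rho> n (?a n) (y * p n))"
      using ev_p_pos ev_shape_ge[OF y(2)] eventually_ge_at_top[of 2] ev_shape_gt
    proof eventually_elim
      case (elim n)
      have q: "real n - 1 < p n" using np[of n] elim by simp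
      note [measurable] = borel_measurable_laguerre_density[OF \<beta> q]
      have "ennreal (smallest_eigenvalue_prob n (p n) \<beta> (p n * y)) =
        (\<integral>\<^sup>+x. ennreal (laguerre_density n (p n) \<beta> x * (if \<exists>i\<in>{1..n}. x i < p n * y then 1 else 0)) \<partial>lebesgue_power {1..n})"
        using elim by (intro smallest_eigenvalue_prob_eq(2) \<beta> q) auto
      also have "\<dots> \<le> (\<integral>\<^sup>+x. ennreal (laguerre_density n (p n) \<beta> x * ((\<Prod>i\<in>{1..n}. \<bar>x i\<bar> powr 0) *
          (if \<exists>i\<in>{1..n}. x i \<le> p n * y then 1 else 0))) \<partial>lebesgue_power {1..n})"
      proof (intro nn_integral_mono ennreal_leI)
        fix x
        show "laguerre_density n (p n) \<beta> x * (if \<exists>i\<in>{1..n}. x i < p n * y then 1 else 0) \<le>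
          laguerre_density n (p n) \<beta> x * ((\<Prod>i\<in>{1..n}. \<bar>x i\<bar> powr 0) * (if \<exists>i\<in>{1..n}. x i \<le> p n * y then 1 else 0))"
        proof (cases "\<forall>i\<in>{1..n}. 0 < x i")
          case True
          have pr: "(\<Prod>i\<in>{1..n}. \<bar>x i\<bar> powr 0) = 1"
          proof (intro prod.neutral ballI)
            fix i assume "i \<in> {1..n}"
            with True have "0 < x i" by blast
            then show "\<bar>x i\<bar> powr 0 = 1" by simp
          qed
          have "(if \<exists>i\<in>{1..n}. x i < p n * y then 1 else 0::real) \<le> (if \<exists>i\<in>{1..n}. x i \<le> p n * y then 1 else 0)"
            by (auto intro: less_imp_le)
          then show ?thesis unfolding pr mult_1_left by (intro mult_left_mono laguerre_density_nonneg[OF \<beta> q])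
        next
          case False
          show ?thesis unfolding laguerre_density_def if_not_P[OF False] by simp
        qed
      qed
      also have "\<dots> \<le> ennreal (laguerre_selberg \<beta> n (\<beta> * (p n - real n + 1) / 2 + 0) / laguerre_selberg \<beta> n (\<beta> * (p n - real n + 1) / 2) *
         exp (tail_exponent \<beta> \<rho> n (?a n) (p n * y)))"
        using elim y \<rho> by (intro laguerre_density_tail \<beta> q) (auto simp: mult.commute)
      also have "laguerre_selberg \<beta> n (\<beta> * (p n - real n + 1) / 2 + 0) / laguerre_selberg \<beta> n (\<beta> * (p n - real n + 1) / 2) = 1"
        using laguerre_selberg_pos[OF \<beta>, of "\<beta> * (p n - real n + 1) / 2" n] elim by simp
      finally show ?case by (simp add: mult.commute)
    qed
  qed
qed


text \<open>\<open>R\<close> is the factor of the bound for fixed parameters, and its ingredients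
  converge one by one: both slopes to \<theta>, the fluctuation exponent and the bad terms to
  0.\<close>

lemma second_moment_bound_tendsto:
  obtains R where "R \<longlonglongrightarrow> 1"
    "\<forall>\<^sub>F n in sequentially. 0 < smallest_eigenvalue_prob n (p n) \<beta> (p n * y) \<and>
      (\<integral>\<^sup>+x. ennreal ((IS_estimator n (p n) \<beta> y x)\<^sup>2) \<partial>sampling_measure n (p n) \<beta> y) \<le>
        ennreal ((smallest_eigenvalue_prob n (p n) \<beta> (p n * y))\<^sup>2 * R n)"
proof -
  \<comment> \<open>Strictly above \<open>y\<close>, so that \<open>t' - t\<close> is of order
    \<open>p\<close>, and strictly below \<beta>, so that the bad weight decays
    exponentially.\<close>
  define \<tau> where "\<tau> = (y + \<beta>) / 2"
  have \<tau>: "0 < \<tau>" "y < \<tau>" "\<tau> < \<beta>" using y by (auto simp: \<tau>_def)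
  obtain \<rho> c where \<rho>: "0 < \<rho>" "\<rho> < 1" and c: "0 < c" and
    lim: "\<And>p x M. filterlim p at_top sequentially \<Longrightarrow> filterlim M at_top sequentially \<Longrightarrow>
      (\<lambda>n. real (M n) / p n) \<longlonglongrightarrow> 0 \<Longrightarrow> (\<lambda>n. x n / p n) \<longlonglongrightarrow> \<beta> / 2 \<Longrightarrow>
      (\<lambda>n. tail_exponent \<beta> \<rho> (M n) (x n) (\<tau> * p n) / p n) \<longlonglongrightarrow> - c"
    using tail_exponent_rate_neg[OF \<beta> \<tau>(1,3)] by blast
  define a where "a n = \<beta> * (p n - real n + 1) / 2" for n
  define t where "t n = p n * y" for n
  define t' where "t' n = \<tau> * p n" for n
  define \<theta> where "\<theta> = (\<beta> - y) / (2 * y)"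
  define m where "m n = real (n - 1)" for n :: nat
  define \<theta>1 where "\<theta>1 n = (a n - 1) / t n - 1 / 2 - \<beta> * m n / (t' n - t n)" for n
  \<comment> \<open>Tends to 0, so that \<open>K\<close> keeps the limiting slope, but so slowly
    that \<open>\<delta> n * t n\<close> still grows like \<open>sqrt (p n)\<close> and the
    truncation error vanishes.\<close>
  define \<delta> where "\<delta> n = 1 / sqrt (p n)" for n
  define K where "K n = (a n - 1) / (t n * (1 - \<delta> n)) - 1 / 2" for n
  define T1 where "T1 n = exp (tail_exponent \<beta> \<rho> (n - 1) (a n) (t' n))" for n
  define X where "X n = (2 * (a n + 2 * \<beta> + \<beta> / 2 * m n)) powr (2 * \<beta> * m n) *
    exp (tail_exponent \<beta> \<rho> (n - 1) (a n + 2 * \<beta>) (t' n)) / ((t' n - t n) powr (\<beta> * m n) * (1 - T1 n))\<^sup>2" for n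
  define e where "e n = m n * (\<beta>\<^sup>2 * (t' n / (t' n - t n))\<^sup>2 / (a n - 1))" for n
  define R where "R n = 1 / (((1 - exp (- (K n * \<delta> n * t n))) / K n)\<^sup>2 * (\<theta> * (2 * \<theta>1 n - \<theta>))) *
      (exp (e n) / (1 - T1 n) + X n)" for n
  have \<theta>: "0 < \<theta>" "\<theta> = \<beta> / 2 / y - 1 / 2" using y by (auto simp: \<theta>_def diff_divide_distrib)
  have ap: "(\<lambda>n. (a n + d) / p n) \<longlonglongrightarrow> \<beta> / 2" for d
    unfolding a_def by (rule shape_over_p_tendsto)
  have ap0: "(\<lambda>n. a n / p n) \<longlonglongrightarrow> \<beta> / 2" using ap[of 0] by simp
  have a1p: "(\<lambda>n. (a n - 1) / p n) \<longlonglongrightarrow> \<beta> / 2" using ap[of "-1"] by simp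
  have mp: "(\<lambda>n. m n / p n) \<longlonglongrightarrow> 0" unfolding m_def by (rule pred_n_over_p_tendsto)
  have predlim: "filterlim (\<lambda>n::nat. n - 1) at_top sequentially" by (rule filterlim_minus_const_nat_at_top)
  have \<delta>0: "\<delta> \<longlonglongrightarrow> 0"
    using tendsto_inverse_0_at_top[OF filterlim_compose[OF sqrt_at_top p_at_top]]
    unfolding \<delta>_def by (simp add: inverse_eq_divide)
  have \<theta>1lim: "\<theta>1 \<longlonglongrightarrow> \<theta>"
  proof -
    have "(\<lambda>n. (a n - 1) / p n / y - 1 / 2 - \<beta> * (m n / p n) / (\<tau> - y)) \<longlonglongrightarrow> \<beta> / 2 / y - 1 / 2 - \<beta> * 0 / (\<tau> - y)"
      using y \<tau> by (intro tendsto_intros a1p mp) auto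
    moreover have "\<forall>\<^sub>F n in sequentially. (a n - 1) / p n / y - 1 / 2 - \<beta> * (m n / p n) / (\<tau> - y) = \<theta>1 n"
      using ev_p_pos
    proof eventually_elim
      case (elim n)
      have "t' n - t n = p n * (\<tau> - y)" by (simp add: t'_def t_def algebra_simps)
      then show ?case using elim \<tau> by (simp add: \<theta>1_def t_def)
    qed
    ultimately show ?thesis using \<theta>(2) Lim_transform_eventually by fastforce
  qed
  have Klim: "K \<longlonglongrightarrow> \<theta>"
  proof -
    have "(\<lambda>n. (a n - 1) / p n / (y * (1 - \<delta> n)) - 1 / 2) \<longlonglongrightarrow> \<beta> / 2 / (y * (1 - 0)) - 1 / 2"
      using y by (intro tendsto_intros a1p \<delta>0) auto
    moreover have "(\<lambda>n. (a n - 1) / p n / (y * (1 - \<delta> n)) - 1 / 2) = K"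
      by (intro ext) (simp add: K_def t_def)
    ultimately show ?thesis using \<theta>(2) by simp
  qed
  have explim: "(\<lambda>n. exp (- (K n * \<delta> n * t n))) \<longlonglongrightarrow> 0"
  proof -
    have "filterlim (\<lambda>n. (K n * y) * sqrt (p n)) at_top sequentially"
      using \<theta>(1) y by (intro filterlim_tendsto_pos_mult_at_top[OF tendsto_mult[OF Klim tendsto_const]]
        filterlim_compose[OF sqrt_at_top p_at_top]) auto
    moreover have "\<forall>\<^sub>F n in sequentially. (K n * y) * sqrt (p n) = K n * \<delta> n * t n"
      using ev_p_pos
    proof eventually_elim
      case (elim n)
      then have "p n / sqrt (p n) = sqrt (p n)" by (simp add: real_div_sqrt)
      moreover have "\<delta> n * t n = y * (p n / sqrt (p n))" by (simp add: \<delta>_def t_def)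
      ultimately show ?case by (simp only: mult.assoc)
    qed
    ultimately have "filterlim (\<lambda>n. K n * \<delta> n * t n) at_top sequentially"
      by (rule filterlim_cong[THEN iffD1, OF refl refl, rotated])
    then have "filterlim (\<lambda>n. - (K n * \<delta> n * t n)) at_bot sequentially"
      by (simp only: filterlim_uminus_at_bot minus_minus)
    then show ?thesis by (rule filterlim_compose[OF exp_at_bot])
  qed
  have elim0: "e \<longlonglongrightarrow> 0"
  proof -
    have "(\<lambda>n. m n / p n * (\<beta>\<^sup>2 * (\<tau> / (\<tau> - y))\<^sup>2 / ((a n - 1) / p n))) \<longlonglongrightarrow> 0 * (\<beta>\<^sup>2 * (\<tau> / (\<tau> - y))\<^sup>2 / (\<beta> / 2))"
      using \<beta> by (intro tendsto_intros a1p mp) auto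
    moreover have "\<forall>\<^sub>F n in sequentially. m n / p n * (\<beta>\<^sup>2 * (\<tau> / (\<tau> - y))\<^sup>2 / ((a n - 1) / p n)) = e n"
      using ev_p_pos
    proof eventually_elim
      case (elim n)
      have "t' n - t n = p n * (\<tau> - y)" by (simp add: t'_def t_def algebra_simps)
      then have "t' n / (t' n - t n) = \<tau> / (\<tau> - y)" using elim \<tau> by (simp add: t'_def)
      then show ?case using elim by (simp add: e_def)
    qed
    ultimately show ?thesis using Lim_transform_eventually by fastforce
  qed
  have T1lim: "T1 \<longlonglongrightarrow> 0"
    unfolding T1_def t'_def using pred_n_over_p_tendsto
    by (intro exp_tendsto_0_of_rate[OF lim c p_at_top] p_at_top predlim ap0)
  have Xlim: "X \<longlonglongrightarrow> 0"
  proof -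
    define E where "E n = tail_exponent \<beta> \<rho> (n - 1) (a n + 2 * \<beta>) (t' n)" for n
    \<comment> \<open>Quotient of the two bases in \<open>X\<close>. Both are of order
      \<open>p n\<close>, so \<open>w\<close> converges and its power with exponent of order
      \<open>n\<close> is only \<open>exp (o(p))\<close>.\<close>
    define w where "w n = 2 * ((a n + 2 * \<beta>) / p n + \<beta> / 2 * (m n / p n)) / (\<tau> - y)" for n
    define F where "F n = 2 * \<beta> * m n * ln (w n) + E n" for n
    have Ep: "(\<lambda>n. E n / p n) \<longlonglongrightarrow> - c"
      unfolding E_def t'_def using pred_n_over_p_tendsto by (intro lim p_at_top predlim ap)
    have wl: "w \<longlonglongrightarrow> 2 * (\<beta> / 2 + \<beta> / 2 * 0) / (\<tau> - y)"
      unfolding w_def using \<tau> by (intro tendsto_intros ap mp) auto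
    have "(\<lambda>n. 2 * \<beta> * (m n / p n) * ln (w n) + E n / p n) \<longlonglongrightarrow> 2 * \<beta> * 0 * ln (2 * (\<beta> / 2 + \<beta> / 2 * 0) / (\<tau> - y)) + - c"
      using \<beta> \<tau> by (intro tendsto_intros wl mp Ep) auto
    then have "(\<lambda>n. F n / p n) \<longlonglongrightarrow> - c" by (simp add: F_def add_divide_distrib)
    then have "(\<lambda>n. exp (F n)) \<longlonglongrightarrow> 0" by (rule exp_tendsto_0_of_rate[OF _ c p_at_top])
    then have "(\<lambda>n. exp (F n) / (1 - T1 n)\<^sup>2) \<longlonglongrightarrow> 0 / (1 - 0)\<^sup>2"
      by (intro tendsto_intros T1lim) auto
    moreover have "\<forall>\<^sub>F n in sequentially. exp (F n) / (1 - T1 n)\<^sup>2 = X n"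
      using ev_p_pos ev_shape_gt
    proof eventually_elim
      case (elim n)
      have d: "t' n - t n = p n * (\<tau> - y)" by (simp add: t'_def t_def algebra_simps)
      have dp: "0 < t' n - t n" unfolding d using elim \<tau> by simp
      define v where "v = 2 * (a n + 2 * \<beta> + \<beta> / 2 * m n)"
      have "0 \<le> \<beta> / 2 * m n" using \<beta> by (simp add: m_def)
      then have v: "0 < v" unfolding v_def using elim \<beta> by (simp add: a_def add_pos_pos add_pos_nonneg)
      have wv: "w n = v / (t' n - t n)"
        unfolding d w_def v_def using elim \<tau> by (simp add: field_simps)
      have "exp (2 * \<beta> * m n * ln (w n)) = v powr (2 * \<beta> * m n) / (t' n - t n) powr (2 * \<beta> * m n)"
        unfolding wv using v dp by (simp add: powr_def ln_div right_diff_distrib exp_diff)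
      moreover have "((t' n - t n) powr (\<beta> * m n))\<^sup>2 = (t' n - t n) powr (2 * \<beta> * m n)"
        by (simp add: power2_eq_square powr_add[symmetric] mult.assoc)
      ultimately show ?case
        unfolding X_def F_def exp_add E_def[symmetric] v_def[symmetric] by (simp add: power_mult_distrib)
    qed
    ultimately show ?thesis using Lim_transform_eventually by fastforce
  qed
  \<comment> \<open>The first moment contributes \<open>(1 / \<theta>)\<^sup>2\<close> and the
    second moment \<open>1 / (\<theta> * \<theta>)\<close>; they cancel because the proposal rate is
    the limiting slope.\<close>
  have "R \<longlonglongrightarrow> 1 / (((1 - 0) / \<theta>)\<^sup>2 * (\<theta> * (2 * \<theta> - \<theta>))) * (exp 0 / (1 - 0) + 0)"
    unfolding R_def using \<theta>(1) by (intro tendsto_intros explim Klim \<theta>1lim elim0 T1lim Xlim) auto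
  then have "R \<longlonglongrightarrow> 1" using \<theta>(1) by (simp add: power2_eq_square)
  moreover have "\<forall>\<^sub>F n in sequentially. 0 < smallest_eigenvalue_prob n (p n) \<beta> (p n * y) \<and>
      (\<integral>\<^sup>+x. ennreal ((IS_estimator n (p n) \<beta> y x)\<^sup>2) \<partial>sampling_measure n (p n) \<beta> y) \<le>
        ennreal ((smallest_eigenvalue_prob n (p n) \<beta> (p n * y))\<^sup>2 * R n)"
  proof -
    have "\<forall>\<^sub>F n in sequentially. \<theta> / 2 < \<theta>1 n" using \<theta>(1) by (intro order_tendstoD(1)[OF \<theta>1lim]) auto
    moreover have "\<forall>\<^sub>F n in sequentially. 0 < K n" using \<theta>(1) by (intro order_tendstoD(1)[OF Klim])
    moreover have "\<forall>\<^sub>F n in sequentially. \<delta> n < 1" by (intro order_tendstoD(2)[OF \<delta>0]) auto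
    moreover have "\<forall>\<^sub>F n in sequentially. T1 n < 1" by (intro order_tendstoD(2)[OF T1lim]) auto
    ultimately show ?thesis
      using ev_p_pos ev_shape_gt ev_shape_ge[OF \<tau>(3)] eventually_ge_at_top[of 3]
    proof eventually_elim
      case (elim n)
      have ctx: "0 < \<beta>" "0 < y" "y < \<beta>" "2 \<le> n" "real n \<le> p n" "a n = \<beta> * (p n - real n + 1) / 2" "t n = p n * y" "\<theta> = (\<beta> - y) / (2 * y)"
        using \<beta> y np[of n] elim by (auto simp: a_def t_def \<theta>_def)
      have \<theta>1: "\<theta> < 2 * \<theta>1 n" using elim(1) by simp
      have h: "3 \<le> n" "1 < a n" "t n < t' n" "t' n \<le> 2 * a n"
        "\<theta>1 n \<le> (a n - 1) / t n - 1 / 2 - \<beta> * real (n - 1) / (t' n - t n)" "0 < \<delta> n"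
        using elim \<tau> by (auto simp: a_def t_def t'_def \<theta>1_def \<delta>_def m_def)
      note B = relative_second_moment_le[OF ctx h(1-4) \<theta>1 h(5,6) elim(3) elim(2)[unfolded K_def] \<rho> elim(4)[unfolded T1_def]]
      show ?case
        using B unfolding t_def[symmetric] R_def X_def K_def T1_def e_def m_def by blast
    qed
  qed
  ultimately show thesis by (rule that)
qed


end

section \<open>From the bound to the three regimes\<close>

lemma borel_measurable_IS_estimator_sampling:
  assumes "2 \<le> n"
  shows "IS_estimator n p \<beta> y \<in> borel_measurable (sampling_measure n p \<beta> y)"
  using borel_measurable_IS_estimator[OF assms] by (simp add: sampling_measure_def)

lemma IS_estimator_unbiased:
  assumes "0 < \<beta>" "0 < y" "y < \<beta>" "2 \<le> n" "real n \<le> p"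
  shows "integrable (sampling_measure n p \<beta> y) (IS_estimator n p \<beta> y)"
    and "(\<integral>x. IS_estimator n p \<beta> y x \<partial>sampling_measure n p \<beta> y) = smallest_eigenvalue_prob n p \<beta> (p * y)"
proof -
  note nn = nn_integral_IS_estimator[OF assms refl refl refl]
  note m = borel_measurable_IS_estimator_sampling[OF assms(4), of p \<beta> y]
  note nonneg = IS_estimator_nonneg[OF assms refl refl refl]
  have P: "0 \<le> smallest_eigenvalue_prob n p \<beta> (p * y)" by (simp add: smallest_eigenvalue_prob_def)
  show "integrable (sampling_measure n p \<beta> y) (IS_estimator n p \<beta> y)"
    using m nonneg by (intro integrableI_nonneg) (auto simp: nn)
  show "(\<integral>x. IS_estimator n p \<beta> y x \<partial>sampling_measure n p \<beta> y) = smallest_eigenvalue_prob n p \<beta> (p * y)"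
    using m nonneg P by (subst integral_eq_nn_integral) (auto simp: nn)
qed

text \<open>Cauchy--Schwarz against the constant 1. It is the lower half of the sandwich for the
  relative second moment.\<close>

lemma prob_squared_le_second_moment:
  assumes "0 < \<beta>" "0 < y" "y < \<beta>" "2 \<le> n" "real n \<le> p"
  shows "ennreal ((smallest_eigenvalue_prob n p \<beta> (p * y))\<^sup>2) \<le>
    (\<integral>\<^sup>+x. ennreal ((IS_estimator n p \<beta> y x)\<^sup>2) \<partial>sampling_measure n p \<beta> y)"
proof -
  let ?Q = "sampling_measure n p \<beta> y"
  note m = borel_measurable_IS_estimator_sampling[OF assms(4), of p \<beta> y]
  note nonneg = IS_estimator_nonneg[OF assms refl refl refl]
  have P: "0 \<le> smallest_eigenvalue_prob n p \<beta> (p * y)" by (simp add: smallest_eigenvalue_prob_def)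
  have "(\<integral>\<^sup>+x. ennreal (IS_estimator n p \<beta> y x) * 1 \<partial>?Q)\<^sup>2 \<le> (\<integral>\<^sup>+x. (ennreal (IS_estimator n p \<beta> y x))\<^sup>2 \<partial>?Q) * (\<integral>\<^sup>+x. 1\<^sup>2 \<partial>?Q)"
    using m by (intro Cauchy_Schwarz_nn_integral) auto
  also have "(\<integral>\<^sup>+x. 1\<^sup>2 \<partial>?Q) = 1" using emeasure_sampling_measure[OF assms] by simp
  finally show ?thesis
    using P nonneg by (simp add: nn_integral_IS_estimator[OF assms refl refl refl] ennreal_power)
qed

text \<open>The nonnegative integral is bounded first, so that integrability is known and the
  Bochner integral is the true second moment, not the default value 0.\<close>

lemma second_moment_ratio_tendsto:
  fixes p :: "nat \<Rightarrow> real"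
  assumes \<beta>y: "0 < \<beta>" "0 < y" "y < \<beta>" and np: "\<And>n. 1 \<le> n \<Longrightarrow> real n \<le> p n"
    and pn: "filterlim (\<lambda>n. p n / real n) at_top sequentially"
  shows "\<forall>\<^sub>F n in sequentially. integrable (sampling_measure n (p n) \<beta> y) (\<lambda>x. (IS_estimator n (p n) \<beta> y x)\<^sup>2)"
    and "(\<lambda>n. (\<integral>x. (IS_estimator n (p n) \<beta> y x)\<^sup>2 \<partial>sampling_measure n (p n) \<beta> y) / (smallest_eigenvalue_prob n (p n) \<beta> (p n * y))\<^sup>2) \<longlonglongrightarrow> 1"
    and "\<forall>\<^sub>F n in sequentially. 0 < smallest_eigenvalue_prob n (p n) \<beta> (p n * y)"
proof -
  let ?P = "\<lambda>n. smallest_eigenvalue_prob n (p n) \<beta> (p n * y)"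
  let ?Q = "\<lambda>n. sampling_measure n (p n) \<beta> y"
  let ?L = "\<lambda>n. IS_estimator n (p n) \<beta> y"
  obtain R where R: "R \<longlonglongrightarrow> 1" and ev: "\<forall>\<^sub>F n in sequentially. 0 < ?P n \<and>
      (\<integral>\<^sup>+x. ennreal ((?L n x)\<^sup>2) \<partial>?Q n) \<le> ennreal ((?P n)\<^sup>2 * R n)"
    using second_moment_bound_tendsto[OF \<beta>y np pn] by blast
  have R0: "\<forall>\<^sub>F n in sequentially. 0 < R n" by (intro order_tendstoD(1)[OF R]) auto
  have ev': "\<forall>\<^sub>F n in sequentially. 0 < ?P n \<and> integrable (?Q n) (\<lambda>x. (?L n x)\<^sup>2) \<and>
     1 \<le> (\<integral>x. (?L n x)\<^sup>2 \<partial>?Q n) / (?P n)\<^sup>2 \<and> (\<integral>x. (?L n x)\<^sup>2 \<partial>?Q n) / (?P n)\<^sup>2 \<le> R n"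
    using ev R0 eventually_ge_at_top[of 2]
  proof eventually_elim
    case (elim n)
    have n: "real n \<le> p n" using np[of n] elim by simp
    have m: "?L n \<in> borel_measurable (?Q n)" by (rule borel_measurable_IS_estimator_sampling) (rule elim)
    have int: "integrable (?Q n) (\<lambda>x. (?L n x)\<^sup>2)"
      using m elim by (intro integrableI_nonneg) (auto intro: le_less_trans)
    have nn: "(\<integral>\<^sup>+x. ennreal ((?L n x)\<^sup>2) \<partial>?Q n) = ennreal (\<integral>x. (?L n x)\<^sup>2 \<partial>?Q n)"
      by (intro nn_integral_eq_integral int) auto
    have "0 \<le> (\<integral>x. (?L n x)\<^sup>2 \<partial>?Q n)" by simp
    then have "(?P n)\<^sup>2 \<le> (\<integral>x. (?L n x)\<^sup>2 \<partial>?Q n)"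
      using prob_squared_le_second_moment[OF \<beta>y elim(3) n] unfolding nn by (simp only: ennreal_le_iff)
    moreover have "(\<integral>x. (?L n x)\<^sup>2 \<partial>?Q n) \<le> (?P n)\<^sup>2 * R n"
      using elim unfolding nn by (auto simp: ennreal_le_iff)
    ultimately show ?case using elim int by (simp add: pos_le_divide_eq pos_divide_le_eq mult.commute)
  qed
  show "\<forall>\<^sub>F n in sequentially. integrable (?Q n) (\<lambda>x. (?L n x)\<^sup>2)" using ev' by eventually_elim simp
  show "\<forall>\<^sub>F n in sequentially. 0 < ?P n" using ev' by eventually_elim simp
  show "(\<lambda>n. (\<integral>x. (?L n x)\<^sup>2 \<partial>?Q n) / (?P n)\<^sup>2) \<longlonglongrightarrow> 1"
    by (rule tendsto_sandwich[OF _ _ tendsto_const R]; use ev' in eventually_elim) auto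
qed

text \<open>Both scaling regimes supply an eventual lower bound of order
  \<open>n powr (5 / 3)\<close> on \<open>p n\<close>, hence one of order
  \<open>n powr (2 / 3)\<close> on \<open>p n / n\<close>.\<close>

lemma ratio_at_top_of_five_thirds:
  fixes p :: "nat \<Rightarrow> real"
  assumes "0 < c" "\<forall>\<^sub>F n in sequentially. c \<le> p n / real n powr (5 / 3)"
  shows "filterlim (\<lambda>n. p n / real n) at_top sequentially"
proof (rule filterlim_at_top_mono)
  show "filterlim (\<lambda>n. c * real n powr (2 / 3)) at_top sequentially" using assms(1) by real_asymp
  show "\<forall>\<^sub>F n in sequentially. c * real n powr (2 / 3) \<le> p n / real n"
    using assms(2) eventually_gt_at_top[of 0]
  proof eventually_elim
    case (elim n)
    have "real n powr (5 / 3) = real n powr (2 / 3) * real n"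
      using elim powr_add[of "real n" "2 / 3" 1] by simp
    then show ?case using elim by (simp add: pos_le_divide_eq mult.assoc)
  qed
qed

theorem theorem5:
  fixes \<beta> y :: real and p :: "nat \<Rightarrow> real"
    and Q :: "nat \<Rightarrow> (nat \<Rightarrow> real) measure"
    and L :: "nat \<Rightarrow> (nat \<Rightarrow> real) \<Rightarrow> real"
    and P :: "nat \<Rightarrow> real"
  assumes "0 < \<beta>" and "0 < y" and "y < \<beta>"
    and "\<And>n. 1 \<le> n \<Longrightarrow> real n \<le> p n"
  defines "Q \<equiv> \<lambda>n. sampling_measure n (p n) \<beta> y"
    and "L \<equiv> \<lambda>n. IS_estimator n (p n) \<beta> y"
    and "P \<equiv> \<lambda>n. smallest_eigenvalue_prob n (p n) \<beta> (p n * y)"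
  shows "(filterlim (\<lambda>n. p n / real n powr (5 / 3)) at_top sequentially \<longrightarrow>
           (\<forall>\<^sub>F n in sequentially. integrable (Q n) (\<lambda>x. (L n x)\<^sup>2)) \<and>
           (\<lambda>n. (\<integral>x. (L n x)\<^sup>2 \<partial>Q n) / (P n)\<^sup>2) \<longlonglongrightarrow> 1) \<and>
         ((\<lambda>n. p n / real n powr (5 / 3)) \<in> \<Theta>(\<lambda>_. 1) \<longrightarrow>
           (\<forall>\<^sub>F n in sequentially. integrable (Q n) (\<lambda>x. (L n x)\<^sup>2)) \<and>
           (\<lambda>n. \<integral>x. (L n x)\<^sup>2 \<partial>Q n) \<in> O(\<lambda>n. (P n)\<^sup>2)) \<and>
         (filterlim (\<lambda>n. p n / real n) at_top sequentially \<longrightarrow>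
           (\<forall>n\<ge>2. integrable (Q n) (L n) \<and> (\<integral>x. L n x \<partial>Q n) = P n) \<and>
           (\<forall>\<^sub>F n in sequentially. integrable (Q n) (\<lambda>x. (L n x)\<^sup>2)) \<and>
           (\<lambda>n. ln (\<integral>x. (L n x)\<^sup>2 \<partial>Q n) / (2 * ln (P n))) \<longlonglongrightarrow> 1)"
proof -
  note asm = assms(1-4)
  have main: "\<forall>\<^sub>F n in sequentially. integrable (Q n) (\<lambda>x. (L n x)\<^sup>2)"
      "(\<lambda>n. (\<integral>x. (L n x)\<^sup>2 \<partial>Q n) / (P n)\<^sup>2) \<longlonglongrightarrow> 1"
      "\<forall>\<^sub>F n in sequentially. 0 < P n"
    if "filterlim (\<lambda>n. p n / real n) at_top sequentially"
    unfolding Q_def L_def P_def by (rule second_moment_ratio_tendsto[OF asm(1-3) _ that], rule asm(4), assumption)+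
  have "(\<forall>\<^sub>F n in sequentially. integrable (Q n) (\<lambda>x. (L n x)\<^sup>2)) \<and>
           (\<lambda>n. (\<integral>x. (L n x)\<^sup>2 \<partial>Q n) / (P n)\<^sup>2) \<longlonglongrightarrow> 1"
    if "filterlim (\<lambda>n. p n / real n powr (5 / 3)) at_top sequentially"
  proof -
    have "\<forall>\<^sub>F n in sequentially. 1 \<le> p n / real n powr (5 / 3)"
      using that by (simp add: filterlim_at_top)
    from ratio_at_top_of_five_thirds[OF zero_less_one this] show ?thesis using main(1,2) by blast
  qed
  moreover have "(\<forall>\<^sub>F n in sequentially. integrable (Q n) (\<lambda>x. (L n x)\<^sup>2)) \<and>
           (\<lambda>n. \<integral>x. (L n x)\<^sup>2 \<partial>Q n) \<in> O(\<lambda>n. (P n)\<^sup>2)"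
    if "(\<lambda>n. p n / real n powr (5 / 3)) \<in> \<Theta>(\<lambda>_. 1)"
  proof -
    \<comment> \<open>The lower half of \<Theta> keeps the quotient away from 0.\<close>
    from that have "(\<lambda>n. p n / real n powr (5 / 3)) \<in> \<Omega>(\<lambda>_. 1)" by blast
    then obtain c where c: "0 < c" "\<forall>\<^sub>F n in sequentially. c * norm (1::real) \<le> norm (p n / real n powr (5 / 3))"
      by (rule landau_omega.bigE)
    have "\<forall>\<^sub>F n in sequentially. c \<le> p n / real n powr (5 / 3)"
      using c(2) eventually_ge_at_top[of 1]
    proof eventually_elim
      case (elim n)
      have "0 \<le> p n" using asm(4)[of n] elim by simp
      then show ?case using elim by simp
    qed
    note r = ratio_at_top_of_five_thirds[OF c(1) this]
    have "(\<lambda>n. \<integral>x. (L n x)\<^sup>2 \<partial>Q n) \<in> O(\<lambda>n. (P n)\<^sup>2)"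
    proof (rule bigoI_tendsto[OF main(2)[OF r]])
      show "\<forall>\<^sub>F n in sequentially. (P n)\<^sup>2 \<noteq> 0" using main(3)[OF r] by eventually_elim simp
    qed
    with main(1)[OF r] show ?thesis by blast
  qed
  moreover have "(\<lambda>n. ln (\<integral>x. (L n x)\<^sup>2 \<partial>Q n) / (2 * ln (P n))) \<longlonglongrightarrow> 1"
    if r: "filterlim (\<lambda>n. p n / real n) at_top sequentially"
  proof -
    have P0: "P \<longlonglongrightarrow> 0"
      unfolding P_def by (rule smallest_eigenvalue_prob_tendsto_0[OF asm(1-3) _ r]) (rule asm(4))
    then have "filterlim P (at_right 0) sequentially"
      using main(3)[OF r] by (auto simp: filterlim_at elim: eventually_mono)
    then have "filterlim (\<lambda>n. ln (P n)) at_bot sequentially"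
      by (rule filterlim_compose[OF ln_at_0])
    then have "filterlim (\<lambda>n. - ln (P n)) at_top sequentially"
      by (simp add: filterlim_uminus_at_bot)
    then have i: "(\<lambda>n. inverse (- ln (P n))) \<longlonglongrightarrow> 0" by (rule tendsto_inverse_0_at_top)
    \<comment> \<open>The efficiency quotient is 1 plus the logarithm of the relative second moment
      over \<open>2 * ln (P n)\<close>; the numerator tends to 0 and the denominator to minus
      infinity.\<close>
    have "(\<lambda>n. 1 - ln ((\<integral>x. (L n x)\<^sup>2 \<partial>Q n) / (P n)\<^sup>2) / 2 * inverse (- ln (P n))) \<longlonglongrightarrow> 1 - ln 1 / 2 * 0"
      by (intro tendsto_intros main(2)[OF r] i) auto
    moreover have "\<forall>\<^sub>F n in sequentially. 1 - ln ((\<integral>x. (L n x)\<^sup>2 \<partial>Q n) / (P n)\<^sup>2) / 2 * inverse (- ln (P n)) =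
      ln (\<integral>x. (L n x)\<^sup>2 \<partial>Q n) / (2 * ln (P n))"
      using main(3)[OF r] order_tendstoD(2)[OF P0 zero_less_one] order_tendstoD(1)[OF main(2)[OF r] zero_less_one]
    proof eventually_elim
      case (elim n)
      have "0 < (\<integral>x. (L n x)\<^sup>2 \<partial>Q n)" using elim by (simp add: zero_less_divide_iff)
      then have "ln ((\<integral>x. (L n x)\<^sup>2 \<partial>Q n) / (P n)\<^sup>2) = ln (\<integral>x. (L n x)\<^sup>2 \<partial>Q n) - 2 * ln (P n)"
        using elim by (simp add: ln_div ln_realpow)
      moreover have "ln (P n) \<noteq> 0" using elim by simp
      ultimately show ?case by (simp add: field_simps)
    qed
    ultimately show ?thesis using Lim_transform_eventually by fastforce
  qed
  moreover have "integrable (Q n) (L n) \<and> (\<integral>x. L n x \<partial>Q n) = P n" if "2 \<le> n" for n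
    using IS_estimator_unbiased[OF asm(1-3) that asm(4)[of n]] that unfolding Q_def L_def P_def by simp
  ultimately show ?thesis using main(1) by blast
qed

end
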